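(* Let $f\colon(\Gamma,\mathscr{G})\to(\Gamma,\mathscr{G})$ be a relative train track map on a finite graph of groups, with respect to a maximal filtration $\varnothing=\Gamma_0\subset\Gamma_1\subset\cdots\subset\Gamma_m=\Gamma$, and let $H_k$ be an irreducible stratum. Let $(\Gamma'_k,\mathscr{G}'_k)$ denote the (possibly disconnected) marked graph of groups obtained from $\Gamma_k$ by collapsing each component of $\Gamma_{k-1}$. Then the restriction of $f$ to $\Gamma_k$ factors through the collapse, and the resulting map $f_k\colon(\Gamma'_k,\mathscr{G}'_k)\to(\Gamma'_k,\mathscr{G}'_k)$ is an irreducible train track map.
   Context: Graphs of groups. A graph of groups $(\Gamma,\mathscr{G})$ is a connected graph with vertex groups $\mathscr{G}_v$, edge groups $\mathscr{G}_e=\mathscr{G}_{\bar e}$ and monomorphisms $\iota_e\colon\mathscr{G}_e\to\mathscr{G}_{\tau(e)}$, where $\bar e$ is $e$ reversed, $\tau(e)$ is the terminal vertex of the oriented edge $e$, and $\mathrm{st}(v)=\{e:\tau(e)=v\}$. A path is a sequence $e_1'g_1e_2g_2\cdots g_{k-1}e_k'$ with $e_1'e_2\cdots e_k'$ an edge path in $\Gamma$ (first and last terms may be segments or empty) and $g_i\in\mathscr{G}_{\tau(e_i)}$. Homotopy rel endpoints is generated by inserting or deleting $\sigma\bar\sigma$ and replacing $g\,e\,\iota_e(h)\,g'$ with $g\,\iota_{\bar e}(h)\,e\,g'$, $h\in\mathscr{G}_e$. $\pi_1(\Gamma,\mathscr{G},p)$ is the group of homotopy classes of loops at $p$, acting on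 the Bass–Serre tree $\tilde\Gamma$. Collapsing. Collapsing a connected subgraph $\Lambda\subset\Gamma$ gives the graph $\Gamma/\Lambda$ in which the vertex $\Lambda$ has vertex group $\pi_1(\Lambda,\mathscr{G}|_\Lambda)$, all other vertex and edge groups are unchanged, and for an edge $e\not\subset\Lambda$ with $\tau(e)\in\Lambda$ the monomorphism $\iota_e$ is composed with the inclusion $\mathscr{G}_{\tau(e)}\hookrightarrow\pi_1(\Lambda,\mathscr{G}|_\Lambda)$. A disconnected subgraph is collapsed component by component. Morphisms and realizations. A morphism is a graph map (vertices to vertices, edges to edges or collapsed to vertices) with homomorphisms $f_v\colon\mathscr{L}_v\to\mathscr{G}_{f(v)}$, $f_e\colon\mathscr{L}_e\to\mathscr{G}_{f(e)}$ and elements $\delta_e\in\mathscr{G}_{f(\tau(e))}$ with $f_{\tau(e)}(\iota_e(h))=\delta_e\iota_{f(e)}(f_e(h))\delta_e^{-1}$ ($\iota_{f(e)}$ is the identity if $e$ is collapsed). It acts on paths by $g\mapsto f_v(g)$, $e\mapsto\delta_{\bar e}f(e)\delta_e^{-1}$. Subdividing at an interior point of $e$ declares it a vertex with group $\mathscr{G}_e$. A topological realization of an outer automorphism $\varphi$ of $\pi_1(\Gamma,\mathscr{G})$ is a continuous $f\colon(\Gamma,\mathscr{G})\to(\Gamma,\mathscr{G})$ which becomes a morphism after subdividing each edge of the domain into finitely many edges, sends vertices to vertices and edges to tight edge paths (no subpath $e\,g\,\bar e$ with $g\in\iota_e(\mathscr{G}_e)$), collapses no edge, and induces $\varphi$.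 For possibly disconnected graphs of groups the same terminology is used componentwise. Turns. A turn at $v$ is an unordered pair $\{([g],e),([g'],e')\}$ of elements of $\coprod_{e\in\mathrm{st}(v)}\mathscr{G}_v/\iota_e(\mathscr{G}_e)\times\{e\}$; it is degenerate if the two elements are equal. $Df$ acts on turns by applying to each entry $([g],e)\mapsto([f_v(g)\delta_{\hat e}],f(\hat e))$, where $\hat e$ is the terminal edge of the subdivision of $e$. A turn is illegal if its image under some iterate of $Df$ is degenerate, otherwise legal. The path $\cdots e_i\,g_{i+1}\,e_{i+1}\cdots$ takes the turns $\{([1],e_i),([g_{i+1}],\bar e_{i+1})\}$; a path is legal if it takes only legal turns. A topological realization is a train track map if it sends each edge to a legal path (equivalently, for all $l\ge1$, $f^l$ restricted to each edge is an immersion). Irreducibility. The transition matrix of $f$ has $ij$th entry the number of times $f(e_j)$ crosses $e_i$ in either direction. A nonnegative integer matrix $M$ is irreducible if for all $i,j$ some $M^l$, $l\ge1$, has positive $ij$ entry. $f$ is irreducible if its transition matrix is. Relative train tracks. A filtration $\varnothing=\Gamma_0\subset\cdots\subset\Gamma_m=\Gamma$ by (not necessarily connected) subgraphs is preserved by $f$ if $f(\Gamma_i)\subset\Gamma_i$. The stratum $H_k=\overline{\Gamma_k\setminus\Gamma_{k-1}}$ has a transition matrix $M_k$ (rows and columns indexed by edges of $H_k$, with $ij$th entry the number of times the $f$-image of the $j$th edge of $H_k$ crosses the $i$th edge of $H_k$ in either direction); $H_k$ is irreducible if $M_k$ is, and the filtration is maximal if each $M_k$ is irreducible or zero. An irreducible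 stratum is exponentially-growing if its Perron–Frobenius eigenvalue is $>1$. $H_k$ contains a turn $\{([g],e),([g'],e')\}$ if $e,e'$ are in $H_k$. A topological realization $f$ is a relative train track map if it preserves a maximal filtration such that for each exponentially-growing $H_k$: (RTT-i) $Df$ maps the set of turns in $H_k$ into itself; (RTT-ii) if $\gamma\subset\Gamma_{k-1}$ is a nontrivial path with endpoints in $H_k\cap\Gamma_{k-1}$, then $f(\gamma)$ is a homotopically nontrivial path with endpoints in $H_k\cap\Gamma_{k-1}$; (RTT-iii) for each legal path $\gamma$ in $H_k$, $f(\gamma)$ does not contain any illegal turns in $H_k$.
   Formalization: That f_k induces an outer automorphism (isomorphisms on π_1 of components) can fail as stated; it is claimed exactly when f restricted to Γ_k induces such isomorphisms. All other clauses of "irreducible train track map", and the factorization, are claimed without this condition. *)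

theory Defs
  imports Complex_Main "HOL-Algebra.Coset"
begin

section \<open>Graphs of groups\<close>

text \<open>Graphs are Serre graphs: every edge is oriented, \<open>ebar\<close> reverses it and \<open>tm\<close> is its
  terminal vertex. Connectedness is a separate predicate, because subgraphs and their collapses
  may be disconnected.\<close>

record ('v, 'e, 'g, 'h) gog =
  verts :: "'v set"
  edges :: "'e set"
  ebar  :: "'e \<Rightarrow> 'e"
  tm    :: "'e \<Rightarrow> 'v"
  vgrp  :: "'v \<Rightarrow> 'g monoid"
  egrp  :: "'e \<Rightarrow> 'h monoid"
  iota  :: "'e \<Rightarrow> 'h \<Rightarrow> 'g"

definition graph_of_groups :: "('v, 'e, 'g, 'h) gog \<Rightarrow> bool" where
  "graph_of_groups G \<longleftrightarrow>
     (\<forall>e\<in>edges G. ebar G e \<in> edges G \<and> ebar G e \<noteq> e \<and> ebar G (ebar G e) = e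
        \<and> tm G e \<in> verts G) \<and>
     (\<forall>v\<in>verts G. group (vgrp G v)) \<and>
     (\<forall>e\<in>edges G. group (egrp G e) \<and> egrp G (ebar G e) = egrp G e
        \<and> iota G e \<in> mon (egrp G e) (vgrp G (tm G e)))"

definition finite_graph :: "('v, 'e, 'g, 'h) gog \<Rightarrow> bool" where
  "finite_graph G \<longleftrightarrow> finite (verts G) \<and> finite (edges G)"

definition org :: "('v, 'e, 'g, 'h) gog \<Rightarrow> 'e \<Rightarrow> 'v" where
  "org G e = tm G (ebar G e)"

definition subgraph :: "('v, 'e, 'g, 'h) gog \<Rightarrow> 'v set \<times> 'e set \<Rightarrow> bool" where
  "subgraph G S \<longleftrightarrow> fst S \<subseteq> verts G \<and> snd S \<subseteq> edges G \<and>
     (\<forall>e\<in>snd S. ebar G e \<in> snd S \<and> tm G e \<in> fst S)"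

definition restrict_gog ::
    "('v, 'e, 'g, 'h) gog \<Rightarrow> 'v set \<times> 'e set \<Rightarrow> ('v, 'e, 'g, 'h) gog" where
  "restrict_gog G S = G\<lparr>verts := fst S, edges := snd S\<rparr>"


section \<open>Paths, homotopy and the fundamental group\<close>

text \<open>\<open>(v, g\<^sub>0, [(e\<^sub>1, g\<^sub>1), \<dots>, (e\<^sub>n, g\<^sub>n)])\<close> is the path \<open>g\<^sub>0 e\<^sub>1 g\<^sub>1 \<dots> e\<^sub>n g\<^sub>n\<close> starting at the vertex
  \<open>v\<close>; two consecutive edges with nothing in between are written with the group element \<open>1\<close>.
  Only paths with endpoints at vertices are needed.\<close>

type_synonym ('v, 'e, 'g) path = "'v \<times> 'g \<times> ('e \<times> 'g) list"

fun is_path :: "('v, 'e, 'g, 'h) gog \<Rightarrow> ('v, 'e, 'g) path \<Rightarrow> bool" where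
  "is_path G (v, g, []) \<longleftrightarrow> v \<in> verts G \<and> g \<in> carrier (vgrp G v)"
| "is_path G (v, g, (e, a) # xs) \<longleftrightarrow> v \<in> verts G \<and> g \<in> carrier (vgrp G v) \<and>
     e \<in> edges G \<and> org G e = v \<and> is_path G (tm G e, a, xs)"

definition path_start :: "('v, 'e, 'g) path \<Rightarrow> 'v" where
  "path_start = fst"

fun path_end :: "('v, 'e, 'g, 'h) gog \<Rightarrow> ('v, 'e, 'g) path \<Rightarrow> 'v" where
  "path_end G (v, g, []) = v"
| "path_end G (v, g, (e, a) # xs) = path_end G (tm G e, a, xs)"

definition path_edges :: "('v, 'e, 'g) path \<Rightarrow> 'e list" where
  "path_edges \<gamma> = map fst (snd (snd \<gamma>))"

definition path_from_to :: "('v, 'e, 'g, 'h) gog \<Rightarrow> 'v \<Rightarrow> 'v \<Rightarrow> ('v, 'e, 'g) path \<Rightarrow> bool" where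
  "path_from_to G v w \<gamma> \<longleftrightarrow> is_path G \<gamma> \<and> path_start \<gamma> = v \<and> path_end G \<gamma> = w"

definition connected_gog :: "('v, 'e, 'g, 'h) gog \<Rightarrow> bool" where
  "connected_gog G \<longleftrightarrow> verts G \<noteq> {} \<and>
     (\<forall>v\<in>verts G. \<forall>w\<in>verts G. \<exists>\<gamma>. path_from_to G v w \<gamma>)"

definition edge_path :: "('v, 'e, 'g, 'h) gog \<Rightarrow> 'e \<Rightarrow> ('v, 'e, 'g) path" where
  "edge_path G e = (org G e, \<one>\<^bsub>vgrp G (org G e)\<^esub>, [(e, \<one>\<^bsub>vgrp G (tm G e)\<^esub>)])"

definition trivial_path :: "('v, 'e, 'g, 'h) gog \<Rightarrow> 'v \<Rightarrow> ('v, 'e, 'g) path" where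
  "trivial_path G v = (v, \<one>\<^bsub>vgrp G v\<^esub>, [])"

text \<open>Concatenation multiplies the last group element of the first path by the first group
  element of the second one.\<close>

fun path_cat :: "('v, 'e, 'g, 'h) gog \<Rightarrow> ('v, 'e, 'g) path \<Rightarrow> ('v, 'e, 'g) path \<Rightarrow> ('v, 'e, 'g) path"
    (infixl "\<bullet>\<index>" 70) where
  "path_cat G (v, g, []) (w, h, ys) = (v, g \<otimes>\<^bsub>vgrp G v\<^esub> h, ys)"
| "path_cat G (v, g, (e, a) # xs) q =
     (let (w, b, zs) = path_cat G (tm G e, a, xs) q in (v, g, (e, b) # zs))"

fun path_rev :: "('v, 'e, 'g, 'h) gog \<Rightarrow> ('v, 'e, 'g) path \<Rightarrow> ('v, 'e, 'g) path" where
  "path_rev G (v, g, []) = (v, inv\<^bsub>vgrp G v\<^esub> g, [])"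
| "path_rev G (v, g, (e, a) # xs) =
     path_rev G (tm G e, a, xs)
       \<bullet>\<^bsub>G\<^esub> (tm G e, \<one>\<^bsub>vgrp G (tm G e)\<^esub>, [(ebar G e, inv\<^bsub>vgrp G v\<^esub> g)])"

inductive elem_homotopy ::
    "('v, 'e, 'g, 'h) gog \<Rightarrow> ('v, 'e, 'g) path \<Rightarrow> ('v, 'e, 'g) path \<Rightarrow> bool"
  for G :: "('v, 'e, 'g, 'h) gog" where
  cancel: "\<lbrakk>is_path G \<alpha>; is_path G \<sigma>; is_path G \<beta>; path_end G \<alpha> = path_start \<sigma>;
      path_start \<sigma> = path_start \<beta>\<rbrakk> \<Longrightarrow>
    elem_homotopy G (\<alpha> \<bullet>\<^bsub>G\<^esub> \<sigma> \<bullet>\<^bsub>G\<^esub> path_rev G \<sigma> \<bullet>\<^bsub>G\<^esub> \<beta>) (\<alpha> \<bullet>\<^bsub>G\<^esub> \<beta>)"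
| slide: "\<lbrakk>is_path G \<alpha>; is_path G \<beta>; e \<in> edges G; h \<in> carrier (egrp G e);
      path_end G \<alpha> = org G e; path_start \<beta> = tm G e\<rbrakk> \<Longrightarrow>
    elem_homotopy G (\<alpha> \<bullet>\<^bsub>G\<^esub> edge_path G e \<bullet>\<^bsub>G\<^esub> (tm G e, iota G e h, []) \<bullet>\<^bsub>G\<^esub> \<beta>)
                    (\<alpha> \<bullet>\<^bsub>G\<^esub> (org G e, iota G (ebar G e) h, []) \<bullet>\<^bsub>G\<^esub> edge_path G e \<bullet>\<^bsub>G\<^esub> \<beta>)"

definition homotopic ::
    "('v, 'e, 'g, 'h) gog \<Rightarrow> ('v, 'e, 'g) path \<Rightarrow> ('v, 'e, 'g) path \<Rightarrow> bool" where
  "homotopic G = equivclp (elem_homotopy G)"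

definition homotopy_class ::
    "('v, 'e, 'g, 'h) gog \<Rightarrow> ('v, 'e, 'g) path \<Rightarrow> ('v, 'e, 'g) path set" where
  "homotopy_class G \<gamma> = {\<gamma>'. homotopic G \<gamma> \<gamma>'}"

text \<open>A path is trivial if its underlying edge path is constant, that is, if it crosses no edge
  and hence is a single vertex group element.\<close>

definition homotopically_nontrivial ::
    "('v, 'e, 'g, 'h) gog \<Rightarrow> ('v, 'e, 'g) path \<Rightarrow> bool" where
  "homotopically_nontrivial G \<gamma> \<longleftrightarrow> \<not> (\<exists>\<gamma>'. is_path G \<gamma>' \<and> path_edges \<gamma>' = [] \<and> homotopic G \<gamma> \<gamma>')"

definition pi1 :: "('v, 'e, 'g, 'h) gog \<Rightarrow> 'v \<Rightarrow> ('v, 'e, 'g) path set monoid" where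
  "pi1 G p = \<lparr>carrier = homotopy_class G ` {\<gamma>. path_from_to G p p \<gamma>},
              monoid.mult = (\<lambda>x y. \<Union>\<alpha>\<in>x. \<Union>\<beta>\<in>y. homotopy_class G (\<alpha> \<bullet>\<^bsub>G\<^esub> \<beta>)),
              one = homotopy_class G (trivial_path G p)\<rparr>"


section \<open>Maps of graphs of groups\<close>

text \<open>A map is recorded by its effect on paths: \<open>emap e\<close> is the image path of the edge \<open>e\<close>. For a
  morphism in the sense of graphs of groups it is \<open>\<delta>\<^bsub>ebar e\<^esub> f(e) \<delta>\<^bsub>e\<^esub>\<^sup>-\<^sup>1\<close>, or
  \<open>\<delta>\<^bsub>ebar e\<^esub> \<delta>\<^bsub>e\<^esub>\<^sup>-\<^sup>1\<close> if \<open>e\<close> is collapsed.\<close>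

record ('v, 'e, 'g, 'w, 'd, 'k) gmap =
  vmap :: "'v \<Rightarrow> 'w"
  vhom :: "'v \<Rightarrow> 'g \<Rightarrow> 'k"
  emap :: "'e \<Rightarrow> ('w, 'd, 'k) path"

fun path_image :: "('v, 'e, 'g, 'h) gog \<Rightarrow> ('w, 'd, 'k, 'l) gog \<Rightarrow> ('v, 'e, 'g, 'w, 'd, 'k) gmap
    \<Rightarrow> ('v, 'e, 'g) path \<Rightarrow> ('w, 'd, 'k) path" where
  "path_image G H f (v, g, xs) =
     foldl (\<lambda>\<pi> (e, a). \<pi> \<bullet>\<^bsub>H\<^esub> emap f e \<bullet>\<^bsub>H\<^esub> (vmap f (tm G e), vhom f (tm G e) a, []))
       (vmap f v, vhom f v g, []) xs"

fun tight :: "('v, 'e, 'g, 'h) gog \<Rightarrow> ('v, 'e, 'g) path \<Rightarrow> bool" where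
  "tight G (v, g, (e, a) # (e', a') # xs) \<longleftrightarrow>
     \<not> (e' = ebar G e \<and> a \<in> iota G e ` carrier (egrp G e)) \<and> tight G (tm G e, a, (e', a') # xs)"
| "tight G (v, g, _) \<longleftrightarrow> True"

text \<open>Subdivide \<open>e\<close> into segments \<open>\<epsilon>\<^sub>0, \<dots>, \<epsilon>\<^bsub>n-1\<^esub>\<close>; the edge groups of the segments and the
  vertex groups of the interior vertices are all \<open>egrp G e\<close>, and the monomorphisms of the segments
  into the latter are identities. The predicate says that \<open>\<epsilon>\<^sub>i \<mapsto> E i\<close>, with edge homomorphisms
  \<open>\<phi> i\<close> and with \<open>\<delta>\<^bsub>\<epsilon>\<^esub> = dp i\<close>, \<open>\<delta>\<^bsub>ebar \<epsilon>\<^esub> = dm i\<close> for \<open>\<epsilon> = \<epsilon>\<^sub>i\<close>, is a morphism and that \<open>emap f e\<close>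
  is the resulting image of \<open>\<epsilon>\<^sub>0 \<dots> \<epsilon>\<^bsub>n-1\<^esub>\<close>. Here \<open>\<psi> i\<close> is the homomorphism at the \<open>i\<close>th vertex of
  the subdivided edge; at the two ends it is the one of \<open>f\<close> precomposed with \<open>iota\<close>.\<close>

definition morphism_on_subdivision ::
    "('v, 'e, 'g, 'h) gog \<Rightarrow> ('v, 'e, 'g, 'v, 'e, 'g) gmap \<Rightarrow> 'e \<Rightarrow> bool" where
  "morphism_on_subdivision G f e \<longleftrightarrow>
     (case emap f e of (_, a, xs) \<Rightarrow>
       let n = length xs; E = (\<lambda>i. fst (xs ! i)) in
       n \<ge> 1 \<and>
       (\<exists>(\<phi> :: nat \<Rightarrow> 'h \<Rightarrow> 'h) (\<psi> :: nat \<Rightarrow> 'h \<Rightarrow> 'g) (dm :: nat \<Rightarrow> 'g) (dp :: nat \<Rightarrow> 'g).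
         (\<forall>i<n. \<phi> i \<in> hom (egrp G e) (egrp G (E i)) \<and>
            dm i \<in> carrier (vgrp G (org G (E i))) \<and> dp i \<in> carrier (vgrp G (tm G (E i))) \<and>
            (\<forall>h\<in>carrier (egrp G e).
               \<psi> i h = dm i \<otimes>\<^bsub>vgrp G (org G (E i))\<^esub> iota G (ebar G (E i)) (\<phi> i h)
                       \<otimes>\<^bsub>vgrp G (org G (E i))\<^esub> inv\<^bsub>vgrp G (org G (E i))\<^esub> dm i \<and>
               \<psi> (Suc i) h = dp i \<otimes>\<^bsub>vgrp G (tm G (E i))\<^esub> iota G (E i) (\<phi> i h)
                       \<otimes>\<^bsub>vgrp G (tm G (E i))\<^esub> inv\<^bsub>vgrp G (tm G (E i))\<^esub> dp i)) \<and>
         (\<forall>h\<in>carrier (egrp G e).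
            \<psi> 0 h = vhom f (org G e) (iota G (ebar G e) h) \<and>
            \<psi> n h = vhom f (tm G e) (iota G e h)) \<and>
         a = dm 0 \<and>
         (\<forall>i<n. snd (xs ! i) =
            (if Suc i < n
             then inv\<^bsub>vgrp G (tm G (E i))\<^esub> dp i \<otimes>\<^bsub>vgrp G (tm G (E i))\<^esub> dm (Suc i)
             else inv\<^bsub>vgrp G (tm G (E i))\<^esub> dp i))))"

text \<open>The clauses of a topological realization other than the one on the fundamental group.\<close>

definition edge_path_map ::
    "('v, 'e, 'g, 'h) gog \<Rightarrow> ('v, 'e, 'g, 'v, 'e, 'g) gmap \<Rightarrow> bool" where
  "edge_path_map G f \<longleftrightarrow> graph_of_groups G \<and>
     (\<forall>v\<in>verts G. vmap f v \<in> verts G \<and> vhom f v \<in> hom (vgrp G v) (vgrp G (vmap f v))) \<and>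
     (\<forall>e\<in>edges G. path_from_to G (vmap f (org G e)) (vmap f (tm G e)) (emap f e) \<and>
        emap f (ebar G e) = path_rev G (emap f e) \<and>
        path_edges (emap f e) \<noteq> [] \<and> tight G (emap f e) \<and> morphism_on_subdivision G f e)"

definition pi1_map :: "('v, 'e, 'g, 'h) gog \<Rightarrow> ('v, 'e, 'g, 'v, 'e, 'g) gmap \<Rightarrow>
    ('v, 'e, 'g) path set \<Rightarrow> ('v, 'e, 'g) path set" where
  "pi1_map G f x = (\<Union>\<gamma>\<in>x. homotopy_class G (path_image G G f \<gamma>))"

text \<open>On a connected graph of groups, conjugating the isomorphism by a path from \<open>p\<close> to
  \<open>vmap f p\<close> gives an automorphism of \<open>pi1 G p\<close>, well defined up to inner automorphisms; this is
  the outer automorphism which \<open>f\<close> realizes. On a disconnected one the condition says that \<open>f\<close>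
  induces an isomorphism from the fundamental group of the component of \<open>p\<close> to that of the
  component of \<open>vmap f p\<close>.\<close>

definition pi1_iso_at ::
    "('v, 'e, 'g, 'h) gog \<Rightarrow> ('v, 'e, 'g, 'v, 'e, 'g) gmap \<Rightarrow> 'v \<Rightarrow> bool" where
  "pi1_iso_at G f p \<longleftrightarrow> pi1_map G f \<in> iso (pi1 G p) (pi1 G (vmap f p))"

definition topological_realization ::
    "('v, 'e, 'g, 'h) gog \<Rightarrow> ('v, 'e, 'g, 'v, 'e, 'g) gmap \<Rightarrow> bool" where
  "topological_realization G f \<longleftrightarrow> edge_path_map G f \<and> (\<forall>p\<in>verts G. pi1_iso_at G f p)"


section \<open>Turns and train track maps\<close>

text \<open>\<open>direction G g e\<close> is the pair \<open>([g], e)\<close>, with \<open>[g]\<close> a coset in \<open>vgrp G (tm G e)\<close>.\<close>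

definition direction :: "('v, 'e, 'g, 'h) gog \<Rightarrow> 'g \<Rightarrow> 'e \<Rightarrow> 'g set \<times> 'e" where
  "direction G g e = (g <#\<^bsub>vgrp G (tm G e)\<^esub> (iota G e ` carrier (egrp G e)), e)"

definition directions_at :: "('v, 'e, 'g, 'h) gog \<Rightarrow> 'v \<Rightarrow> ('g set \<times> 'e) set" where
  "directions_at G v = {direction G g e | g e. e \<in> edges G \<and> tm G e = v \<and> g \<in> carrier (vgrp G v)}"

definition turns :: "('v, 'e, 'g, 'h) gog \<Rightarrow> ('g set \<times> 'e) set set" where
  "turns G = {{d, d'} | v d d'. v \<in> verts G \<and> d \<in> directions_at G v \<and> d' \<in> directions_at G v}"

definition degenerate :: "('g set \<times> 'e) set \<Rightarrow> bool" where
  "degenerate T \<longleftrightarrow> (\<exists>d. T = {d})"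

text \<open>\<open>([g], e) \<mapsto> ([f\<^sub>v(g) \<delta>], e')\<close>, where \<open>e'\<close> is the last edge of \<open>emap f e\<close> and \<open>\<delta>\<close> is the
  inverse of the group element after it. All members of the union are the same coset.\<close>

definition Ddir :: "('v, 'e, 'g, 'h) gog \<Rightarrow> ('v, 'e, 'g, 'v, 'e, 'g) gmap \<Rightarrow>
    'g set \<times> 'e \<Rightarrow> 'g set \<times> 'e" where
  "Ddir G f d = (case d of (C, e) \<Rightarrow> case last (snd (snd (emap f e))) of (e', a) \<Rightarrow>
     (\<Union>g\<in>C. fst (direction G (vhom f (tm G e) g
                 \<otimes>\<^bsub>vgrp G (tm G e')\<^esub> inv\<^bsub>vgrp G (tm G e')\<^esub> a) e'), e'))"

definition Dturn :: "('v, 'e, 'g, 'h) gog \<Rightarrow> ('v, 'e, 'g, 'v, 'e, 'g) gmap \<Rightarrow>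
    ('g set \<times> 'e) set \<Rightarrow> ('g set \<times> 'e) set" where
  "Dturn G f T = Ddir G f ` T"

definition illegal_turn :: "('v, 'e, 'g, 'h) gog \<Rightarrow> ('v, 'e, 'g, 'v, 'e, 'g) gmap \<Rightarrow>
    ('g set \<times> 'e) set \<Rightarrow> bool" where
  "illegal_turn G f T \<longleftrightarrow> (\<exists>l. degenerate ((Dturn G f ^^ l) T))"

fun turns_taken :: "('v, 'e, 'g, 'h) gog \<Rightarrow> ('v, 'e, 'g) path \<Rightarrow> ('g set \<times> 'e) set set" where
  "turns_taken G (v, g, (e, a) # (e', a') # xs) =
     insert {direction G (\<one>\<^bsub>vgrp G (tm G e)\<^esub>) e, direction G a (ebar G e')}
       (turns_taken G (tm G e, a, (e', a') # xs))"
| "turns_taken G (v, g, _) = {}"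

definition legal_path :: "('v, 'e, 'g, 'h) gog \<Rightarrow> ('v, 'e, 'g, 'v, 'e, 'g) gmap \<Rightarrow>
    ('v, 'e, 'g) path \<Rightarrow> bool" where
  "legal_path G f \<gamma> \<longleftrightarrow> is_path G \<gamma> \<and> (\<forall>T\<in>turns_taken G \<gamma>. \<not> illegal_turn G f T)"

definition edges_to_legal_paths ::
    "('v, 'e, 'g, 'h) gog \<Rightarrow> ('v, 'e, 'g, 'v, 'e, 'g) gmap \<Rightarrow> bool" where
  "edges_to_legal_paths G f \<longleftrightarrow> (\<forall>e\<in>edges G. legal_path G f (emap f e))"

text \<open>A map of a subgraph of groups may fail to induce isomorphisms on the fundamental groups of the
  components although the map of the whole graph of groups does: take
  \<open>\<langle>b, t | t b t\<^sup>-\<^sup>1 = b\<^sup>2\<rangle> * \<langle>c\<rangle>\<close>, the automorphism which is conjugation by \<open>t\<close> on the first factor and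
  the identity on the second, and the edge joining the vertex with group \<open>\<langle>b\<rangle>\<close> to the one with group
  \<open>\<langle>c\<rangle>\<close>. For this reason \<open>edge_path_map\<close>, \<open>edges_to_legal_paths\<close> and \<open>pi1_iso_at\<close> are kept
  available separately.\<close>

definition train_track_map ::
    "('v, 'e, 'g, 'h) gog \<Rightarrow> ('v, 'e, 'g, 'v, 'e, 'g) gmap \<Rightarrow> bool" where
  "train_track_map G f \<longleftrightarrow> topological_realization G f \<and> edges_to_legal_paths G f"


section \<open>Transition matrices\<close>

text \<open>Matrices are indexed by unoriented edges \<open>{e, ebar G e}\<close>.\<close>

definition unoriented :: "('v, 'e, 'g, 'h) gog \<Rightarrow> 'e set \<Rightarrow> 'e set set" where
  "unoriented G A = (\<lambda>e. {e, ebar G e}) ` A"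

definition transition :: "('v, 'e, 'g, 'v, 'e, 'g) gmap \<Rightarrow> 'e set \<Rightarrow> 'e set \<Rightarrow> nat" where
  "transition f i j = length (filter (\<lambda>e. e \<in> i) (path_edges (emap f (SOME e. e \<in> j))))"

fun mat_power :: "'i set \<Rightarrow> ('i \<Rightarrow> 'i \<Rightarrow> nat) \<Rightarrow> nat \<Rightarrow> 'i \<Rightarrow> 'i \<Rightarrow> nat" where
  "mat_power I M 0 i j = (if i = j then 1 else 0)"
| "mat_power I M (Suc l) i j = (\<Sum>k\<in>I. M i k * mat_power I M l k j)"

definition irreducible_matrix :: "'i set \<Rightarrow> ('i \<Rightarrow> 'i \<Rightarrow> nat) \<Rightarrow> bool" where
  "irreducible_matrix I M \<longleftrightarrow> (\<forall>i\<in>I. \<forall>j\<in>I. \<exists>l\<ge>1. mat_power I M l i j > 0)"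

definition zero_matrix :: "'i set \<Rightarrow> ('i \<Rightarrow> 'i \<Rightarrow> nat) \<Rightarrow> bool" where
  "zero_matrix I M \<longleftrightarrow> (\<forall>i\<in>I. \<forall>j\<in>I. M i j = 0)"

text \<open>The Perron--Frobenius eigenvalue of an irreducible matrix is the eigenvalue which has an
  eigenvector with positive entries.\<close>

definition perron_frobenius_eigenvalue :: "'i set \<Rightarrow> ('i \<Rightarrow> 'i \<Rightarrow> nat) \<Rightarrow> real \<Rightarrow> bool" where
  "perron_frobenius_eigenvalue I M lam \<longleftrightarrow> I \<noteq> {} \<and>
     (\<exists>x. (\<forall>i\<in>I. x i > 0) \<and> (\<forall>i\<in>I. (\<Sum>j\<in>I. real (M i j) * x j) = lam * x i))"

definition irreducible_map ::
    "('v, 'e, 'g, 'h) gog \<Rightarrow> ('v, 'e, 'g, 'v, 'e, 'g) gmap \<Rightarrow> bool" where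
  "irreducible_map G f \<longleftrightarrow> irreducible_matrix (unoriented G (edges G)) (transition f)"


section \<open>Relative train track maps\<close>

text \<open>A filtration is a sequence of subgraphs \<open>F i\<close>, each one a pair of a vertex set and an edge set.
  The edges of the stratum \<open>H k\<close> are \<open>snd (F k) - snd (F (k - 1))\<close>.\<close>

definition filtration ::
    "('v, 'e, 'g, 'h) gog \<Rightarrow> (nat \<Rightarrow> 'v set \<times> 'e set) \<Rightarrow> nat \<Rightarrow> bool" where
  "filtration G F m \<longleftrightarrow> F 0 = ({}, {}) \<and> F m = (verts G, edges G) \<and>
     (\<forall>i\<le>m. subgraph G (F i)) \<and>
     (\<forall>i<m. fst (F i) \<subseteq> fst (F (Suc i)) \<and> snd (F i) \<subseteq> snd (F (Suc i)))"

definition preserves_filtration ::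
    "('v, 'e, 'g, 'v, 'e, 'g) gmap \<Rightarrow> (nat \<Rightarrow> 'v set \<times> 'e set) \<Rightarrow> nat \<Rightarrow> bool" where
  "preserves_filtration f F m \<longleftrightarrow>
     (\<forall>i\<le>m. vmap f ` fst (F i) \<subseteq> fst (F i) \<and>
        (\<forall>e\<in>snd (F i). set (path_edges (emap f e)) \<subseteq> snd (F i)))"

definition stratum_edges :: "(nat \<Rightarrow> 'v set \<times> 'e set) \<Rightarrow> nat \<Rightarrow> 'e set" where
  "stratum_edges F k = snd (F k) - snd (F (k - 1))"

definition stratum_verts :: "('v, 'e, 'g, 'h) gog \<Rightarrow> (nat \<Rightarrow> 'v set \<times> 'e set) \<Rightarrow> nat \<Rightarrow> 'v set" where
  "stratum_verts G F k = (fst (F k) - fst (F (k - 1))) \<union> tm G ` stratum_edges F k"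

definition irreducible_stratum :: "('v, 'e, 'g, 'h) gog \<Rightarrow> ('v, 'e, 'g, 'v, 'e, 'g) gmap \<Rightarrow>
    (nat \<Rightarrow> 'v set \<times> 'e set) \<Rightarrow> nat \<Rightarrow> bool" where
  "irreducible_stratum G f F k \<longleftrightarrow>
     irreducible_matrix (unoriented G (stratum_edges F k)) (transition f)"

definition maximal_filtration :: "('v, 'e, 'g, 'h) gog \<Rightarrow> ('v, 'e, 'g, 'v, 'e, 'g) gmap \<Rightarrow>
    (nat \<Rightarrow> 'v set \<times> 'e set) \<Rightarrow> nat \<Rightarrow> bool" where
  "maximal_filtration G f F m \<longleftrightarrow> (\<forall>k. 1 \<le> k \<and> k \<le> m \<longrightarrow>
     irreducible_stratum G f F k \<or>
     zero_matrix (unoriented G (stratum_edges F k)) (transition f))"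

definition exponentially_growing :: "('v, 'e, 'g, 'h) gog \<Rightarrow> ('v, 'e, 'g, 'v, 'e, 'g) gmap \<Rightarrow>
    (nat \<Rightarrow> 'v set \<times> 'e set) \<Rightarrow> nat \<Rightarrow> bool" where
  "exponentially_growing G f F k \<longleftrightarrow> irreducible_stratum G f F k \<and>
     (\<exists>lam>1. perron_frobenius_eigenvalue (unoriented G (stratum_edges F k)) (transition f) lam)"

definition turns_in :: "('v, 'e, 'g, 'h) gog \<Rightarrow> 'e set \<Rightarrow> ('g set \<times> 'e) set set" where
  "turns_in G A = {T \<in> turns G. snd ` T \<subseteq> A}"

definition RTT_i where
  "RTT_i G f F k \<longleftrightarrow>
     Dturn G f ` turns_in G (stratum_edges F k) \<subseteq> turns_in G (stratum_edges F k)"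

definition RTT_ii where
  "RTT_ii G f F k \<longleftrightarrow>
     (\<forall>\<gamma>. is_path (restrict_gog G (F (k - 1))) \<gamma> \<and>
        {path_start \<gamma>, path_end G \<gamma>} \<subseteq> stratum_verts G F k \<inter> fst (F (k - 1)) \<and>
        homotopically_nontrivial G \<gamma> \<longrightarrow>
      homotopically_nontrivial G (path_image G G f \<gamma>) \<and>
      {path_start (path_image G G f \<gamma>), path_end G (path_image G G f \<gamma>)}
        \<subseteq> stratum_verts G F k \<inter> fst (F (k - 1)))"

definition RTT_iii where
  "RTT_iii G f F k \<longleftrightarrow>
     (\<forall>\<gamma>. legal_path G f \<gamma> \<and> path_edges \<gamma> \<noteq> [] \<and> set (path_edges \<gamma>) \<subseteq> stratum_edges F k \<longrightarrow>
       (\<forall>T \<in> turns_taken G (path_image G G f \<gamma>) \<inter> turns_in G (stratum_edges F k).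
          \<not> illegal_turn G f T))"

definition relative_train_track_map :: "('v, 'e, 'g, 'h) gog \<Rightarrow>
    ('v, 'e, 'g, 'v, 'e, 'g) gmap \<Rightarrow> (nat \<Rightarrow> 'v set \<times> 'e set) \<Rightarrow> nat \<Rightarrow> bool" where
  "relative_train_track_map G f F m \<longleftrightarrow> connected_gog G \<and> topological_realization G f \<and>
     filtration G F m \<and> preserves_filtration f F m \<and> maximal_filtration G f F m \<and>
     (\<forall>k. 1 \<le> k \<and> k \<le> m \<and> exponentially_growing G f F k \<longrightarrow>
        RTT_i G f F k \<and> RTT_ii G f F k \<and> RTT_iii G f F k)"


section \<open>Collapsing a subgraph\<close>

text \<open>Collapsing the components of a subgraph \<open>S\<close> of \<open>G\<close>. The vertices outside \<open>S\<close> are adjoined to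
  \<open>S\<close> as isolated vertices: collapsing such a one-point component changes nothing, since its
  fundamental group is its vertex group, and all vertices can be treated alike. The collapse
  depends on a base vertex \<open>p v\<close> for the component of each vertex \<open>v\<close>, which also serves as the
  name of the collapsed vertex, and on a path \<open>\<alpha> v\<close> in this component from \<open>p v\<close> to \<open>v\<close>, which
  gives the inclusion of the group of \<open>v\<close> into the fundamental group based at \<open>p v\<close>.\<close>

definition collapsed_part ::
    "('v, 'e, 'g, 'h) gog \<Rightarrow> 'v set \<times> 'e set \<Rightarrow> ('v, 'e, 'g, 'h) gog" where
  "collapsed_part G S = restrict_gog G (verts G, snd S)"

definition base_data :: "('v, 'e, 'g, 'h) gog \<Rightarrow> 'v set \<times> 'e set \<Rightarrow>
    ('v \<Rightarrow> 'v) \<Rightarrow> ('v \<Rightarrow> ('v, 'e, 'g) path) \<Rightarrow> bool" where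
  "base_data G S p \<alpha> \<longleftrightarrow>
     (\<forall>v\<in>verts G. path_from_to (collapsed_part G S) (p v) v (\<alpha> v) \<and>
        \<alpha> (p v) = trivial_path G (p v)) \<and>
     (\<forall>v\<in>verts G. \<forall>w\<in>verts G. (\<exists>\<gamma>. path_from_to (collapsed_part G S) v w \<gamma>) \<longrightarrow> p v = p w)"

text \<open>For a path \<open>\<gamma>\<close> in the collapsed part, from \<open>v\<close> to \<open>w\<close>, the loop at \<open>p v = p w\<close> it determines.\<close>

definition collapse_elt :: "('v, 'e, 'g, 'h) gog \<Rightarrow> 'v set \<times> 'e set \<Rightarrow>
    ('v \<Rightarrow> ('v, 'e, 'g) path) \<Rightarrow> ('v, 'e, 'g) path \<Rightarrow> ('v, 'e, 'g) path set" where
  "collapse_elt G S \<alpha> \<gamma> = homotopy_class (collapsed_part G S)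
     (\<alpha> (path_start \<gamma>) \<bullet>\<^bsub>G\<^esub> \<gamma> \<bullet>\<^bsub>G\<^esub> path_rev G (\<alpha> (path_end G \<gamma>)))"

definition collapse :: "('v, 'e, 'g, 'h) gog \<Rightarrow> 'v set \<times> 'e set \<Rightarrow>
    ('v \<Rightarrow> 'v) \<Rightarrow> ('v \<Rightarrow> ('v, 'e, 'g) path) \<Rightarrow> ('v, 'e, ('v, 'e, 'g) path set, 'h) gog" where
  "collapse G S p \<alpha> =
     \<lparr>verts = p ` verts G,
      edges = edges G - snd S,
      ebar = ebar G,
      tm = (\<lambda>e. p (tm G e)),
      vgrp = (\<lambda>v. pi1 (collapsed_part G S) v),
      egrp = egrp G,
      iota = (\<lambda>e h. collapse_elt G S \<alpha> (tm G e, iota G e h, []))\<rparr>"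

definition collapse_map :: "('v, 'e, 'g, 'h) gog \<Rightarrow> 'v set \<times> 'e set \<Rightarrow>
    ('v \<Rightarrow> 'v) \<Rightarrow> ('v \<Rightarrow> ('v, 'e, 'g) path) \<Rightarrow>
    ('v, 'e, 'g, 'v, 'e, ('v, 'e, 'g) path set) gmap" where
  "collapse_map G S p \<alpha> =
     \<lparr>vmap = p,
      vhom = (\<lambda>v g. collapse_elt G S \<alpha> (v, g, [])),
      emap = (\<lambda>e. if e \<in> snd S then (p (org G e), collapse_elt G S \<alpha> (edge_path G e), [])
                  else edge_path (collapse G S p \<alpha>) e)\<rparr>"

text \<open>The map induced on the collapse by a map \<open>f\<close> which sends \<open>S\<close> into itself. In the collapse, the
  edge \<open>e\<close> is the image of the path \<open>\<alpha> (org G e) \<bullet> e \<bullet> path_rev (\<alpha> (tm G e))\<close> between base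
  vertices, to which \<open>f\<close> and then the collapse are applied; likewise for the loops at the base
  vertices which make up the vertex groups.\<close>

definition induced_map :: "('v, 'e, 'g, 'h) gog \<Rightarrow> 'v set \<times> 'e set \<Rightarrow>
    ('v \<Rightarrow> 'v) \<Rightarrow> ('v \<Rightarrow> ('v, 'e, 'g) path) \<Rightarrow> ('v, 'e, 'g, 'v, 'e, 'g) gmap \<Rightarrow>
    ('v, 'e, ('v, 'e, 'g) path set, 'v, 'e, ('v, 'e, 'g) path set) gmap" where
  "induced_map G S p \<alpha> f =
     \<lparr>vmap = (\<lambda>v. p (vmap f v)),
      vhom = (\<lambda>v x. \<Union>\<gamma>\<in>x. collapse_elt G S \<alpha> (path_image G G f \<gamma>)),
      emap = (\<lambda>e. path_image G (collapse G S p \<alpha>) (collapse_map G S p \<alpha>)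
                (path_image G G f (\<alpha> (org G e) \<bullet>\<^bsub>G\<^esub> edge_path G e \<bullet>\<^bsub>G\<^esub> path_rev G (\<alpha> (tm G e)))))\<rparr>"

text \<open>\<open>f'\<close> is the factorization of \<open>f\<close> through the collapse. Since the collapse of a path which does
  not run between base vertices depends on \<open>\<alpha>\<close>, the two composites agree up to a vertex group
  element \<open>\<eta> v\<close> for each vertex \<open>v\<close>, which is trivial at the base vertices. No homotopy
  is involved.\<close>

definition factors_through_collapse :: "('v, 'e, 'g, 'h) gog \<Rightarrow> 'v set \<times> 'e set \<Rightarrow>
    ('v \<Rightarrow> 'v) \<Rightarrow> ('v \<Rightarrow> ('v, 'e, 'g) path) \<Rightarrow> ('v, 'e, 'g, 'v, 'e, 'g) gmap \<Rightarrow>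
    ('v, 'e, ('v, 'e, 'g) path set, 'v, 'e, ('v, 'e, 'g) path set) gmap \<Rightarrow> bool" where
  "factors_through_collapse G S p \<alpha> f f' \<longleftrightarrow>
     (let G' = collapse G S p \<alpha>; c = path_image G G' (collapse_map G S p \<alpha>) in
      (\<forall>v\<in>verts G. vmap f' (p v) = p (vmap f v)) \<and>
      (\<exists>\<eta>. (\<forall>v\<in>verts G. \<eta> v \<in> carrier (vgrp G' (p (vmap f v)))) \<and>
           (\<forall>v\<in>verts G. p v = v \<longrightarrow> \<eta> v = \<one>\<^bsub>vgrp G' (p (vmap f v))\<^esub>) \<and>
           (\<forall>v w \<gamma>. path_from_to G v w \<gamma> \<longrightarrow>
              path_image G' G' f' (c \<gamma>) =
                (p (vmap f v), \<eta> v, []) \<bullet>\<^bsub>G'\<^esub> c (path_image G G f \<gamma>)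
                  \<bullet>\<^bsub>G'\<^esub> (p (vmap f w), inv\<^bsub>vgrp G' (p (vmap f w))\<^esub> \<eta> w, []))))"

end

theory Submission
  imports Defs
begin

text \<open>Every homotopy class of paths has a unique normal form. Hence subgraphs of groups inject on
  fundamental groups, and tight paths in \<open>\<Gamma>\<^sub>k\<close> stay tight in the collapse: a cancelling pair \<open>e\<close>,
  \<open>\<bar>e\<close> there comes from a subpath in \<open>\<Gamma>\<^sub>k\<^sub>-\<^sub>1\<close> homotopic to an element of \<open>\<iota>\<^sub>e(G\<^sub>e)\<close>. So the collapse
  identifies homotopy classes of loops at the base points with those of \<open>\<Gamma>\<^sub>k\<close>, and \<open>f\<close> induces a
  map of the collapse.

  A turn of the collapse is given by two edges of \<open>H\<^sub>k\<close> and a path \<open>\<sigma>\<close> in \<open>\<Gamma>\<^sub>k\<^sub>-\<^sub>1\<close> between them. If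
  \<open>\<sigma>\<close> is homotopically nontrivial, so are its images by (RTT-ii), and the turn never
  degenerates. If \<open>\<sigma>\<close> is a vertex group element, the turn is one of \<open>H\<^sub>k\<close>, which (RTT-i) keeps in
  \<open>H\<^sub>k\<close>, and for turns taken by images of edges (RTT-iii) excludes degeneration. When \<open>H\<^sub>k\<close> is not
  exponentially growing, its transition matrix is a permutation matrix: an irreducible
  nonnegative integer matrix with a further nonzero entry has Perron--Frobenius eigenvalue
  greater than one. Then the image of each edge crosses a single edge of \<open>H\<^sub>k\<close>, and no turn is
  taken in the collapse.\<close>

subsection \<open>Paths\<close>

text \<open>Triviality of paths below the stratum and degeneracy of turns in the collapse concern
  homotopy classes, so the word problem has to be solved in a form that passes to subgraphs. The
  normal form does this: its formulas never consult the vertex or edge sets, so it is literally the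
  same in every subgraph. A second obstacle is base points. The collapse of a path that does not run
  between base vertices depends on the paths \<open>\<alpha>\<close>, so collapsing commutes with
  \<open>f\<close> only up to elements \<open>\<eta> v\<close>. These cancel in concatenations, and
  on turns they amount to a left translation, which does not affect degeneracy. The restriction of
  \<open>f\<close> to \<open>F k\<close> inherits injectivity on fundamental groups from the whole
  graph, but surjectivity onto the group of the target component can fail. The collapse changes
  neither property. Hence the conclusion gives injectivity outright, and for isomorphism an
  equivalence between the restriction and its collapse.\<close>

lemma org_ebar:
  assumes "graph_of_groups G" "e \<in> edges G"
  shows "org G (ebar G e) = tm G e" "org G e \<in> verts G" "tm G e \<in> verts G" "ebar G e \<in> edges G"
    "ebar G (ebar G e) = e" "ebar G e \<noteq> e" "tm G (ebar G e) = org G e"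
  using assms by (auto simp: graph_of_groups_def org_def)

lemma group_vgrp: "graph_of_groups G \<Longrightarrow> v \<in> verts G \<Longrightarrow> group (vgrp G v)"
  by (auto simp: graph_of_groups_def)

lemma vgrp_simps [simp]:
  assumes "graph_of_groups G" "v \<in> verts G"
  shows "\<one>\<^bsub>vgrp G v\<^esub> \<in> carrier (vgrp G v)" "inv\<^bsub>vgrp G v\<^esub> \<one>\<^bsub>vgrp G v\<^esub> = \<one>\<^bsub>vgrp G v\<^esub>"
    "g \<in> carrier (vgrp G v) \<Longrightarrow> inv\<^bsub>vgrp G v\<^esub> g \<in> carrier (vgrp G v)"
    "g \<in> carrier (vgrp G v) \<Longrightarrow> inv\<^bsub>vgrp G v\<^esub> (inv\<^bsub>vgrp G v\<^esub> g) = g"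
    "g \<in> carrier (vgrp G v) \<Longrightarrow> \<one>\<^bsub>vgrp G v\<^esub> \<otimes>\<^bsub>vgrp G v\<^esub> g = g"
    "g \<in> carrier (vgrp G v) \<Longrightarrow> g \<otimes>\<^bsub>vgrp G v\<^esub> \<one>\<^bsub>vgrp G v\<^esub> = g"
    "g \<in> carrier (vgrp G v) \<Longrightarrow> g \<otimes>\<^bsub>vgrp G v\<^esub> inv\<^bsub>vgrp G v\<^esub> g = \<one>\<^bsub>vgrp G v\<^esub>"
    "g \<in> carrier (vgrp G v) \<Longrightarrow> inv\<^bsub>vgrp G v\<^esub> g \<otimes>\<^bsub>vgrp G v\<^esub> g = \<one>\<^bsub>vgrp G v\<^esub>"
    "g \<in> carrier (vgrp G v) \<Longrightarrow> h \<in> carrier (vgrp G v) \<Longrightarrow> g \<otimes>\<^bsub>vgrp G v\<^esub> h \<in> carrier (vgrp G v)"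
proof -
  interpret group "vgrp G v" using assms by (simp add: group_vgrp)
  show "\<one>\<^bsub>vgrp G v\<^esub> \<in> carrier (vgrp G v)" "inv\<^bsub>vgrp G v\<^esub> \<one>\<^bsub>vgrp G v\<^esub> = \<one>\<^bsub>vgrp G v\<^esub>"
    "g \<in> carrier (vgrp G v) \<Longrightarrow> inv\<^bsub>vgrp G v\<^esub> g \<in> carrier (vgrp G v)"
    "g \<in> carrier (vgrp G v) \<Longrightarrow> inv\<^bsub>vgrp G v\<^esub> (inv\<^bsub>vgrp G v\<^esub> g) = g"
    "g \<in> carrier (vgrp G v) \<Longrightarrow> \<one>\<^bsub>vgrp G v\<^esub> \<otimes>\<^bsub>vgrp G v\<^esub> g = g"
    "g \<in> carrier (vgrp G v) \<Longrightarrow> g \<otimes>\<^bsub>vgrp G v\<^esub> \<one>\<^bsub>vgrp G v\<^esub> = g"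
    "g \<in> carrier (vgrp G v) \<Longrightarrow> g \<otimes>\<^bsub>vgrp G v\<^esub> inv\<^bsub>vgrp G v\<^esub> g = \<one>\<^bsub>vgrp G v\<^esub>"
    "g \<in> carrier (vgrp G v) \<Longrightarrow> inv\<^bsub>vgrp G v\<^esub> g \<otimes>\<^bsub>vgrp G v\<^esub> g = \<one>\<^bsub>vgrp G v\<^esub>"
    "g \<in> carrier (vgrp G v) \<Longrightarrow> h \<in> carrier (vgrp G v) \<Longrightarrow> g \<otimes>\<^bsub>vgrp G v\<^esub> h \<in> carrier (vgrp G v)"
    by (auto intro: m_closed)
qed

lemma vgrp_assoc:
  assumes "graph_of_groups G" "v \<in> verts G"
    "x \<in> carrier (vgrp G v)" "y \<in> carrier (vgrp G v)" "z \<in> carrier (vgrp G v)"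
  shows "x \<otimes>\<^bsub>vgrp G v\<^esub> y \<otimes>\<^bsub>vgrp G v\<^esub> z = x \<otimes>\<^bsub>vgrp G v\<^esub> (y \<otimes>\<^bsub>vgrp G v\<^esub> z)"
  using group_vgrp[OF assms(1,2)] assms(3-) by (simp add: group.is_monoid monoid.m_assoc)

lemma vgrp_inv_mult:
  assumes "graph_of_groups G" "v \<in> verts G" "x \<in> carrier (vgrp G v)" "y \<in> carrier (vgrp G v)"
  shows "inv\<^bsub>vgrp G v\<^esub> (x \<otimes>\<^bsub>vgrp G v\<^esub> y) = inv\<^bsub>vgrp G v\<^esub> y \<otimes>\<^bsub>vgrp G v\<^esub> inv\<^bsub>vgrp G v\<^esub> x"
  using group_vgrp[OF assms(1,2)] assms(3-) by (simp add: group.inv_mult_group)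

lemma group_egrp: "graph_of_groups G \<Longrightarrow> e \<in> edges G \<Longrightarrow> group (egrp G e)"
  by (auto simp: graph_of_groups_def)

lemma egrp_ebar [simp]: "graph_of_groups G \<Longrightarrow> e \<in> edges G \<Longrightarrow> egrp G (ebar G e) = egrp G e"
  by (auto simp: graph_of_groups_def)

lemma iota_mon: "graph_of_groups G \<Longrightarrow> e \<in> edges G \<Longrightarrow> iota G e \<in> mon (egrp G e) (vgrp G (tm G e))"
  by (auto simp: graph_of_groups_def)

lemma iota_closed [simp]:
  "graph_of_groups G \<Longrightarrow> e \<in> edges G \<Longrightarrow> h \<in> carrier (egrp G e) \<Longrightarrow> iota G e h \<in> carrier (vgrp G (tm G e))"
  using iota_mon by (fastforce simp: mon_def hom_def)

lemma iota_ebar_closed [simp]: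
  "graph_of_groups G \<Longrightarrow> e \<in> edges G \<Longrightarrow> h \<in> carrier (egrp G e) \<Longrightarrow>
    iota G (ebar G e) h \<in> carrier (vgrp G (org G e))"
  using iota_closed[of G "ebar G e" h] by (simp add: org_ebar)

lemma group_hom_iota:
  "graph_of_groups G \<Longrightarrow> e \<in> edges G \<Longrightarrow> group_hom (egrp G e) (vgrp G (tm G e)) (iota G e)"
  using iota_mon[of G e] by (auto simp: group_hom_def group_hom_axioms_def group_vgrp group_egrp
    org_ebar mon_def)

lemma group_hom_iota_ebar:
  "graph_of_groups G \<Longrightarrow> e \<in> edges G \<Longrightarrow>
    group_hom (egrp G e) (vgrp G (org G e)) (iota G (ebar G e))"
  using group_hom_iota[of G "ebar G e"] by (simp add: org_ebar)

lemma iota_inj: "graph_of_groups G \<Longrightarrow> e \<in> edges G \<Longrightarrow> inj_on (iota G e) (carrier (egrp G e))"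
  using iota_mon[of G e] by (auto simp: mon_def)

text \<open>Projections take the place of \<open>let\<close>, so that the equation rewrites without
  a case split on the recursive result; it replaces the defining equation in the simpset.\<close>

lemma path_cat_Cons: "(v, g, (e, a) # xs) \<bullet>\<^bsub>G\<^esub> q =
   (v, g, (e, fst (snd ((tm G e, a, xs) \<bullet>\<^bsub>G\<^esub> q))) # snd (snd ((tm G e, a, xs) \<bullet>\<^bsub>G\<^esub> q)))"
  by (simp add: case_prod_unfold Let_def)

declare path_cat.simps(2) [simp del] path_cat_Cons [simp]

lemma path_start_cat [simp]: "path_start (x \<bullet>\<^bsub>G\<^esub> y) = path_start x"
  by (induction G x y rule: path_cat.induct) (auto simp: path_start_def case_prod_unfold)

lemma path_start_tuple [simp]: "path_start (v, q) = v"
  by (simp add: path_start_def)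

lemma fst_cat [simp]: "fst (x \<bullet>\<^bsub>G\<^esub> y) = fst x"
  using path_start_cat unfolding path_start_def .

lemma path_edges_tuple [simp]: "path_edges (v, g, xs) = map fst xs"
  by (simp add: path_edges_def)

lemma path_edges_cat [simp]: "path_edges (x \<bullet>\<^bsub>G\<^esub> y) = path_edges x @ path_edges y"
  by (induction G x y rule: path_cat.induct) (auto simp: path_edges_def case_prod_unfold)

lemma is_path_start: "is_path G x \<Longrightarrow> path_start x \<in> verts G"
  by (cases x; cases "snd (snd x)") auto

lemma path_end_cat [simp]:
  "path_end G x = path_start y \<Longrightarrow> path_end G (x \<bullet>\<^bsub>G\<^esub> y) = path_end G y"
proof (induction G x y rule: path_cat.induct)
  case (1 G v g w h ys)
  then show ?case by (cases ys) auto
next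
  case (2 G v g e a xs q)
  obtain w b zs where "(tm G e, a, xs) \<bullet>\<^bsub>G\<^esub> q = (w, b, zs)" by (metis prod_cases3)
  moreover from this have "w = tm G e"
    using path_start_cat[of G "(tm G e, a, xs)" q] by simp
  ultimately show ?case using 2 by simp
qed

lemma is_path_cat [simp]:
  "graph_of_groups G \<Longrightarrow> is_path G x \<Longrightarrow> is_path G y \<Longrightarrow> path_end G x = path_start y \<Longrightarrow>
    is_path G (x \<bullet>\<^bsub>G\<^esub> y)"
proof (induction G x y rule: path_cat.induct)
  case (1 G v g w h ys)
  then show ?case by (cases ys) auto
next
  case (2 G v g e a xs q)
  obtain w b zs where *: "(tm G e, a, xs) \<bullet>\<^bsub>G\<^esub> q = (w, b, zs)" by (metis prod_cases3)
  moreover from this have "w = tm G e"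
    using path_start_cat[of G "(tm G e, a, xs)" q] by simp
  ultimately show ?case using 2 by simp
qed

lemma is_path_end [simp]: "is_path G x \<Longrightarrow> path_end G x \<in> verts G"
  by (induction G x rule: is_path.induct) auto

text \<open>\<open>path_cat\<close> multiplies in the vertex group of its left argument. If the
  middle path has no edge, three elements meet, and matching endpoints put them into one
  group.\<close>

lemma path_cat_assoc:
  "graph_of_groups G \<Longrightarrow> is_path G x \<Longrightarrow> is_path G y \<Longrightarrow> is_path G z \<Longrightarrow>
   path_end G x = path_start y \<Longrightarrow> path_end G y = path_start z \<Longrightarrow>
   x \<bullet>\<^bsub>G\<^esub> y \<bullet>\<^bsub>G\<^esub> z = x \<bullet>\<^bsub>G\<^esub> (y \<bullet>\<^bsub>G\<^esub> z)"
proof (induction G x rule: is_path.induct)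
  case (1 G v g)
  obtain w b ys where y: "y = (w, b, ys)" by (metis prod_cases3)
  obtain u c zs where z: "z = (u, c, zs)" by (metis prod_cases3)
  show ?case
  proof (cases ys)
    case Nil
    then have "c \<in> carrier (vgrp G u)" using 1 z by (cases zs) auto
    then show ?thesis using 1 y z Nil by (auto simp: vgrp_assoc)
  next
    case (Cons p ys')
    then show ?thesis using 1 y z by (cases p) simp
  qed
next
  case (2 G v g e a xs)
  obtain w b zs where *: "(tm G e, a, xs) \<bullet>\<^bsub>G\<^esub> y = (w, b, zs)" by (metis prod_cases3)
  moreover from this have "w = tm G e"
    using path_start_cat[of G "(tm G e, a, xs)" y] by simp
  moreover have "(tm G e, a, xs) \<bullet>\<^bsub>G\<^esub> y \<bullet>\<^bsub>G\<^esub> z = (tm G e, a, xs) \<bullet>\<^bsub>G\<^esub> (y \<bullet>\<^bsub>G\<^esub> z)"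
    using 2 by simp
  ultimately show ?case by simp
qed

lemma is_path_trivial [simp]: "graph_of_groups G \<Longrightarrow> v \<in> verts G \<Longrightarrow> is_path G (trivial_path G v)"
  by (simp add: trivial_path_def)

lemma trivial_path_ends [simp]:
  "path_start (trivial_path G v) = v" "path_end G (trivial_path G v) = v"
  "path_edges (trivial_path G v) = []"
  by (auto simp: trivial_path_def)

lemma trivial_cat:
  "graph_of_groups G \<Longrightarrow> is_path G x \<Longrightarrow> path_start x = v \<Longrightarrow> trivial_path G v \<bullet>\<^bsub>G\<^esub> x = x"
  by (cases x; cases "snd (snd x)") (auto simp: trivial_path_def)

lemma cat_trivial:
  "graph_of_groups G \<Longrightarrow> is_path G x \<Longrightarrow> path_end G x = v \<Longrightarrow> x \<bullet>\<^bsub>G\<^esub> trivial_path G v = x"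
proof (induction G x rule: is_path.induct)
  case (1 G v g)
  then show ?case
    by (auto simp: trivial_path_def)
qed simp

lemma edge_path_props [simp]:
  "path_start (edge_path G e) = org G e" "path_end G (edge_path G e) = tm G e"
  "path_edges (edge_path G e) = [e]"
  by (auto simp: edge_path_def)

lemma is_path_edge_path [simp]: "graph_of_groups G \<Longrightarrow> e \<in> edges G \<Longrightarrow> is_path G (edge_path G e)"
  by (simp add: edge_path_def org_ebar)

text \<open>Writes the leading letter as a factor, so that statements about concatenations become
  induction steps along a path.\<close>

lemma path_Cons_eq:
  assumes "graph_of_groups G" "is_path G (v, g, (e, a) # xs)"
  shows "(v, g, (e, a) # xs) = (v, g, []) \<bullet>\<^bsub>G\<^esub> edge_path G e \<bullet>\<^bsub>G\<^esub> (tm G e, a, xs)"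
proof -
  have "a \<in> carrier (vgrp G (tm G e))" using assms by (cases xs) auto
  then show ?thesis using assms by (auto simp: edge_path_def org_ebar)
qed

lemma path_rev_Cons: "path_rev G (v, g, (e, a) # xs) =
   path_rev G (tm G e, a, xs) \<bullet>\<^bsub>G\<^esub> (tm G e, \<one>\<^bsub>vgrp G (tm G e)\<^esub>, [(ebar G e, inv\<^bsub>vgrp G v\<^esub> g)])"
  by simp

lemma path_start_rev [simp]: "path_start (path_rev G x) = path_end G x"
  by (induction G x rule: is_path.induct) auto

lemma path_edges_rev [simp]: "path_edges (path_rev G x) = rev (map (ebar G) (path_edges x))"
  by (induction G x rule: is_path.induct) auto

lemma path_rev_props: "graph_of_groups G \<Longrightarrow> is_path G x \<Longrightarrow>
    is_path G (path_rev G x) \<and> path_end G (path_rev G x) = path_start x"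
proof (induction G x rule: is_path.induct)
  case (1 G v g)
  then show ?case by simp
next
  case (2 G v g e a xs)
  have "is_path G (tm G e, \<one>\<^bsub>vgrp G (tm G e)\<^esub>, [(ebar G e, inv\<^bsub>vgrp G v\<^esub> g)])"
    using 2 by (auto simp: org_ebar)
  then show ?case using 2 by (auto simp: org_ebar)
qed

lemma is_path_rev [simp]: "graph_of_groups G \<Longrightarrow> is_path G x \<Longrightarrow> is_path G (path_rev G x)"
  and path_end_rev [simp]: "graph_of_groups G \<Longrightarrow> is_path G x \<Longrightarrow> path_end G (path_rev G x) = path_start x"
  using path_rev_props by blast+

lemma vertex_path_cat [simp]: "(v, g, []) \<bullet>\<^bsub>G\<^esub> (w, h, ys) = (v, g \<otimes>\<^bsub>vgrp G v\<^esub> h, ys)"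
  by simp

lemma is_path_fst_group: "is_path G (v, g, xs) \<Longrightarrow> g \<in> carrier (vgrp G v) \<and> v \<in> verts G"
  by (cases xs) auto

lemma path_rev_vertex_cat:
  assumes "graph_of_groups G" "is_path G y" "g \<in> carrier (vgrp G v)" "path_start y = v"
  shows "path_rev G ((v, g, []) \<bullet>\<^bsub>G\<^esub> y) = path_rev G y \<bullet>\<^bsub>G\<^esub> (v, inv\<^bsub>vgrp G v\<^esub> g, [])"
proof -
  obtain b ys where y: "y = (v, b, ys)" using assms(4) by (cases y) auto
  have b: "b \<in> carrier (vgrp G v)" "v \<in> verts G" using assms y is_path_fst_group[of G v b ys] by auto
  show ?thesis
  proof (cases ys)
    case Nil
    then show ?thesis using y b assms by (simp add: vgrp_inv_mult)
  next
    case (Cons p zs)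
    obtain e c where p: "p = (e, c)" by (cases p)
    have e: "e \<in> edges G" "org G e = v" and z: "is_path G (tm G e, c, zs)"
      using assms y Cons p by auto
      have ip: "is_path G (tm G e, \<one>\<^bsub>vgrp G (tm G e)\<^esub>, [(ebar G e, inv\<^bsub>vgrp G v\<^esub> b)])"
      using assms e b by (auto simp: org_ebar)
    have "path_rev G y \<bullet>\<^bsub>G\<^esub> (v, inv\<^bsub>vgrp G v\<^esub> g, []) = 
       path_rev G (tm G e, c, zs) \<bullet>\<^bsub>G\<^esub> (tm G e, \<one>\<^bsub>vgrp G (tm G e)\<^esub>, [(ebar G e, inv\<^bsub>vgrp G v\<^esub> b)])
       \<bullet>\<^bsub>G\<^esub> (v, inv\<^bsub>vgrp G v\<^esub> g, [])"
      using y Cons p by simp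
    also have "\<dots> = path_rev G (tm G e, c, zs) \<bullet>\<^bsub>G\<^esub> ((tm G e, \<one>\<^bsub>vgrp G (tm G e)\<^esub>, [(ebar G e, inv\<^bsub>vgrp G v\<^esub> b)])
       \<bullet>\<^bsub>G\<^esub> (v, inv\<^bsub>vgrp G v\<^esub> g, []))"
      using assms z ip e b by (intro path_cat_assoc) (auto simp: org_ebar)
    also have "\<dots> = path_rev G ((v, g, []) \<bullet>\<^bsub>G\<^esub> y)"
      using y Cons p e b assms by (simp add: vgrp_inv_mult org_ebar)
    finally show ?thesis ..
  qed
qed

lemma path_rev_cat:
  "graph_of_groups G \<Longrightarrow> is_path G x \<Longrightarrow> is_path G y \<Longrightarrow> path_end G x = path_start y \<Longrightarrow>
   path_rev G (x \<bullet>\<^bsub>G\<^esub> y) = path_rev G y \<bullet>\<^bsub>G\<^esub> path_rev G x"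
proof (induction G x rule: is_path.induct)
  case (1 G v g)
  have "path_rev G ((v, g, []) \<bullet>\<^bsub>G\<^esub> y) = path_rev G y \<bullet>\<^bsub>G\<^esub> (v, inv\<^bsub>vgrp G v\<^esub> g, [])"
    by (rule path_rev_vertex_cat) (use 1 in auto)
  then show ?case by (simp only: path_rev.simps)
next
  case (2 G v g e a xs)
  let ?x = "(tm G e, a, xs)" and ?e = "(tm G e, \<one>\<^bsub>vgrp G (tm G e)\<^esub>, [(ebar G e, inv\<^bsub>vgrp G v\<^esub> g)])"
  have x: "is_path G ?x" "path_end G ?x = path_start y" using 2(3,5) by simp_all
  have IH: "path_rev G (?x \<bullet>\<^bsub>G\<^esub> y) = path_rev G y \<bullet>\<^bsub>G\<^esub> path_rev G ?x"
    using 2(1)[OF 2(2) x(1) 2(4) x(2)] .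
  have e: "is_path G ?e" using 2(2,3) by (auto simp: org_ebar)
  obtain b zs where q: "?x \<bullet>\<^bsub>G\<^esub> y = (tm G e, b, zs)"
  proof -
    have "fst (?x \<bullet>\<^bsub>G\<^esub> y) = tm G e" unfolding fst_cat by simp
    then show thesis using that[of "fst (snd (?x \<bullet>\<^bsub>G\<^esub> y))" "snd (snd (?x \<bullet>\<^bsub>G\<^esub> y))"]
      by (simp add: prod_eq_iff)
  qed
  have "path_rev G ((v, g, (e, a) # xs) \<bullet>\<^bsub>G\<^esub> y) = path_rev G (?x \<bullet>\<^bsub>G\<^esub> y) \<bullet>\<^bsub>G\<^esub> ?e"
    unfolding path_cat_Cons q by simp
  also have "\<dots> = path_rev G y \<bullet>\<^bsub>G\<^esub> (path_rev G ?x \<bullet>\<^bsub>G\<^esub> ?e)"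
    unfolding IH by (rule path_cat_assoc) (use 2(2,4) x e in simp_all)
  finally show ?case by simp
qed

lemma path_rev_edge_path:
  "graph_of_groups G \<Longrightarrow> e \<in> edges G \<Longrightarrow> path_rev G (edge_path G e) = edge_path G (ebar G e)"
  by (simp add: edge_path_def org_ebar)

lemma path_rev_rev [simp]:
  "graph_of_groups G \<Longrightarrow> is_path G x \<Longrightarrow> path_rev G (path_rev G x) = x"
proof (induction G x rule: is_path.induct)
  case (1 G v g)
  then show ?case by simp
next
  case (2 G v g e a xs)
  let ?y = "(v, g, []) \<bullet>\<^bsub>G\<^esub> edge_path G e" and ?z = "(tm G e, a, xs)"
  have x: "is_path G (v, g, [])" "is_path G (edge_path G e)" "is_path G ?y" "is_path G ?z"
    "path_end G ?y = tm G e" "path_end G (v, g, []) = org G e"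
    using 2 by (auto simp del: path_cat.simps)
  have "path_rev G (path_rev G (?y \<bullet>\<^bsub>G\<^esub> ?z)) =
      path_rev G (path_rev G ?y) \<bullet>\<^bsub>G\<^esub> path_rev G (path_rev G ?z)"
    using 2(2) x by (simp add: path_rev_cat del: path_rev.simps path_cat.simps vertex_path_cat)
  also have "path_rev G (path_rev G ?y) =
      path_rev G (path_rev G (v, g, [])) \<bullet>\<^bsub>G\<^esub> path_rev G (path_rev G (edge_path G e))"
    using 2(2) x by (simp add: path_rev_cat del: path_rev.simps path_cat.simps vertex_path_cat)
  also have "path_rev G (path_rev G (v, g, [])) = (v, g, [])" using 2 by simp
  also have "path_rev G (path_rev G (edge_path G e)) = edge_path G e"
    using 2 by (simp add: path_rev_edge_path org_ebar)
  also have "path_rev G (path_rev G ?z) = ?z" using 2 by simp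
  finally show ?case using path_Cons_eq[OF 2(2,3)] by simp
qed

subsection \<open>Normal forms\<close>

text \<open>The coset is a right coset \<open>H a\<close> of the image \<open>H\<close> of
  \<open>iota\<close>. The coset \<open>H\<close> itself is forced to have representative 1, so that
  a pair of opposite edges is cancellable exactly when the representative between them is 1.\<close>

definition coset_rep :: "('v, 'e, 'g, 'h) gog \<Rightarrow> 'e \<Rightarrow> 'g \<Rightarrow> 'g" where
  "coset_rep G e a =
     (if a \<in> iota G e ` carrier (egrp G e) then \<one>\<^bsub>vgrp G (tm G e)\<^esub>
      else SOME s. s \<in> carrier (vgrp G (tm G e)) \<and>
        (\<exists>h\<in>carrier (egrp G e). a = iota G e h \<otimes>\<^bsub>vgrp G (tm G e)\<^esub> s))"

text \<open>The edge group coordinate of \<open>a\<close>, the part that can be moved to the left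
  across \<open>e\<close>. It is unique because \<open>iota\<close> is injective.\<close>

definition edge_part :: "('v, 'e, 'g, 'h) gog \<Rightarrow> 'e \<Rightarrow> 'g \<Rightarrow> 'h" where
  "edge_part G e a = (SOME h. h \<in> carrier (egrp G e) \<and>
     a = iota G e h \<otimes>\<^bsub>vgrp G (tm G e)\<^esub> coset_rep G e a)"

context
  fixes G :: "('v, 'e, 'g, 'h) gog" and e :: 'e
  assumes G: "graph_of_groups G" and e: "e \<in> edges G"
begin

interpretation i: group_hom "egrp G e" "vgrp G (tm G e)" "iota G e"
  using G e by (rule group_hom_iota)

lemma coset_rep_edge_part:
  assumes "a \<in> carrier (vgrp G (tm G e))"
  shows "coset_rep G e a \<in> carrier (vgrp G (tm G e))" (is ?A)
    and "edge_part G e a \<in> carrier (egrp G e)" (is ?B)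
    and "iota G e (edge_part G e a) \<otimes>\<^bsub>vgrp G (tm G e)\<^esub> coset_rep G e a = a" (is ?C)
proof -
  have *: "?A \<and> (\<exists>h. h \<in> carrier (egrp G e) \<and> a = iota G e h \<otimes>\<^bsub>vgrp G (tm G e)\<^esub> coset_rep G e a)"
  proof (cases "a \<in> iota G e ` carrier (egrp G e)")
    case True
    then show ?thesis by (auto simp: coset_rep_def)
  next
    case False
    have "a \<in> carrier (vgrp G (tm G e)) \<and> (\<exists>h\<in>carrier (egrp G e). a = iota G e h \<otimes>\<^bsub>vgrp G (tm G e)\<^esub> a)"
      using assms by (auto intro!: bexI[of _ "\<one>\<^bsub>egrp G e\<^esub>"])
    then have "\<exists>s. s \<in> carrier (vgrp G (tm G e)) \<and>
        (\<exists>h\<in>carrier (egrp G e). a = iota G e h \<otimes>\<^bsub>vgrp G (tm G e)\<^esub> s)" ..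
    from someI_ex[OF this] show ?thesis using False by (auto simp: coset_rep_def)
  qed
  then show ?A by simp
  from * have "\<exists>h. h \<in> carrier (egrp G e) \<and> a = iota G e h \<otimes>\<^bsub>vgrp G (tm G e)\<^esub> coset_rep G e a" ..
  from someI_ex[OF this] show ?B ?C by (auto simp: edge_part_def)
qed

text \<open>Multiplying by \<open>iota G e k\<close> only permutes the witnesses \<open>h\<close>.
  So the predicate under \<open>SOME\<close> in \<open>coset_rep\<close> depends on the coset alone,
  and equal cosets receive the same representative.\<close>

lemma iota_mult_coset_iff:
  assumes "a \<in> carrier (vgrp G (tm G e))" "s \<in> carrier (vgrp G (tm G e))" "k \<in> carrier (egrp G e)"
  shows "(\<exists>h\<in>carrier (egrp G e). iota G e k \<otimes>\<^bsub>vgrp G (tm G e)\<^esub> a = iota G e h \<otimes>\<^bsub>vgrp G (tm G e)\<^esub> s) \<longleftrightarrow>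
    (\<exists>h\<in>carrier (egrp G e). a = iota G e h \<otimes>\<^bsub>vgrp G (tm G e)\<^esub> s)"
proof safe
  fix h assume h: "h \<in> carrier (egrp G e)" "iota G e k \<otimes>\<^bsub>vgrp G (tm G e)\<^esub> a = iota G e h \<otimes>\<^bsub>vgrp G (tm G e)\<^esub> s"
  have "a = iota G e (inv\<^bsub>egrp G e\<^esub> k) \<otimes>\<^bsub>vgrp G (tm G e)\<^esub> (iota G e k \<otimes>\<^bsub>vgrp G (tm G e)\<^esub> a)"
    using assms by (simp add: i.H.m_assoc[symmetric])
  then show "\<exists>h\<in>carrier (egrp G e). a = iota G e h \<otimes>\<^bsub>vgrp G (tm G e)\<^esub> s"
    using assms h by (auto intro!: bexI[of _ "inv\<^bsub>egrp G e\<^esub> k \<otimes>\<^bsub>egrp G e\<^esub> h"] simp: i.H.m_assoc)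
next
  fix h assume h: "h \<in> carrier (egrp G e)" "a = iota G e h \<otimes>\<^bsub>vgrp G (tm G e)\<^esub> s"
  then show "\<exists>h'\<in>carrier (egrp G e). iota G e k \<otimes>\<^bsub>vgrp G (tm G e)\<^esub> (iota G e h \<otimes>\<^bsub>vgrp G (tm G e)\<^esub> s) = iota G e h' \<otimes>\<^bsub>vgrp G (tm G e)\<^esub> s"
    using assms by (auto intro!: bexI[of _ "k \<otimes>\<^bsub>egrp G e\<^esub> h"] simp: i.H.m_assoc)
qed

lemma coset_rep_iota_mult [simp]:
  assumes a: "a \<in> carrier (vgrp G (tm G e))" and k: "k \<in> carrier (egrp G e)"
  shows "coset_rep G e (iota G e k \<otimes>\<^bsub>vgrp G (tm G e)\<^esub> a) = coset_rep G e a"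
proof -
  have "iota G e k \<otimes>\<^bsub>vgrp G (tm G e)\<^esub> a \<in> iota G e ` carrier (egrp G e) \<longleftrightarrow> a \<in> iota G e ` carrier (egrp G e)"
    using iota_mult_coset_iff[OF a _ k, of "\<one>\<^bsub>vgrp G (tm G e)\<^esub>"] by (auto simp: image_iff)
  moreover have "(s \<in> carrier (vgrp G (tm G e)) \<and>
        (\<exists>h\<in>carrier (egrp G e). iota G e k \<otimes>\<^bsub>vgrp G (tm G e)\<^esub> a = iota G e h \<otimes>\<^bsub>vgrp G (tm G e)\<^esub> s)) \<longleftrightarrow>
      (s \<in> carrier (vgrp G (tm G e)) \<and> (\<exists>h\<in>carrier (egrp G e). a = iota G e h \<otimes>\<^bsub>vgrp G (tm G e)\<^esub> s))" for s
    using iota_mult_coset_iff[OF a _ k, of s] by blast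
  ultimately show ?thesis by (simp add: coset_rep_def)
qed

lemma edge_part_eqI:
  assumes "h \<in> carrier (egrp G e)" "iota G e h \<otimes>\<^bsub>vgrp G (tm G e)\<^esub> coset_rep G e a = a"
    "a \<in> carrier (vgrp G (tm G e))"
  shows "edge_part G e a = h"
proof -
  note c = coset_rep_edge_part[OF assms(3)]
  have "iota G e (edge_part G e a) = iota G e h"
    using c assms by (metis i.H.right_cancel i.hom_closed)
  then show ?thesis using c assms iota_inj[OF G e] by (auto dest: inj_onD)
qed

lemma edge_part_iota_mult [simp]:
  assumes a: "a \<in> carrier (vgrp G (tm G e))" and k: "k \<in> carrier (egrp G e)"
  shows "edge_part G e (iota G e k \<otimes>\<^bsub>vgrp G (tm G e)\<^esub> a) = k \<otimes>\<^bsub>egrp G e\<^esub> edge_part G e a"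
  using coset_rep_edge_part[OF a] a k by (intro edge_part_eqI) (auto simp: i.H.m_assoc)

lemma coset_rep_coset_rep [simp]:
  assumes "a \<in> carrier (vgrp G (tm G e))"
  shows "coset_rep G e (coset_rep G e a) = coset_rep G e a"
  using coset_rep_iota_mult[of "coset_rep G e a" "edge_part G e a"] coset_rep_edge_part[OF assms] by simp

lemma edge_part_rep:
  assumes "a \<in> carrier (vgrp G (tm G e))" "coset_rep G e a = a"
  shows "edge_part G e a = \<one>\<^bsub>egrp G e\<^esub>"
  using assms by (intro edge_part_eqI) auto

lemma coset_rep_eq_one:
  assumes "a \<in> carrier (vgrp G (tm G e))" "coset_rep G e a = \<one>\<^bsub>vgrp G (tm G e)\<^esub>"
  shows "a = iota G e (edge_part G e a)"
  using coset_rep_edge_part[OF assms(1)] assms(2) by simp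

lemma coset_rep_iota [simp]: "k \<in> carrier (egrp G e) \<Longrightarrow> coset_rep G e (iota G e k) = \<one>\<^bsub>vgrp G (tm G e)\<^esub>"
  by (simp add: coset_rep_def)

lemma edge_part_iota [simp]: "k \<in> carrier (egrp G e) \<Longrightarrow> edge_part G e (iota G e k) = k"
  by (intro edge_part_eqI) auto

end

text \<open>A word is normal if every group element after an edge \<open>e\<close> represents its right coset of the
  image of \<open>iota e\<close>, and no cancellation \<open>e 1 \<bar>e\<close> is left. Paths act on normal words by
  multiplication from the left (van der Waerden's trick).\<close>

fun normal_word :: "('v, 'e, 'g, 'h) gog \<Rightarrow> ('e \<times> 'g) list \<Rightarrow> bool" where
  "normal_word G [] \<longleftrightarrow> True"
| "normal_word G ((e, s) # ys) \<longleftrightarrow> coset_rep G e s = s \<and>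
     \<not> (s = \<one>\<^bsub>vgrp G (tm G e)\<^esub> \<and> map fst (take 1 ys) = [ebar G e]) \<and> normal_word G ys"

definition normal_path :: "('v, 'e, 'g, 'h) gog \<Rightarrow> ('v, 'e, 'g) path \<Rightarrow> bool" where
  "normal_path G w \<longleftrightarrow> is_path G w \<and> normal_word G (snd (snd w))"

section \<open>The left action of paths on normal words\<close>

definition vertex_act :: "('v, 'e, 'g, 'h) gog \<Rightarrow> 'v \<Rightarrow> 'g \<Rightarrow> ('v, 'e, 'g) path \<Rightarrow> ('v, 'e, 'g) path" where
  "vertex_act G v g w = (v, g \<otimes>\<^bsub>vgrp G v\<^esub> fst (snd w), snd (snd w))"

text \<open>Splitting \<open>a\<close> into edge part and representative, the edge part slides to
  the left across \<open>e\<close>. The representative stays behind; if it is 1 and the next letter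
  is the reverse of \<open>e\<close>, the two edges cancel and the neighbouring group elements
  merge.\<close>

definition edge_act :: "('v, 'e, 'g, 'h) gog \<Rightarrow> 'e \<Rightarrow> ('v, 'e, 'g) path \<Rightarrow> ('v, 'e, 'g) path" where
  "edge_act G e w =
     (let a = fst (snd w); ys = snd (snd w); s = coset_rep G e a;
          b = iota G (ebar G e) (edge_part G e a) in
      if s = \<one>\<^bsub>vgrp G (tm G e)\<^esub> \<and> map fst (take 1 ys) = [ebar G e]
      then (org G e, b \<otimes>\<^bsub>vgrp G (org G e)\<^esub> snd (hd ys), tl ys)
      else (org G e, b, (e, s) # ys))"

fun path_act :: "('v, 'e, 'g, 'h) gog \<Rightarrow> ('v, 'e, 'g) path \<Rightarrow> ('v, 'e, 'g) path \<Rightarrow> ('v, 'e, 'g) path" where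
  "path_act G (v, g, []) w = vertex_act G v g w"
| "path_act G (v, g, (e, a) # xs) w = vertex_act G v g (edge_act G e (path_act G (tm G e, a, xs) w))"

text \<open>The image of the trivial word under the action. Paths that act alike have the same
  normal form, so no confluence of a rewriting system has to be shown.\<close>

definition normal_form :: "('v, 'e, 'g, 'h) gog \<Rightarrow> ('v, 'e, 'g) path \<Rightarrow> ('v, 'e, 'g) path" where
  "normal_form G x = path_act G x (trivial_path G (path_end G x))"

lemma path_cases:
  obtains v g where "w = (v, g, [])" | v g e a xs where "w = (v, g, (e, a) # xs)"
  by (metis list.exhaust prod.collapse)

lemma path_start_vertex_act [simp]: "path_start (vertex_act G v g w) = v"
  by (simp add: vertex_act_def)

lemma path_start_edge_act [simp]: "path_start (edge_act G e w) = org G e"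
  by (simp add: edge_act_def Let_def)

lemma vertex_act:
  assumes "graph_of_groups G" "normal_path G w" "path_start w = v" "g \<in> carrier (vgrp G v)"
  shows "normal_path G (vertex_act G v g w)" "path_end G (vertex_act G v g w) = path_end G w"
  using assms by (cases w rule: path_cases; simp add: normal_path_def vertex_act_def)+

lemma vertex_act_mult:
  assumes "graph_of_groups G" "is_path G w" "path_start w = v" "g \<in> carrier (vgrp G v)" "h \<in> carrier (vgrp G v)"
  shows "vertex_act G v g (vertex_act G v h w) = vertex_act G v (g \<otimes>\<^bsub>vgrp G v\<^esub> h) w"
  using assms by (cases w rule: path_cases) (auto simp: vertex_act_def vgrp_assoc)

lemma vertex_act_one:
  assumes "graph_of_groups G" "is_path G w" "path_start w = v"
  shows "vertex_act G v \<one>\<^bsub>vgrp G v\<^esub> w = w"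
  using assms by (cases w rule: path_cases) (auto simp: vertex_act_def)

context
  fixes G :: "('v, 'e, 'g, 'h) gog" and e :: 'e and w :: "('v, 'e, 'g) path"
  assumes G: "graph_of_groups G" and e: "e \<in> edges G" and w: "is_path G w" and s: "path_start w = tm G e"
begin

lemma edge_act_cases:
  obtains (cancel) a b ys where "w = (tm G e, a, (ebar G e, b) # ys)"
      "coset_rep G e a = \<one>\<^bsub>vgrp G (tm G e)\<^esub>" "a = iota G e (edge_part G e a)"
      "edge_part G e a \<in> carrier (egrp G e)" "is_path G (org G e, b, ys)"
      "edge_act G e w = (org G e, iota G (ebar G e) (edge_part G e a) \<otimes>\<^bsub>vgrp G (org G e)\<^esub> b, ys)"
    | (append) a ys where "w = (tm G e, a, ys)" "a \<in> carrier (vgrp G (tm G e))"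
      "\<not> (coset_rep G e a = \<one>\<^bsub>vgrp G (tm G e)\<^esub> \<and> map fst (take 1 ys) = [ebar G e])"
      "edge_part G e a \<in> carrier (egrp G e)" "coset_rep G e a \<in> carrier (vgrp G (tm G e))"
      "is_path G (tm G e, coset_rep G e a, ys)"
      "edge_act G e w = (org G e, iota G (ebar G e) (edge_part G e a), (e, coset_rep G e a) # ys)"
proof -
  obtain a ys where w': "w = (tm G e, a, ys)" using s by (cases w) auto
  have a: "a \<in> carrier (vgrp G (tm G e))" using w w' by (cases ys) auto
  note c = coset_rep_edge_part[OF G e a]
  have p: "is_path G (tm G e, coset_rep G e a, ys)" using w w' c by (cases ys) auto
  show ?thesis
  proof (cases "coset_rep G e a = \<one>\<^bsub>vgrp G (tm G e)\<^esub> \<and> map fst (take 1 ys) = [ebar G e]")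
    case True
    then obtain b zs where ys: "ys = (ebar G e, b) # zs" by (cases ys) auto
    show ?thesis
      by (rule cancel[of a b zs]) (use True ys w w' c coset_rep_eq_one[OF G e a] G e in \<open>auto simp: edge_act_def org_ebar Let_def\<close>)
  next
    case False
    show ?thesis by (rule append[of a ys]) (use False w' a c p in \<open>auto simp: edge_act_def Let_def\<close>)
  qed
qed

text \<open>The cancelling branch removes a leading letter. The other branch is taken exactly when
  the new letter satisfies the non-cancellation clause of \<open>normal_word\<close>, and
  representatives represent themselves.\<close>

lemma edge_act:
  shows "is_path G (edge_act G e w)" "path_end G (edge_act G e w) = path_end G w"
    "normal_path G w \<Longrightarrow> normal_path G (edge_act G e w)"
proof -
  have "is_path G (edge_act G e w) \<and> path_end G (edge_act G e w) = path_end G w \<and>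
     (normal_path G w \<longrightarrow> normal_path G (edge_act G e w))"
  proof (cases rule: edge_act_cases)
    case (cancel a b ys)
    then show ?thesis using G e by (cases ys) (auto simp: normal_path_def org_ebar)
  next
    case (append a ys)
    then show ?thesis using G e w by (cases ys) (auto simp: normal_path_def org_ebar)
  qed
  then show "is_path G (edge_act G e w)" "path_end G (edge_act G e w) = path_end G w"
    "normal_path G w \<Longrightarrow> normal_path G (edge_act G e w)" by auto
qed

text \<open>A left factor \<open>iota G e h\<close> leaves the coset of \<open>a\<close> unchanged,
  hence also the representative and the branch taken, and multiplies the edge part by
  \<open>h\<close>.\<close>

lemma edge_act_slide:
  assumes h: "h \<in> carrier (egrp G e)"
  shows "edge_act G e (vertex_act G (tm G e) (iota G e h) w) =
    vertex_act G (org G e) (iota G (ebar G e) h) (edge_act G e w)"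
proof -
  obtain a ys where w': "w = (tm G e, a, ys)" using s by (cases w) auto
  have a: "a \<in> carrier (vgrp G (tm G e))" using w w' by (cases ys) auto
  have b: "snd (hd ys) \<in> carrier (vgrp G (org G e))" if "map fst (take 1 ys) = [ebar G e]"
    using that w w' G e by (cases ys) (auto simp: org_ebar dest: is_path_fst_group)
  interpret i: group_hom "egrp G e" "vgrp G (org G e)" "iota G (ebar G e)"
    using G e by (rule group_hom_iota_ebar)
  show ?thesis
    using a h w' b coset_rep_edge_part[OF G e a] G e
    by (auto simp: edge_act_def vertex_act_def Let_def i.H.m_assoc)
qed

end

text \<open>This needs a normal \<open>w\<close>. After a cancellation the exposed element
  \<open>b\<close> is a representative, so acting by the reverse edge splits off exactly the edge
  part and puts \<open>b\<close> back, and the non-cancellation clause at \<open>b\<close> prevents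
  a second cancellation. In the other branch the leading element has trivial representative, and the
  letter just added cancels.\<close>

lemma edge_act_ebar:
  assumes G: "graph_of_groups G" and e: "e \<in> edges G" and w: "normal_path G w" and s: "path_start w = tm G e"
  shows "edge_act G (ebar G e) (edge_act G e w) = w"
proof -
  have ip: "is_path G w" using w by (simp add: normal_path_def)
  note e' = org_ebar[OF G e]
  interpret i: group_hom "egrp G e" "vgrp G (org G e)" "iota G (ebar G e)"
    using G e by (rule group_hom_iota_ebar)
  have eg: "egrp G (ebar G e) = egrp G e" using G e by simp
  from G e ip s show ?thesis
  proof (cases rule: edge_act_cases)
    case (cancel a b ys)
    have b: "b \<in> carrier (vgrp G (org G e))" using cancel is_path_fst_group[of G "org G e" b ys] by simp
    have r: "coset_rep G (ebar G e) b = b" and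
      nc: "\<not> (b = \<one>\<^bsub>vgrp G (org G e)\<^esub> \<and> map fst (take 1 ys) = [e])"
      using w cancel e' by (auto simp: normal_path_def)
    have cr: "coset_rep G (ebar G e) (iota G (ebar G e) (edge_part G e a) \<otimes>\<^bsub>vgrp G (org G e)\<^esub> b) = b"
      using coset_rep_iota_mult[OF G e'(4), of b "edge_part G e a"] e' b cancel r eg by simp
    have "edge_part G (ebar G e) (iota G (ebar G e) (edge_part G e a) \<otimes>\<^bsub>vgrp G (org G e)\<^esub> b) =
        edge_part G e a \<otimes>\<^bsub>egrp G e\<^esub> edge_part G (ebar G e) b"
      using edge_part_iota_mult[OF G e'(4), of b "edge_part G e a"] e' b cancel eg by simp
    also have "edge_part G (ebar G e) b = \<one>\<^bsub>egrp G e\<^esub>"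
      using edge_part_rep[OF G e'(4), of b] r b e' eg by simp
    finally have ep: "edge_part G (ebar G e) (iota G (ebar G e) (edge_part G e a) \<otimes>\<^bsub>vgrp G (org G e)\<^esub> b) = edge_part G e a"
      using cancel by simp
    show ?thesis unfolding cancel(6) using cr ep nc cancel(3) e'
      by (auto simp: edge_act_def Let_def cancel(1))
  next
    case (append a ys)
    have "coset_rep G (ebar G e) (iota G (ebar G e) (edge_part G e a)) = \<one>\<^bsub>vgrp G (org G e)\<^esub>"
      using coset_rep_iota[OF G e'(4), of "edge_part G e a"] append e' eg by simp
    moreover have "edge_part G (ebar G e) (iota G (ebar G e) (edge_part G e a)) = edge_part G e a"
      using edge_part_iota[OF G e'(4), of "edge_part G e a"] append eg by simp
    ultimately show ?thesis unfolding append(7) using e' append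
      coset_rep_edge_part(3)[OF G e append(2)]
      by (simp add: edge_act_def Let_def)
  qed
qed

lemma path_act:
  assumes "graph_of_groups G"
  shows "is_path G x \<Longrightarrow> normal_path G w \<Longrightarrow> path_start w = path_end G x \<Longrightarrow>
    normal_path G (path_act G x w) \<and> path_start (path_act G x w) = path_start x \<and>
    path_end G (path_act G x w) = path_end G w"
  using assms
proof (induction G x w rule: path_act.induct)
  case (1 G v g w)
  then show ?case by (simp add: vertex_act)
next
  case (2 G v g e a xs w)
  let ?w = "path_act G (tm G e, a, xs) w"
  have "normal_path G ?w" "path_start ?w = tm G e" "path_end G ?w = path_end G w" using 2 by simp_all
  then have "normal_path G (edge_act G e ?w)" "path_end G (edge_act G e ?w) = path_end G w"
    using 2 edge_act[of G e ?w] by (auto simp: normal_path_def)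
  then show ?case using 2 by (simp add: vertex_act)
qed

lemma path_act_props [simp]:
  assumes "graph_of_groups G" "is_path G x" "normal_path G w" "path_start w = path_end G x"
  shows "normal_path G (path_act G x w)" "path_start (path_act G x w) = path_start x"
    "path_end G (path_act G x w) = path_end G w"
  using path_act[OF assms] by auto

lemma normal_path_is_path: "normal_path G w \<Longrightarrow> is_path G w"
  by (simp add: normal_path_def)

lemma path_act_vertex_cat:
  assumes "graph_of_groups G" "is_path G x" "normal_path G w" "path_start w = path_end G x"
    "path_start x = v" "g \<in> carrier (vgrp G v)"
  shows "path_act G ((v, g, []) \<bullet>\<^bsub>G\<^esub> x) w = vertex_act G v g (path_act G x w)"
proof (cases x rule: path_cases)
  case (1 u b)
  then show ?thesis using assms
    by (simp add: vertex_act_mult normal_path_is_path)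
next
  case (2 u b e a xs)
  let ?w = "path_act G (tm G e, a, xs) w"
  have "normal_path G ?w" "path_start ?w = tm G e" using assms 2 by auto
  then have "is_path G (edge_act G e ?w)" using edge_act(1)[of G e ?w] assms 2
    by (auto simp: normal_path_def)
  then show ?thesis using assms 2 by (auto simp: vertex_act_mult)
qed

lemma path_act_cat [simp]:
  assumes "graph_of_groups G"
  shows "is_path G x \<Longrightarrow> is_path G y \<Longrightarrow> path_end G x = path_start y \<Longrightarrow> normal_path G w \<Longrightarrow>
    path_start w = path_end G y \<Longrightarrow> path_act G (x \<bullet>\<^bsub>G\<^esub> y) w = path_act G x (path_act G y w)"
  using assms
proof (induction G x rule: is_path.induct)
  case (1 G v g)
  show ?case by (subst path_act_vertex_cat) (use 1 in auto)
next
  case (2 G v g e a xs)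
  let ?x = "(tm G e, a, xs)"
  have x: "is_path G ?x" "path_end G ?x = path_start y" using 2(2,4) by simp_all
  have IH: "path_act G (?x \<bullet>\<^bsub>G\<^esub> y) w = path_act G ?x (path_act G y w)"
    using 2(1)[OF x(1) 2(3) x(2) 2(5,6,7)] .
  have "fst (?x \<bullet>\<^bsub>G\<^esub> y) = tm G e" unfolding fst_cat by simp
  then have q: "(tm G e, fst (snd (?x \<bullet>\<^bsub>G\<^esub> y)), snd (snd (?x \<bullet>\<^bsub>G\<^esub> y))) = ?x \<bullet>\<^bsub>G\<^esub> y"
    by (simp add: prod_eq_iff)
  show ?case unfolding path_cat_Cons path_act.simps q IH ..
qed

lemma normal_trivial [simp]: "graph_of_groups G \<Longrightarrow> v \<in> verts G \<Longrightarrow> normal_path G (trivial_path G v)"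
  by (simp add: normal_path_def) (simp add: trivial_path_def)

lemma path_act_edge_path [simp]:
  assumes "graph_of_groups G" "e \<in> edges G" "normal_path G w" "path_start w = tm G e"
  shows "path_act G (edge_path G e) w = edge_act G e w"
proof -
  have "is_path G (edge_act G e w)" using edge_act(1)[of G e w] assms by (auto simp: normal_path_def)
  then show ?thesis using assms by (simp add: edge_path_def vertex_act_one normal_path_is_path)
qed

text \<open>Reversed paths act as inverses, which comes down to \<open>edge_act_ebar\<close> letter
  by letter. This makes cancellation moves invisible to the action.\<close>

lemma path_act_rev [simp]:
  assumes "graph_of_groups G"
  shows "is_path G x \<Longrightarrow> normal_path G w \<Longrightarrow> path_start w = path_end G x \<Longrightarrow>
    path_act G (path_rev G x) (path_act G x w) = w"
  using assms
proof (induction G x arbitrary: w rule: is_path.induct)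
  case (1 G v g)
  then show ?case by (simp add: vertex_act_mult vertex_act_one normal_path_is_path)
next
  case (2 G v g e a xs)
  note G = \<open>graph_of_groups G\<close>
  let ?x = "(tm G e, a, xs)" and ?e = "(tm G e, \<one>\<^bsub>vgrp G (tm G e)\<^esub>, [(ebar G e, inv\<^bsub>vgrp G v\<^esub> g)])"
  let ?w = "path_act G ?x w" 
  have x: "is_path G ?x" "path_end G ?x = path_start w" using 2(2,4) by simp_all
  have e: "e \<in> edges G" "v = org G e" "v \<in> verts G" "g \<in> carrier (vgrp G v)" using 2 by auto
  note e' = org_ebar[OF G e(1)]
  have w: "normal_path G ?w" "path_start ?w = tm G e" using x 2(3) G by simp_all
  let ?u = "edge_act G e ?w"
  have u: "normal_path G ?u" "path_start ?u = v"
    using edge_act(3)[OF G e(1) _ w(2)] w e by (auto simp: normal_path_def)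
  have ip: "is_path G ?e" using G e e' by auto
  have "path_act G ?e (vertex_act G v g ?u) = vertex_act G (tm G e) \<one>\<^bsub>vgrp G (tm G e)\<^esub>
      (edge_act G (ebar G e) (vertex_act G v (inv\<^bsub>vgrp G v\<^esub> g) (vertex_act G v g ?u)))"
    using e e' by simp
  also have "vertex_act G v (inv\<^bsub>vgrp G v\<^esub> g) (vertex_act G v g ?u) = ?u"
    using G e u by (simp add: vertex_act_mult vertex_act_one normal_path_is_path)
  also have "edge_act G (ebar G e) ?u = ?w" using edge_act_ebar[OF G e(1) w] .
  also have "vertex_act G (tm G e) \<one>\<^bsub>vgrp G (tm G e)\<^esub> ?w = ?w"
    using G w by (simp add: vertex_act_one normal_path_is_path)
  finally have 1: "path_act G ?e (vertex_act G v g ?u) = ?w" .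
  have nv: "normal_path G (vertex_act G v g ?u)" using vertex_act[OF G u e(4)] by simp
  have "path_act G (path_rev G (v, g, (e, a) # xs)) (vertex_act G v g ?u) =
    path_act G (path_rev G ?x) (path_act G ?e (vertex_act G v g ?u))"
    unfolding path_rev_Cons using G x ip nv e e' by (intro path_act_cat) auto
  also have "\<dots> = w" unfolding 1 using 2(1)[OF x(1) 2(3) _ G] x(2) by simp
  finally show ?case by simp
qed

lemma path_act_rev' [simp]:
  assumes "graph_of_groups G" "is_path G x" "normal_path G w" "path_start w = path_start x"
  shows "path_act G x (path_act G (path_rev G x) w) = w"
  using path_act_rev[of G "path_rev G x" w] assms by simp

text \<open>The purpose of the action: a \<open>cancel\<close> move does not change it by
  \<open>path_act_rev'\<close>, a \<open>slide\<close> move by \<open>edge_act_slide\<close>.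
  Homotopic paths therefore act in the same way.\<close>

lemma elem_homotopy_path_act:
  assumes G: "graph_of_groups G" and "elem_homotopy G x y"
  shows "is_path G x" "is_path G y" "path_start x = path_start y" "path_end G x = path_end G y"
    "normal_path G w \<Longrightarrow> path_start w = path_end G x \<Longrightarrow> path_act G x w = path_act G y w"
proof -
  have "is_path G x \<and> is_path G y \<and> path_start x = path_start y \<and> path_end G x = path_end G y \<and>
    (normal_path G w \<longrightarrow> path_start w = path_end G x \<longrightarrow> path_act G x w = path_act G y w)"
    using assms(2)
  proof cases
    case (cancel \<alpha> \<sigma> \<beta>)
    note [simp] = G cancel
    show ?thesis by simp
  next
    case (slide \<alpha> \<beta> e h)
    note [simp] = G slide(3-) org_ebar[OF G slide(5)]
    have p: "is_path G (tm G e, iota G e h, [])" "is_path G (org G e, iota G (ebar G e) h, [])" by simp_all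
    show ?thesis
    proof (cases "normal_path G w \<and> path_start w = path_end G \<beta>")
      case True
      let ?w = "path_act G \<beta> w"
      have w: "normal_path G ?w" "path_start ?w = tm G e" using True by auto
      have 1: "path_act G (tm G e, iota G e h, []) ?w = vertex_act G (tm G e) (iota G e h) ?w"
        "path_act G (org G e, iota G (ebar G e) h, []) (edge_act G e ?w) = 
          vertex_act G (org G e) (iota G (ebar G e) h) (edge_act G e ?w)" by simp_all
      have v: "normal_path G (vertex_act G (tm G e) (iota G e h) ?w)"
        using vertex_act[OF _ w, of "iota G e h"] by simp
      have 2: "edge_act G e (vertex_act G (tm G e) (iota G e h) ?w) =
         vertex_act G (org G e) (iota G (ebar G e) h) (edge_act G e ?w)"
        using w by (intro edge_act_slide) (auto simp: normal_path_is_path)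
      have n: "normal_path G (edge_act G e ?w)"
        using w edge_act(3)[of G e ?w] by (simp add: normal_path_is_path)
      note 3 = n vertex_act[OF _ n, of "org G e" "iota G (ebar G e) h"]
      show ?thesis unfolding slide(1,2) using True w p 1 2 v 3 
        by (simp del: path_act.simps path_cat.simps is_path.simps vertex_path_cat)
    next
      case False
      then show ?thesis unfolding slide(1,2) using p 
        by (auto simp del: path_act.simps path_cat.simps is_path.simps vertex_path_cat)
    qed
  qed
  then show "is_path G x" "is_path G y" "path_start x = path_start y" "path_end G x = path_end G y"
    "normal_path G w \<Longrightarrow> path_start w = path_end G x \<Longrightarrow> path_act G x w = path_act G y w" by auto
qed

lemma normal_form_props [simp]:
  assumes "graph_of_groups G" "is_path G x"
  shows "normal_path G (normal_form G x)" "path_start (normal_form G x) = path_start x"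
    "path_end G (normal_form G x) = path_end G x"
  using assms by (simp_all add: normal_form_def)

lemma normal_form_vertex [simp]:
  "graph_of_groups G \<Longrightarrow> v \<in> verts G \<Longrightarrow> g \<in> carrier (vgrp G v) \<Longrightarrow> normal_form G (v, g, []) = (v, g, [])"
  by (simp add: normal_form_def vertex_act_def trivial_path_def)

lemma normal_form_cat:
  assumes "graph_of_groups G" "is_path G x" "is_path G y" "path_end G x = path_start y"
  shows "normal_form G (x \<bullet>\<^bsub>G\<^esub> y) = path_act G x (normal_form G y)"
  using assms by (simp add: normal_form_def)

subsection \<open>Homotopy\<close>

lemma homotopic_refl [simp]: "homotopic G x x"
  by (simp add: homotopic_def)

lemma homotopic_sym: "homotopic G x y \<Longrightarrow> homotopic G y x"
  unfolding homotopic_def by (rule equivclp_sym)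

lemma homotopic_trans [trans]: "homotopic G x y \<Longrightarrow> homotopic G y z \<Longrightarrow> homotopic G x z"
  unfolding homotopic_def by (rule equivclp_trans)

lemma homotopic_elem: "elem_homotopy G x y \<Longrightarrow> homotopic G x y"
  unfolding homotopic_def by auto

lemma homotopic_induct [consumes 1, case_names refl step]:
  assumes "homotopic G x y" "P x"
    and "\<And>y z. homotopic G x y \<Longrightarrow> elem_homotopy G y z \<or> elem_homotopy G z y \<Longrightarrow> P y \<Longrightarrow> P z"
  shows "P y"
  using assms unfolding homotopic_def by (induction rule: equivclp_induct) auto

lemma homotopic_props:
  assumes G: "graph_of_groups G" and h: "homotopic G x y" and x: "is_path G x"
  shows "is_path G y" "path_start y = path_start x" "path_end G y = path_end G x"
    "normal_path G w \<Longrightarrow> path_start w = path_end G x \<Longrightarrow> path_act G y w = path_act G x w"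
    "normal_form G y = normal_form G x"
proof -
  have *: "is_path G y \<and> path_start y = path_start x \<and> path_end G y = path_end G x \<and>
    (\<forall>w. normal_path G w \<longrightarrow> path_start w = path_end G x \<longrightarrow> path_act G y w = path_act G x w)"
    using h
  proof (induction rule: homotopic_induct)
    case refl
    then show ?case using x by simp
  next
    case (step y z)
    then show ?case using elem_homotopy_path_act[OF G, of y z] elem_homotopy_path_act[OF G, of z y] by metis
  qed
  then show "is_path G y" "path_start y = path_start x" "path_end G y = path_end G x"
    "normal_path G w \<Longrightarrow> path_start w = path_end G x \<Longrightarrow> path_act G y w = path_act G x w" by blast+
  have "normal_path G (trivial_path G (path_end G x))" using G x by simp
  then show "normal_form G y = normal_form G x" unfolding normal_form_def
    using * by (metis trivial_path_ends(1))
qed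

lemma elem_homotopy_cat:
  assumes G: "graph_of_groups G" and "elem_homotopy G x y" and z: "is_path G z" "path_end G z = path_start x"
  shows "elem_homotopy G (z \<bullet>\<^bsub>G\<^esub> x) (z \<bullet>\<^bsub>G\<^esub> y)"
  using assms(2)
proof cases
  case (cancel \<alpha> \<sigma> \<beta>)
  have "elem_homotopy G ((z \<bullet>\<^bsub>G\<^esub> \<alpha>) \<bullet>\<^bsub>G\<^esub> \<sigma> \<bullet>\<^bsub>G\<^esub> path_rev G \<sigma> \<bullet>\<^bsub>G\<^esub> \<beta>) ((z \<bullet>\<^bsub>G\<^esub> \<alpha>) \<bullet>\<^bsub>G\<^esub> \<beta>)"
    using G cancel z by (intro elem_homotopy.cancel) auto
  then show ?thesis using G cancel z by (simp add: path_cat_assoc)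
next
  case (slide \<alpha> \<beta> e h)
  have "elem_homotopy G ((z \<bullet>\<^bsub>G\<^esub> \<alpha>) \<bullet>\<^bsub>G\<^esub> edge_path G e \<bullet>\<^bsub>G\<^esub> (tm G e, iota G e h, []) \<bullet>\<^bsub>G\<^esub> \<beta>)
                    ((z \<bullet>\<^bsub>G\<^esub> \<alpha>) \<bullet>\<^bsub>G\<^esub> (org G e, iota G (ebar G e) h, []) \<bullet>\<^bsub>G\<^esub> edge_path G e \<bullet>\<^bsub>G\<^esub> \<beta>)"
    using G slide z by (intro elem_homotopy.slide) auto
  moreover have "is_path G (tm G e, iota G e h, [])" "is_path G (org G e, iota G (ebar G e) h, [])"
    using G slide by (auto simp: org_ebar)
  ultimately show ?thesis using G slide z
    by (simp add: path_cat_assoc org_ebar del: path_cat.simps is_path.simps vertex_path_cat)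
qed

lemma homotopic_cat_left:
  assumes G: "graph_of_groups G" and "homotopic G x y" and x: "is_path G x" and z: "is_path G z" "path_end G z = path_start x"
  shows "homotopic G (z \<bullet>\<^bsub>G\<^esub> x) (z \<bullet>\<^bsub>G\<^esub> y)"
  using assms(2)
proof (induction rule: homotopic_induct)
  case (step u w)
  have "is_path G u" "path_start u = path_start x" using homotopic_props[OF G step(1) x] by auto
  then have "path_start u = path_start x \<and> path_start w = path_start x"
    using step(2) elem_homotopy_path_act[OF G] by metis
  then have "homotopic G (z \<bullet>\<^bsub>G\<^esub> u) (z \<bullet>\<^bsub>G\<^esub> w)" using step(2) z
    by (metis G elem_homotopy_cat homotopic_elem homotopic_sym)
  then show ?case using step(3) homotopic_trans by metis
qed simp

text \<open>The action is realized by homotopies: one \<open>slide\<close> carries the edge part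
  across \<open>e\<close>, and in the cancelling branch one \<open>cancel\<close> with the single
  edge as \<open>\<sigma>\<close> removes the pair.\<close>

lemma homotopic_edge_act:
  assumes G: "graph_of_groups G" and e: "e \<in> edges G" and w: "is_path G w" and s: "path_start w = tm G e"
  shows "homotopic G (edge_path G e \<bullet>\<^bsub>G\<^esub> w) (edge_act G e w)"
proof -
  obtain a ys where w': "w = (tm G e, a, ys)" using s by (cases w) auto
  have a: "a \<in> carrier (vgrp G (tm G e))" using w w' by (cases ys) auto
  note c = coset_rep_edge_part[OF G e a] and e' = org_ebar[OF G e]
  let ?h = "edge_part G e a" and ?s = "coset_rep G e a"
  have p: "is_path G (tm G e, ?s, ys)" using w w' c by (cases ys) auto
  have "elem_homotopy G (trivial_path G (org G e) \<bullet>\<^bsub>G\<^esub> edge_path G e \<bullet>\<^bsub>G\<^esub> (tm G e, iota G e ?h, []) \<bullet>\<^bsub>G\<^esub> (tm G e, ?s, ys))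
      (trivial_path G (org G e) \<bullet>\<^bsub>G\<^esub> (org G e, iota G (ebar G e) ?h, []) \<bullet>\<^bsub>G\<^esub> edge_path G e \<bullet>\<^bsub>G\<^esub> (tm G e, ?s, ys))"
    using G e p c e' by (intro elem_homotopy.slide) auto
  moreover have "trivial_path G (org G e) \<bullet>\<^bsub>G\<^esub> edge_path G e \<bullet>\<^bsub>G\<^esub> (tm G e, iota G e ?h, []) \<bullet>\<^bsub>G\<^esub> (tm G e, ?s, ys)
      = edge_path G e \<bullet>\<^bsub>G\<^esub> w"
    using G e c e' w' a by (simp add: trivial_cat edge_path_def vgrp_assoc[symmetric])
  moreover have 1: "trivial_path G (org G e) \<bullet>\<^bsub>G\<^esub> (org G e, iota G (ebar G e) ?h, []) \<bullet>\<^bsub>G\<^esub> edge_path G e \<bullet>\<^bsub>G\<^esub> (tm G e, ?s, ys)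
      = (org G e, iota G (ebar G e) ?h, (e, ?s) # ys)"
    using G e c e' by (simp add: trivial_path_def edge_path_def)
  ultimately have 2: "homotopic G (edge_path G e \<bullet>\<^bsub>G\<^esub> w) (org G e, iota G (ebar G e) ?h, (e, ?s) # ys)"
    using homotopic_elem by metis
  from G e w s show ?thesis
  proof (cases rule: edge_act_cases)
    case (cancel a' b zs)
    have [simp]: "a' = a" "ys = (ebar G e, b) # zs" using cancel(1) w' by auto
    have b: "b \<in> carrier (vgrp G (org G e))" using is_path_fst_group[OF cancel(5)] by simp
    have "elem_homotopy G ((org G e, iota G (ebar G e) ?h, []) \<bullet>\<^bsub>G\<^esub> edge_path G e \<bullet>\<^bsub>G\<^esub> path_rev G (edge_path G e) \<bullet>\<^bsub>G\<^esub> (org G e, b, zs))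
      ((org G e, iota G (ebar G e) ?h, []) \<bullet>\<^bsub>G\<^esub> (org G e, b, zs))"
      using G e e' c cancel(5) by (intro elem_homotopy.cancel) auto
    moreover have "(org G e, iota G (ebar G e) ?h, []) \<bullet>\<^bsub>G\<^esub> edge_path G e \<bullet>\<^bsub>G\<^esub> path_rev G (edge_path G e) \<bullet>\<^bsub>G\<^esub> (org G e, b, zs)
      = (org G e, iota G (ebar G e) ?h, (e, ?s) # ys)"
      using G e e' c b cancel(2) by (simp add: edge_path_def)
    ultimately have "homotopic G (org G e, iota G (ebar G e) ?h, (e, ?s) # ys) (edge_act G e w)"
      using homotopic_elem cancel(6) by simp
    then show ?thesis using 2 homotopic_trans by metis
  next
    case (append a' ys')
    then show ?thesis using 2 w' by simp
  qed
qed

lemma homotopic_path_act: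
  assumes G: "graph_of_groups G"
  shows "is_path G x \<Longrightarrow> normal_path G w \<Longrightarrow> path_start w = path_end G x \<Longrightarrow>
    homotopic G (x \<bullet>\<^bsub>G\<^esub> w) (path_act G x w)"
  using G
proof (induction G x w rule: path_act.induct)
  case (1 G v g w)
  then show ?case by (cases w) (simp add: vertex_act_def)
next
  case (2 G v g e a xs w)
  note G = \<open>graph_of_groups G\<close>
  let ?x = "(tm G e, a, xs)" and ?v = "(v, g, [])"
  let ?w = "path_act G ?x w"
  have x: "is_path G ?x" "path_end G ?x = path_start w" using 2(2,4) by simp_all
  have e: "e \<in> edges G" "v = org G e" "v \<in> verts G" "g \<in> carrier (vgrp G v)" using 2 by auto
  have v: "is_path G ?v" "is_path G (edge_path G e)" "path_end G ?v = org G e" using G e by auto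
  have w: "is_path G w" "is_path G ?w" "path_start ?w = tm G e"
    using G x 2(3) by (simp_all add: normal_path_is_path)
  have xw: "is_path G (?x \<bullet>\<^bsub>G\<^esub> w)" using G x w by (intro is_path_cat)
  have 1: "homotopic G (?x \<bullet>\<^bsub>G\<^esub> w) ?w" using 2(1)[OF x(1) 2(3) _ G] x(2) by simp
  have "homotopic G (edge_path G e \<bullet>\<^bsub>G\<^esub> (?x \<bullet>\<^bsub>G\<^esub> w)) (edge_path G e \<bullet>\<^bsub>G\<^esub> ?w)"
    by (rule homotopic_cat_left[OF G 1]) (use xw v in auto)
  also have "homotopic G (edge_path G e \<bullet>\<^bsub>G\<^esub> ?w) (edge_act G e ?w)"
    by (rule homotopic_edge_act[OF G e(1) w(2,3)])
  finally have "homotopic G (?v \<bullet>\<^bsub>G\<^esub> (edge_path G e \<bullet>\<^bsub>G\<^esub> (?x \<bullet>\<^bsub>G\<^esub> w))) (?v \<bullet>\<^bsub>G\<^esub> edge_act G e ?w)"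
    by (rule homotopic_cat_left[OF G]) (use G v xw e in auto)
  moreover have "?v \<bullet>\<^bsub>G\<^esub> edge_act G e ?w = path_act G (v, g, (e, a) # xs) w"
    by (cases "edge_act G e ?w") (simp add: vertex_act_def)
  moreover have "?v \<bullet>\<^bsub>G\<^esub> (edge_path G e \<bullet>\<^bsub>G\<^esub> (?x \<bullet>\<^bsub>G\<^esub> w)) = (v, g, (e, a) # xs) \<bullet>\<^bsub>G\<^esub> w"
  proof -
    have ve: "is_path G (?v \<bullet>\<^bsub>G\<^esub> edge_path G e)" "path_end G (?v \<bullet>\<^bsub>G\<^esub> edge_path G e) = path_start ?x"
      using G v by (simp_all del: path_cat.simps vertex_path_cat is_path.simps)
    have "(v, g, (e, a) # xs) \<bullet>\<^bsub>G\<^esub> w = ?v \<bullet>\<^bsub>G\<^esub> edge_path G e \<bullet>\<^bsub>G\<^esub> ?x \<bullet>\<^bsub>G\<^esub> w"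
      using path_Cons_eq[OF G 2(2)] by simp
    also have "\<dots> = ?v \<bullet>\<^bsub>G\<^esub> edge_path G e \<bullet>\<^bsub>G\<^esub> (?x \<bullet>\<^bsub>G\<^esub> w)"
      by (rule path_cat_assoc[OF G ve(1) x(1) w(1) ve(2) x(2)])
    also have "\<dots> = ?v \<bullet>\<^bsub>G\<^esub> (edge_path G e \<bullet>\<^bsub>G\<^esub> (?x \<bullet>\<^bsub>G\<^esub> w))"
      by (rule path_cat_assoc[OF G v(1,2) xw v(3)[folded edge_path_props(1)]]) simp
    finally show ?thesis ..
  qed
  ultimately show ?case by simp
qed

lemma homotopic_normal_form:
  assumes "graph_of_groups G" "is_path G x"
  shows "homotopic G x (normal_form G x)"
  using homotopic_path_act[OF assms, of "trivial_path G (path_end G x)"] assms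
  by (simp add: normal_form_def cat_trivial)

text \<open>The normal form theorem. Homotopic paths have equal normal forms because they act alike;
  conversely every path is homotopic to its normal form.\<close>

theorem homotopic_iff:
  assumes "graph_of_groups G" "is_path G x" "is_path G y"
  shows "homotopic G x y \<longleftrightarrow> normal_form G x = normal_form G y"
  using assms homotopic_props homotopic_normal_form homotopic_sym homotopic_trans by metis

lemma homotopy_class_eq_iff:
  assumes "graph_of_groups G" "is_path G x" "is_path G y"
  shows "homotopy_class G x = homotopy_class G y \<longleftrightarrow> normal_form G x = normal_form G y"
proof -
  have "homotopy_class G x = homotopy_class G y \<longleftrightarrow> homotopic G x y"
    unfolding homotopy_class_def
    by (metis (mono_tags) Collect_cong homotopic_refl homotopic_sym homotopic_trans mem_Collect_eq)
  then show ?thesis using homotopic_iff[OF assms] by simp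
qed

lemma in_homotopy_class:
  assumes "graph_of_groups G" "is_path G x" "y \<in> homotopy_class G x"
  shows "is_path G y" "path_start y = path_start x" "path_end G y = path_end G x"
    "normal_form G y = normal_form G x"
  using homotopic_props[OF assms(1) _ assms(2), of y] assms(3) by (auto simp: homotopy_class_def)

lemma homotopy_class_self [simp]: "x \<in> homotopy_class G x"
  by (simp add: homotopy_class_def)

text \<open>Computing the normal form only pushes edge group elements to the left, so an element
  between two edges is changed only on the right, by the image of the group of the following edge. A
  cancellation would force the original element into the image of \<open>iota\<close>, which
  tightness forbids. The third clause of the conclusion records this change at the front and is what
  the induction needs.\<close>

lemma tight_normal_form:
  assumes "graph_of_groups G"
  shows "is_path G (v, g, xs) \<Longrightarrow> tight G (v, g, xs) \<Longrightarrow>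
    \<exists>g' ys. normal_form G (v, g, xs) = (v, g', ys) \<and> map fst ys = map fst xs \<and>
      (\<forall>e a zs. xs = (e, a) # zs \<longrightarrow> (\<exists>h\<in>carrier (egrp G e). g' = g \<otimes>\<^bsub>vgrp G v\<^esub> iota G (ebar G e) h))"
  using assms
proof (induction xs arbitrary: v g)
  case Nil
  then show ?case by simp
next
  case (Cons p xs)
  obtain e a where p: "p = (e, a)" by (cases p)
  note G = \<open>graph_of_groups G\<close>
  have x: "is_path G (tm G e, a, xs)" "tight G (tm G e, a, xs)" using Cons(2,3) p by (cases xs; auto)+
  have e: "e \<in> edges G" "v = org G e" "g \<in> carrier (vgrp G v)" using Cons(2) p by auto
  note e' = org_ebar[OF G e(1)]
  obtain a' ys where w: "normal_form G (tm G e, a, xs) = (tm G e, a', ys)" and ys: "map fst ys = map fst xs"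
    and a': "\<And>e' b zs. xs = (e', b) # zs \<Longrightarrow> \<exists>h\<in>carrier (egrp G e'). a' = a \<otimes>\<^bsub>vgrp G (tm G e)\<^esub> iota G (ebar G e') h"
    using Cons(1)[OF x G] by blast
  have aa: "a \<in> carrier (vgrp G (tm G e))" using is_path_fst_group[OF x(1)] by simp
  let ?w = "normal_form G (tm G e, a, xs)"
  have nw: "is_path G ?w" "path_start ?w = tm G e" using G x by (simp_all add: normal_path_is_path)
  have N: "normal_form G (v, g, p # xs) = vertex_act G v g (edge_act G e ?w)"
    using p by (simp add: normal_form_def)
  from G e(1) nw show ?case
  proof (cases rule: edge_act_cases)
    case (cancel a1 b zs)
    have [simp]: "a1 = a'" "ys = (ebar G e, b) # zs" using cancel w by auto
    then obtain c us where xs: "xs = (ebar G e, c) # us" using ys by (cases xs) auto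
    obtain h where h: "h \<in> carrier (egrp G e)" "a' = a \<otimes>\<^bsub>vgrp G (tm G e)\<^esub> iota G e h"
      using a'[OF xs] G e e' by auto
    interpret i: group_hom "egrp G e" "vgrp G (tm G e)" "iota G e" using G e(1) by (rule group_hom_iota)
    \<comment> \<open>In the cancelling branch \<open>a'\<close> lies in the image of
      \<open>iota G e\<close>. It differs from \<open>a\<close> by an element of the same image,
      since the following edge is the reverse of \<open>e\<close>; so \<open>a\<close> lies there
      too.\<close>
    have "a = a' \<otimes>\<^bsub>vgrp G (tm G e)\<^esub> iota G e (inv\<^bsub>egrp G e\<^esub> h)"
      using h aa by (simp add: i.H.m_assoc)
    also have "\<dots> = iota G e (edge_part G e a' \<otimes>\<^bsub>egrp G e\<^esub> inv\<^bsub>egrp G e\<^esub> h)"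
      using h cancel(3,4) by simp
    finally have "a \<in> iota G e ` carrier (egrp G e)" by (rule image_eqI) (use h cancel(4) in simp)
    then show ?thesis using Cons(3) p xs by simp
  next
    case (append a1 ys1)
    then have "ys1 = ys" "a1 = a'" using w by auto
    then show ?thesis using N append ys p e by (auto simp: vertex_act_def)
  qed
qed

lemma path_edges_normal_form:
  assumes "graph_of_groups G" "is_path G x" "tight G x"
  shows "path_edges (normal_form G x) = path_edges x"
  using tight_normal_form[of G "fst x" "fst (snd x)" "snd (snd x)"] assms by (auto simp: path_edges_def)

text \<open>An element of the image of \<open>iota\<close> has representative 1, so in a normal word
  it is 1, and between opposite edges this is excluded.\<close>

lemma normal_path_tight:
  assumes "graph_of_groups G"
  shows "is_path G x \<Longrightarrow> normal_word G (snd (snd x)) \<Longrightarrow> tight G x"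
  using assms
proof (induction G x rule: tight.induct)
  case (1 G v g e a e' a' xs)
  then have "e \<in> edges G" by simp
  have "\<not> (e' = ebar G e \<and> a \<in> iota G e ` carrier (egrp G e))"
  proof
    assume *: "e' = ebar G e \<and> a \<in> iota G e ` carrier (egrp G e)"
    then have "coset_rep G e a = \<one>\<^bsub>vgrp G (tm G e)\<^esub>" by (simp add: coset_rep_def)
    then show False using 1 * by auto
  qed
  then show ?case using 1 by simp
qed auto

lemma tight_normal_form_path: "graph_of_groups G \<Longrightarrow> is_path G x \<Longrightarrow> tight G (normal_form G x)"
  using normal_path_tight[of G "normal_form G x"] normal_form_props(1)[of G x] by (simp add: normal_path_def)

lemma edgeless_eq: "path_edges x = [] \<Longrightarrow> x = (path_start x, fst (snd x), [])"
  by (cases x rule: path_cases) auto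

lemma normal_form_edgeless:
  assumes "graph_of_groups G" "is_path G x" "path_edges x = []"
  shows "normal_form G x = x"
  using assms by (cases x rule: path_cases) auto

text \<open>A path without edges is its own normal form, so a path is homotopic to such a path
  exactly when its normal form has no edge.\<close>

lemma homotopically_nontrivial_iff:
  assumes "graph_of_groups G" "is_path G x"
  shows "homotopically_nontrivial G x \<longleftrightarrow> path_edges (normal_form G x) \<noteq> []"
  unfolding homotopically_nontrivial_def
  using assms homotopic_props homotopic_normal_form normal_form_edgeless normal_form_props normal_path_is_path by metis


lemma path_act_cong:
  assumes "graph_of_groups G" "is_path G x" "is_path G y" "normal_form G x = normal_form G y"
    "normal_path G w" "path_start w = path_end G x"
  shows "path_act G x w = path_act G y w"
  using homotopic_iff[OF assms(1-3)] homotopic_props(4)[OF assms(1) _ assms(2) assms(5,6), of y] assms(4)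
  by simp

lemma normal_form_eq_ends:
  assumes "graph_of_groups G" "is_path G x" "is_path G y" "normal_form G x = normal_form G y"
  shows "path_start x = path_start y" "path_end G x = path_end G y"
  using assms normal_form_props by metis+

lemma normal_form_cat_cong:
  assumes "graph_of_groups G" "is_path G x" "is_path G x'" "normal_form G x = normal_form G x'"
    "is_path G y" "is_path G y'" "normal_form G y = normal_form G y'" "path_end G x = path_start y"
  shows "normal_form G (x \<bullet>\<^bsub>G\<^esub> y) = normal_form G (x' \<bullet>\<^bsub>G\<^esub> y')"
proof -
  have "path_end G x' = path_start y'"
    using normal_form_eq_ends[OF assms(1-4)] normal_form_eq_ends[OF assms(1,5-7)] assms(8) by simp
  moreover have "path_act G x (normal_form G y) = path_act G x' (normal_form G y)"
    by (rule path_act_cong[OF assms(1-4)])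
      (use assms(1,5,8) in \<open>simp_all\<close>)
  ultimately show ?thesis unfolding assms(7) using assms by (simp add: normal_form_cat)
qed

subsection \<open>Subgraphs\<close>

lemma restrict_gog_simps [simp]:
  "verts (restrict_gog G S) = fst S" "edges (restrict_gog G S) = snd S" "ebar (restrict_gog G S) = ebar G"
  "tm (restrict_gog G S) = tm G" "vgrp (restrict_gog G S) = vgrp G" "egrp (restrict_gog G S) = egrp G"
  "iota (restrict_gog G S) = iota G" "org (restrict_gog G S) = org G"
  by (auto simp: restrict_gog_def org_def fun_eq_iff)

lemma path_cat_restrict [simp]: "path_cat (restrict_gog G S) x y = path_cat G x y"
  by (induction G x y rule: path_cat.induct) auto

lemma path_end_restrict [simp]: "path_end (restrict_gog G S) x = path_end G x"
  by (induction G x rule: path_end.induct) auto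

lemma path_rev_restrict [simp]: "path_rev (restrict_gog G S) x = path_rev G x"
  by (induction G x rule: path_rev.induct) auto

lemma edge_trivial_path_restrict [simp]:
  "edge_path (restrict_gog G S) = edge_path G" "trivial_path (restrict_gog G S) = trivial_path G"
  by (auto simp: edge_path_def trivial_path_def fun_eq_iff)

lemma tight_restrict [simp]: "tight (restrict_gog G S) x = tight G x"
  by (induction G x rule: tight.induct) auto

text \<open>The action uses only groups, \<open>iota\<close>, \<open>ebar\<close> and
  \<open>tm\<close>, which restriction leaves alone. Together with \<open>homotopic_iff\<close> this
  says that subgraphs of groups inject on fundamental groups.\<close>

lemma normal_form_restrict [simp]:
  fixes G :: "('v, 'e, 'g, 'h) gog"
  shows "normal_form (restrict_gog G S) x = normal_form G x"
proof -
  have rep: "coset_rep (restrict_gog G S) = coset_rep G" for G :: "('v, 'e, 'g, 'h) gog"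
    by (auto simp: coset_rep_def fun_eq_iff)
  then have "edge_part (restrict_gog G S) = edge_part G" for G :: "('v, 'e, 'g, 'h) gog"
    by (auto simp: edge_part_def fun_eq_iff)
  with rep have e: "edge_act (restrict_gog G S) = edge_act G" for G :: "('v, 'e, 'g, 'h) gog"
    by (auto simp: edge_act_def Let_def fun_eq_iff)
  have v: "vertex_act (restrict_gog G S) = vertex_act G" for G :: "('v, 'e, 'g, 'h) gog"
    by (auto simp: vertex_act_def fun_eq_iff)
  have "path_act (restrict_gog G S) x w = path_act G x w" for w
    by (induction G x w rule: path_act.induct) (simp_all only: path_act.simps e v restrict_gog_simps)
  then show ?thesis by (simp add: normal_form_def)
qed

lemma graph_of_groups_restrict [simp]:
  assumes G: "graph_of_groups G" and S: "subgraph G S"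
  shows "graph_of_groups (restrict_gog G S)"
  unfolding graph_of_groups_def restrict_gog_simps
proof (intro conjI ballI)
  fix e assume e: "e \<in> snd S"
  then have e': "e \<in> edges G" "ebar G e \<in> snd S" "tm G e \<in> fst S" using S by (auto simp: subgraph_def)
  note * = org_ebar[OF G e'(1)]
  show "ebar G e \<in> snd S" "tm G e \<in> fst S" by fact+
  show "ebar G e \<noteq> e" "ebar G (ebar G e) = e" by fact+
  show "group (egrp G e)" "egrp G (ebar G e) = egrp G e" "iota G e \<in> mon (egrp G e) (vgrp G (tm G e))"
    using G e'(1) by (rule group_egrp egrp_ebar iota_mon)+
next
  fix v assume "v \<in> fst S"
  then have "v \<in> verts G" using S by (auto simp: subgraph_def)
  then show "group (vgrp G v)" by (rule group_vgrp[OF G])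
qed

lemma is_path_restrict:
  assumes "subgraph G S"
  shows "is_path (restrict_gog G S) x \<longleftrightarrow>
    is_path G x \<and> path_start x \<in> fst S \<and> set (path_edges x) \<subseteq> snd S"
  using assms by (induction G x rule: is_path.induct) (auto simp: subgraph_def)

lemma path_image_restrict [simp]:
  "path_image (restrict_gog G S) H f x = path_image G H f x"
  "path_image G (restrict_gog H S) f x = path_image G H f x"
  by (cases x; simp)+

subsection \<open>Fundamental groups\<close>

lemma homotopy_class_mult:
  assumes "graph_of_groups G" "is_path G x" "is_path G y" "path_end G x = path_start y"
  shows "homotopy_class G x \<otimes>\<^bsub>pi1 G v\<^esub> homotopy_class G y = homotopy_class G (x \<bullet>\<^bsub>G\<^esub> y)"
proof -
  have "homotopy_class G (x' \<bullet>\<^bsub>G\<^esub> y') = homotopy_class G (x \<bullet>\<^bsub>G\<^esub> y)"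
    if "x' \<in> homotopy_class G x" "y' \<in> homotopy_class G y" for x' y'
    using in_homotopy_class[OF assms(1,2) that(1)] in_homotopy_class[OF assms(1,3) that(2)] assms
    by (subst homotopy_class_eq_iff) (auto intro!: normal_form_cat_cong)
  note * = this
  have "homotopy_class G x \<otimes>\<^bsub>pi1 G v\<^esub> homotopy_class G y =
      (\<Union>x'\<in>homotopy_class G x. \<Union>y'\<in>homotopy_class G y. homotopy_class G (x' \<bullet>\<^bsub>G\<^esub> y'))"
    by (simp only: pi1_def monoid.select_convs)
  also have "\<dots> = (\<Union>x'\<in>homotopy_class G x. \<Union>y'\<in>homotopy_class G y. homotopy_class G (x \<bullet>\<^bsub>G\<^esub> y))"
    by (intro SUP_cong refl *)
  finally have "homotopy_class G x \<otimes>\<^bsub>pi1 G v\<^esub> homotopy_class G y =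
      (\<Union>x'\<in>homotopy_class G x. \<Union>y'\<in>homotopy_class G y. homotopy_class G (x \<bullet>\<^bsub>G\<^esub> y))" .
  moreover have "homotopy_class G x \<noteq> {}" "homotopy_class G y \<noteq> {}"
    using homotopy_class_self by fast+
  ultimately show ?thesis by simp
qed

lemma pi1_simps:
  "carrier (pi1 G v) = homotopy_class G ` {\<gamma>. path_from_to G v v \<gamma>}"
  "\<one>\<^bsub>pi1 G v\<^esub> = homotopy_class G (trivial_path G v)"
  by (auto simp: pi1_def)

lemma pi1_cases:
  assumes "x \<in> carrier (pi1 G v)"
  obtains \<gamma> where "x = homotopy_class G \<gamma>" "is_path G \<gamma>" "path_start \<gamma> = v" "path_end G \<gamma> = v"
  using assms by (auto simp: pi1_simps path_from_to_def)

lemma pi1_class [simp]: "is_path G \<gamma> \<Longrightarrow> path_start \<gamma> = v \<Longrightarrow> path_end G \<gamma> = v \<Longrightarrow>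
    homotopy_class G \<gamma> \<in> carrier (pi1 G v)"
  by (auto simp: pi1_simps path_from_to_def)

lemma homotopy_class_rev_cat:
  assumes "graph_of_groups G" "is_path G x"
  shows "homotopy_class G (path_rev G x \<bullet>\<^bsub>G\<^esub> x) = homotopy_class G (trivial_path G (path_end G x))"
    "homotopy_class G (x \<bullet>\<^bsub>G\<^esub> path_rev G x) = homotopy_class G (trivial_path G (path_start x))"
proof -
  have v: "path_start x \<in> verts G" using assms is_path_start by blast
  show "homotopy_class G (path_rev G x \<bullet>\<^bsub>G\<^esub> x) = homotopy_class G (trivial_path G (path_end G x))"
    "homotopy_class G (x \<bullet>\<^bsub>G\<^esub> path_rev G x) = homotopy_class G (trivial_path G (path_start x))"
    using assms v by (simp_all add: homotopy_class_eq_iff normal_form_def) (simp_all add: trivial_path_def vertex_act_def)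
qed

lemma group_pi1:
  assumes G: "graph_of_groups G" and v: "v \<in> verts G"
  shows "group (pi1 G v)"
proof (rule groupI)
  fix x y assume "x \<in> carrier (pi1 G v)" "y \<in> carrier (pi1 G v)"
  then show "x \<otimes>\<^bsub>pi1 G v\<^esub> y \<in> carrier (pi1 G v)"
    using G by (elim pi1_cases) (auto simp: homotopy_class_mult)
  fix z assume "z \<in> carrier (pi1 G v)"
  then show "x \<otimes>\<^bsub>pi1 G v\<^esub> y \<otimes>\<^bsub>pi1 G v\<^esub> z = x \<otimes>\<^bsub>pi1 G v\<^esub> (y \<otimes>\<^bsub>pi1 G v\<^esub> z)"
    using G \<open>x \<in> _\<close> \<open>y \<in> _\<close> by (elim pi1_cases) (auto simp: homotopy_class_mult path_cat_assoc)
next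
  show "\<one>\<^bsub>pi1 G v\<^esub> \<in> carrier (pi1 G v)" using assms by (simp add: pi1_simps(2))
next
  fix x assume x: "x \<in> carrier (pi1 G v)"
  then show "\<one>\<^bsub>pi1 G v\<^esub> \<otimes>\<^bsub>pi1 G v\<^esub> x = x"
    using assms by (elim pi1_cases) (auto simp: pi1_simps(2) homotopy_class_mult trivial_cat)
  from x obtain \<gamma> where "x = homotopy_class G \<gamma>" "is_path G \<gamma>" "path_start \<gamma> = v" "path_end G \<gamma> = v"
    by (rule pi1_cases)
  then show "\<exists>y\<in>carrier (pi1 G v). y \<otimes>\<^bsub>pi1 G v\<^esub> x = \<one>\<^bsub>pi1 G v\<^esub>" using G
    by (intro bexI[of _ "homotopy_class G (path_rev G \<gamma>)"])
      (auto simp: homotopy_class_mult homotopy_class_rev_cat pi1_simps(2))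
qed

subsection \<open>Images of paths\<close>

text \<open>What is needed for \<open>path_image\<close> to commute with concatenation and reversal,
  and no more: edges may be sent to paths without edges and no edge homomorphisms are demanded. Thus
  it covers the map to the collapse as well as \<open>f\<close> and the induced map.\<close>

definition path_morphism ::
    "('v, 'e, 'g, 'h) gog \<Rightarrow> ('w, 'd, 'k, 'l) gog \<Rightarrow> ('v, 'e, 'g, 'w, 'd, 'k) gmap \<Rightarrow> bool" where
  "path_morphism G H f \<longleftrightarrow> graph_of_groups G \<and> graph_of_groups H \<and>
     (\<forall>v\<in>verts G. vmap f v \<in> verts H \<and> vhom f v \<in> hom (vgrp G v) (vgrp H (vmap f v))) \<and>
     (\<forall>e\<in>edges G. path_from_to H (vmap f (org G e)) (vmap f (tm G e)) (emap f e) \<and>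
        emap f (ebar G e) = path_rev H (emap f e))"

lemma path_image_vertex [simp]: "path_image G H f (v, g, []) = (vmap f v, vhom f v g, [])"
  by simp

declare path_image.simps [simp del]

context
  fixes G :: "('v, 'e, 'g, 'h) gog" and H :: "('w, 'd, 'k, 'l) gog" and f :: "('v, 'e, 'g, 'w, 'd, 'k) gmap"
  assumes f: "path_morphism G H f"
begin

lemma path_morphism_graphs: "graph_of_groups G" "graph_of_groups H"
  using f by (auto simp: path_morphism_def)

lemma path_morphism_vertex:
  assumes "v \<in> verts G"
  shows "vmap f v \<in> verts H" "vhom f v \<in> hom (vgrp G v) (vgrp H (vmap f v))"
    "g \<in> carrier (vgrp G v) \<Longrightarrow> vhom f v g \<in> carrier (vgrp H (vmap f v))"
    "g \<in> carrier (vgrp G v) \<Longrightarrow> h \<in> carrier (vgrp G v) \<Longrightarrow>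
      vhom f v (g \<otimes>\<^bsub>vgrp G v\<^esub> h) = vhom f v g \<otimes>\<^bsub>vgrp H (vmap f v)\<^esub> vhom f v h"
    "vhom f v \<one>\<^bsub>vgrp G v\<^esub> = \<one>\<^bsub>vgrp H (vmap f v)\<^esub>"
    "g \<in> carrier (vgrp G v) \<Longrightarrow> vhom f v (inv\<^bsub>vgrp G v\<^esub> g) = inv\<^bsub>vgrp H (vmap f v)\<^esub> vhom f v g"
proof -
  show h: "vmap f v \<in> verts H" "vhom f v \<in> hom (vgrp G v) (vgrp H (vmap f v))"
    using f assms by (auto simp: path_morphism_def)
  then interpret group_hom "vgrp G v" "vgrp H (vmap f v)" "vhom f v"
    using assms by (simp add: group_hom_def group_hom_axioms_def group_vgrp path_morphism_graphs)
  show "g \<in> carrier (vgrp G v) \<Longrightarrow> vhom f v g \<in> carrier (vgrp H (vmap f v))"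
    "g \<in> carrier (vgrp G v) \<Longrightarrow> h \<in> carrier (vgrp G v) \<Longrightarrow>
      vhom f v (g \<otimes>\<^bsub>vgrp G v\<^esub> h) = vhom f v g \<otimes>\<^bsub>vgrp H (vmap f v)\<^esub> vhom f v h"
    "vhom f v \<one>\<^bsub>vgrp G v\<^esub> = \<one>\<^bsub>vgrp H (vmap f v)\<^esub>"
    "g \<in> carrier (vgrp G v) \<Longrightarrow> vhom f v (inv\<^bsub>vgrp G v\<^esub> g) = inv\<^bsub>vgrp H (vmap f v)\<^esub> vhom f v g"
    by simp_all
qed

lemma path_morphism_edge:
  assumes "e \<in> edges G"
  shows "is_path H (emap f e)" "path_start (emap f e) = vmap f (org G e)"
    "path_end H (emap f e) = vmap f (tm G e)" "emap f (ebar G e) = path_rev H (emap f e)"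
  using f assms by (auto simp: path_morphism_def path_from_to_def)

text \<open>Pulls a prefix out of the left fold in \<open>path_image\<close>. This turns the fold
  into a recursion on the first edge, the form used in inductions.\<close>

lemma path_image_foldl:
  assumes "is_path G (v, g, xs)" "is_path H \<pi>" "is_path H \<rho>" "path_end H \<pi> = path_start \<rho>" "path_end H \<rho> = vmap f v"
  shows "foldl (\<lambda>\<pi> (e, a). \<pi> \<bullet>\<^bsub>H\<^esub> emap f e \<bullet>\<^bsub>H\<^esub> (vmap f (tm G e), vhom f (tm G e) a, [])) (\<pi> \<bullet>\<^bsub>H\<^esub> \<rho>) xs =
    \<pi> \<bullet>\<^bsub>H\<^esub> foldl (\<lambda>\<pi> (e, a). \<pi> \<bullet>\<^bsub>H\<^esub> emap f e \<bullet>\<^bsub>H\<^esub> (vmap f (tm G e), vhom f (tm G e) a, [])) \<rho> xs"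
  using assms
proof (induction xs arbitrary: v g \<rho>)
  case (Cons p xs)
  obtain e a where p: "p = (e, a)" by (cases p)
  have e: "e \<in> edges G" "org G e = v" and x: "is_path G (tm G e, a, xs)" using Cons(2) p by auto
  note H = path_morphism_graphs(2) and E = path_morphism_edge[OF e(1)] and e' = org_ebar[OF path_morphism_graphs(1) e(1)]
  have a: "a \<in> carrier (vgrp G (tm G e))" using is_path_fst_group[OF x] by simp
  let ?a = "(vmap f (tm G e), vhom f (tm G e) a, [])"
  have ip: "is_path H ?a" using path_morphism_vertex[OF e'(3)] a by simp
  have 1: "is_path H (\<rho> \<bullet>\<^bsub>H\<^esub> emap f e)" "path_end H (\<rho> \<bullet>\<^bsub>H\<^esub> emap f e) = vmap f (tm G e)"
    "path_end H \<rho> = path_start (emap f e)"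
    using H E Cons(4,6) e by auto
  have 2: "is_path H (\<rho> \<bullet>\<^bsub>H\<^esub> emap f e \<bullet>\<^bsub>H\<^esub> ?a)" "path_end H (\<rho> \<bullet>\<^bsub>H\<^esub> emap f e \<bullet>\<^bsub>H\<^esub> ?a) = vmap f (tm G e)"
    using H 1 ip by (simp_all del: is_path.simps path_cat.simps)
  have "(\<pi> \<bullet>\<^bsub>H\<^esub> \<rho>) \<bullet>\<^bsub>H\<^esub> emap f e \<bullet>\<^bsub>H\<^esub> ?a = \<pi> \<bullet>\<^bsub>H\<^esub> (\<rho> \<bullet>\<^bsub>H\<^esub> emap f e \<bullet>\<^bsub>H\<^esub> ?a)"
    using H Cons(3-5) E ip 1 by (simp add: path_cat_assoc del: is_path.simps path_cat.simps)
  then show ?case using Cons(1)[OF x Cons(3) 2(1) _ 2(2)] Cons(5) p by simp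
qed simp

lemma path_image_basic:
  "is_path G x \<Longrightarrow> is_path H (path_image G H f x) \<and> path_start (path_image G H f x) = vmap f (path_start x) \<and>
     path_end H (path_image G H f x) = vmap f (path_end G x)"
  "is_path G (v, g, (e, a) # xs) \<Longrightarrow> path_image G H f (v, g, (e, a) # xs) =
    (vmap f v, vhom f v g, []) \<bullet>\<^bsub>H\<^esub> (emap f e \<bullet>\<^bsub>H\<^esub> path_image G H f (tm G e, a, xs))"
proof -
  note H = path_morphism_graphs(2) and G = path_morphism_graphs(1)
  show *: "path_image G H f (v, g, (e, a) # xs) =
    (vmap f v, vhom f v g, []) \<bullet>\<^bsub>H\<^esub> (emap f e \<bullet>\<^bsub>H\<^esub> path_image G H f (tm G e, a, xs))"
    if ip: "is_path G (v, g, (e, a) # xs)" for v g e a xs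
  proof -
    have e: "e \<in> edges G" "org G e = v" and x: "is_path G (tm G e, a, xs)" using ip by auto
    note E = path_morphism_edge[OF e(1)] and e' = org_ebar[OF G e(1)]
    let ?F = "foldl (\<lambda>\<pi> (e, a). \<pi> \<bullet>\<^bsub>H\<^esub> emap f e \<bullet>\<^bsub>H\<^esub> (vmap f (tm G e), vhom f (tm G e) a, []))"
    let ?a = "(vmap f (tm G e), vhom f (tm G e) a, [])" and ?v = "(vmap f v, vhom f v g, [])"
    have pa: "is_path H ?a" using path_morphism_vertex[OF e'(3)] is_path_fst_group[OF x] by simp
    have pv: "is_path H ?v" using path_morphism_vertex[of v] is_path_fst_group[OF ip] by simp
    have Ea: "is_path H (emap f e \<bullet>\<^bsub>H\<^esub> ?a)" "path_end H (emap f e \<bullet>\<^bsub>H\<^esub> ?a) = vmap f (tm G e)"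
      using E pa H by (simp_all del: path_cat.simps is_path.simps)
    have "path_image G H f (v, g, (e, a) # xs) = ?F (?v \<bullet>\<^bsub>H\<^esub> (emap f e \<bullet>\<^bsub>H\<^esub> ?a)) xs"
      using H E pa pv e by (simp add: path_image.simps path_cat_assoc del: path_cat.simps is_path.simps)
    also have "\<dots> = ?v \<bullet>\<^bsub>H\<^esub> ?F (emap f e \<bullet>\<^bsub>H\<^esub> ?a) xs"
      by (rule path_image_foldl[OF x pv Ea(1) _ Ea(2)]) (use E e in simp)
    also have "?F (emap f e \<bullet>\<^bsub>H\<^esub> ?a) xs = emap f e \<bullet>\<^bsub>H\<^esub> ?F ?a xs"
      by (rule path_image_foldl[OF x E(1) pa]) (use E e in simp_all)
    finally show ?thesis by (simp add: path_image.simps)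
  qed
  have "is_path G (v, g, xs) \<Longrightarrow> is_path H (path_image G H f (v, g, xs)) \<and> path_start (path_image G H f (v, g, xs)) = vmap f v \<and>
     path_end H (path_image G H f (v, g, xs)) = vmap f (path_end G (v, g, xs))" for v g xs
  proof (induction xs arbitrary: v g)
    case Nil
    then show ?case using path_morphism_vertex[of v] by simp
  next
    case (Cons p xs)
    obtain e a where p: "p = (e, a)" by (cases p)
    have e: "e \<in> edges G" "org G e = v" and x: "is_path G (tm G e, a, xs)" using Cons(2) p by auto
    note E = path_morphism_edge[OF e(1)] and e' = org_ebar[OF G e(1)]
    have pv: "is_path H (vmap f v, vhom f v g, [])" using path_morphism_vertex[of v] is_path_fst_group[OF Cons(2)] by simp
    show ?case unfolding p *[OF Cons(2)[unfolded p]] using Cons(1)[OF x] E pv H e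
      by (simp del: path_cat.simps is_path.simps)
  qed
  then show "is_path G x \<Longrightarrow> is_path H (path_image G H f x) \<and> path_start (path_image G H f x) = vmap f (path_start x) \<and>
     path_end H (path_image G H f x) = vmap f (path_end G x)" by (cases x) auto
qed

lemma path_image_is_path [simp]: "is_path G x \<Longrightarrow> is_path H (path_image G H f x)"
  and path_image_start [simp]: "is_path G x \<Longrightarrow> path_start (path_image G H f x) = vmap f (path_start x)"
  and path_image_end [simp]: "is_path G x \<Longrightarrow> path_end H (path_image G H f x) = vmap f (path_end G x)"
  using path_image_basic(1) by blast+

lemma path_image_edge_path:
  assumes "e \<in> edges G"
  shows "path_image G H f (edge_path G e) = emap f e"
proof -
  note H = path_morphism_graphs(2) and G = path_morphism_graphs(1)
  note E = path_morphism_edge[OF assms] and e' = org_ebar[OF G assms]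
  have "path_image G H f (edge_path G e) = trivial_path H (vmap f (org G e)) \<bullet>\<^bsub>H\<^esub> (emap f e \<bullet>\<^bsub>H\<^esub> trivial_path H (vmap f (tm G e)))"
    using path_image_basic(2)[of "org G e" "\<one>\<^bsub>vgrp G (org G e)\<^esub>" e "\<one>\<^bsub>vgrp G (tm G e)\<^esub>" "[]"] G assms e'
      path_morphism_vertex[OF e'(2)] path_morphism_vertex[OF e'(3)]
    by (simp add: edge_path_def trivial_path_def)
  then show ?thesis using E H by (simp add: cat_trivial trivial_cat)
qed

lemma path_image_trivial: "v \<in> verts G \<Longrightarrow> path_image G H f (trivial_path G v) = trivial_path H (vmap f v)"
  using path_morphism_vertex by (simp add: trivial_path_def)

lemma path_image_vertex_cat:
  assumes "g \<in> carrier (vgrp G v)" "is_path G y" "path_start y = v"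
  shows "path_image G H f ((v, g, []) \<bullet>\<^bsub>G\<^esub> y) = (vmap f v, vhom f v g, []) \<bullet>\<^bsub>H\<^esub> path_image G H f y"
proof (cases y rule: path_cases)
  case (1 w b)
  then show ?thesis using assms path_morphism_vertex[of v] by auto
next
  case (2 w b e a xs)
  note H = path_morphism_graphs(2) and G = path_morphism_graphs(1)
  have w: "w = v" "b \<in> carrier (vgrp G v)" "v \<in> verts G" using assms 2 is_path_fst_group[of G w b] by auto
  have e: "e \<in> edges G" "org G e = v" and x: "is_path G (tm G e, a, xs)" using assms 2 by auto
  note E = path_morphism_edge[OF e(1)] and V = path_morphism_vertex[OF w(3)]
  let ?y = "emap f e \<bullet>\<^bsub>H\<^esub> path_image G H f (tm G e, a, xs)"
  have y: "is_path H ?y" "path_start ?y = vmap f v" using E x H e by auto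
  have "path_image G H f ((v, g, []) \<bullet>\<^bsub>G\<^esub> y) = (vmap f v, vhom f v g \<otimes>\<^bsub>vgrp H (vmap f v)\<^esub> vhom f v b, []) \<bullet>\<^bsub>H\<^esub> ?y"
    using assms 2 w V G by (simp add: path_image_basic(2))
  also have "\<dots> = (vmap f v, vhom f v g, []) \<bullet>\<^bsub>H\<^esub> (vmap f v, vhom f v b, []) \<bullet>\<^bsub>H\<^esub> ?y" by simp
  also have "\<dots> = (vmap f v, vhom f v g, []) \<bullet>\<^bsub>H\<^esub> ((vmap f v, vhom f v b, []) \<bullet>\<^bsub>H\<^esub> ?y)"
    using y V assms w by (intro path_cat_assoc[OF H]) auto
  finally show ?thesis using assms 2 w by (simp add: path_image_basic(2))
qed

lemma path_image_cat:
  "is_path G x \<Longrightarrow> is_path G y \<Longrightarrow> path_end G x = path_start y \<Longrightarrow>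
    path_image G H f (x \<bullet>\<^bsub>G\<^esub> y) = path_image G H f x \<bullet>\<^bsub>H\<^esub> path_image G H f y"
proof -
  note H = path_morphism_graphs(2) and G = path_morphism_graphs(1)
  have "is_path G (v, g, xs) \<Longrightarrow> is_path G y \<Longrightarrow> path_end G (v, g, xs) = path_start y \<Longrightarrow>
    path_image G H f ((v, g, xs) \<bullet>\<^bsub>G\<^esub> y) = path_image G H f (v, g, xs) \<bullet>\<^bsub>H\<^esub> path_image G H f y" for v g xs
  proof (induction xs arbitrary: v g)
    case Nil
    show ?case by (subst path_image_vertex_cat) (use Nil in auto)
  next
    case (Cons p xs)
    obtain e a where p: "p = (e, a)" by (cases p)
    let ?x = "(tm G e, a, xs)" and ?v = "(vmap f v, vhom f v g, [])"
    have e: "e \<in> edges G" "org G e = v" and x: "is_path G ?x" "path_end G ?x = path_start y"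
      using Cons(2,4) p by auto
    note E = path_morphism_edge[OF e(1)]
    have pv: "is_path H ?v" using path_morphism_vertex[of v] is_path_fst_group[OF Cons(2)] by simp
    have "fst (?x \<bullet>\<^bsub>G\<^esub> y) = tm G e" unfolding fst_cat by simp
    then have q: "(tm G e, fst (snd (?x \<bullet>\<^bsub>G\<^esub> y)), snd (snd (?x \<bullet>\<^bsub>G\<^esub> y))) = ?x \<bullet>\<^bsub>G\<^esub> y"
      by (simp add: prod_eq_iff)
    have "is_path G ((v, g, p # xs) \<bullet>\<^bsub>G\<^esub> y)" using G Cons(2,3,4) by (rule is_path_cat)
    then have "path_image G H f ((v, g, p # xs) \<bullet>\<^bsub>G\<^esub> y) = ?v \<bullet>\<^bsub>H\<^esub> (emap f e \<bullet>\<^bsub>H\<^esub> path_image G H f (?x \<bullet>\<^bsub>G\<^esub> y))"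
      unfolding p path_cat_Cons by (subst path_image_basic(2)) (simp_all only: q)
    also have "\<dots> = ?v \<bullet>\<^bsub>H\<^esub> (emap f e \<bullet>\<^bsub>H\<^esub> (path_image G H f ?x \<bullet>\<^bsub>H\<^esub> path_image G H f y))"
      using Cons(1)[OF x(1) Cons(3) x(2)] by simp
    also have "\<dots> = ?v \<bullet>\<^bsub>H\<^esub> (emap f e \<bullet>\<^bsub>H\<^esub> path_image G H f ?x) \<bullet>\<^bsub>H\<^esub> path_image G H f y"
      using pv E x Cons(3) H e by (simp add: path_cat_assoc del: path_cat.simps is_path.simps)
    also have "?v \<bullet>\<^bsub>H\<^esub> (emap f e \<bullet>\<^bsub>H\<^esub> path_image G H f ?x) = path_image G H f (v, g, p # xs)"
      using Cons(2) p by (simp only: path_image_basic(2))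
    finally show ?case .
  qed
  then show "is_path G x \<Longrightarrow> is_path G y \<Longrightarrow> path_end G x = path_start y \<Longrightarrow>
    path_image G H f (x \<bullet>\<^bsub>G\<^esub> y) = path_image G H f x \<bullet>\<^bsub>H\<^esub> path_image G H f y" by (cases x) auto
qed

lemma path_image_rev:
  "is_path G x \<Longrightarrow> path_image G H f (path_rev G x) = path_rev H (path_image G H f x)"
proof -
  note H = path_morphism_graphs(2) and G = path_morphism_graphs(1)
  have "is_path G (v, g, xs) \<Longrightarrow> path_image G H f (path_rev G (v, g, xs)) = path_rev H (path_image G H f (v, g, xs))" for v g xs
  proof (induction xs arbitrary: v g)
    case Nil
    then show ?case using path_morphism_vertex[of v] by simp
  next
    case (Cons p xs)
    obtain e a where p: "p = (e, a)" by (cases p)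
    let ?x = "(tm G e, a, xs)" and ?v = "(v, g, [])"
    have e: "e \<in> edges G" "org G e = v" and x: "is_path G ?x" and v: "is_path G ?v"
      using Cons(2) p by auto
    have ve: "is_path G (edge_path G e)" "path_end G ?v = path_start (edge_path G e)"
      "is_path G (?v \<bullet>\<^bsub>G\<^esub> edge_path G e)" "path_end G (?v \<bullet>\<^bsub>G\<^esub> edge_path G e) = path_start ?x"
      using e G v by (simp_all del: path_cat.simps is_path.simps vertex_path_cat)
    note E = path_morphism_edge[OF e(1)] and e' = org_ebar[OF G e(1)]
    have 1: "path_image G H f (path_rev G (edge_path G e)) = path_rev H (path_image G H f (edge_path G e))"
      using e' e G E by (simp add: path_rev_edge_path path_image_edge_path)
    have 2: "path_image G H f (path_rev G ?v) = path_rev H (path_image G H f ?v)"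
      using v path_morphism_vertex[of v] by simp
    have 3: "(v, g, p # xs) = ?v \<bullet>\<^bsub>G\<^esub> edge_path G e \<bullet>\<^bsub>G\<^esub> ?x" using path_Cons_eq[OF G] Cons(2) p by metis
    show ?case unfolding 3 using Cons(1)[OF x] 1 2 G H x v ve
      by (simp add: path_rev_cat path_image_cat del: path_cat.simps path_rev.simps is_path.simps vertex_path_cat path_image_vertex)
  qed
  then show "is_path G x \<Longrightarrow> path_image G H f (path_rev G x) = path_rev H (path_image G H f x)"
    by (cases x) auto
qed

text \<open>Cancellations are respected automatically because images commute with reversal. So
  homotopy invariance reduces to the slide relation of a single edge, the assumption
  \<open>rel\<close>.\<close>

lemma path_image_homotopic:
  assumes rel: "\<And>e h. e \<in> edges G \<Longrightarrow> h \<in> carrier (egrp G e) \<Longrightarrow>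
      normal_form H (emap f e \<bullet>\<^bsub>H\<^esub> (vmap f (tm G e), vhom f (tm G e) (iota G e h), [])) =
      normal_form H ((vmap f (org G e), vhom f (org G e) (iota G (ebar G e) h), []) \<bullet>\<^bsub>H\<^esub> emap f e)"
    and xy: "homotopic G x y" and x: "is_path G x"
  shows "normal_form H (path_image G H f x) = normal_form H (path_image G H f y)"
proof -
  note H = path_morphism_graphs(2) and G = path_morphism_graphs(1)
  have elem: "normal_form H (path_image G H f x) = normal_form H (path_image G H f y)" if "elem_homotopy G x y" for x y
    using that
  proof cases
    case (cancel \<alpha> \<sigma> \<beta>)
    have "normal_path H (normal_form H (path_image G H f \<beta>))" "path_start (normal_form H (path_image G H f \<beta>)) = vmap f (path_start \<beta>)"
      using cancel G H by auto
    then show ?thesis using cancel G H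
      by (simp add: path_image_cat path_image_rev normal_form_cat)
  next
    case (slide \<alpha> \<beta> e h)
    note E = path_morphism_edge[OF slide(5)] and e' = org_ebar[OF G slide(5)]
    let ?A = "path_image G H f \<alpha>" and ?B = "path_image G H f \<beta>"
    let ?v = "(org G e, iota G (ebar G e) h, [])" and ?w = "(tm G e, iota G e h, [])"
    have vw: "is_path G ?v" "is_path G ?w" using G slide e' by simp_all
    let ?v' = "path_image G H f ?v" and ?w' = "path_image G H f ?w"
    have vw': "is_path H ?v'" "is_path H ?w'" "path_start ?v' = vmap f (org G e)" "path_start ?w' = vmap f (tm G e)"
      "path_end H ?v' = vmap f (org G e)" "path_end H ?w' = vmap f (tm G e)" using vw 
        path_image_is_path[OF vw(1)] path_image_is_path[OF vw(2)] by simp_all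
    have AB: "is_path H ?A" "is_path H ?B" "path_end H ?A = vmap f (org G e)" "path_start ?B = vmap f (tm G e)"
      using slide by simp_all
    have 1: "path_image G H f x = ?A \<bullet>\<^bsub>H\<^esub> (emap f e \<bullet>\<^bsub>H\<^esub> ?w' \<bullet>\<^bsub>H\<^esub> ?B)"
      unfolding slide using G H slide vw vw' AB E
      by (simp add: path_image_cat path_cat_assoc path_image_edge_path del: path_cat.simps is_path.simps vertex_path_cat path_image_vertex)
    have 2: "path_image G H f y = ?A \<bullet>\<^bsub>H\<^esub> (?v' \<bullet>\<^bsub>H\<^esub> emap f e \<bullet>\<^bsub>H\<^esub> ?B)"
      unfolding slide using G H slide vw vw' AB E
      by (simp add: path_image_cat path_cat_assoc path_image_edge_path del: path_cat.simps is_path.simps vertex_path_cat path_image_vertex)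
    have "normal_form H (emap f e \<bullet>\<^bsub>H\<^esub> ?w') = normal_form H (?v' \<bullet>\<^bsub>H\<^esub> emap f e)"
      using rel[OF slide(5,6)] by simp
    then have "normal_form H (emap f e \<bullet>\<^bsub>H\<^esub> ?w' \<bullet>\<^bsub>H\<^esub> ?B) = normal_form H (?v' \<bullet>\<^bsub>H\<^esub> emap f e \<bullet>\<^bsub>H\<^esub> ?B)"
      using H vw' E AB by (rule_tac normal_form_cat_cong) (simp_all del: is_path.simps path_cat.simps vertex_path_cat path_image_vertex)
    then show ?thesis unfolding 1 2 using H vw' E AB
      by (rule_tac normal_form_cat_cong) (simp_all del: is_path.simps path_cat.simps vertex_path_cat path_image_vertex)
  qed
  show ?thesis using xy
  proof (induction rule: homotopic_induct)
    case (step y z)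
    then show ?case using elem by metis
  qed simp
qed

end

subsection \<open>Edge maps\<close>

text \<open>\<open>slides G E \<gamma> \<theta> \<xi>\<close> says that elements \<open>h\<close> of the edge group \<open>E\<close> can be moved across \<open>\<gamma>\<close>,
  changing \<open>\<theta> h\<close> at its start into \<open>\<xi> h\<close> at its end, by homomorphisms to the groups of the edges of
  \<open>\<gamma>\<close>. Unlike \<open>morphism_on_subdivision\<close>, this does not mention the elements \<open>\<delta>\<close> and is compatible
  with concatenation.\<close>

fun slides :: "('v, 'e, 'g, 'h) gog \<Rightarrow> 'h monoid \<Rightarrow> ('v, 'e, 'g) path \<Rightarrow> ('h \<Rightarrow> 'g) \<Rightarrow> ('h \<Rightarrow> 'g) \<Rightarrow> bool" where
  "slides G E (v, a, []) \<theta> \<xi> \<longleftrightarrow> (\<forall>h\<in>carrier E. \<theta> h \<otimes>\<^bsub>vgrp G v\<^esub> a = a \<otimes>\<^bsub>vgrp G v\<^esub> \<xi> h)"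
| "slides G E (v, a, (e, b) # xs) \<theta> \<xi> \<longleftrightarrow> (\<exists>\<phi>\<in>hom E (egrp G e).
     (\<forall>h\<in>carrier E. \<theta> h \<otimes>\<^bsub>vgrp G v\<^esub> a = a \<otimes>\<^bsub>vgrp G v\<^esub> iota G (ebar G e) (\<phi> h)) \<and>
     slides G E (tm G e, b, xs) (\<lambda>h. iota G e (\<phi> h)) \<xi>)"

lemma all_le_Suc: "(\<forall>i\<le>Suc n. P i) \<longleftrightarrow> P 0 \<and> (\<forall>i\<le>n. P (Suc i))"
  by (metis Suc_le_mono le0 not0_implies_Suc)

lemma all_less_Suc0: "(\<forall>i<Suc n. P i) \<longleftrightarrow> P 0 \<and> (\<forall>i<n. P (Suc i))"
  by (metis Suc_less_eq less_Suc_eq_0_disj)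

text \<open>Unrolls the recursion into the indexed families that occur in
  \<open>morphism_on_subdivision\<close>. Position 0 carries the data at the start and position
  \<open>Suc j\<close> the data after the edge with index \<open>j\<close>, hence
  \<open>case_nat\<close>. At the last position there is no further edge, and \<open>\<xi>\<close>
  takes its place.\<close>

lemma slides_iff_index:
  "slides G E (v, a, xs) \<theta> \<xi> \<longleftrightarrow> (\<exists>\<phi>. (\<forall>i<length xs. \<phi> i \<in> hom E (egrp G (fst (xs ! i)))) \<and>
     (\<forall>i\<le>length xs. \<forall>h\<in>carrier E.
        case_nat \<theta> (\<lambda>j h. iota G (fst (xs ! j)) (\<phi> j h)) i h
          \<otimes>\<^bsub>vgrp G (case_nat v (\<lambda>j. tm G (fst (xs ! j))) i)\<^esub> case_nat a (\<lambda>j. snd (xs ! j)) i =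
        case_nat a (\<lambda>j. snd (xs ! j)) i \<otimes>\<^bsub>vgrp G (case_nat v (\<lambda>j. tm G (fst (xs ! j))) i)\<^esub>
          (if i < length xs then iota G (ebar G (fst (xs ! i))) (\<phi> i h) else \<xi> h)))"
proof (induction xs arbitrary: v a \<theta>)
  case Nil
  show ?case by simp
next
  case (Cons p xs)
  obtain e b where p: "p = (e, b)" by (cases p)
  let ?Q = "\<lambda>v a \<theta> \<phi> xs i. (\<forall>h\<in>carrier E.
        case_nat \<theta> (\<lambda>j h. iota G (fst (xs ! j)) (\<phi> j h)) i h
          \<otimes>\<^bsub>vgrp G (case_nat v (\<lambda>j. tm G (fst (xs ! j))) i)\<^esub> case_nat a (\<lambda>j. snd (xs ! j)) i =
        case_nat a (\<lambda>j. snd (xs ! j)) i \<otimes>\<^bsub>vgrp G (case_nat v (\<lambda>j. tm G (fst (xs ! j))) i)\<^esub>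
          (if i < length xs then iota G (ebar G (fst (xs ! i))) (\<phi> i h) else \<xi> h))"
  \<comment> \<open>Removing the first edge shifts every position by one, and the image of
    \<open>\<phi> 0\<close> at the end of that edge becomes the new \<open>\<theta>\<close>.\<close>
  have shift: "?Q v a \<theta> \<phi> (p # xs) (Suc i) \<longleftrightarrow> ?Q (tm G e) b (\<lambda>h. iota G e (\<phi> 0 h)) (\<lambda>i. \<phi> (Suc i)) xs i" for \<phi> i
    using p by (cases i) simp_all
  show ?case
  proof
    assume "slides G E (v, a, p # xs) \<theta> \<xi>"
    then obtain \<phi>0 where 0: "\<phi>0 \<in> hom E (egrp G e)" "\<forall>h\<in>carrier E. \<theta> h \<otimes>\<^bsub>vgrp G v\<^esub> a = a \<otimes>\<^bsub>vgrp G v\<^esub> iota G (ebar G e) (\<phi>0 h)"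
      and s: "slides G E (tm G e, b, xs) (\<lambda>h. iota G e (\<phi>0 h)) \<xi>" unfolding p by auto
    obtain \<phi> where \<phi>: "\<forall>i<length xs. \<phi> i \<in> hom E (egrp G (fst (xs ! i)))"
      "\<forall>i\<le>length xs. ?Q (tm G e) b (\<lambda>h. iota G e (\<phi>0 h)) \<phi> xs i"
      using s unfolding Cons by blast
    let ?\<phi> = "case_nat \<phi>0 \<phi>"
    have len: "length (p # xs) = Suc (length xs)" by simp
    have "\<forall>i<length (p # xs). ?\<phi> i \<in> hom E (egrp G (fst ((p # xs) ! i)))"
      using 0(1) \<phi>(1) p by (simp add: all_less_Suc0)
    moreover have A: "?Q v a \<theta> ?\<phi> (p # xs) 0" using 0(2) p by simp
    have B: "\<forall>i\<le>length xs. ?Q v a \<theta> ?\<phi> (p # xs) (Suc i)"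
    proof (intro allI impI)
      fix i assume "i \<le> length xs"
      then show "?Q v a \<theta> ?\<phi> (p # xs) (Suc i)" using \<phi>(2)
        shift[where \<phi>="?\<phi>" and i=i, unfolded nat.case] by (simp only: nat.case) blast
    qed
    have "\<forall>i\<le>length (p # xs). ?Q v a \<theta> ?\<phi> (p # xs) i"
      using all_le_Suc[THEN iffD2, OF conjI[OF A B]] unfolding len .
    ultimately show "\<exists>\<phi>. (\<forall>i<length (p # xs). \<phi> i \<in> hom E (egrp G (fst ((p # xs) ! i)))) \<and> 
      (\<forall>i\<le>length (p # xs). ?Q v a \<theta> \<phi> (p # xs) i)" by blast
  next
    assume "\<exists>\<phi>. (\<forall>i<length (p # xs). \<phi> i \<in> hom E (egrp G (fst ((p # xs) ! i)))) \<and> 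
      (\<forall>i\<le>length (p # xs). ?Q v a \<theta> \<phi> (p # xs) i)"
    then obtain \<phi> where \<phi>: "\<forall>i<length (p # xs). \<phi> i \<in> hom E (egrp G (fst ((p # xs) ! i)))"
      "\<forall>i\<le>length (p # xs). ?Q v a \<theta> \<phi> (p # xs) i" by blast
    have 1: "\<phi> 0 \<in> hom E (egrp G e)" "\<forall>i<length xs. \<phi> (Suc i) \<in> hom E (egrp G (fst (xs ! i)))"
      using \<phi>(1) p by (auto simp: all_less_Suc0)
    have 2: "?Q v a \<theta> \<phi> (p # xs) 0" "\<forall>i\<le>length xs. ?Q (tm G e) b (\<lambda>h. iota G e (\<phi> 0 h)) (\<lambda>i. \<phi> (Suc i)) xs i"
    proof -
      show "?Q v a \<theta> \<phi> (p # xs) 0" using \<phi>(2) by blast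
      show "\<forall>i\<le>length xs. ?Q (tm G e) b (\<lambda>h. iota G e (\<phi> 0 h)) (\<lambda>i. \<phi> (Suc i)) xs i"
      proof (intro allI impI)
        fix i assume "i \<le> length xs"
        then have "Suc i \<le> length (p # xs)" by simp
        with \<phi>(2) have "?Q v a \<theta> \<phi> (p # xs) (Suc i)" by blast
        then show "?Q (tm G e) b (\<lambda>h. iota G e (\<phi> 0 h)) (\<lambda>i. \<phi> (Suc i)) xs i" unfolding shift .
      qed
    qed
    have "slides G E (tm G e, b, xs) (\<lambda>h. iota G e (\<phi> 0 h)) \<xi>"
      unfolding Cons by (rule exI[of _ "\<lambda>i. \<phi> (Suc i)"], intro conjI) (fact 1(2), fact 2(2))
    then show "slides G E (v, a, p # xs) \<theta> \<xi>"
      unfolding p slides.simps using 2(1) p by (intro bexI[OF _ 1(1)] conjI) simp_all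
  qed
qed

lemma is_path_nth:
  assumes "is_path G (v, a, xs)"
  shows "i < length xs \<Longrightarrow> fst (xs ! i) \<in> edges G \<and> org G (fst (xs ! i)) = case_nat v (\<lambda>j. tm G (fst (xs ! j))) i"
    "i \<le> length xs \<Longrightarrow> case_nat a (\<lambda>j. snd (xs ! j)) i \<in> carrier (vgrp G (case_nat v (\<lambda>j. tm G (fst (xs ! j))) i)) \<and>
      case_nat v (\<lambda>j. tm G (fst (xs ! j))) i \<in> verts G"
    "xs \<noteq> [] \<Longrightarrow> path_end G (v, a, xs) = tm G (fst (last xs))"
proof -
  show "i < length xs \<Longrightarrow> fst (xs ! i) \<in> edges G \<and> org G (fst (xs ! i)) = case_nat v (\<lambda>j. tm G (fst (xs ! j))) i"
    using assms
  proof (induction xs arbitrary: i v a)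
    case (Cons p xs)
    obtain e b where p: "p = (e, b)" by (cases p)
    show ?case
    proof (cases i)
      case (Suc j)
      then show ?thesis using Cons(1)[of j "tm G e" b] Cons(2,3) p by (cases j) auto
    qed (use Cons p in auto)
  qed simp
  show "i \<le> length xs \<Longrightarrow> case_nat a (\<lambda>j. snd (xs ! j)) i \<in> carrier (vgrp G (case_nat v (\<lambda>j. tm G (fst (xs ! j))) i)) \<and>
      case_nat v (\<lambda>j. tm G (fst (xs ! j))) i \<in> verts G"
    using assms
  proof (induction xs arbitrary: i v a)
    case (Cons p xs)
    obtain e b where p: "p = (e, b)" by (cases p)
    show ?case
    proof (cases i)
      case (Suc j)
      then show ?thesis using Cons(1)[of j "tm G e" b] Cons(2,3) p by (cases j) auto
    qed (use Cons p in auto)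
  qed simp
  show "xs \<noteq> [] \<Longrightarrow> path_end G (v, a, xs) = tm G (fst (last xs))"
  proof (induction xs arbitrary: v a)
    case (Cons p xs)
    then show ?case by (cases p; cases xs) auto
  qed simp
qed

text \<open>Meant for an interior vertex of a subdivided edge: \<open>p\<close> and \<open>d\<close>
  are the elements \<open>\<delta>\<close> of the two adjacent segments, and
  \<open>inv p \<otimes> d\<close> is the only combination of them that is visible in the image
  path.\<close>

lemma (in group) conj_eq_swap:
  assumes "p \<in> carrier G" "d \<in> carrier G" "x \<in> carrier G" "y \<in> carrier G"
    "p \<otimes> x \<otimes> inv p = d \<otimes> y \<otimes> inv d"
  shows "x \<otimes> (inv p \<otimes> d) = inv p \<otimes> d \<otimes> y"
proof -
  have "x \<otimes> (inv p \<otimes> d) = inv p \<otimes> (p \<otimes> x \<otimes> inv p) \<otimes> d"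
    using assms(1-4) by (simp add: m_assoc[symmetric])
  also have "\<dots> = inv p \<otimes> d \<otimes> y" unfolding assms(5) using assms(1-4) by (simp add: m_assoc)
  finally show ?thesis .
qed

lemma (in group) swap_imp_conj:
  assumes "b \<in> carrier G" "x \<in> carrier G" "y \<in> carrier G" "x \<otimes> b = b \<otimes> y"
  shows "x = b \<otimes> y \<otimes> inv b" "y = inv b \<otimes> x \<otimes> b"
proof -
  have "x = x \<otimes> b \<otimes> inv b" using assms(1,2) by (simp add: m_assoc)
  then show "x = b \<otimes> y \<otimes> inv b" using assms(4) by simp
  have "y = inv b \<otimes> (b \<otimes> y)" using assms(1,3) by (simp add: m_assoc[symmetric])
  then show "y = inv b \<otimes> x \<otimes> b" using assms by (simp add: m_assoc)
qed

text \<open>Each \<open>\<psi>\<close> at an interior vertex is given by two conjugation formulas;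
  equating them eliminates it and leaves a commutation relation with the group element of the path
  there. Conversely, the \<open>\<delta>\<close> can be chosen freely as long as they give these
  group elements.\<close>

lemma morphism_on_subdivision_iff_slides:
  assumes G: "graph_of_groups G" and ip: "is_path G (emap f e)"
    and \<theta>: "\<And>h. h \<in> carrier (egrp G e) \<Longrightarrow> vhom f (org G e) (iota G (ebar G e) h) \<in> carrier (vgrp G (path_start (emap f e)))"
    and \<xi>: "\<And>h. h \<in> carrier (egrp G e) \<Longrightarrow> vhom f (tm G e) (iota G e h) \<in> carrier (vgrp G (path_end G (emap f e)))"
  shows "morphism_on_subdivision G f e \<longleftrightarrow> path_edges (emap f e) \<noteq> [] \<and>
    slides G (egrp G e) (emap f e) (\<lambda>h. vhom f (org G e) (iota G (ebar G e) h)) (\<lambda>h. vhom f (tm G e) (iota G e h))"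
proof (cases "path_edges (emap f e) = []")
  case True
  then show ?thesis by (cases "emap f e") (simp add: morphism_on_subdivision_def)
next
  case False
  obtain v a xs where em: "emap f e = (v, a, xs)" by (cases "emap f e")
  let ?\<theta> = "\<lambda>h. vhom f (org G e) (iota G (ebar G e) h)" and ?\<xi> = "\<lambda>h. vhom f (tm G e) (iota G e h)"
  let ?n = "length xs" and ?E = "\<lambda>i. fst (xs ! i)"
  let ?V = "case_nat v (\<lambda>j. tm G (?E j))" and ?c = "case_nat a (\<lambda>j. snd (xs ! j))"
  have n: "?n > 0" "?n \<ge> 1" using False em by (auto simp: Suc_le_eq)
  have endv: "path_end G (v, a, xs) = ?V ?n"
    using is_path_nth(3)[of G v a xs] ip em n by (cases xs rule: rev_cases) auto
  have ed: "?E i \<in> edges G" "org G (?E i) = ?V i" if "i < ?n" for i using is_path_nth(1)[of G v a xs i] ip em that by auto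
  have cc: "?c i \<in> carrier (vgrp G (?V i))" "?V i \<in> verts G" if "i \<le> ?n" for i using is_path_nth(2)[of G v a xs i] ip em that by auto
  have tmV: "tm G (?E i) = ?V (Suc i)" for i by simp
  show ?thesis
  proof
    assume "morphism_on_subdivision G f e"
    then obtain \<phi> \<psi> dm dp where
      \<phi>: "\<And>i. i < ?n \<Longrightarrow> \<phi> i \<in> hom (egrp G e) (egrp G (?E i))" and
      dm: "\<And>i. i < ?n \<Longrightarrow> dm i \<in> carrier (vgrp G (org G (?E i)))" and
      dp: "\<And>i. i < ?n \<Longrightarrow> dp i \<in> carrier (vgrp G (tm G (?E i)))" and
      \<psi>1: "\<And>i h. i < ?n \<Longrightarrow> h \<in> carrier (egrp G e) \<Longrightarrow>
         \<psi> i h = dm i \<otimes>\<^bsub>vgrp G (org G (?E i))\<^esub> iota G (ebar G (?E i)) (\<phi> i h)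
                       \<otimes>\<^bsub>vgrp G (org G (?E i))\<^esub> inv\<^bsub>vgrp G (org G (?E i))\<^esub> dm i" and
      \<psi>2: "\<And>i h. i < ?n \<Longrightarrow> h \<in> carrier (egrp G e) \<Longrightarrow>
         \<psi> (Suc i) h = dp i \<otimes>\<^bsub>vgrp G (tm G (?E i))\<^esub> iota G (?E i) (\<phi> i h)
                       \<otimes>\<^bsub>vgrp G (tm G (?E i))\<^esub> inv\<^bsub>vgrp G (tm G (?E i))\<^esub> dp i" and
      ends: "\<And>h. h \<in> carrier (egrp G e) \<Longrightarrow> \<psi> 0 h = ?\<theta> h" "\<And>h. h \<in> carrier (egrp G e) \<Longrightarrow> \<psi> ?n h = ?\<xi> h" and
      a: "a = dm 0" and
      b: "\<And>i. i < ?n \<Longrightarrow> snd (xs ! i) = (if Suc i < ?n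
             then inv\<^bsub>vgrp G (tm G (?E i))\<^esub> dp i \<otimes>\<^bsub>vgrp G (tm G (?E i))\<^esub> dm (Suc i)
             else inv\<^bsub>vgrp G (tm G (?E i))\<^esub> dp i)"
      unfolding morphism_on_subdivision_def em Let_def prod.case by blast
    have io: "iota G (?E i) (\<phi> i h) \<in> carrier (vgrp G (tm G (?E i)))" 
       "iota G (ebar G (?E i)) (\<phi> i h) \<in> carrier (vgrp G (org G (?E i)))"
      if "i < ?n" "h \<in> carrier (egrp G e)" for i h
      using \<phi>[OF that(1)] that ed(1)[OF that(1)] G by (simp_all add: hom_def Pi_iff)
    have "case_nat ?\<theta> (\<lambda>j h. iota G (?E j) (\<phi> j h)) i h \<otimes>\<^bsub>vgrp G (?V i)\<^esub> ?c i =
        ?c i \<otimes>\<^bsub>vgrp G (?V i)\<^esub> (if i < ?n then iota G (ebar G (?E i)) (\<phi> i h) else ?\<xi> h)"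
      if i: "i \<le> ?n" and h: "h \<in> carrier (egrp G e)" for i h
    proof -
      interpret group "vgrp G (?V i)" using cc(2)[OF i] G by (intro group_vgrp)
      show ?thesis
      proof (cases i)
        case 0
        have "org G (?E 0) = v" using ed(2)[of 0] n by simp
        then have "?\<theta> h = a \<otimes>\<^bsub>vgrp G v\<^esub> iota G (ebar G (?E 0)) (\<phi> 0 h) \<otimes>\<^bsub>vgrp G v\<^esub> inv\<^bsub>vgrp G v\<^esub> a"
          and "iota G (ebar G (?E 0)) (\<phi> 0 h) \<in> carrier (vgrp G v)" "a \<in> carrier (vgrp G v)"
          using \<psi>1[of 0 h] ends(1)[OF h] a n h io[of 0 h] dm[of 0] by auto
        then show ?thesis using 0 n G cc(2)[of 0] by (simp add: vgrp_assoc)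
      next
        case (Suc j)
        then have j: "j < ?n" using i by simp
        note dpj = dp[OF j] and ioj = io[OF j h] and ps = \<psi>2[OF j h] and bj = b[OF j]
        show ?thesis
        proof (cases "i < ?n")
          case True
          have oi: "org G (?E i) = tm G (?E j)" using ed(2)[OF True] Suc by simp
          \<comment> \<open>The two formulas for \<open>\<psi> i\<close>, from the segment before
            the vertex and from the one after it.\<close>
          have "dp j \<otimes>\<^bsub>vgrp G (tm G (?E j))\<^esub> iota G (?E j) (\<phi> j h) \<otimes>\<^bsub>vgrp G (tm G (?E j))\<^esub> inv\<^bsub>vgrp G (tm G (?E j))\<^esub> dp j =
            dm i \<otimes>\<^bsub>vgrp G (tm G (?E j))\<^esub> iota G (ebar G (?E i)) (\<phi> i h) \<otimes>\<^bsub>vgrp G (tm G (?E j))\<^esub> inv\<^bsub>vgrp G (tm G (?E j))\<^esub> dm i"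
            using ps \<psi>1[OF True h] Suc oi by simp
          then have "iota G (?E j) (\<phi> j h) \<otimes>\<^bsub>vgrp G (tm G (?E j))\<^esub> (inv\<^bsub>vgrp G (tm G (?E j))\<^esub> dp j \<otimes>\<^bsub>vgrp G (tm G (?E j))\<^esub> dm i) =
             inv\<^bsub>vgrp G (tm G (?E j))\<^esub> dp j \<otimes>\<^bsub>vgrp G (tm G (?E j))\<^esub> dm i \<otimes>\<^bsub>vgrp G (tm G (?E j))\<^esub> iota G (ebar G (?E i)) (\<phi> i h)"
            using conj_eq_swap[of "dp j" "dm i" "iota G (?E j) (\<phi> j h)" "iota G (ebar G (?E i)) (\<phi> i h)"]
              dpj dm[OF True] io[OF True h] ioj oi Suc by simp
          then show ?thesis using Suc True bj by simp
        next
          case False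
          then have "i = ?n" using i by simp
          then have "?\<xi> h = dp j \<otimes>\<^bsub>vgrp G (tm G (?E j))\<^esub> iota G (?E j) (\<phi> j h) \<otimes>\<^bsub>vgrp G (tm G (?E j))\<^esub> inv\<^bsub>vgrp G (tm G (?E j))\<^esub> dp j"
            using ps ends(2)[OF h] Suc by simp
          then show ?thesis using Suc \<open>i = ?n\<close> bj dpj ioj G cc(2)[OF i]
            by (simp add: vgrp_assoc[symmetric])
        qed
      qed
    qed
    then have "slides G (egrp G e) (v, a, xs) ?\<theta> ?\<xi>" unfolding slides_iff_index using \<phi> by blast
    then show "path_edges (emap f e) \<noteq> [] \<and> slides G (egrp G e) (emap f e) ?\<theta> ?\<xi>"
      using False em by simp
  next
    assume "path_edges (emap f e) \<noteq> [] \<and> slides G (egrp G e) (emap f e) ?\<theta> ?\<xi>"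
    then obtain \<phi> where \<phi>: "\<And>i. i < ?n \<Longrightarrow> \<phi> i \<in> hom (egrp G e) (egrp G (?E i))" and
      eq: "\<And>i h. i \<le> ?n \<Longrightarrow> h \<in> carrier (egrp G e) \<Longrightarrow> 
        case_nat ?\<theta> (\<lambda>j h. iota G (?E j) (\<phi> j h)) i h \<otimes>\<^bsub>vgrp G (?V i)\<^esub> ?c i =
        ?c i \<otimes>\<^bsub>vgrp G (?V i)\<^esub> (if i < ?n then iota G (ebar G (?E i)) (\<phi> i h) else ?\<xi> h)"
      unfolding em slides_iff_index by blast
    \<comment> \<open>Between two segments only the product of \<open>inv (dp i)\<close> and
      \<open>dm (Suc i)\<close> is determined. It is assigned entirely to \<open>dm\<close>, with
      \<open>dp\<close> trivial, except after the last edge, where no \<open>dm\<close>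
      follows.\<close>
    define dp where "dp i = (if Suc i < ?n then \<one>\<^bsub>vgrp G (tm G (?E i))\<^esub> else inv\<^bsub>vgrp G (tm G (?E i))\<^esub> (snd (xs ! i)))" for i
    define \<psi> where "\<psi> i = (if i < ?n then case_nat ?\<theta> (\<lambda>j h. iota G (?E j) (\<phi> j h)) i else ?\<xi>)" for i
    have io: "iota G (?E i) (\<phi> i h) \<in> carrier (vgrp G (tm G (?E i)))" 
       "iota G (ebar G (?E i)) (\<phi> i h) \<in> carrier (vgrp G (?V i))"
      if "i < ?n" "h \<in> carrier (egrp G e)" for i h
      using \<phi>[OF that(1)] that ed[OF that(1)] G iota_ebar_closed[OF G ed(1)[OF that(1)], of "\<phi> i h"] by (simp_all add: hom_def Pi_iff)
    have L: "case_nat ?\<theta> (\<lambda>j h. iota G (?E j) (\<phi> j h)) i h \<in> carrier (vgrp G (?V i))"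
      if "i \<le> ?n" "h \<in> carrier (egrp G e)" for i h
      using that \<theta>[OF that(2)] io[OF _ that(2)] em by (cases i) auto
    have 1: "\<psi> i h = ?c i \<otimes>\<^bsub>vgrp G (?V i)\<^esub> iota G (ebar G (?E i)) (\<phi> i h) \<otimes>\<^bsub>vgrp G (?V i)\<^esub> inv\<^bsub>vgrp G (?V i)\<^esub> ?c i"
      if i: "i < ?n" and h: "h \<in> carrier (egrp G e)" for i h
    proof -
      have i': "i \<le> ?n" using i by simp
      interpret group "vgrp G (?V i)" using cc(2)[OF i'] G by (intro group_vgrp)
      show ?thesis using swap_imp_conj(1)[OF cc(1)[OF i'] L[OF i' h] io(2)[OF i h]] eq[OF i' h] i
        by (simp add: \<psi>_def)
    qed
    have 2: "\<psi> (Suc i) h = dp i \<otimes>\<^bsub>vgrp G (tm G (?E i))\<^esub> iota G (?E i) (\<phi> i h) \<otimes>\<^bsub>vgrp G (tm G (?E i))\<^esub> inv\<^bsub>vgrp G (tm G (?E i))\<^esub> dp i"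
      if i: "i < ?n" and h: "h \<in> carrier (egrp G e)" for i h
    proof -
      have i': "Suc i \<le> ?n" using i by simp
      interpret group "vgrp G (?V (Suc i))" using cc(2)[OF i'] G by (intro group_vgrp)
      show ?thesis
      proof (cases "Suc i < ?n")
        case True
        then show ?thesis using io(1)[OF i h] G cc(2)[OF i'] by (simp add: \<psi>_def dp_def)
      next
        case False
        then have n': "?n = Suc i" using i by simp
        then have "?\<xi> h \<in> carrier (vgrp G (tm G (?E i)))" using \<xi>[OF h] em endv by simp
        then show ?thesis using swap_imp_conj(2)[OF cc(1)[OF i'] L[OF i' h], of "?\<xi> h"] eq[OF i' h] n' cc[OF i'] G
          by (simp add: \<psi>_def dp_def)
      qed
    qed
    have 3: "snd (xs ! i) = (if Suc i < ?n
             then inv\<^bsub>vgrp G (tm G (?E i))\<^esub> dp i \<otimes>\<^bsub>vgrp G (tm G (?E i))\<^esub> ?c (Suc i)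
             else inv\<^bsub>vgrp G (tm G (?E i))\<^esub> dp i)" if "i < ?n" for i
      using cc[of "Suc i"] that G by (simp add: dp_def)
    have 4: "dp i \<in> carrier (vgrp G (tm G (?E i)))" if "i < ?n" for i
      using cc[of "Suc i"] that G by (simp add: dp_def)
    have 5: "?c i \<in> carrier (vgrp G (?V i))" if "i < ?n" for i using cc(1)[of i] that by simp
    show "morphism_on_subdivision G f e"
      unfolding morphism_on_subdivision_def em Let_def prod.case
      apply (intro conjI n(2))
      apply (rule exI[of _ \<phi>], rule exI[of _ \<psi>], rule exI[of _ ?c], rule exI[of _ dp])
      apply (intro conjI allI impI ballI)
      subgoal using \<phi> by blast
      subgoal for i using 5[of i] ed(2)[of i] by simp
      subgoal using 4 by blast
      subgoal for i h using 1[of i h] ed(2)[of i] by simp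
      subgoal using 2 by blast
      subgoal using n by (simp add: \<psi>_def)
      subgoal by (simp add: \<psi>_def)
      subgoal by simp
      subgoal using 3 by simp
      done
  qed
qed


lemma slides_cat:
  assumes G: "graph_of_groups G"
  shows "is_path G x \<Longrightarrow> is_path G y \<Longrightarrow> path_end G x = path_start y \<Longrightarrow>
    slides G E x \<theta> \<xi> \<Longrightarrow> slides G E y \<xi> \<zeta> \<Longrightarrow>
    (\<And>h. h \<in> carrier E \<Longrightarrow> \<theta> h \<in> carrier (vgrp G (path_start x))) \<Longrightarrow>
    (\<And>h. h \<in> carrier E \<Longrightarrow> \<xi> h \<in> carrier (vgrp G (path_start y))) \<Longrightarrow>
    (\<And>h. h \<in> carrier E \<Longrightarrow> \<zeta> h \<in> carrier (vgrp G (path_end G y))) \<Longrightarrow>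
    slides G E (x \<bullet>\<^bsub>G\<^esub> y) \<theta> \<zeta>"
  using G
proof (induction G x arbitrary: \<theta> rule: is_path.induct)
  case (1 G v a)
  note G = \<open>graph_of_groups G\<close>
  have v: "v \<in> verts G" "a \<in> carrier (vgrp G v)" using 1 by simp_all
  have *: "\<theta> h \<otimes>\<^bsub>vgrp G v\<^esub> (a \<otimes>\<^bsub>vgrp G v\<^esub> b) = a \<otimes>\<^bsub>vgrp G v\<^esub> b \<otimes>\<^bsub>vgrp G v\<^esub> z"
    if "h \<in> carrier E" "b \<in> carrier (vgrp G v)" "z \<in> carrier (vgrp G v)" "\<xi> h \<otimes>\<^bsub>vgrp G v\<^esub> b = b \<otimes>\<^bsub>vgrp G v\<^esub> z" for h b z
  proof -
    have h: "\<theta> h \<in> carrier (vgrp G v)" "\<xi> h \<in> carrier (vgrp G v)" "\<theta> h \<otimes>\<^bsub>vgrp G v\<^esub> a = a \<otimes>\<^bsub>vgrp G v\<^esub> \<xi> h"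
      using 1(3,4,6,7) that(1) by simp_all
    have "\<theta> h \<otimes>\<^bsub>vgrp G v\<^esub> (a \<otimes>\<^bsub>vgrp G v\<^esub> b) = \<theta> h \<otimes>\<^bsub>vgrp G v\<^esub> a \<otimes>\<^bsub>vgrp G v\<^esub> b"
      using vgrp_assoc[OF G v(1) h(1) v(2) that(2)] by simp
    also have "\<dots> = a \<otimes>\<^bsub>vgrp G v\<^esub> (\<xi> h \<otimes>\<^bsub>vgrp G v\<^esub> b)" unfolding h(3) using G v h that by (simp add: vgrp_assoc)
    also have "\<dots> = a \<otimes>\<^bsub>vgrp G v\<^esub> b \<otimes>\<^bsub>vgrp G v\<^esub> z" unfolding that(4) using G v that by (simp add: vgrp_assoc)
    finally show ?thesis .
  qed
  show ?case
  proof (cases y rule: path_cases)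
    case (1 w b)
    then show ?thesis using * 1 \<open>slides G E y \<xi> \<zeta>\<close> \<open>path_end G (v, a, []) = path_start y\<close> \<open>is_path G y\<close>
        \<open>\<And>h. h \<in> carrier E \<Longrightarrow> \<zeta> h \<in> carrier (vgrp G (path_end G y))\<close> by simp
  next
    case (2 w b e c ys)
    then have w: "w = v" "b \<in> carrier (vgrp G v)" "e \<in> edges G" "org G e = v"
      using 1(2,3) by auto
    obtain \<phi> where \<phi>: "\<phi> \<in> hom E (egrp G e)" "\<forall>h\<in>carrier E. \<xi> h \<otimes>\<^bsub>vgrp G v\<^esub> b = b \<otimes>\<^bsub>vgrp G v\<^esub> iota G (ebar G e) (\<phi> h)"
      "slides G E (tm G e, c, ys) (\<lambda>h. iota G e (\<phi> h)) \<zeta>" using 1(5) 2 w by auto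
    have c: "iota G (ebar G e) (\<phi> h) \<in> carrier (vgrp G v)" if "h \<in> carrier E" for h
      using \<phi>(1) that G w(3) iota_ebar_closed[OF G w(3), of "\<phi> h"] w(4) by (simp add: hom_def Pi_iff)
    have "\<theta> h \<otimes>\<^bsub>vgrp G v\<^esub> (a \<otimes>\<^bsub>vgrp G v\<^esub> b) = a \<otimes>\<^bsub>vgrp G v\<^esub> b \<otimes>\<^bsub>vgrp G v\<^esub> iota G (ebar G e) (\<phi> h)"
      if "h \<in> carrier E" for h
      using *[OF that w(2) c[OF that]] \<phi>(2) that by blast
    then show ?thesis using \<phi>(1,3) 2 w(1) by auto
  qed
next
  case (2 G v a e b xs)
  note G = \<open>graph_of_groups G\<close>
  let ?x = "(tm G e, b, xs)"
  have e: "e \<in> edges G" and x: "is_path G ?x" "path_end G ?x = path_start y" using 2(2,4) by simp_all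
  obtain \<phi> where \<phi>: "\<phi> \<in> hom E (egrp G e)" "\<forall>h\<in>carrier E. \<theta> h \<otimes>\<^bsub>vgrp G v\<^esub> a = a \<otimes>\<^bsub>vgrp G v\<^esub> iota G (ebar G e) (\<phi> h)"
      "slides G E ?x (\<lambda>h. iota G e (\<phi> h)) \<xi>" using 2(5) by auto
  have c: "iota G e (\<phi> h) \<in> carrier (vgrp G (path_start ?x))" if "h \<in> carrier E" for h
    using \<phi>(1) that G e by (simp add: hom_def Pi_iff)
  have "slides G E (?x \<bullet>\<^bsub>G\<^esub> y) (\<lambda>h. iota G e (\<phi> h)) \<zeta>"
    using 2(1)[OF x(1) 2(3) x(2) \<phi>(3) 2(6) c 2(8,9) G] by simp
  moreover have "fst (?x \<bullet>\<^bsub>G\<^esub> y) = tm G e" unfolding fst_cat by simp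
  then have "(tm G e, fst (snd (?x \<bullet>\<^bsub>G\<^esub> y)), snd (snd (?x \<bullet>\<^bsub>G\<^esub> y))) = ?x \<bullet>\<^bsub>G\<^esub> y" by (simp add: prod_eq_iff)
  ultimately show ?case using \<phi> unfolding path_cat_Cons slides.simps by auto
qed

text \<open>\<open>edge_act_slide\<close> iterated along the path; the homomorphisms in
  \<open>slides\<close> provide the edge group element to be moved across each letter.\<close>

lemma slides_path_act:
  assumes G: "graph_of_groups G"
  shows "is_path G x \<Longrightarrow> slides G E x \<theta> \<xi> \<Longrightarrow>
    (\<And>h. h \<in> carrier E \<Longrightarrow> \<theta> h \<in> carrier (vgrp G (path_start x))) \<Longrightarrow>
    (\<And>h. h \<in> carrier E \<Longrightarrow> \<xi> h \<in> carrier (vgrp G (path_end G x))) \<Longrightarrow>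
    normal_path G w \<Longrightarrow> path_start w = path_end G x \<Longrightarrow> h \<in> carrier E \<Longrightarrow>
    path_act G x (vertex_act G (path_end G x) (\<xi> h) w) = vertex_act G (path_start x) (\<theta> h) (path_act G x w)"
  using G
proof (induction G x arbitrary: \<theta> rule: is_path.induct)
  case (1 G v a)
  then show ?case by (simp add: vertex_act_mult normal_path_is_path)
next
  case (2 G v a e b xs)
  note G = \<open>graph_of_groups G\<close>
  let ?x = "(tm G e, b, xs)"
  let ?w = "path_act G ?x w"
  have e: "e \<in> edges G" "org G e = v" "v \<in> verts G" "a \<in> carrier (vgrp G v)" 
    and x: "is_path G ?x" "path_end G ?x = path_start w" "path_end G (v, a, (e, b) # xs) = path_end G ?x"
    using 2(2,7) by simp_all
  obtain \<phi> where \<phi>: "\<phi> \<in> hom E (egrp G e)" "\<forall>h\<in>carrier E. \<theta> h \<otimes>\<^bsub>vgrp G v\<^esub> a = a \<otimes>\<^bsub>vgrp G v\<^esub> iota G (ebar G e) (\<phi> h)"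
      "slides G E ?x (\<lambda>h. iota G e (\<phi> h)) \<xi>" using 2(3) by auto
  have c: "iota G e (\<phi> h) \<in> carrier (vgrp G (path_start ?x))" if "h \<in> carrier E" for h
    using \<phi>(1) that G e by (simp add: hom_def Pi_iff)
  have h: "\<phi> h \<in> carrier (egrp G e)" "\<theta> h \<in> carrier (vgrp G v)" "iota G (ebar G e) (\<phi> h) \<in> carrier (vgrp G v)"
    using \<phi>(1) 2(4)[OF 2(8)] 2(8) iota_ebar_closed[OF G e(1), of "\<phi> h"] e(2) by (simp_all add: hom_def Pi_iff)
  have w: "normal_path G ?w" "path_start ?w = tm G e" "is_path G ?w" 
    using G x 2(6) by (simp_all add: normal_path_is_path)
  have u: "is_path G (edge_act G e ?w)" "path_start (edge_act G e ?w) = v"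
    using edge_act(1)[OF G e(1) w(3,2)] e by simp_all
  have "path_act G ?x (vertex_act G (path_end G ?x) (\<xi> h) w) = vertex_act G (tm G e) (iota G e (\<phi> h)) ?w"
    using 2(1)[OF x(1) \<phi>(3) c 2(5)[unfolded x(3)] 2(6) x(2)[symmetric] 2(8) G] by simp
  then have "path_act G (v, a, (e, b) # xs) (vertex_act G (path_end G ?x) (\<xi> h) w) =
    vertex_act G v a (vertex_act G v (iota G (ebar G e) (\<phi> h)) (edge_act G e ?w))"
    using edge_act_slide[OF G e(1) w(3,2) h(1)] e by simp
  also have "\<dots> = vertex_act G v (\<theta> h) (vertex_act G v a (edge_act G e ?w))"
    using G u e h \<phi>(2) 2(8) by (simp add: vertex_act_mult)
  finally show ?case using x(3) by simp
qed

section \<open>Homotopy invariance of edge path maps\<close>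

lemma edge_path_mapD:
  assumes "edge_path_map G f"
  shows "graph_of_groups G" "path_morphism G G f"
    "e \<in> edges G \<Longrightarrow> path_edges (emap f e) \<noteq> []"
    "e \<in> edges G \<Longrightarrow> tight G (emap f e)"
    "e \<in> edges G \<Longrightarrow> morphism_on_subdivision G f e"
  using assms by (auto simp: edge_path_map_def path_morphism_def)

context
  fixes G :: "('v, 'e, 'g, 'h) gog" and f :: "('v, 'e, 'g, 'v, 'e, 'g) gmap"
  assumes f: "edge_path_map G f"
begin

lemmas G = edge_path_mapD(1)[OF f] and pm = edge_path_mapD(2)[OF f]

lemma edge_path_map_slides:
  assumes e: "e \<in> edges G"
  shows "slides G (egrp G e) (emap f e) (\<lambda>h. vhom f (org G e) (iota G (ebar G e) h)) (\<lambda>h. vhom f (tm G e) (iota G e h))"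
    and "h \<in> carrier (egrp G e) \<Longrightarrow> vhom f (org G e) (iota G (ebar G e) h) \<in> carrier (vgrp G (vmap f (org G e)))"
    and "h \<in> carrier (egrp G e) \<Longrightarrow> vhom f (tm G e) (iota G e h) \<in> carrier (vgrp G (vmap f (tm G e)))"
proof -
  note E = path_morphism_edge[OF pm e] and e' = org_ebar[OF G e]
  show 1: "vhom f (org G e) (iota G (ebar G e) h) \<in> carrier (vgrp G (vmap f (org G e)))" if "h \<in> carrier (egrp G e)" for h
    using path_morphism_vertex(3)[OF pm e'(2)] iota_ebar_closed[OF G e that] by simp
  show 2: "vhom f (tm G e) (iota G e h) \<in> carrier (vgrp G (vmap f (tm G e)))" if "h \<in> carrier (egrp G e)" for h
    using path_morphism_vertex(3)[OF pm e'(3)] iota_closed[OF G e that] by simp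
  show "slides G (egrp G e) (emap f e) (\<lambda>h. vhom f (org G e) (iota G (ebar G e) h)) (\<lambda>h. vhom f (tm G e) (iota G e h))"
    using morphism_on_subdivision_iff_slides[of G f e] edge_path_mapD(5)[OF f e] G E 1 2 by simp
qed

text \<open>The slide relation of \<open>e\<close> after applying \<open>f\<close>. It holds because
  \<open>f\<close> is a morphism on a subdivision of \<open>e\<close>, so the image of
  \<open>h\<close> moves across the whole image path.\<close>

lemma edge_path_map_edge_relation:
  assumes e: "e \<in> edges G" and h: "h \<in> carrier (egrp G e)"
  shows "normal_form G (emap f e \<bullet>\<^bsub>G\<^esub> (vmap f (tm G e), vhom f (tm G e) (iota G e h), [])) =
      normal_form G ((vmap f (org G e), vhom f (org G e) (iota G (ebar G e) h), []) \<bullet>\<^bsub>G\<^esub> emap f e)"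
proof -
  note E = path_morphism_edge[OF pm e] and e' = org_ebar[OF G e] and s = edge_path_map_slides[OF e]
  note V = path_morphism_vertex(1)[OF pm e'(2)] path_morphism_vertex(1)[OF pm e'(3)]
  let ?t = "trivial_path G (vmap f (tm G e))"
  have 1: "normal_form G (vmap f (tm G e), vhom f (tm G e) (iota G e h), []) =
      vertex_act G (vmap f (tm G e)) (vhom f (tm G e) (iota G e h)) ?t"
    using G s(3)[OF h] V by (simp add: vertex_act_def trivial_path_def)
  have "path_act G (emap f e) (vertex_act G (path_end G (emap f e)) (vhom f (tm G e) (iota G e h)) ?t) =
    vertex_act G (path_start (emap f e)) (vhom f (org G e) (iota G (ebar G e) h)) (path_act G (emap f e) ?t)"
    by (rule slides_path_act[OF G E(1) s(1)]) (use E s(2,3) h G V in simp_all)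
  then show ?thesis using G E V s(2,3)[OF h] 
    by (simp add: normal_form_cat 1 del: normal_form_vertex) (simp add: normal_form_def)
qed

lemma edge_path_map_homotopic:
  assumes "is_path G x" "is_path G y" "normal_form G x = normal_form G y"
  shows "normal_form G (path_image G G f x) = normal_form G (path_image G G f y)"
  by (rule path_image_homotopic[OF pm edge_path_map_edge_relation]) (use assms homotopic_iff[OF G assms(1,2)] in auto)

lemma homotopy_class_image:
  assumes "is_path G \<gamma>"
  shows "pi1_map G f (homotopy_class G \<gamma>) = homotopy_class G (path_image G G f \<gamma>)"
proof -
  have "homotopy_class G (path_image G G f \<gamma>') = homotopy_class G (path_image G G f \<gamma>)" if "\<gamma>' \<in> homotopy_class G \<gamma>" for \<gamma>'
  proof -
    note * = in_homotopy_class[OF G assms that]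
    show ?thesis using edge_path_map_homotopic[OF *(1) assms *(4)] * assms G pm
      by (simp add: homotopy_class_eq_iff path_image_is_path[OF pm])
  qed
  then have "pi1_map G f (homotopy_class G \<gamma>) = (\<Union>\<gamma>'\<in>homotopy_class G \<gamma>. homotopy_class G (path_image G G f \<gamma>))"
    unfolding pi1_map_def by (rule SUP_cong[OF refl])
  moreover have "homotopy_class G \<gamma> \<noteq> {}" using homotopy_class_self by fast
  ultimately show ?thesis by simp
qed

lemma pi1_map_hom:
  assumes "v \<in> verts G"
  shows "pi1_map G f \<in> hom (pi1 G v) (pi1 G (vmap f v))"
proof (rule homI)
  fix x y assume "x \<in> carrier (pi1 G v)" "y \<in> carrier (pi1 G v)"
  then obtain \<gamma> \<delta> where *: "x = homotopy_class G \<gamma>" "is_path G \<gamma>" "path_start \<gamma> = v" "path_end G \<gamma> = v"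
     "y = homotopy_class G \<delta>" "is_path G \<delta>" "path_start \<delta> = v" "path_end G \<delta> = v"
    by (elim pi1_cases)
  show "pi1_map G f x \<in> carrier (pi1 G (vmap f v))"
    using * pm by (simp add: homotopy_class_image)
  show "pi1_map G f (x \<otimes>\<^bsub>pi1 G v\<^esub> y) = pi1_map G f x \<otimes>\<^bsub>pi1 G (vmap f v)\<^esub> pi1_map G f y"
    using * pm G by (simp add: homotopy_class_image homotopy_class_mult path_image_cat)
qed

end

lemma edge_path_map_restrict:
  assumes f: "edge_path_map G f" and S: "subgraph G S"
    and V: "\<And>v. v \<in> fst S \<Longrightarrow> vmap f v \<in> fst S"
    and E: "\<And>e. e \<in> snd S \<Longrightarrow> set (path_edges (emap f e)) \<subseteq> snd S"
  shows "edge_path_map (restrict_gog G S) f"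
proof -
  note G = edge_path_mapD(1)[OF f]
  have sub: "\<And>v. v \<in> fst S \<Longrightarrow> v \<in> verts G" "\<And>e. e \<in> snd S \<Longrightarrow> e \<in> edges G \<and> org G e \<in> fst S \<and> tm G e \<in> fst S"
    using S by (auto simp: subgraph_def org_def)
  have "morphism_on_subdivision (restrict_gog G S) f e \<longleftrightarrow> morphism_on_subdivision G f e" for e
    unfolding morphism_on_subdivision_def by simp
  then show ?thesis using f S V E sub unfolding edge_path_map_def 
    by (simp add: path_from_to_def is_path_restrict)
qed

section \<open>Collapsing\<close>

declare path_cat.simps(1) [simp del] path_cat_Cons [simp del] vertex_path_cat [simp del]

lemma normal_form_slide:
  assumes G: "graph_of_groups G" and e: "e \<in> edges G" and h: "h \<in> carrier (egrp G e)"
  shows "normal_form G (edge_path G e \<bullet>\<^bsub>G\<^esub> (tm G e, iota G e h, [])) =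
    normal_form G ((org G e, iota G (ebar G e) h, []) \<bullet>\<^bsub>G\<^esub> edge_path G e)"
proof -
  note e' = org_ebar[OF G e]
  have 1: "is_path G (tm G e, iota G e h, [])" "is_path G (org G e, iota G (ebar G e) h, [])"
    using G e h e' by simp_all
  have "elem_homotopy G
     (trivial_path G (org G e) \<bullet>\<^bsub>G\<^esub> edge_path G e \<bullet>\<^bsub>G\<^esub> (tm G e, iota G e h, []) \<bullet>\<^bsub>G\<^esub> trivial_path G (tm G e))
     (trivial_path G (org G e) \<bullet>\<^bsub>G\<^esub> (org G e, iota G (ebar G e) h, []) \<bullet>\<^bsub>G\<^esub> edge_path G e \<bullet>\<^bsub>G\<^esub> trivial_path G (tm G e))"
    using assms e' by (intro elem_homotopy.slide) auto
  then have "elem_homotopy G (edge_path G e \<bullet>\<^bsub>G\<^esub> (tm G e, iota G e h, []))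
     ((org G e, iota G (ebar G e) h, []) \<bullet>\<^bsub>G\<^esub> edge_path G e)"
    using G e 1 e' by (simp add: trivial_cat cat_trivial del: is_path.simps)
  from homotopic_props(5)[OF G homotopic_elem[OF this]] show ?thesis using G e 1 by simp
qed

lemma subgraph_same_verts: "graph_of_groups G \<Longrightarrow> subgraph G S \<Longrightarrow> subgraph G (verts G, snd S)"
  by (auto simp: subgraph_def org_ebar dest: subsetD)

section \<open>Paths in the collapsed subgraph and their classes\<close>

locale collapse_data =
  fixes K :: "('v, 'e, 'g, 'h) gog" and S :: "'v set \<times> 'e set" and p :: "'v \<Rightarrow> 'v" and \<alpha> :: "'v \<Rightarrow> ('v, 'e, 'g) path"
  assumes K: "graph_of_groups K" and S: "subgraph K S" and base: "base_data K S p \<alpha>"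
begin

abbreviation "C \<equiv> collapsed_part K S"
abbreviation "K' \<equiv> collapse K S p \<alpha>"
abbreviation "elt \<equiv> collapse_elt K S \<alpha>"
abbreviation "c \<equiv> path_image K K' (collapse_map K S p \<alpha>)"

text \<open>These are the paths of \<open>C\<close>, described inside \<open>K\<close> so that facts
  about \<open>K\<close> apply to them. No condition on the starting vertex is needed to match
  \<open>C\<close>, in which vertices outside \<open>S\<close> are isolated.\<close>

definition S_path :: "('v, 'e, 'g) path \<Rightarrow> bool" where
  "S_path \<gamma> \<longleftrightarrow> is_path K \<gamma> \<and> set (path_edges \<gamma>) \<subseteq> snd S"

lemma subgraph_C: "subgraph K (verts K, snd S)"
  using K S by (rule subgraph_same_verts)

lemma C: "graph_of_groups C"
  unfolding collapsed_part_def using K subgraph_C by (rule graph_of_groups_restrict)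

lemma is_path_C [simp]: "is_path C \<gamma> \<longleftrightarrow> S_path \<gamma>"
  unfolding collapsed_part_def is_path_restrict[OF subgraph_C] S_path_def using is_path_start by fastforce

lemma C_simps [simp]:
  "path_cat C x y = path_cat K x y" "path_end C x = path_end K x" "path_rev C x = path_rev K x"
  "normal_form C x = normal_form K x" "trivial_path C v = trivial_path K v" "verts C = verts K"
  by (simp_all add: collapsed_part_def)

lemma S_edges: "e \<in> snd S \<Longrightarrow> e \<in> edges K" "e \<in> snd S \<Longrightarrow> ebar K e \<in> snd S"
  "e \<in> edges K \<Longrightarrow> ebar K e \<in> snd S \<longleftrightarrow> e \<in> snd S"
proof -
  show 1: "e \<in> snd S \<Longrightarrow> e \<in> edges K" and 2: "e \<in> snd S \<Longrightarrow> ebar K e \<in> snd S" for e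
    using S unfolding subgraph_def by auto
  show "e \<in> edges K \<Longrightarrow> ebar K e \<in> snd S \<longleftrightarrow> e \<in> snd S"
    using 2[of e] 2[of "ebar K e"] org_ebar(5)[OF K, of e] by auto
qed

lemma S_path_intros [simp]:
  "S_path x \<Longrightarrow> S_path y \<Longrightarrow> path_end K x = path_start y \<Longrightarrow> S_path (x \<bullet>\<^bsub>K\<^esub> y)"
  "S_path x \<Longrightarrow> S_path (path_rev K x)"
  "e \<in> snd S \<Longrightarrow> S_path (edge_path K e)"
  "v \<in> verts K \<Longrightarrow> S_path (trivial_path K v)"
  "S_path (v, g, []) \<longleftrightarrow> v \<in> verts K \<and> g \<in> carrier (vgrp K v)"
  using K S_edges by (auto simp: S_path_def)

lemma S_path_is_path: "S_path x \<Longrightarrow> is_path K x"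
  by (simp add: S_path_def)

lemma base_component:
  "path_from_to C v w \<gamma> \<Longrightarrow> v \<in> verts K \<Longrightarrow> w \<in> verts K \<Longrightarrow> p v = p w"
  using base unfolding base_data_def by blast

lemma base_path [simp]:
  assumes "v \<in> verts K"
  shows "S_path (\<alpha> v)" "path_start (\<alpha> v) = p v" "path_end K (\<alpha> v) = v"
    "\<alpha> (p v) = trivial_path K (p v)" "p v \<in> verts K" "p (p v) = p v" "is_path K (\<alpha> v)"
proof -
  have *: "path_from_to C (p v) v (\<alpha> v)" using base assms by (auto simp: base_data_def)
  then show **: "S_path (\<alpha> v)" "path_start (\<alpha> v) = p v" "path_end K (\<alpha> v) = v"
    by (auto simp: path_from_to_def)
  show "\<alpha> (p v) = trivial_path K (p v)" using base assms by (auto simp: base_data_def)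
  show "is_path K (\<alpha> v)" using ** by (simp add: S_path_def)
  then show pv: "p v \<in> verts K" using ** is_path_start by metis
  show "p (p v) = p v" by (rule base_component[OF * pv assms])
qed

lemma base_S_path: "S_path \<gamma> \<Longrightarrow> p (path_end K \<gamma>) = p (path_start \<gamma>)"
proof -
  assume g: "S_path \<gamma>"
  then have "path_from_to C (path_start \<gamma>) (path_end K \<gamma>) \<gamma>" by (simp add: path_from_to_def)
  moreover have "path_start \<gamma> \<in> verts K" "path_end K \<gamma> \<in> verts K"
    using S_path_is_path[OF g] is_path_start[of K \<gamma>] by auto
  ultimately show ?thesis by (rule base_component[symmetric])
qed

lemma S_path_ends:
  assumes "S_path \<gamma>"
  shows "is_path K \<gamma>" "path_start \<gamma> \<in> verts K" "path_end K \<gamma> \<in> verts K" "p (path_end K \<gamma>) = p (path_start \<gamma>)"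
  using base_S_path[OF assms] S_path_is_path[OF assms] is_path_start[of K \<gamma>] by auto

lemma cls_eq_iff: "S_path x \<Longrightarrow> S_path y \<Longrightarrow>
    homotopy_class C x = homotopy_class C y \<longleftrightarrow> normal_form K x = normal_form K y"
  using homotopy_class_eq_iff[OF C, of x y] by simp

lemma cls_mult: "S_path x \<Longrightarrow> S_path y \<Longrightarrow> path_end K x = path_start y \<Longrightarrow>
    homotopy_class C x \<otimes>\<^bsub>pi1 C v\<^esub> homotopy_class C y = homotopy_class C (x \<bullet>\<^bsub>K\<^esub> y)"
  using homotopy_class_mult[OF C, of x y] by simp

lemma elt_carrier [simp]:
  assumes "S_path \<gamma>" "v = p (path_start \<gamma>)"
  shows "elt \<gamma> \<in> carrier (pi1 C v)"
  using S_path_ends[OF assms(1)] assms K by (simp add: collapse_elt_def pi1_class)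

text \<open>For fixed ends, \<open>elt\<close> multiplies by the same two paths on both sides, which
  can be undone up to homotopy. Classes in \<open>C\<close> are compared by normal forms of
  \<open>K\<close> because the two graphs have the same normal forms.\<close>

lemma elt_eq_iff:
  assumes "S_path x" "S_path y" "path_start x = path_start y" "path_end K x = path_end K y"
  shows "elt x = elt y \<longleftrightarrow> normal_form K x = normal_form K y"
proof -
  note e = S_path_ends[OF assms(1)] S_path_ends[OF assms(2)]
  let ?A = "\<alpha> (path_start x)" and ?B = "\<alpha> (path_end K x)"
  have 1: "normal_form K z = normal_form K (path_rev K ?A \<bullet>\<^bsub>K\<^esub> (?A \<bullet>\<^bsub>K\<^esub> z \<bullet>\<^bsub>K\<^esub> path_rev K ?B) \<bullet>\<^bsub>K\<^esub> ?B)"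
    if "S_path z" "path_start z = path_start x" "path_end K z = path_end K x" for z
  proof -
    have "normal_path K (normal_form K ?B)" "path_start (normal_form K ?B) = p (path_end K x)" using K e by auto
    moreover have "path_act K (path_rev K ?B) (normal_form K ?B) = trivial_path K (path_end K x)"
      using K e by (simp add: normal_form_def)
    ultimately show ?thesis using S_path_ends[OF that(1)] that K e by (simp add: normal_form_cat) (simp add: normal_form_def)
  qed
  have 2: "elt x = elt y \<longleftrightarrow> normal_form K (?A \<bullet>\<^bsub>K\<^esub> x \<bullet>\<^bsub>K\<^esub> path_rev K ?B) = normal_form K (?A \<bullet>\<^bsub>K\<^esub> y \<bullet>\<^bsub>K\<^esub> path_rev K ?B)"
    using assms e by (simp add: collapse_elt_def cls_eq_iff)
  show ?thesis
  proof
    assume "elt x = elt y"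
    then have "normal_form K (?A \<bullet>\<^bsub>K\<^esub> x \<bullet>\<^bsub>K\<^esub> path_rev K ?B) = normal_form K (?A \<bullet>\<^bsub>K\<^esub> y \<bullet>\<^bsub>K\<^esub> path_rev K ?B)"
      unfolding 2 .
    then have "normal_form K (path_rev K ?A \<bullet>\<^bsub>K\<^esub> (?A \<bullet>\<^bsub>K\<^esub> x \<bullet>\<^bsub>K\<^esub> path_rev K ?B)) =
        normal_form K (path_rev K ?A \<bullet>\<^bsub>K\<^esub> (?A \<bullet>\<^bsub>K\<^esub> y \<bullet>\<^bsub>K\<^esub> path_rev K ?B))"
      by (rule_tac normal_form_cat_cong[OF K]) (use K assms e in simp_all)
    then have "normal_form K (path_rev K ?A \<bullet>\<^bsub>K\<^esub> (?A \<bullet>\<^bsub>K\<^esub> x \<bullet>\<^bsub>K\<^esub> path_rev K ?B) \<bullet>\<^bsub>K\<^esub> ?B) =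
        normal_form K (path_rev K ?A \<bullet>\<^bsub>K\<^esub> (?A \<bullet>\<^bsub>K\<^esub> y \<bullet>\<^bsub>K\<^esub> path_rev K ?B) \<bullet>\<^bsub>K\<^esub> ?B)"
      by (rule_tac normal_form_cat_cong[OF K]) (use K assms e in simp_all)
    moreover note 1[OF assms(1) refl refl] 1[OF assms(2) assms(3,4)[symmetric]]
    ultimately show "normal_form K x = normal_form K y" by (rule_tac trans[OF _ trans[OF _ sym]])
  next
    assume n: "normal_form K x = normal_form K y"
    have "normal_form K (?A \<bullet>\<^bsub>K\<^esub> x) = normal_form K (?A \<bullet>\<^bsub>K\<^esub> y)"
      by (rule normal_form_cat_cong[OF K]) (use K assms e n in simp_all)
    then have "normal_form K (?A \<bullet>\<^bsub>K\<^esub> x \<bullet>\<^bsub>K\<^esub> path_rev K ?B) = normal_form K (?A \<bullet>\<^bsub>K\<^esub> y \<bullet>\<^bsub>K\<^esub> path_rev K ?B)"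
      by (rule_tac normal_form_cat_cong[OF K]) (use K assms e in simp_all)
    then show "elt x = elt y" unfolding 2 .
  qed
qed

text \<open>The two copies of \<open>\<alpha>\<close> at the common vertex cancel. The index
  \<open>v\<close> is free because the multiplication of \<open>pi1\<close> does not depend on the
  base vertex.\<close>

lemma elt_cat:
  assumes "S_path x" "S_path y" "path_end K x = path_start y"
  shows "elt (x \<bullet>\<^bsub>K\<^esub> y) = elt x \<otimes>\<^bsub>pi1 C v\<^esub> elt y"
proof -
  note e = S_path_ends[OF assms(1)] S_path_ends[OF assms(2)]
  have t: "normal_path K (normal_form K (y \<bullet>\<^bsub>K\<^esub> path_rev K (\<alpha> (path_end K y))))"
    "path_start (normal_form K (y \<bullet>\<^bsub>K\<^esub> path_rev K (\<alpha> (path_end K y)))) = path_start y"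
    using K e by simp_all
  have "normal_form K (\<alpha> (path_start x) \<bullet>\<^bsub>K\<^esub> (x \<bullet>\<^bsub>K\<^esub> y) \<bullet>\<^bsub>K\<^esub> path_rev K (\<alpha> (path_end K y))) =
    normal_form K (\<alpha> (path_start x) \<bullet>\<^bsub>K\<^esub> x \<bullet>\<^bsub>K\<^esub> path_rev K (\<alpha> (path_end K x)) \<bullet>\<^bsub>K\<^esub>
       (\<alpha> (path_start y) \<bullet>\<^bsub>K\<^esub> y \<bullet>\<^bsub>K\<^esub> path_rev K (\<alpha> (path_end K y))))"
    using assms K e t by (simp add: normal_form_cat)
  then show ?thesis
    using assms e K by (simp add: collapse_elt_def cls_mult cls_eq_iff)
qed

lemma elt_trivial: "v \<in> verts K \<Longrightarrow> elt (trivial_path K v) = \<one>\<^bsub>pi1 C (p v)\<^esub>"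
  using homotopy_class_rev_cat(2)[OF C, of "\<alpha> v"] K
  by (simp add: collapse_elt_def pi1_simps cat_trivial)

lemma elt_rev:
  assumes "S_path x" "v = p (path_start x)"
  shows "elt (path_rev K x) = inv\<^bsub>pi1 C v\<^esub> elt x"
proof -
  note e = S_path_ends[OF assms(1)]
  interpret group "pi1 C v" using group_pi1[OF C, of v] e assms by simp
  have "elt (path_rev K x) \<otimes>\<^bsub>pi1 C v\<^esub> elt x = elt (path_rev K x \<bullet>\<^bsub>K\<^esub> x)"
    using assms e K elt_cat[of "path_rev K x" x v] by simp
  also have "\<dots> = elt (trivial_path K (path_end K x))"
    using assms e K cls_eq_iff homotopy_class_rev_cat(1)[OF C, of x]
    by (subst elt_eq_iff) simp_all
  also have "\<dots> = \<one>\<^bsub>pi1 C v\<^esub>" using e assms by (simp add: elt_trivial)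
  finally show ?thesis using assms e K by (intro inv_equality[symmetric]) simp_all
qed

lemma elt_surj:
  assumes "x \<in> carrier (pi1 C (p v))" "v \<in> verts K" "w \<in> verts K" "p v = p w"
  obtains \<sigma> where "S_path \<sigma>" "path_start \<sigma> = v" "path_end K \<sigma> = w" "elt \<sigma> = x"
proof -
  obtain \<gamma> where g: "x = homotopy_class C \<gamma>" "S_path \<gamma>" "path_start \<gamma> = p v" "path_end K \<gamma> = p v"
    using pi1_cases[OF assms(1)] by auto
  \<comment> \<open>The inverse of the construction of \<open>elt\<close>: the loop is conjugated
    back along \<open>\<alpha>\<close>, now with two possibly different ends.\<close>
  let ?s = "path_rev K (\<alpha> v) \<bullet>\<^bsub>K\<^esub> \<gamma> \<bullet>\<^bsub>K\<^esub> \<alpha> w"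
  note e = S_path_ends[OF g(2)]
  have s: "S_path ?s" "path_start ?s = v" "path_end K ?s = w" using assms g K e by simp_all
  have t: "normal_path K (trivial_path K (p w))" using assms K by simp
  have "normal_form K (\<alpha> w \<bullet>\<^bsub>K\<^esub> path_rev K (\<alpha> w)) = trivial_path K (p w)"
    using assms K t by (simp add: normal_form_def)
  then have "normal_form K (\<alpha> v \<bullet>\<^bsub>K\<^esub> ?s \<bullet>\<^bsub>K\<^esub> path_rev K (\<alpha> w)) = normal_form K \<gamma>"
    using assms g K e t by (simp add: normal_form_cat) (simp add: normal_form_def)
  then have "elt ?s = x" using s g assms K e by (simp add: collapse_elt_def cls_eq_iff)
  with s show ?thesis by (rule that)
qed

section \<open>The collapse as a graph of groups\<close>

lemma collapse_simps [simp]: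
  "verts K' = p ` verts K" "edges K' = edges K - snd S" "ebar K' = ebar K" "tm K' e = p (tm K e)"
  "vgrp K' v = pi1 C v" "egrp K' = egrp K" "iota K' e h = elt (tm K e, iota K e h, [])"
  "org K' e = p (org K e)"
  by (simp_all add: collapse_def org_def)

lemma group_pi1_C: "v \<in> verts K \<Longrightarrow> group (pi1 C v)"
  using group_pi1[OF C] by simp

lemma elt_vertex_mult:
  assumes "v \<in> verts K" "g \<in> carrier (vgrp K v)" "h \<in> carrier (vgrp K v)"
  shows "elt (v, g \<otimes>\<^bsub>vgrp K v\<^esub> h, []) = elt (v, g, []) \<otimes>\<^bsub>pi1 C u\<^esub> elt (v, h, [])"
  using elt_cat[of "(v, g, [])" "(v, h, [])" u] assms by (simp add: vertex_path_cat)

lemma elt_vertex_inj: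
  assumes "v \<in> verts K" "g \<in> carrier (vgrp K v)" "h \<in> carrier (vgrp K v)" "elt (v, g, []) = elt (v, h, [])"
  shows "g = h"
  using assms K by (simp add: elt_eq_iff)

text \<open>The substance is injectivity of the new \<open>iota\<close>: a vertex group embeds in
  the fundamental group of its component, because distinct elements are distinct normal
  forms.\<close>

lemma graph_of_groups_collapse: "graph_of_groups K'"
  unfolding graph_of_groups_def
proof (intro conjI ballI)
  fix e assume "e \<in> edges K'"
  then have e: "e \<in> edges K - snd S" by simp
  then have e1: "e \<in> edges K" by simp
  note e' = org_ebar[OF K e1]
  show "ebar K' e \<in> edges K'" using e S_edges e' by auto
  show "ebar K' e \<noteq> e" "ebar K' (ebar K' e) = e" "tm K' e \<in> verts K'" using e' by simp_all
  show "group (egrp K' e)" "egrp K' (ebar K' e) = egrp K' e"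
    using K e1 group_egrp[OF K e1] by simp_all
  interpret i: group_hom "egrp K e" "vgrp K (tm K e)" "iota K e" using K e1 by (rule group_hom_iota)
  have "elt (tm K e, iota K e (g \<otimes>\<^bsub>egrp K e\<^esub> h), []) =
      elt (tm K e, iota K e g, []) \<otimes>\<^bsub>pi1 C (p (tm K e))\<^esub> elt (tm K e, iota K e h, [])"
    if "g \<in> carrier (egrp K e)" "h \<in> carrier (egrp K e)" for g h
    using that e' by (simp add: elt_vertex_mult)
  moreover have "inj_on (iota K' e) (carrier (egrp K e))"
  proof (rule inj_onI)
    fix g h assume gh: "g \<in> carrier (egrp K e)" "h \<in> carrier (egrp K e)" "iota K' e g = iota K' e h"
    then have "iota K e g = iota K e h" using elt_vertex_inj[of "tm K e"] e' by simp
    then show "g = h" using gh iota_inj[OF K e1] by (auto dest: inj_onD)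
  qed
  ultimately show "iota K' e \<in> mon (egrp K' e) (vgrp K' (tm K' e))"
    using e' K e1 by (simp add: mon_def hom_def Pi_iff)
next
  fix v assume "v \<in> verts K'"
  then show "group (vgrp K' v)" by (auto intro: group_pi1_C)
qed

lemma vmap_collapse_map [simp]: "vmap (collapse_map K S p \<alpha>) = p"
  "vhom (collapse_map K S p \<alpha>) v g = elt (v, g, [])"
  by (simp_all add: collapse_map_def)

lemma path_morphism_collapse: "path_morphism K K' (collapse_map K S p \<alpha>)"
  unfolding path_morphism_def
proof (intro conjI ballI K graph_of_groups_collapse)
  fix v assume v: "v \<in> verts K"
  then show "vmap (collapse_map K S p \<alpha>) v \<in> verts K'" by simp
  show "vhom (collapse_map K S p \<alpha>) v \<in> hom (vgrp K v) (vgrp K' (vmap (collapse_map K S p \<alpha>) v))"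
    using v by (intro homI) (simp_all add: elt_vertex_mult)
next
  fix e assume e: "e \<in> edges K"
  note e' = org_ebar[OF K e]
  have pe: "p (tm K e) = p (org K e)" if "e \<in> snd S" using base_S_path[of "edge_path K e"] that by simp
  have "path_from_to K' (p (org K e)) (p (tm K e)) (emap (collapse_map K S p \<alpha>) e)"
  proof (cases "e \<in> snd S")
    case True
    then show ?thesis using e e' pe by (simp add: collapse_map_def path_from_to_def)
  next
    case False
    then show ?thesis using e e' is_path_edge_path[OF graph_of_groups_collapse, of e]
      by (simp add: collapse_map_def path_from_to_def)
  qed
  then show "path_from_to K' (vmap (collapse_map K S p \<alpha>) (org K e)) (vmap (collapse_map K S p \<alpha>) (tm K e))
      (emap (collapse_map K S p \<alpha>) e)" by simp
  show "emap (collapse_map K S p \<alpha>) (ebar K e) = path_rev K' (emap (collapse_map K S p \<alpha>) e)"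
  proof (cases "e \<in> snd S")
    case True
    then show ?thesis using e e' pe S_edges elt_rev[of "edge_path K e"] K
      by (simp add: collapse_map_def path_rev_edge_path)
  next
    case False
    then show ?thesis using e e' S_edges path_rev_edge_path[OF graph_of_groups_collapse, of e]
      by (simp add: collapse_map_def)
  qed
qed

lemmas c_is_path [simp] = path_image_is_path[OF path_morphism_collapse]
lemmas c_start [simp] = path_image_start[OF path_morphism_collapse, unfolded vmap_collapse_map]
lemmas c_end [simp] = path_image_end[OF path_morphism_collapse, unfolded vmap_collapse_map]
lemmas c_cat = path_image_cat[OF path_morphism_collapse]
lemmas c_rev = path_image_rev[OF path_morphism_collapse]
lemmas c_edge_path = path_image_edge_path[OF path_morphism_collapse]

text \<open>Along a path in \<open>S\<close> the collapse multiplies the classes of the letters, and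
  by \<open>elt_cat\<close> the product is the class of the whole path.\<close>

lemma c_S_path: "S_path \<gamma> \<Longrightarrow> c \<gamma> = (p (path_start \<gamma>), elt \<gamma>, [])"
proof -
  have "S_path (v, g, xs) \<Longrightarrow> c (v, g, xs) = (p v, elt (v, g, xs), [])" for v g xs
  proof (induction xs arbitrary: v g)
    case Nil
    then show ?case by simp
  next
    case (Cons q xs)
    obtain e a where q: "q = (e, a)" by (cases q)
    let ?x = "(tm K e, a, xs)" and ?v = "(v, g, [])"
    have ip: "is_path K (v, g, (e, a) # xs)" using Cons(2) q by (simp add: S_path_def)
    then have e: "e \<in> snd S" "org K e = v" "e \<in> edges K" and x: "S_path ?x" and v: "S_path ?v"
      using Cons(2) q by (auto simp: S_path_def)
    have pe: "p (tm K e) = p v" using base_S_path[of "edge_path K e"] e by simp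
    have ve: "S_path (?v \<bullet>\<^bsub>K\<^esub> edge_path K e)" using v e by simp
    have em: "emap (collapse_map K S p \<alpha>) e = (p v, elt (edge_path K e), [])"
      using e by (simp add: collapse_map_def)
    interpret group "pi1 C (p v)" using v by (intro group_pi1_C) simp
    have "elt (v, g, (e, a) # xs) = elt ?v \<otimes>\<^bsub>pi1 C (p v)\<^esub> elt (edge_path K e) \<otimes>\<^bsub>pi1 C (p v)\<^esub> elt ?x"
      using path_Cons_eq[OF K ip] elt_cat[of ?v "edge_path K e"] elt_cat[OF ve x] v e by simp
    moreover have "c (v, g, (e, a) # xs) = (p v, elt ?v, []) \<bullet>\<^bsub>K'\<^esub> ((p v, elt (edge_path K e), []) \<bullet>\<^bsub>K'\<^esub> (p v, elt ?x, []))"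
      using path_image_basic(2)[OF path_morphism_collapse ip] em Cons(1)[OF x] pe by simp
    moreover have "elt ?v \<in> carrier (pi1 C (p v))" "elt (edge_path K e) \<in> carrier (pi1 C (p v))" "elt ?x \<in> carrier (pi1 C (p v))"
      using v e x pe by simp_all
    ultimately show ?case using q by (simp add: vertex_path_cat m_assoc)
  qed
  then show "S_path \<gamma> \<Longrightarrow> c \<gamma> = (p (path_start \<gamma>), elt \<gamma>, [])" by (cases \<gamma>) auto
qed

lemma c_block:
  assumes "S_path \<sigma>" "e \<in> edges K - snd S" "path_end K \<sigma> = org K e" "is_path K \<gamma>" "path_start \<gamma> = tm K e"
  shows "c (\<sigma> \<bullet>\<^bsub>K\<^esub> edge_path K e \<bullet>\<^bsub>K\<^esub> \<gamma>) = (p (path_start \<sigma>), elt \<sigma>, (e, fst (snd (c \<gamma>))) # snd (snd (c \<gamma>)))"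
proof -
  note s = S_path_ends[OF assms(1)]
  have e: "e \<in> edges K" using assms by simp
  note e' = org_ebar[OF K e]
  have "path_start (c \<gamma>) = p (tm K e)" using assms by simp
  then obtain x zs where cg: "c \<gamma> = (p (tm K e), x, zs)" by (cases "c \<gamma>") auto
  have "is_path K' (c \<gamma>)" using assms by simp
  then have x: "x \<in> carrier (pi1 C (p (tm K e)))" using cg is_path_fst_group[of K' _ x zs] by simp
  interpret s: group "pi1 C (p (path_start \<sigma>))" using s by (intro group_pi1_C) simp
  interpret t: group "pi1 C (p (tm K e))" using e' by (intro group_pi1_C) simp
  have "c (\<sigma> \<bullet>\<^bsub>K\<^esub> edge_path K e \<bullet>\<^bsub>K\<^esub> \<gamma>) = (p (path_start \<sigma>), elt \<sigma>, []) \<bullet>\<^bsub>K'\<^esub> edge_path K' e \<bullet>\<^bsub>K'\<^esub> (p (tm K e), x, zs)"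
    using assms s K e by (simp add: c_cat c_S_path c_edge_path cg) (simp add: collapse_map_def)
  then show ?thesis using assms s x by (simp add: cg edge_path_def vertex_path_cat path_cat_Cons)
qed

text \<open>The induction suited to collapsing: a path is cut at its edges outside \<open>S\<close>.
  These edges survive, and each piece between them becomes a single vertex group element, as
  \<open>c_block\<close> says.\<close>

lemma block_induct [consumes 1, case_names S_path block]:
  assumes "is_path K \<gamma>"
    and "\<And>\<sigma>. S_path \<sigma> \<Longrightarrow> P \<sigma>"
    and "\<And>\<sigma> e \<gamma>. S_path \<sigma> \<Longrightarrow> e \<in> edges K - snd S \<Longrightarrow> path_end K \<sigma> = org K e \<Longrightarrow> is_path K \<gamma> \<Longrightarrow>
       path_start \<gamma> = tm K e \<Longrightarrow> P \<gamma> \<Longrightarrow> P (\<sigma> \<bullet>\<^bsub>K\<^esub> edge_path K e \<bullet>\<^bsub>K\<^esub> \<gamma>)"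
  shows "P \<gamma>"
proof -
  \<comment> \<open>The claim also carries a decomposition: a leading edge in \<open>S\<close> has
    to be merged with the first piece of the remaining path, and for this the piece must be
    known.\<close>
  have *: "is_path K (v, g, xs) \<Longrightarrow> P (v, g, xs) \<and> (S_path (v, g, xs) \<or> (\<exists>\<sigma> e \<gamma>. S_path \<sigma> \<and> e \<in> edges K - snd S \<and>
     path_end K \<sigma> = org K e \<and> is_path K \<gamma> \<and> path_start \<gamma> = tm K e \<and> P \<gamma> \<and> (v, g, xs) = \<sigma> \<bullet>\<^bsub>K\<^esub> edge_path K e \<bullet>\<^bsub>K\<^esub> \<gamma>))" for v g xs
  proof (induction xs arbitrary: v g)
    case Nil
    then show ?case using assms(2) by simp
  next
    case (Cons q xs)
    obtain e a where q: "q = (e, a)" by (cases q)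
    let ?x = "(tm K e, a, xs)" and ?v = "(v, g, [])"
    have ip: "is_path K (v, g, (e, a) # xs)" using Cons(2) q by simp
    have e: "e \<in> edges K" "org K e = v" and x: "is_path K ?x" and v: "S_path ?v" using ip by auto
    have eq: "(v, g, (e, a) # xs) = ?v \<bullet>\<^bsub>K\<^esub> edge_path K e \<bullet>\<^bsub>K\<^esub> ?x" by (rule path_Cons_eq[OF K ip])
    show ?case
    proof (cases "e \<in> snd S")
      case False
      have "P (?v \<bullet>\<^bsub>K\<^esub> edge_path K e \<bullet>\<^bsub>K\<^esub> ?x)"
        by (rule assms(3)[OF v _ _ x]) (use e False Cons(1)[OF x] in simp_all)
      moreover have "S_path ?v \<and> e \<in> edges K - snd S \<and> path_end K ?v = org K e \<and> is_path K ?x \<and> path_start ?x = tm K e \<and> P ?x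
        \<and> (v, g, q # xs) = ?v \<bullet>\<^bsub>K\<^esub> edge_path K e \<bullet>\<^bsub>K\<^esub> ?x"
        using e False x v Cons(1)[OF x] eq q by simp
      ultimately show ?thesis using eq q by (metis (no_types, lifting))
    next
      case True
      have ve: "S_path (?v \<bullet>\<^bsub>K\<^esub> edge_path K e)" "path_end K (?v \<bullet>\<^bsub>K\<^esub> edge_path K e) = tm K e" using v e True by simp_all
      from Cons(1)[OF x] consider "S_path ?x" | \<sigma> e' \<gamma> where "S_path \<sigma>" "e' \<in> edges K - snd S"
        "path_end K \<sigma> = org K e'" "is_path K \<gamma>" "path_start \<gamma> = tm K e'" "P \<gamma>" "?x = \<sigma> \<bullet>\<^bsub>K\<^esub> edge_path K e' \<bullet>\<^bsub>K\<^esub> \<gamma>" by blast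
      then show ?thesis
      proof cases
        case 1
        then have "S_path (v, g, (e, a) # xs)" unfolding eq using ve by (rule_tac S_path_intros(1)) simp_all
        then show ?thesis using assms(2) q by simp
      next
        case 2
        let ?s = "?v \<bullet>\<^bsub>K\<^esub> edge_path K e \<bullet>\<^bsub>K\<^esub> \<sigma>"
        have ps: "path_start \<sigma> = tm K e" using arg_cong[OF 2(7), of path_start] by simp
        have s: "S_path ?s" "path_end K ?s = org K e'" using ve 2 ps by simp_all
        have "(v, g, (e, a) # xs) = ?s \<bullet>\<^bsub>K\<^esub> edge_path K e' \<bullet>\<^bsub>K\<^esub> \<gamma>"
          unfolding eq 2(7) using K 2(2-5) ve ps S_path_is_path[OF ve(1)] S_path_is_path[OF 2(1)]
          by (simp add: path_cat_assoc)
        moreover have "P (?s \<bullet>\<^bsub>K\<^esub> edge_path K e' \<bullet>\<^bsub>K\<^esub> \<gamma>)" using assms(3)[OF s(1) 2(2) s(2) 2(4,5,6)] .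
        ultimately show ?thesis using s 2 q by (metis (no_types, lifting))
      qed
    qed
  qed
  show ?thesis using *[of "fst \<gamma>" "fst (snd \<gamma>)" "snd (snd \<gamma>)"] assms(1) by simp
qed

end

section \<open>Tightness of pieces of a path and of its collapse\<close>

lemma tight_start_irrelevant: "tight G (v, g, xs) \<longleftrightarrow> tight G (w, h, xs)"
  by (cases "(G, v, g, xs)" rule: tight.cases; cases "(G, w, h, xs)" rule: tight.cases) auto

lemma tight_append:
  assumes "tight G (v, g, xs @ (e, a) # zs)"
  shows "tight G (v, g, xs)" "tight G (tm G e, a, zs)"
    "zs = (e', b) # us \<Longrightarrow> \<not> (e' = ebar G e \<and> a \<in> iota G e ` carrier (egrp G e))"
proof -
  have "tight G (v, g, xs) \<and> tight G (tm G e, a, zs) \<and>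
    (\<forall>e' b us. zs = (e', b) # us \<longrightarrow> \<not> (e' = ebar G e \<and> a \<in> iota G e ` carrier (egrp G e)))"
    using assms
  proof (induction xs arbitrary: v g)
    case Nil
    then show ?case by (cases zs) auto
  next
    case (Cons q xs)
    obtain e1 a1 where q: "q = (e1, a1)" by (cases q)
    have t: "tight G (tm G e1, a1, xs @ (e, a) # zs)" using Cons(2) q by (cases xs) auto
    show ?case using Cons(1)[OF t] Cons(2) q by (cases xs) auto
  qed
  then show "tight G (v, g, xs)" "tight G (tm G e, a, zs)"
    "zs = (e', b) # us \<Longrightarrow> \<not> (e' = ebar G e \<and> a \<in> iota G e ` carrier (egrp G e))" by auto
qed

lemma cat_edge_cat:
  assumes G: "graph_of_groups G" and e: "e \<in> edges G" and z: "is_path G (tm G e, a, zs)"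
  shows "is_path G (v, g, xs) \<Longrightarrow> path_end G (v, g, xs) = org G e \<Longrightarrow>
    (v, g, xs) \<bullet>\<^bsub>G\<^esub> edge_path G e \<bullet>\<^bsub>G\<^esub> (tm G e, a, zs) = (v, g, xs @ (e, a) # zs)"
proof (induction xs arbitrary: v g)
  case Nil
  then show ?case using G org_ebar[OF G e] is_path_fst_group[OF z]
    by (simp add: edge_path_def path_cat_Cons vertex_path_cat)
next
  case (Cons q xs)
  obtain e1 a1 where q: "q = (e1, a1)" by (cases q)
  have x: "is_path G (tm G e1, a1, xs)" "path_end G (tm G e1, a1, xs) = org G e" using Cons(2,3) q by auto
  have "fst ((tm G e1, a1, xs) \<bullet>\<^bsub>G\<^esub> edge_path G e) = tm G e1" unfolding fst_cat by simp
  then have q': "(tm G e1, fst (snd ((tm G e1, a1, xs) \<bullet>\<^bsub>G\<^esub> edge_path G e)), snd (snd ((tm G e1, a1, xs) \<bullet>\<^bsub>G\<^esub> edge_path G e))) =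
      (tm G e1, a1, xs) \<bullet>\<^bsub>G\<^esub> edge_path G e" by (simp add: prod_eq_iff)
  show ?case unfolding q path_cat_Cons q' Cons(1)[OF x] by simp
qed

lemma tight_block:
  assumes G: "graph_of_groups G" and e: "e \<in> edges G" and \<gamma>: "is_path G \<gamma>" "path_start \<gamma> = tm G e"
    and \<sigma>: "is_path G \<sigma>" "path_end G \<sigma> = org G e" and t: "tight G (\<sigma> \<bullet>\<^bsub>G\<^esub> edge_path G e \<bullet>\<^bsub>G\<^esub> \<gamma>)"
  shows "tight G \<sigma>" "tight G \<gamma>"
    "snd (snd \<gamma>) = (e', b) # us \<Longrightarrow> \<not> (e' = ebar G e \<and> fst (snd \<gamma>) \<in> iota G e ` carrier (egrp G e))"
proof -
  obtain a zs where z: "\<gamma> = (tm G e, a, zs)" using \<gamma>(2) by (cases \<gamma>) auto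
  obtain v g xs where s: "\<sigma> = (v, g, xs)" by (cases \<sigma>) auto
  have "tight G (v, g, xs @ (e, a) # zs)" using t cat_edge_cat[OF G e, of a zs v g xs] \<gamma> \<sigma> z s by simp
  note tight_append[OF this]
  then show "tight G \<sigma>" "tight G \<gamma>"
    "snd (snd \<gamma>) = (e', b) # us \<Longrightarrow> \<not> (e' = ebar G e \<and> fst (snd \<gamma>) \<in> iota G e ` carrier (egrp G e))"
    using z s by auto
qed

lemma tight_vertex_cat:
  "tight G ((v, g, []) \<bullet>\<^bsub>G\<^esub> x) \<longleftrightarrow> tight G x"
  "tight G (x \<bullet>\<^bsub>G\<^esub> (w, h, [])) \<longleftrightarrow> tight G x"
proof -
  show "tight G ((v, g, []) \<bullet>\<^bsub>G\<^esub> x) \<longleftrightarrow> tight G x"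
    by (cases x) (simp add: vertex_path_cat tight_start_irrelevant[of G v _ _ "fst x" "fst (snd x)"])
  have "tight G ((v, g, xs) \<bullet>\<^bsub>G\<^esub> (w, h, [])) \<longleftrightarrow> tight G (v, g, xs)" for v g xs
  proof (induction xs arbitrary: v g)
    case Nil
    then show ?case by (simp add: vertex_path_cat)
  next
    case (Cons q xs)
    obtain e a where q: "q = (e, a)" by (cases q)
    show ?case
    proof (cases xs)
      case Nil
      then show ?thesis using q by (simp add: vertex_path_cat path_cat_Cons)
    next
      case (Cons r ys)
      obtain e' a' where r: "r = (e', a')" by (cases r)
      show ?thesis using Cons.IH[of "tm G e" a] q r Cons by (simp add: path_cat_Cons)
    qed
  qed
  then show "tight G (x \<bullet>\<^bsub>G\<^esub> (w, h, [])) \<longleftrightarrow> tight G x" by (cases x) auto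
qed

context collapse_data
begin

lemma block_cases [consumes 1, case_names S_path block]:
  assumes "is_path K \<gamma>"
  obtains "S_path \<gamma>" | \<sigma> e \<gamma>' where "S_path \<sigma>" "e \<in> edges K - snd S" "path_end K \<sigma> = org K e"
    "is_path K \<gamma>'" "path_start \<gamma>' = tm K e" "\<gamma> = \<sigma> \<bullet>\<^bsub>K\<^esub> edge_path K e \<bullet>\<^bsub>K\<^esub> \<gamma>'"
  using assms by (induction rule: block_induct) blast+

lemma path_edges_c: "is_path K \<gamma> \<Longrightarrow> path_edges (c \<gamma>) = filter (\<lambda>e. e \<notin> snd S) (path_edges \<gamma>)"
proof (induction rule: block_induct)
  case (S_path \<sigma>)
  then have "filter (\<lambda>e. e \<notin> snd S) (path_edges \<sigma>) = []" by (auto simp: S_path_def filter_empty_conv)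
  then show ?case using S_path by (simp add: c_S_path)
next
  case (block \<sigma> e \<gamma>)
  have "filter (\<lambda>e. e \<notin> snd S) (path_edges \<sigma>) = []" using block by (auto simp: S_path_def filter_empty_conv)
  then show ?case using block by (simp add: c_block[OF block(1-5)]) (simp add: path_edges_def)
qed

lemma elt_eq_vertex:
  assumes "S_path \<sigma>" "path_start \<sigma> = v" "path_end K \<sigma> = v" "g \<in> carrier (vgrp K v)"
    "elt \<sigma> = elt (v, g, [])"
  shows "normal_form K \<sigma> = (v, g, [])"
proof -
  have "v \<in> verts K" using S_path_ends[OF assms(1)] assms by simp
  then show ?thesis using elt_eq_iff[of \<sigma> "(v, g, [])"] assms K by simp
qed

text \<open>At a cancelling pair of the collapse, the piece in \<open>S\<close> between the two
  edges has an edgeless normal form. The piece is tight as part of a tight path, so it has no more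
  edges than its normal form. Hence it is itself the element \<open>iota K e h\<close>, and the pair
  cancels already in \<open>K\<close>.\<close>

lemma c_tight: "is_path K \<gamma> \<Longrightarrow> tight K \<gamma> \<Longrightarrow> tight K' (c \<gamma>)"
proof (induction rule: block_induct)
  case (S_path \<sigma>)
  then show ?case by (simp add: c_S_path)
next
  case (block \<sigma> e \<gamma>)
  have e: "e \<in> edges K" using block by simp
  note e' = org_ebar[OF K e]
  note t = tight_block[OF K e block(4,5) S_path_is_path[OF block(1)] block(3) block(7)]
  have "path_start (c \<gamma>) = p (tm K e)" using block by simp
  then obtain x zs where cg: "c \<gamma> = (p (tm K e), x, zs)" by (cases "c \<gamma>") auto
  have tc: "tight K' (p (tm K e), x, zs)" using block.IH[OF t(2)] cg by simp
  show ?case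
  proof (cases zs)
    case Nil
    then show ?thesis by (simp add: c_block[OF block(1-5)] cg)
  next
    case (Cons q us)
    obtain e1 b where q: "q = (e1, b)" by (cases q)
    have "\<not> (e1 = ebar K e \<and> x \<in> iota K' e ` carrier (egrp K e))"
    proof
      assume *: "e1 = ebar K e \<and> x \<in> iota K' e ` carrier (egrp K e)"
      then obtain h where h: "h \<in> carrier (egrp K e)" "x = elt (tm K e, iota K e h, [])" by auto
      from block(4) show False
      proof (cases rule: block_cases)
        case S_path
        then show False using cg Cons by (simp add: c_S_path)
      next
        case (block \<sigma>' e2 \<gamma>')
        have x: "x = elt \<sigma>'" "e2 = e1" "path_start \<sigma>' = tm K e"
          using c_block[OF block(1-5)] cg Cons q block(6) \<open>path_start \<gamma> = tm K e\<close> by simp_all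
        then have "path_end K \<sigma>' = tm K e" using block(3) * e' by simp
        then have n: "normal_form K \<sigma>' = (tm K e, iota K e h, [])"
          using elt_eq_vertex[OF block(1) x(3)] x h K e by simp
        have e2: "e2 \<in> edges K" using block by simp
        have s': "is_path K \<sigma>'" using block(1) by (rule S_path_is_path)
        have "tight K \<sigma>'"
          by (rule tight_block(1)[OF K e2 block(4,5) s' block(3)]) (use t(2) block(6) in simp)
        then have "path_edges \<sigma>' = []" using path_edges_normal_form[OF K s'] n by simp
        then have "\<sigma>' = (tm K e, iota K e h, [])" using normal_form_edgeless[OF K s'] n by simp
        moreover obtain a' zs' where "\<gamma>' = (tm K e2, a', zs')" using block(5) by (cases \<gamma>') auto
        ultimately have "\<gamma> = (tm K e, iota K e h, (e2, a') # zs')"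
          using block(3,4,6) cat_edge_cat[OF K e2, of a' zs' "tm K e" "iota K e h" "[]"] s' by simp
        then show False using t(3)[of e2 a' zs'] * h x by simp
      qed
    qed
    then show ?thesis using tc q Cons by (simp add: c_block[OF block(1-5)] cg)
  qed
qed

text \<open>An edge of \<open>S\<close> becomes a group element, and the relation is the slide in
  \<open>K\<close> read through \<open>elt\<close>. Any other edge slides in the collapse
  itself.\<close>

lemma c_edge_relation:
  assumes e: "e \<in> edges K" and h: "h \<in> carrier (egrp K e)"
  shows "normal_form K' (emap (collapse_map K S p \<alpha>) e \<bullet>\<^bsub>K'\<^esub> (p (tm K e), elt (tm K e, iota K e h, []), [])) =
    normal_form K' ((p (org K e), elt (org K e, iota K (ebar K e) h, []), []) \<bullet>\<^bsub>K'\<^esub> emap (collapse_map K S p \<alpha>) e)"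
proof (cases "e \<in> snd S")
  case False
  then show ?thesis
    using normal_form_slide[OF graph_of_groups_collapse, of e h] e h org_ebar[OF K e] by (simp add: collapse_map_def)
next
  case True
  note e' = org_ebar[OF K e]
  have v: "S_path (org K e, iota K (ebar K e) h, [])" "S_path (tm K e, iota K e h, [])"
    using K e e' h by simp_all
  have "elt (edge_path K e \<bullet>\<^bsub>K\<^esub> (tm K e, iota K e h, [])) = elt ((org K e, iota K (ebar K e) h, []) \<bullet>\<^bsub>K\<^esub> edge_path K e)"
    using normal_form_slide[OF K e h] True v by (subst elt_eq_iff) (simp_all del: S_path_intros(5))
  then have "elt (edge_path K e) \<otimes>\<^bsub>pi1 C (p (org K e))\<^esub> elt (tm K e, iota K e h, []) =
      elt (org K e, iota K (ebar K e) h, []) \<otimes>\<^bsub>pi1 C (p (org K e))\<^esub> elt (edge_path K e)"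
    using elt_cat[OF S_path_intros(3)[OF True] v(2), of "p (org K e)"] elt_cat[OF v(1) S_path_intros(3)[OF True], of "p (org K e)"]
    by simp
  then show ?thesis using True by (simp add: collapse_map_def vertex_path_cat)
qed

lemma c_homotopic:
  assumes "is_path K x" "is_path K y" "normal_form K x = normal_form K y"
  shows "normal_form K' (c x) = normal_form K' (c y)"
  by (rule path_image_homotopic[OF path_morphism_collapse])
    (use assms homotopic_iff[OF K assms(1,2)] c_edge_relation in simp_all)

text \<open>The collapse is injective on homotopy classes because it maps tight paths to tight paths.\<close>

lemma c_homotopic_iff:
  assumes x: "is_path K x" and y: "is_path K y" and e: "path_start x = path_start y" "path_end K x = path_end K y"
  shows "normal_form K' (c x) = normal_form K' (c y) \<longleftrightarrow> normal_form K x = normal_form K y"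
proof
  assume eq: "normal_form K' (c x) = normal_form K' (c y)"
  note K' = graph_of_groups_collapse
  let ?v = "path_start x"
  have v: "?v \<in> verts K" using is_path_start[OF x] .
  \<comment> \<open>A tight representative of the loop formed by \<open>x\<close> and the reverse of
    \<open>y\<close>; it has to be shown trivial, and \<open>c_tight\<close> applies to it.\<close>
  let ?z = "normal_form K (x \<bullet>\<^bsub>K\<^esub> path_rev K y)"
  have ip: "is_path K (x \<bullet>\<^bsub>K\<^esub> path_rev K y)" using K x y e by simp
  have z: "is_path K ?z" "path_start ?z = ?v" "path_end K ?z = ?v" "tight K ?z"
    using K ip x y e tight_normal_form_path[OF K ip] by (simp_all add: normal_path_is_path)
  have nz: "normal_form K ?z = ?z" using homotopic_props(5)[OF K homotopic_normal_form[OF K ip] ip] .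
  have "normal_form K' (c ?z) = normal_form K' (c (x \<bullet>\<^bsub>K\<^esub> path_rev K y))"
    using c_homotopic[OF z(1) ip nz] .
  also have "\<dots> = normal_form K' (c x \<bullet>\<^bsub>K'\<^esub> path_rev K' (c y))" using K x y e by (simp add: c_cat c_rev)
  also have "\<dots> = normal_form K' (c y \<bullet>\<^bsub>K'\<^esub> path_rev K' (c y))"
    by (rule normal_form_cat_cong[OF K']) (use K K' x y e eq in simp_all)
  also have "\<dots> = trivial_path K' (p ?v)" using K' y e v by (simp add: normal_form_def del: collapse_simps) simp
  finally have n: "normal_form K' (c ?z) = trivial_path K' (p ?v)" .
  \<comment> \<open>The collapse of \<open>?z\<close> is tight and homotopic to a constant, so it
    crosses no edge. Thus \<open>?z\<close> lies in \<open>S\<close>, where injectivity of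
    \<open>elt\<close> finishes.\<close>
  then have "path_edges (c ?z) = []" using path_edges_normal_form[OF K' c_is_path[OF z(1)] c_tight[OF z(1,4)]] by simp
  then have zS: "S_path ?z" using z path_edges_c[OF z(1)] by (auto simp: S_path_def filter_empty_conv)
  then have "elt ?z = elt (trivial_path K ?v)"
    using n z v c_S_path[OF zS] K' by (simp add: elt_trivial) (simp add: trivial_path_def pi1_simps)
  then have zt: "normal_form K ?z = normal_form K (trivial_path K ?v)"
    using elt_eq_iff[OF zS S_path_intros(4)[OF v]] z by simp
  have "normal_form K x = normal_form K (x \<bullet>\<^bsub>K\<^esub> path_rev K y \<bullet>\<^bsub>K\<^esub> y)"
    using K x y e by (simp add: normal_form_cat) (simp add: normal_form_def)
  also have "\<dots> = normal_form K (trivial_path K ?v \<bullet>\<^bsub>K\<^esub> y)"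
    by (rule normal_form_cat_cong[OF K ip]) (use K v y zt nz e in simp_all)
  also have "\<dots> = normal_form K y" using K y e by (simp add: trivial_cat)
  finally show "normal_form K x = normal_form K y" .
qed (rule c_homotopic[OF x y])

text \<open>Every path of the collapse lifts on the nose, with prescribed endpoints over its ends;
  no homotopy is involved.\<close>

lemma c_surj:
  assumes "is_path K' \<xi>" "path_start \<xi> = p v" "path_end K' \<xi> = p w" "v \<in> verts K" "w \<in> verts K"
  obtains \<gamma> where "is_path K \<gamma>" "path_start \<gamma> = v" "path_end K \<gamma> = w" "c \<gamma> = \<xi>"
proof -
  have "is_path K' (p v, x, zs) \<Longrightarrow> path_end K' (p v, x, zs) = p w \<Longrightarrow> v \<in> verts K \<Longrightarrow>
    \<exists>\<gamma>. is_path K \<gamma> \<and> path_start \<gamma> = v \<and> path_end K \<gamma> = w \<and> c \<gamma> = (p v, x, zs)" for v x zs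
  proof (induction zs arbitrary: v x)
    case Nil
    then obtain \<sigma> where s: "S_path \<sigma>" "path_start \<sigma> = v" "path_end K \<sigma> = w" "elt \<sigma> = x"
      using elt_surj[of x v w] assms(5) by auto
    then show ?case using S_path_is_path[OF s(1)] c_S_path[OF s(1)] by (intro exI[of _ \<sigma>]) simp
  next
    case (Cons q zs)
    obtain e y where q: "q = (e, y)" by (cases q)
    have e: "e \<in> edges K - snd S" "p (org K e) = p v" "x \<in> carrier (pi1 C (p v))" 
      and z: "is_path K' (p (tm K e), y, zs)" "path_end K' (p (tm K e), y, zs) = p w"
      using Cons(2,3) q by simp_all
    have e1: "e \<in> edges K" using e by simp
    note e' = org_ebar[OF K e1]
    \<comment> \<open>Consecutive edges of the collapse need not meet in \<open>K\<close>; only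
      their base vertices agree. A path in \<open>S\<close> with the prescribed class joins
      them.\<close>
    obtain \<sigma> where s: "S_path \<sigma>" "path_start \<sigma> = v" "path_end K \<sigma> = org K e" "elt \<sigma> = x"
      using elt_surj[OF e(3) Cons(4) e'(2)] e(2) by metis
    obtain \<gamma> where g: "is_path K \<gamma>" "path_start \<gamma> = tm K e" "path_end K \<gamma> = w" "c \<gamma> = (p (tm K e), y, zs)"
      using Cons(1)[OF z e'(3)] by blast
    have "c (\<sigma> \<bullet>\<^bsub>K\<^esub> edge_path K e \<bullet>\<^bsub>K\<^esub> \<gamma>) = (p v, x, q # zs)"
      using c_block[OF s(1) e(1) s(3) g(1,2)] s g q by simp
    moreover have "is_path K (\<sigma> \<bullet>\<^bsub>K\<^esub> edge_path K e \<bullet>\<^bsub>K\<^esub> \<gamma>)" "path_end K (\<sigma> \<bullet>\<^bsub>K\<^esub> edge_path K e \<bullet>\<^bsub>K\<^esub> \<gamma>) = w"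
      using K e1 s g S_path_is_path[OF s(1)] by simp_all
    ultimately show ?case using s by (intro exI[of _ "\<sigma> \<bullet>\<^bsub>K\<^esub> edge_path K e \<bullet>\<^bsub>K\<^esub> \<gamma>"]) simp
  qed
  from this[of v "fst (snd \<xi>)" "snd (snd \<xi>)"] show thesis using assms that by (cases \<xi>) auto
qed

end

subsection \<open>The induced map\<close>

text \<open>\<open>f_S\<close> lets \<open>f\<close> descend to the collapse. \<open>f_not_S\<close>
  ensures that the descended map collapses no edge.\<close>

locale collapse_map_data = collapse_data K S p \<alpha>
  for K :: "('v, 'e, 'g, 'h) gog" and S p \<alpha> +
  fixes f :: "('v, 'e, 'g, 'v, 'e, 'g) gmap"
  assumes f: "edge_path_map K f"
    and f_S: "e \<in> snd S \<Longrightarrow> set (path_edges (emap f e)) \<subseteq> snd S"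
    and f_not_S: "e \<in> edges K - snd S \<Longrightarrow> \<not> set (path_edges (emap f e)) \<subseteq> snd S"
begin

abbreviation "fi \<equiv> path_image K K f"
abbreviation "f' \<equiv> induced_map K S p \<alpha> f"
abbreviation "f'i \<equiv> path_image K' K' f'"

text \<open>The defect of commutation at \<open>v\<close>: the class of the image of the connecting
  path \<open>\<alpha> v\<close>, which need not be the connecting path of
  \<open>vmap f v\<close>.\<close>

definition \<eta> :: "'v \<Rightarrow> ('v, 'e, 'g) path set" where
  "\<eta> v = elt (fi (\<alpha> v))"

lemmas K' = graph_of_groups_collapse
lemmas f_pm = edge_path_mapD(2)[OF f]
lemmas fi_path [simp] = path_image_is_path[OF f_pm] path_image_start[OF f_pm] path_image_end[OF f_pm]
lemmas f_vertex = path_morphism_vertex[OF f_pm]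
lemmas f_edge = path_morphism_edge[OF f_pm]
lemmas fi_cat = path_image_cat[OF f_pm]
lemmas fi_rev = path_image_rev[OF f_pm]

lemma fi_S_path [simp]: "S_path \<gamma> \<Longrightarrow> S_path (fi \<gamma>)"
proof -
  have "S_path (v, g, xs) \<Longrightarrow> set (path_edges (fi (v, g, xs))) \<subseteq> snd S" for v g xs
  proof (induction xs arbitrary: v g)
    case (Cons q xs)
    obtain e a where q: "q = (e, a)" by (cases q)
    have "is_path K (v, g, (e, a) # xs)" "e \<in> snd S" "S_path (tm K e, a, xs)"
      using Cons(2) q by (auto simp: S_path_def)
    then show ?case using path_image_basic(2)[OF f_pm, of v g e a xs] Cons(1) f_S q by simp
  qed simp
  then show "S_path \<gamma> \<Longrightarrow> S_path (fi \<gamma>)" by (cases \<gamma>) (auto simp: S_path_def)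
qed

lemma p_vmap [simp]: "v \<in> verts K \<Longrightarrow> p (vmap f (p v)) = p (vmap f v)"
  using base_S_path[OF fi_S_path[OF base_path(1)], of v] by simp

lemma induced_map_simps [simp]:
  "vmap f' v = p (vmap f v)"
  "emap f' e = c (fi (\<alpha> (org K e) \<bullet>\<^bsub>K\<^esub> edge_path K e \<bullet>\<^bsub>K\<^esub> path_rev K (\<alpha> (tm K e))))"
  by (simp_all add: induced_map_def)

lemma vmap_verts [simp]: "v \<in> verts K \<Longrightarrow> vmap f v \<in> verts K"
  by (rule f_vertex)

lemma \<eta>_carrier [simp]: "v \<in> verts K \<Longrightarrow> u = p (vmap f v) \<Longrightarrow> \<eta> v \<in> carrier (pi1 C u)"
  by (simp add: \<eta>_def)

lemma \<eta>_base: "v \<in> verts K \<Longrightarrow> p v = v \<Longrightarrow> \<eta> v = \<one>\<^bsub>pi1 C (p (vmap f v))\<^esub>"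
  using base_path(4)[of v] path_image_trivial[OF f_pm, of v] by (simp add: \<eta>_def elt_trivial)

text \<open>\<open>induced_map\<close> takes a union over all representatives of a class. Since
  \<open>f\<close> respects homotopy, all members of the union coincide.\<close>

lemma vhom_induced:
  assumes \<gamma>: "S_path \<gamma>"
  shows "vhom f' u (homotopy_class C \<gamma>) = elt (fi \<gamma>)"
proof -
  have "elt (fi \<gamma>') = elt (fi \<gamma>)" if "\<gamma>' \<in> homotopy_class C \<gamma>" for \<gamma>'
  proof -
    have *: "S_path \<gamma>'" "path_start \<gamma>' = path_start \<gamma>" "path_end K \<gamma>' = path_end K \<gamma>" "normal_form K \<gamma>' = normal_form K \<gamma>"
      using in_homotopy_class[OF C _ that] \<gamma> by simp_all
    have ip: "is_path K \<gamma>" "is_path K \<gamma>'" using \<gamma> * by (simp_all add: S_path_is_path)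
    show ?thesis using edge_path_map_homotopic[OF f ip(2,1) *(4)] * \<gamma> ip by (subst elt_eq_iff) simp_all
  qed
  then have "vhom f' u (homotopy_class C \<gamma>) = (\<Union>\<gamma>'\<in>homotopy_class C \<gamma>. elt (fi \<gamma>))"
    unfolding induced_map_def gmap.simps by (rule SUP_cong[OF refl])
  moreover have "homotopy_class C \<gamma> \<noteq> {}" using homotopy_class_self by fast
  ultimately show ?thesis by simp
qed

text \<open>By definition \<open>elt \<gamma>\<close> is the class of \<open>\<gamma>\<close> framed
  by connecting paths. Applying \<open>f\<close> turns the frame into \<open>\<eta>\<close> at the
  two ends.\<close>

lemma vhom_induced_elt:
  assumes \<gamma>: "S_path \<gamma>"
  shows "vhom f' u (elt \<gamma>) = \<eta> (path_start \<gamma>) \<otimes>\<^bsub>pi1 C w\<^esub> elt (fi \<gamma>) \<otimes>\<^bsub>pi1 C w\<^esub> inv\<^bsub>pi1 C (p (vmap f (path_end K \<gamma>)))\<^esub> \<eta> (path_end K \<gamma>)"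
proof -
  note e = S_path_ends[OF \<gamma>]
  let ?A = "\<alpha> (path_start \<gamma>)" and ?B = "\<alpha> (path_end K \<gamma>)"
  have ip: "is_path K ?A" "is_path K ?B" "is_path K \<gamma>" using e by simp_all
  have "vhom f' u (elt \<gamma>) = elt (fi (?A \<bullet>\<^bsub>K\<^esub> \<gamma> \<bullet>\<^bsub>K\<^esub> path_rev K ?B))"
    unfolding collapse_elt_def[of K S \<alpha> \<gamma>] using \<gamma> e by (intro vhom_induced) simp
  also have "fi (?A \<bullet>\<^bsub>K\<^esub> \<gamma> \<bullet>\<^bsub>K\<^esub> path_rev K ?B) = fi ?A \<bullet>\<^bsub>K\<^esub> fi \<gamma> \<bullet>\<^bsub>K\<^esub> path_rev K (fi ?B)"
    using K ip e by (simp add: fi_cat fi_rev)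
  also have "elt \<dots> = elt (fi ?A) \<otimes>\<^bsub>pi1 C w\<^esub> elt (fi \<gamma>) \<otimes>\<^bsub>pi1 C w\<^esub> elt (path_rev K (fi ?B))"
    using \<gamma> e ip elt_cat[of "fi ?A \<bullet>\<^bsub>K\<^esub> fi \<gamma>" "path_rev K (fi ?B)" w] elt_cat[of "fi ?A" "fi \<gamma>" w] by simp
  also have "elt (path_rev K (fi ?B)) = inv\<^bsub>pi1 C (p (vmap f (path_end K \<gamma>)))\<^esub> elt (fi ?B)"
    by (rule elt_rev) (use p_vmap[OF e(3)] e(3) in simp_all)
  finally show ?thesis by (simp add: \<eta>_def)
qed

lemma c_fi_base: "v \<in> verts K \<Longrightarrow> c (fi (\<alpha> v)) = (p (vmap f v), \<eta> v, [])"
  by (simp add: c_S_path \<eta>_def)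

lemma c_fi_base_rev: "v \<in> verts K \<Longrightarrow>
    c (fi (path_rev K (\<alpha> v))) = (p (vmap f v), inv\<^bsub>pi1 C (p (vmap f v))\<^esub> \<eta> v, [])"
  by (simp add: fi_rev c_rev c_fi_base)

lemma \<eta>_path: "v \<in> verts K \<Longrightarrow> is_path K' (p (vmap f v), \<eta> v, [])"
  "v \<in> verts K \<Longrightarrow> is_path K' (p (vmap f v), inv\<^bsub>pi1 C (p (vmap f v))\<^esub> \<eta> v, [])"
  using vgrp_simps(3)[OF K', of "p (vmap f v)" "\<eta> v"] by simp_all

lemma emap_induced:
  assumes "e \<in> edges K"
  shows "emap f' e = (p (vmap f (org K e)), \<eta> (org K e), []) \<bullet>\<^bsub>K'\<^esub> c (emap f e) \<bullet>\<^bsub>K'\<^esub>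
    (p (vmap f (tm K e)), inv\<^bsub>pi1 C (p (vmap f (tm K e)))\<^esub> \<eta> (tm K e), [])"
proof -
  note e' = org_ebar[OF K assms] and E = f_edge[OF assms]
  have "emap f' e = c (fi (\<alpha> (org K e))) \<bullet>\<^bsub>K'\<^esub> c (emap f e) \<bullet>\<^bsub>K'\<^esub> c (fi (path_rev K (\<alpha> (tm K e))))"
    using assms e' E K by (simp add: fi_cat c_cat path_image_edge_path[OF f_pm])
  then show ?thesis using e' by (simp only: c_fi_base c_fi_base_rev)
qed

lemma path_morphism_induced: "path_morphism K' K' f'"
  unfolding path_morphism_def
proof (intro conjI ballI K')
  fix v assume "v \<in> verts K'"
  then have v: "v \<in> verts K" "p v = v" by auto
  then show "vmap f' v \<in> verts K'" by simp
  have "vhom f' v \<in> hom (pi1 C v) (pi1 C (p (vmap f v)))"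
  proof (rule homI)
    fix x y assume "x \<in> carrier (pi1 C v)" "y \<in> carrier (pi1 C v)"
    then obtain \<gamma> \<delta> where g: "x = homotopy_class C \<gamma>" "S_path \<gamma>" "path_start \<gamma> = v" "path_end K \<gamma> = v"
       "y = homotopy_class C \<delta>" "S_path \<delta>" "path_start \<delta> = v" "path_end K \<delta> = v"
      by (elim pi1_cases) simp
    then have ip: "is_path K \<gamma>" "is_path K \<delta>" by (simp_all add: S_path_is_path)
    show "vhom f' v x \<in> carrier (pi1 C (p (vmap f v)))" using g ip by (simp add: vhom_induced)
    show "vhom f' v (x \<otimes>\<^bsub>pi1 C v\<^esub> y) = vhom f' v x \<otimes>\<^bsub>pi1 C (p (vmap f v))\<^esub> vhom f' v y"
      using g ip by (simp add: vhom_induced cls_mult fi_cat elt_cat[of _ _ "p (vmap f v)"])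
  qed
  then show "vhom f' v \<in> hom (vgrp K' v) (vgrp K' (vmap f' v))" by simp
next
  fix e assume "e \<in> edges K'"
  then have e: "e \<in> edges K" by simp
  note e' = org_ebar[OF K e]
  show "path_from_to K' (vmap f' (org K' e)) (vmap f' (tm K' e)) (emap f' e)"
    using K e e' by (simp add: path_from_to_def)
  have "path_rev K (\<alpha> (org K e) \<bullet>\<^bsub>K\<^esub> edge_path K e \<bullet>\<^bsub>K\<^esub> path_rev K (\<alpha> (tm K e))) =
     \<alpha> (tm K e) \<bullet>\<^bsub>K\<^esub> edge_path K (ebar K e) \<bullet>\<^bsub>K\<^esub> path_rev K (\<alpha> (org K e))"
    using K e e' by (simp add: path_rev_cat path_rev_edge_path path_cat_assoc)
  then have "emap f' (ebar K e) = c (fi (path_rev K (\<alpha> (org K e) \<bullet>\<^bsub>K\<^esub> edge_path K e \<bullet>\<^bsub>K\<^esub> path_rev K (\<alpha> (tm K e)))))"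
    using e' by simp
  also have "\<dots> = path_rev K' (emap f' e)" unfolding induced_map_simps
    using K e e' by (simp add: fi_rev c_rev)
  finally show "emap f' (ebar K' e) = path_rev K' (emap f' e)" by simp
qed

lemmas f'i_cat = path_image_cat[OF path_morphism_induced]

text \<open>The formula is multiplicative: at the junction of two paths the factors
  \<open>\<eta>\<close> and its inverse meet and cancel. It therefore suffices to check paths in
  \<open>S\<close> and single edges outside \<open>S\<close>. It is an equality of paths, not only
  of homotopy classes.\<close>

lemma factorization:
  assumes "is_path K \<gamma>"
  shows "f'i (c \<gamma>) = (p (vmap f (path_start \<gamma>)), \<eta> (path_start \<gamma>), []) \<bullet>\<^bsub>K'\<^esub> c (fi \<gamma>) \<bullet>\<^bsub>K'\<^esub>
    (p (vmap f (path_end K \<gamma>)), inv\<^bsub>pi1 C (p (vmap f (path_end K \<gamma>)))\<^esub> \<eta> (path_end K \<gamma>), [])"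
    (is "?P \<gamma>")
proof -
  have cat: "?P (x \<bullet>\<^bsub>K\<^esub> y)" if x: "?P x" "is_path K x" and y: "?P y" "is_path K y" "path_start y = path_end K x" for x y
  proof -
    let ?u = "path_end K x"
    let ?q = "(p (vmap f ?u), inv\<^bsub>pi1 C (p (vmap f ?u))\<^esub> \<eta> ?u, [])" and ?r = "(p (vmap f ?u), \<eta> ?u, [])"
    have u: "?u \<in> verts K" using x by simp
    have s: "path_start x \<in> verts K" "path_end K y \<in> verts K" using x y is_path_start[of K x] by simp_all
    note * = \<eta>_path[OF u] \<eta>_path[OF s(1)] \<eta>_path[OF s(2)]
    \<comment> \<open>The cancellation at the junction: the end correction of the first path
      followed by the start correction of the second is trivial.\<close>
    have "?q \<bullet>\<^bsub>K'\<^esub> ?r = trivial_path K' (p (vmap f ?u))"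
      using vgrp_simps(8)[OF K', of "p (vmap f ?u)" "\<eta> ?u"] u by (simp add: trivial_path_def vertex_path_cat)
    then have "?q \<bullet>\<^bsub>K'\<^esub> (?r \<bullet>\<^bsub>K'\<^esub> z) = z" if "is_path K' z" "path_start z = p (vmap f ?u)" for z
      using that * K' path_cat_assoc[OF K' *(2) *(1) that(1)] by (simp add: trivial_cat del: is_path.simps)
    then have **: "?q \<bullet>\<^bsub>K'\<^esub> (?r \<bullet>\<^bsub>K'\<^esub> (c (fi y) \<bullet>\<^bsub>K'\<^esub> z)) = c (fi y) \<bullet>\<^bsub>K'\<^esub> z"
      if "is_path K' z" "path_start z = p (vmap f (path_end K y))" for z
      using that K' y by simp
    show ?thesis using x y K K' * s
      by (simp add: c_cat fi_cat f'i_cat path_cat_assoc ** del: is_path.simps induced_map_simps)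
  qed
  have S: "?P \<sigma>" if s: "S_path \<sigma>" for \<sigma>
  proof -
    note e = S_path_ends[OF s]
    have pe: "p (vmap f (path_end K \<sigma>)) = p (vmap f (path_start \<sigma>))"
      using S_path_ends(4)[OF fi_S_path[OF s]] e by simp
    have "f'i (c \<sigma>) = (p (vmap f (path_start \<sigma>)), vhom f' (p (path_start \<sigma>)) (elt \<sigma>), [])"
      using e s by (simp add: c_S_path)
    then show ?thesis using e s pe vhom_induced_elt[OF s, of _ "p (vmap f (path_start \<sigma>))"]
      by (simp add: c_S_path vertex_path_cat)
  qed
  show ?thesis using assms
  proof (induction rule: block_induct)
    case (S_path \<sigma>)
    then show ?case by (rule S)
  next
    case (block \<sigma> e \<gamma>)
    have e: "e \<in> edges K" "e \<in> edges K'" using block by simp_all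
    have "f'i (c (edge_path K e)) = emap f' e"
      using e block(2) path_image_edge_path[OF path_morphism_induced e(2)]
      by (simp add: c_edge_path del: induced_map_simps) (simp add: collapse_map_def del: induced_map_simps)
    then have "?P (edge_path K e)" using e emap_induced[OF e(1)] by (simp add: path_image_edge_path[OF f_pm] del: induced_map_simps)
    then have "?P (\<sigma> \<bullet>\<^bsub>K\<^esub> edge_path K e)"
      using e block K S[OF block(1)] by (rule_tac cat) (simp_all add: S_path_is_path del: induced_map_simps)
    then show ?case using e block K by (rule_tac cat) (simp_all add: S_path_is_path del: induced_map_simps)
  qed
qed

theorem factors: "factors_through_collapse K S p \<alpha> f f'"
  unfolding factors_through_collapse_def Let_def
proof (intro conjI ballI exI[of _ \<eta>] allI impI)
  fix v w \<gamma> assume "path_from_to K v w \<gamma>"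
  then show "f'i (c \<gamma>) = (p (vmap f v), \<eta> v, []) \<bullet>\<^bsub>K'\<^esub> c (fi \<gamma>) \<bullet>\<^bsub>K'\<^esub>
      (p (vmap f w), inv\<^bsub>vgrp K' (p (vmap f w))\<^esub> \<eta> w, [])"
    using factorization[of \<gamma>] by (auto simp: path_from_to_def)
qed (simp_all add: \<eta>_base)

text \<open>Sliding is transported letter by letter. An edge outside \<open>S\<close> keeps its
  homomorphism \<open>\<phi>\<close>. An edge of \<open>S\<close> has become a group element, across
  which sliding is an equation in the fundamental group of the component; its \<open>\<phi>\<close>
  drops out of the data.\<close>

lemma slides_collapse:
  shows "is_path K (v, a, xs) \<Longrightarrow> slides K E (v, a, xs) \<theta> \<xi> \<Longrightarrow>
    (\<And>h. h \<in> carrier E \<Longrightarrow> \<theta> h \<in> carrier (vgrp K v)) \<Longrightarrow>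
    (\<And>h. h \<in> carrier E \<Longrightarrow> \<xi> h \<in> carrier (vgrp K (path_end K (v, a, xs)))) \<Longrightarrow>
    slides K' E (c (v, a, xs)) (\<lambda>h. elt (v, \<theta> h, [])) (\<lambda>h. elt (path_end K (v, a, xs), \<xi> h, []))"
proof (induction xs arbitrary: v a \<theta>)
  case Nil
  then show ?case by (simp add: elt_vertex_mult[symmetric])
next
  case (Cons q xs)
  obtain e b where q: "q = (e, b)" by (cases q)
  let ?x = "(tm K e, b, xs)"
  have ip: "is_path K (v, a, (e, b) # xs)" using Cons(2) q by simp
  then have e: "e \<in> edges K" "org K e = v" "v \<in> verts K" "a \<in> carrier (vgrp K v)" and x: "is_path K ?x" by auto
  note e' = org_ebar[OF K e(1)]
  obtain \<phi> where \<phi>: "\<phi> \<in> hom E (egrp K e)" "\<And>h. h \<in> carrier E \<Longrightarrow> \<theta> h \<otimes>\<^bsub>vgrp K v\<^esub> a = a \<otimes>\<^bsub>vgrp K v\<^esub> iota K (ebar K e) (\<phi> h)"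
    and s: "slides K E ?x (\<lambda>h. iota K e (\<phi> h)) \<xi>" using Cons(3) q by auto
  have h: "\<phi> h \<in> carrier (egrp K e)" "iota K e (\<phi> h) \<in> carrier (vgrp K (tm K e))" "iota K (ebar K e) (\<phi> h) \<in> carrier (vgrp K v)"
    if "h \<in> carrier E" for h
    using \<phi>(1) that K e(1) iota_ebar_closed[OF K e(1), of "\<phi> h"] e(2) by (simp_all add: hom_def Pi_iff)
  let ?\<theta> = "\<lambda>h. elt (v, \<theta> h, [])" and ?o = "\<lambda>h. elt (org K e, iota K (ebar K e) (\<phi> h), [])" and
    ?t = "\<lambda>h. elt (tm K e, iota K e (\<phi> h), [])" and ?\<xi> = "\<lambda>h. elt (path_end K ?x, \<xi> h, [])"
  have 1: "slides K' E (c ?x) ?t ?\<xi>"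
    using Cons(1)[OF x s] h(2) Cons(5) q by simp
  have ee: "is_path K' (emap (collapse_map K S p \<alpha>) e)" "path_start (emap (collapse_map K S p \<alpha>) e) = p v"
    "path_end K' (emap (collapse_map K S p \<alpha>) e) = p (tm K e)"
    using path_morphism_edge[OF path_morphism_collapse e(1)] e(2) by simp_all
  have 2: "slides K' E (emap (collapse_map K S p \<alpha>) e) ?o ?t"
  proof (cases "e \<in> snd S")
    case True
    have pe: "p (tm K e) = p (org K e)" using base_S_path[of "edge_path K e"] True by simp
    interpret group "pi1 C (p (org K e))" using e' by (intro group_pi1_C) simp
    have "?o h \<otimes>\<^bsub>pi1 C (p (org K e))\<^esub> elt (edge_path K e) = elt (edge_path K e) \<otimes>\<^bsub>pi1 C (p (org K e))\<^esub> ?t h"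
      if "h \<in> carrier E" for h
      using c_edge_relation[OF e(1) h(1)[OF that]] True pe h[OF that] e e' K'
        m_closed[of "?o h" "elt (edge_path K e)"] m_closed[of "elt (edge_path K e)" "?t h"]
      by (simp add: collapse_map_def vertex_path_cat)
    then show ?thesis using True by (simp add: collapse_map_def)
  next
    case False
    have "?o h \<otimes>\<^bsub>pi1 C (p (org K e))\<^esub> \<one>\<^bsub>pi1 C (p (org K e))\<^esub> = \<one>\<^bsub>pi1 C (p (org K e))\<^esub> \<otimes>\<^bsub>pi1 C (p (org K e))\<^esub> ?o h"
      "?t h \<otimes>\<^bsub>pi1 C (p (tm K e))\<^esub> \<one>\<^bsub>pi1 C (p (tm K e))\<^esub> = \<one>\<^bsub>pi1 C (p (tm K e))\<^esub> \<otimes>\<^bsub>pi1 C (p (tm K e))\<^esub> ?t h"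
      if "h \<in> carrier E" for h
      using vgrp_simps(5,6)[OF K', of "p (org K e)" "?o h"] vgrp_simps(5,6)[OF K', of "p (tm K e)" "?t h"]
        h[OF that] e e' by simp_all
    then show ?thesis using False \<phi>(1) e' by (auto simp: collapse_map_def edge_path_def intro!: bexI[of _ \<phi>])
  qed
  have 3: "slides K' E (p v, elt (v, a, []), []) ?\<theta> ?o"
    using \<phi>(2) e h Cons(4) by (auto simp: elt_vertex_mult[symmetric])
  have v: "is_path K' (p v, elt (v, a, []), [])" using e by simp
  have c1: "?\<theta> h \<in> carrier (vgrp K' (p v))" "?o h \<in> carrier (vgrp K' (p v))" "?t h \<in> carrier (vgrp K' (p (tm K e)))"
    "?\<xi> h \<in> carrier (vgrp K' (p (path_end K ?x)))" if "h \<in> carrier E" for h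
    using h[OF that] e e' Cons(4,5) that q x by simp_all
  have "slides K' E (emap (collapse_map K S p \<alpha>) e \<bullet>\<^bsub>K'\<^esub> c ?x) ?o ?\<xi>"
    by (rule slides_cat[OF K' ee(1) _ _ 2 1]) (use ee x c1 in simp_all)
  then have "slides K' E ((p v, elt (v, a, []), []) \<bullet>\<^bsub>K'\<^esub> (emap (collapse_map K S p \<alpha>) e \<bullet>\<^bsub>K'\<^esub> c ?x)) ?\<theta> ?\<xi>"
    by (rule_tac slides_cat[OF K' v _ _ 3]) (use K' ee x c1 in simp_all)
  then show ?case using path_image_basic(2)[OF path_morphism_collapse ip] q by simp
qed

text \<open>The corrections by \<open>\<eta>\<close> are edgeless, so they affect neither tightness
  nor the edges crossed. The subdivision condition is checked through \<open>slides\<close>, which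
  can be concatenated, instead of through the elements \<open>\<delta>\<close>.\<close>

lemma edge_path_map_induced: "edge_path_map K' f'"
proof -
  have edge: "path_edges (emap f' e) \<noteq> [] \<and> tight K' (emap f' e) \<and> morphism_on_subdivision K' f' e"
    if "e \<in> edges K'" for e
  proof -
    have e: "e \<in> edges K - snd S" "e \<in> edges K" using that by simp_all
    note e' = org_ebar[OF K e(2)] and E = f_edge[OF e(2)]
    have em: "path_edges (emap f' e) \<noteq> []"
      using E e' f_not_S[OF e(1)]
      by (auto simp: emap_induced[OF e(2)] path_edges_c filter_empty_conv simp del: induced_map_simps)
    have t: "tight K' (emap f' e)" unfolding emap_induced[OF e(2)] tight_vertex_cat
      by (rule c_tight[OF E(1) edge_path_mapD(4)[OF f e(2)]])
    let ?u = "p (vmap f (org K e))" and ?w = "p (vmap f (tm K e))"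
    let ?E = "egrp K e"
    let ?\<theta> = "\<lambda>h. vhom f (org K e) (iota K (ebar K e) h)" and ?\<xi> = "\<lambda>h. vhom f (tm K e) (iota K e h)"
    let ?\<theta>1 = "\<lambda>h. elt (vmap f (org K e), ?\<theta> h, [])" and ?\<xi>1 = "\<lambda>h. elt (vmap f (tm K e), ?\<xi> h, [])"
    let ?\<theta>2 = "\<lambda>h. vhom f' (p (org K e)) (elt (org K e, iota K (ebar K e) h, []))"
    let ?\<xi>2 = "\<lambda>h. vhom f' (p (tm K e)) (elt (tm K e, iota K e h, []))"
    note s = edge_path_map_slides[OF f e(2)]
    obtain v a xs where vax: "emap f e = (v, a, xs)" by (cases "emap f e")
    have "slides K' ?E (c (v, a, xs)) (\<lambda>h. elt (v, ?\<theta> h, [])) (\<lambda>h. elt (path_end K (v, a, xs), ?\<xi> h, []))"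
      by (rule slides_collapse) (use E s vax in simp_all)
    then have 1: "slides K' ?E (c (emap f e)) ?\<theta>1 ?\<xi>1" using E vax by simp
    have v: "?u \<in> verts K'" "?w \<in> verts K'" using e' by simp_all
    interpret u: group "pi1 C ?u" using group_vgrp[OF K' v(1)] by simp
    interpret w: group "pi1 C ?w" using group_vgrp[OF K' v(2)] by simp
    have o: "S_path (org K e, iota K (ebar K e) h, [])" "S_path (tm K e, iota K e h, [])" if "h \<in> carrier ?E" for h
      using K e e' that by simp_all
    have c1: "?\<theta>1 h \<in> carrier (pi1 C ?u)" "?\<xi>1 h \<in> carrier (pi1 C ?w)" if "h \<in> carrier ?E" for h
      using s(2,3)[OF that] e' by simp_all
    have 2: "?\<theta>2 h = \<eta> (org K e) \<otimes>\<^bsub>pi1 C ?u\<^esub> ?\<theta>1 h \<otimes>\<^bsub>pi1 C ?u\<^esub> inv\<^bsub>pi1 C ?u\<^esub> \<eta> (org K e)"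
      "?\<xi>2 h = \<eta> (tm K e) \<otimes>\<^bsub>pi1 C ?w\<^esub> ?\<xi>1 h \<otimes>\<^bsub>pi1 C ?w\<^esub> inv\<^bsub>pi1 C ?w\<^esub> \<eta> (tm K e)" if "h \<in> carrier ?E" for h
      using vhom_induced_elt[OF o(1)[OF that], of _ ?u] vhom_induced_elt[OF o(2)[OF that], of _ ?w] by simp_all
    have \<eta>: "\<eta> (org K e) \<in> carrier (pi1 C ?u)" "\<eta> (tm K e) \<in> carrier (pi1 C ?w)" using e' by simp_all
    have c2: "?\<theta>2 h \<in> carrier (pi1 C ?u)" "?\<xi>2 h \<in> carrier (pi1 C ?w)" if "h \<in> carrier ?E" for h
      unfolding 2[OF that] using c1[OF that] \<eta> by simp_all
    \<comment> \<open>Across the edgeless corrections at both ends, sliding is conjugation by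
      \<open>\<eta>\<close>, and this is how \<open>vhom\<close> of the induced map differs from the
      collapsed \<open>vhom f\<close>.\<close>
    have 3: "slides K' ?E (?u, \<eta> (org K e), []) ?\<theta>2 ?\<theta>1"
      unfolding slides.simps collapse_simps using 2(1) c1 \<eta> by (simp add: u.m_assoc)
    have 4: "slides K' ?E (?w, inv\<^bsub>pi1 C ?w\<^esub> \<eta> (tm K e), []) ?\<xi>1 ?\<xi>2"
      unfolding slides.simps collapse_simps using 2(2) c1 \<eta> by (simp add: w.m_assoc[symmetric])
    note ip = \<eta>_path(1)[OF e'(2)] \<eta>_path(2)[OF e'(3)]
    have "slides K' ?E ((?u, \<eta> (org K e), []) \<bullet>\<^bsub>K'\<^esub> c (emap f e)) ?\<theta>2 ?\<xi>1"
      by (rule slides_cat[OF K' ip(1) _ _ 3 1]) (use E c1 c2 in simp_all)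
    then have "slides K' ?E (emap f' e) ?\<theta>2 ?\<xi>2" unfolding emap_induced[OF e(2)]
      by (rule_tac slides_cat[OF K' _ ip(2) _ _ 4]) (use E c1 c2 K' ip in \<open>simp_all del: is_path.simps\<close>)
    moreover have "path_start (emap f' e) = ?u" "path_end K' (emap f' e) = ?w" "is_path K' (emap f' e)"
      using path_morphism_edge[OF path_morphism_induced that] e' by (simp_all del: induced_map_simps(2))
    ultimately have "morphism_on_subdivision K' f' e"
      using morphism_on_subdivision_iff_slides[OF K', of f' e] em c2 e' by (simp del: induced_map_simps)
    with em t show ?thesis by blast
  qed
  then show ?thesis using path_morphism_induced K'
    unfolding edge_path_map_def path_morphism_def by blast
qed

end

section \<open>Injectivity and surjectivity on fundamental groups\<close>

lemma pi1_map_inj_iff: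
  assumes "edge_path_map G f" "v \<in> verts G"
  shows "inj_on (pi1_map G f) (carrier (pi1 G v)) \<longleftrightarrow>
    (\<forall>x y. path_from_to G v v x \<and> path_from_to G v v y \<and>
      normal_form G (path_image G G f x) = normal_form G (path_image G G f y) \<longrightarrow> normal_form G x = normal_form G y)"
proof -
  note G = edge_path_mapD(1)[OF assms(1)] and pm = edge_path_mapD(2)[OF assms(1)]
  have eq: "pi1_map G f (homotopy_class G x) = pi1_map G f (homotopy_class G y) \<longleftrightarrow>
      normal_form G (path_image G G f x) = normal_form G (path_image G G f y)"
    "homotopy_class G x = homotopy_class G y \<longleftrightarrow> normal_form G x = normal_form G y"
    if "path_from_to G v v x" "path_from_to G v v y" for x y
    using that homotopy_class_image[OF assms(1)] path_image_is_path[OF pm]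
    by (simp_all add: path_from_to_def homotopy_class_eq_iff[OF G])
  then show ?thesis unfolding inj_on_def pi1_simps by (simp add: imp_conjL)
qed

lemma pi1_map_surj_iff:
  assumes "edge_path_map G f" "v \<in> verts G"
  shows "pi1_map G f ` carrier (pi1 G v) = carrier (pi1 G (vmap f v)) \<longleftrightarrow>
    (\<forall>z. path_from_to G (vmap f v) (vmap f v) z \<longrightarrow>
      (\<exists>x. path_from_to G v v x \<and> normal_form G (path_image G G f x) = normal_form G z))"
proof -
  note G = edge_path_mapD(1)[OF assms(1)] and pm = edge_path_mapD(2)[OF assms(1)]
  have "pi1_map G f ` carrier (pi1 G v) = carrier (pi1 G (vmap f v)) \<longleftrightarrow>
    carrier (pi1 G (vmap f v)) \<subseteq> pi1_map G f ` carrier (pi1 G v)"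
    using pi1_map_hom[OF assms] by (auto simp: hom_def)
  also have "\<dots> \<longleftrightarrow> (\<forall>z. path_from_to G (vmap f v) (vmap f v) z \<longrightarrow>
      (\<exists>x. path_from_to G v v x \<and> homotopy_class G z = pi1_map G f (homotopy_class G x)))"
    unfolding pi1_simps by blast
  also have "\<dots> \<longleftrightarrow> (\<forall>z. path_from_to G (vmap f v) (vmap f v) z \<longrightarrow>
      (\<exists>x. path_from_to G v v x \<and> normal_form G (path_image G G f x) = normal_form G z))"
  proof -
    have "homotopy_class G z = pi1_map G f (homotopy_class G x) \<longleftrightarrow>
        normal_form G (path_image G G f x) = normal_form G z"
      if "path_from_to G (vmap f v) (vmap f v) z" "path_from_to G v v x" for x z
      using that homotopy_class_image[OF assms(1)] path_image_is_path[OF pm]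
      by (auto simp: path_from_to_def homotopy_class_eq_iff[OF G])
    then show ?thesis by blast
  qed
  finally show ?thesis .
qed

lemma pi1_iso_at_iff:
  assumes "edge_path_map G f" "v \<in> verts G"
  shows "pi1_iso_at G f v \<longleftrightarrow> inj_on (pi1_map G f) (carrier (pi1 G v)) \<and>
    pi1_map G f ` carrier (pi1 G v) = carrier (pi1 G (vmap f v))"
  using pi1_map_hom[OF assms] by (auto simp: pi1_iso_at_def iso_def bij_betw_def)

context collapse_map_data
begin

text \<open>By \<open>factorization\<close> the two images carry the same corrections at their
  common ends. These can be cancelled, and \<open>c\<close> is injective on homotopy classes of
  paths with given ends.\<close>

lemma f'i_homotopic_iff:
  assumes "is_path K x" "path_start x = v" "path_end K x = w" "is_path K y" "path_start y = v" "path_end K y = w"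
  shows "normal_form K' (f'i (c x)) = normal_form K' (f'i (c y)) \<longleftrightarrow> normal_form K (fi x) = normal_form K (fi y)"
proof -
  let ?a = "(p (vmap f v), \<eta> v, [])" and ?b = "(p (vmap f w), inv\<^bsub>pi1 C (p (vmap f w))\<^esub> \<eta> w, [])"
  have v: "v \<in> verts K" "w \<in> verts K" using assms is_path_start[of K x] is_path_end[of K x] by auto
  note ip = \<eta>_path(1)[OF v(1)] \<eta>_path(2)[OF v(2)]
  have cancel: "normal_form K' z = normal_form K' (path_rev K' ?a \<bullet>\<^bsub>K'\<^esub> (?a \<bullet>\<^bsub>K'\<^esub> z \<bullet>\<^bsub>K'\<^esub> ?b) \<bullet>\<^bsub>K'\<^esub> path_rev K' ?b)"
    if "is_path K' z" "path_start z = p (vmap f v)" "path_end K' z = p (vmap f w)" for z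
  proof -
    have "normal_form K' (path_rev K' ?b) = path_act K' (path_rev K' ?b) (trivial_path K' (p (vmap f w)))"
      unfolding normal_form_def using ip K' by (simp del: path_rev.simps is_path.simps path_act.simps)
    then have "path_act K' ?b (normal_form K' (path_rev K' ?b)) = trivial_path K' (p (vmap f w))"
      using ip K' v by (simp del: path_rev.simps is_path.simps path_act.simps)
    then show ?thesis using that ip K' v
      by (simp add: normal_form_cat del: path_rev.simps is_path.simps path_act.simps) (simp add: normal_form_def)
  qed
  let ?X = "c (fi x)" and ?Y = "c (fi y)"
  have ip2: "is_path K' ?X" "is_path K' ?Y" "path_start ?X = p (vmap f v)" "path_end K' ?X = p (vmap f w)"
    "path_start ?Y = p (vmap f v)" "path_end K' ?Y = p (vmap f w)" using assms by simp_all
  have "normal_form K' (f'i (c x)) = normal_form K' (f'i (c y)) \<longleftrightarrow>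
      normal_form K' (?a \<bullet>\<^bsub>K'\<^esub> ?X \<bullet>\<^bsub>K'\<^esub> ?b) = normal_form K' (?a \<bullet>\<^bsub>K'\<^esub> ?Y \<bullet>\<^bsub>K'\<^esub> ?b)"
    using factorization[OF assms(1)] factorization[OF assms(4)] assms by simp
  also have "\<dots> \<longleftrightarrow> normal_form K' ?X = normal_form K' ?Y"
  proof
    assume n: "normal_form K' ?X = normal_form K' ?Y"
    have "normal_form K' (?a \<bullet>\<^bsub>K'\<^esub> ?X) = normal_form K' (?a \<bullet>\<^bsub>K'\<^esub> ?Y)"
      by (rule normal_form_cat_cong[OF K' ip(1,1) refl _ _ n]) (use ip2 in simp_all)
    then show "normal_form K' (?a \<bullet>\<^bsub>K'\<^esub> ?X \<bullet>\<^bsub>K'\<^esub> ?b) = normal_form K' (?a \<bullet>\<^bsub>K'\<^esub> ?Y \<bullet>\<^bsub>K'\<^esub> ?b)"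
      by (rule_tac normal_form_cat_cong[OF K']) (use ip ip2 K' in \<open>simp_all del: is_path.simps\<close>)
  next
    assume "normal_form K' (?a \<bullet>\<^bsub>K'\<^esub> ?X \<bullet>\<^bsub>K'\<^esub> ?b) = normal_form K' (?a \<bullet>\<^bsub>K'\<^esub> ?Y \<bullet>\<^bsub>K'\<^esub> ?b)"
    then have "normal_form K' (path_rev K' ?a \<bullet>\<^bsub>K'\<^esub> (?a \<bullet>\<^bsub>K'\<^esub> ?X \<bullet>\<^bsub>K'\<^esub> ?b)) =
        normal_form K' (path_rev K' ?a \<bullet>\<^bsub>K'\<^esub> (?a \<bullet>\<^bsub>K'\<^esub> ?Y \<bullet>\<^bsub>K'\<^esub> ?b))"
      by (rule_tac normal_form_cat_cong[OF K']) (use ip ip2 K' in \<open>simp_all del: is_path.simps path_rev.simps\<close>)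
    then have "normal_form K' (path_rev K' ?a \<bullet>\<^bsub>K'\<^esub> (?a \<bullet>\<^bsub>K'\<^esub> ?X \<bullet>\<^bsub>K'\<^esub> ?b) \<bullet>\<^bsub>K'\<^esub> path_rev K' ?b) =
        normal_form K' (path_rev K' ?a \<bullet>\<^bsub>K'\<^esub> (?a \<bullet>\<^bsub>K'\<^esub> ?Y \<bullet>\<^bsub>K'\<^esub> ?b) \<bullet>\<^bsub>K'\<^esub> path_rev K' ?b)"
      by (rule_tac normal_form_cat_cong[OF K']) (use ip ip2 K' in \<open>simp_all del: is_path.simps path_rev.simps\<close>)
    then show "normal_form K' ?X = normal_form K' ?Y"
      by (rule trans[OF cancel[OF ip2(1,3,4)] trans[OF _ cancel[OF ip2(2,5,6), symmetric]]])
  qed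
  also have "\<dots> \<longleftrightarrow> normal_form K (fi x) = normal_form K (fi y)"
    using assms by (intro c_homotopic_iff) simp_all
  finally show ?thesis .
qed

lemma loops_collapse:
  assumes "v \<in> verts K"
  shows "path_from_to K v v \<gamma> \<Longrightarrow> path_from_to K' (p v) (p v) (c \<gamma>)"
    "path_from_to K' (p v) (p v) \<xi> \<Longrightarrow> \<exists>\<gamma>. path_from_to K v v \<gamma> \<and> c \<gamma> = \<xi>"
proof -
  show "path_from_to K v v \<gamma> \<Longrightarrow> path_from_to K' (p v) (p v) (c \<gamma>)" by (auto simp: path_from_to_def)
  show "path_from_to K' (p v) (p v) \<xi> \<Longrightarrow> \<exists>\<gamma>. path_from_to K v v \<gamma> \<and> c \<gamma> = \<xi>"
    using c_surj[of \<xi> v v] assms unfolding path_from_to_def by metis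
qed

text \<open>Loops at \<open>v\<close> and loops at \<open>p v\<close> in the collapse correspond
  under \<open>c\<close> up to homotopy, and by \<open>f'i_homotopic_iff\<close> the two maps
  identify corresponding pairs.\<close>

lemma pi1_map_induced_inj_iff:
  assumes v: "v \<in> verts K"
  shows "inj_on (pi1_map K' f') (carrier (pi1 K' (p v))) \<longleftrightarrow> inj_on (pi1_map K f) (carrier (pi1 K v))"
proof -
  have 1: "normal_form K' (f'i (c x)) = normal_form K' (f'i (c y)) \<longleftrightarrow> normal_form K (fi x) = normal_form K (fi y)"
    "normal_form K' (c x) = normal_form K' (c y) \<longleftrightarrow> normal_form K x = normal_form K y"
    if "path_from_to K v v x" "path_from_to K v v y" for x y
    using f'i_homotopic_iff[of x v v y] c_homotopic_iff[of x y] that by (auto simp: path_from_to_def)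
  have pv: "p v \<in> verts K'" using v by simp
  note loops = loops_collapse[OF v]
  have "(\<forall>x y. path_from_to K' (p v) (p v) x \<and> path_from_to K' (p v) (p v) y \<and>
        normal_form K' (f'i x) = normal_form K' (f'i y) \<longrightarrow> normal_form K' x = normal_form K' y) \<longleftrightarrow>
      (\<forall>x y. path_from_to K v v x \<and> path_from_to K v v y \<and>
        normal_form K (fi x) = normal_form K (fi y) \<longrightarrow> normal_form K x = normal_form K y)" (is "?A \<longleftrightarrow> ?B")
  proof (intro iffI allI impI)
    fix x y assume A: ?A and xy: "path_from_to K v v x \<and> path_from_to K v v y \<and>
        normal_form K (fi x) = normal_form K (fi y)"
    then have "normal_form K' (f'i (c x)) = normal_form K' (f'i (c y))" using 1(1)[of x y] by blast
    with xy loops(1)[of x] loops(1)[of y] A have "normal_form K' (c x) = normal_form K' (c y)" by blast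
    then show "normal_form K x = normal_form K y" using 1(2)[of x y] xy by blast
  next
    fix \<xi> \<zeta> assume B: ?B and xy: "path_from_to K' (p v) (p v) \<xi> \<and> path_from_to K' (p v) (p v) \<zeta> \<and>
        normal_form K' (f'i \<xi>) = normal_form K' (f'i \<zeta>)"
    then obtain x y where *: "path_from_to K v v x" "c x = \<xi>" "path_from_to K v v y" "c y = \<zeta>"
      using loops(2)[of \<xi>] loops(2)[of \<zeta>] by blast
    then have "normal_form K (fi x) = normal_form K (fi y)" using 1(1)[of x y] xy by blast
    with B * have "normal_form K x = normal_form K y" by blast
    then show "normal_form K' \<xi> = normal_form K' \<zeta>" using 1(2)[of x y] * by blast
  qed
  with pi1_map_inj_iff[OF edge_path_map_induced pv] pi1_map_inj_iff[OF f v] show ?thesis by simp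
qed

text \<open>On loops at \<open>v\<close> the two maps differ by conjugation with
  \<open>\<eta> v\<close>, which is a bijection of the target group.\<close>

lemma pi1_map_induced_surj_iff:
  assumes v: "v \<in> verts K"
  shows "pi1_map K' f' ` carrier (pi1 K' (p v)) = carrier (pi1 K' (vmap f' (p v))) \<longleftrightarrow>
    pi1_map K f ` carrier (pi1 K v) = carrier (pi1 K (vmap f v))"
proof -
  let ?u = "p (vmap f v)"
  let ?a = "(?u, \<eta> v, [])" and ?b = "(?u, inv\<^bsub>pi1 C ?u\<^esub> \<eta> v, [])"
  have pv: "p v \<in> verts K'" and u: "?u \<in> verts K'" using v by simp_all
  note ip = \<eta>_path[OF v]
  have ab: "?a \<bullet>\<^bsub>K'\<^esub> ?b = trivial_path K' ?u" "?b \<bullet>\<^bsub>K'\<^esub> ?a = trivial_path K' ?u"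
    using vgrp_simps(7,8)[OF K' u, of "\<eta> v"] v by (simp_all add: trivial_path_def vertex_path_cat)
  have conj: "?a \<bullet>\<^bsub>K'\<^esub> (?b \<bullet>\<^bsub>K'\<^esub> z \<bullet>\<^bsub>K'\<^esub> ?a) \<bullet>\<^bsub>K'\<^esub> ?b = z"
    if z: "is_path K' z" "path_start z = ?u" "path_end K' z = ?u" for z
  proof -
    have "?a \<bullet>\<^bsub>K'\<^esub> (?b \<bullet>\<^bsub>K'\<^esub> z \<bullet>\<^bsub>K'\<^esub> ?a) \<bullet>\<^bsub>K'\<^esub> ?b = (?a \<bullet>\<^bsub>K'\<^esub> ?b) \<bullet>\<^bsub>K'\<^esub> z \<bullet>\<^bsub>K'\<^esub> (?a \<bullet>\<^bsub>K'\<^esub> ?b)"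
      using ip z K' by (simp add: path_cat_assoc del: is_path.simps)
    then show ?thesis using z K' by (simp add: ab trivial_cat cat_trivial)
  qed
  have fac: "f'i (c x) = ?a \<bullet>\<^bsub>K'\<^esub> c (fi x) \<bullet>\<^bsub>K'\<^esub> ?b" if "path_from_to K v v x" for x
    using factorization[of x] that by (auto simp: path_from_to_def)
  have key: "normal_form K' (?a \<bullet>\<^bsub>K'\<^esub> c (fi x) \<bullet>\<^bsub>K'\<^esub> ?b) = normal_form K' (?a \<bullet>\<^bsub>K'\<^esub> c z \<bullet>\<^bsub>K'\<^esub> ?b) \<longleftrightarrow>
      normal_form K (fi x) = normal_form K z"
    if x: "path_from_to K v v x" and z: "path_from_to K (vmap f v) (vmap f v) z" for x z
  proof -
    have ip2: "is_path K' (c (fi x))" "path_start (c (fi x)) = ?u" "path_end K' (c (fi x)) = ?u"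
      "is_path K' (c z)" "path_start (c z) = ?u" "path_end K' (c z) = ?u"
      using x z by (auto simp: path_from_to_def)
    have cong: "normal_form K' (y \<bullet>\<^bsub>K'\<^esub> s \<bullet>\<^bsub>K'\<^esub> y') = normal_form K' (y \<bullet>\<^bsub>K'\<^esub> t \<bullet>\<^bsub>K'\<^esub> y')"
      if "normal_form K' s = normal_form K' t" "is_path K' y" "is_path K' y'" "is_path K' s" "is_path K' t"
        "path_end K' y = ?u" "path_start y' = ?u" "path_start s = ?u" "path_end K' s = ?u" "path_start t = ?u" "path_end K' t = ?u"
      for s t y y'
    proof -
      have "normal_form K' (y \<bullet>\<^bsub>K'\<^esub> s) = normal_form K' (y \<bullet>\<^bsub>K'\<^esub> t)"
        by (rule normal_form_cat_cong[OF K']) (use that in simp_all)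
      then show ?thesis by (rule_tac normal_form_cat_cong[OF K']) (use that K' in simp_all)
    qed
    have conj': "?b \<bullet>\<^bsub>K'\<^esub> (?a \<bullet>\<^bsub>K'\<^esub> s \<bullet>\<^bsub>K'\<^esub> ?b) \<bullet>\<^bsub>K'\<^esub> ?a = s"
      if "is_path K' s" "path_start s = ?u" "path_end K' s = ?u" for s
    proof -
      have "?b \<bullet>\<^bsub>K'\<^esub> (?a \<bullet>\<^bsub>K'\<^esub> s \<bullet>\<^bsub>K'\<^esub> ?b) \<bullet>\<^bsub>K'\<^esub> ?a = (?b \<bullet>\<^bsub>K'\<^esub> ?a) \<bullet>\<^bsub>K'\<^esub> s \<bullet>\<^bsub>K'\<^esub> (?b \<bullet>\<^bsub>K'\<^esub> ?a)"
        using ip that K' by (simp add: path_cat_assoc del: is_path.simps)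
      then show ?thesis using that K' by (simp add: ab trivial_cat cat_trivial)
    qed
    have "normal_form K' (?a \<bullet>\<^bsub>K'\<^esub> c (fi x) \<bullet>\<^bsub>K'\<^esub> ?b) = normal_form K' (?a \<bullet>\<^bsub>K'\<^esub> c z \<bullet>\<^bsub>K'\<^esub> ?b) \<longleftrightarrow>
        normal_form K' (c (fi x)) = normal_form K' (c z)"
    proof
      assume "normal_form K' (?a \<bullet>\<^bsub>K'\<^esub> c (fi x) \<bullet>\<^bsub>K'\<^esub> ?b) = normal_form K' (?a \<bullet>\<^bsub>K'\<^esub> c z \<bullet>\<^bsub>K'\<^esub> ?b)"
      from cong[OF this ip(2,1)] show "normal_form K' (c (fi x)) = normal_form K' (c z)"
        using ip ip2 K' by (simp add: conj' del: is_path.simps)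
    next
      assume "normal_form K' (c (fi x)) = normal_form K' (c z)"
      from cong[OF this ip] show "normal_form K' (?a \<bullet>\<^bsub>K'\<^esub> c (fi x) \<bullet>\<^bsub>K'\<^esub> ?b) = normal_form K' (?a \<bullet>\<^bsub>K'\<^esub> c z \<bullet>\<^bsub>K'\<^esub> ?b)"
        using ip2 by simp
    qed
    also have "\<dots> \<longleftrightarrow> normal_form K (fi x) = normal_form K z"
      using x z by (intro c_homotopic_iff) (auto simp: path_from_to_def)
    finally show ?thesis .
  qed
  have vu: "vmap f' (p v) = ?u" using v by simp
  have "(\<forall>z. path_from_to K' ?u ?u z \<longrightarrow>
        (\<exists>x. path_from_to K' (p v) (p v) x \<and> normal_form K' (f'i x) = normal_form K' z)) \<longleftrightarrow>
      (\<forall>z. path_from_to K (vmap f v) (vmap f v) z \<longrightarrow>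
        (\<exists>x. path_from_to K v v x \<and> normal_form K (fi x) = normal_form K z))"
  proof (intro iffI allI impI)
    fix z assume A: "\<forall>z. path_from_to K' ?u ?u z \<longrightarrow>
        (\<exists>x. path_from_to K' (p v) (p v) x \<and> normal_form K' (f'i x) = normal_form K' z)"
      and z: "path_from_to K (vmap f v) (vmap f v) z"
    have "path_from_to K' ?u ?u (?a \<bullet>\<^bsub>K'\<^esub> c z \<bullet>\<^bsub>K'\<^esub> ?b)"
      using z ip K' by (simp add: path_from_to_def del: is_path.simps)
    with A obtain \<xi> where x: "path_from_to K' (p v) (p v) \<xi>" "normal_form K' (f'i \<xi>) = normal_form K' (?a \<bullet>\<^bsub>K'\<^esub> c z \<bullet>\<^bsub>K'\<^esub> ?b)"
      by blast
    then obtain x where "path_from_to K v v x" "c x = \<xi>" using loops_collapse(2)[OF v] by blast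
    then show "\<exists>x. path_from_to K v v x \<and> normal_form K (fi x) = normal_form K z"
      using x key[OF _ z] fac by metis
  next
    fix z assume A: "\<forall>z. path_from_to K (vmap f v) (vmap f v) z \<longrightarrow>
        (\<exists>x. path_from_to K v v x \<and> normal_form K (fi x) = normal_form K z)"
      and z: "path_from_to K' ?u ?u z"
    \<comment> \<open>The target is conjugated by the inverse of \<open>\<eta> v\<close> before it
      is lifted, so that the corrections in \<open>factorization\<close> restore it.\<close>
    have "path_from_to K' ?u ?u (?b \<bullet>\<^bsub>K'\<^esub> z \<bullet>\<^bsub>K'\<^esub> ?a)"
      using z ip K' by (simp add: path_from_to_def del: is_path.simps)
    then obtain y where y: "path_from_to K (vmap f v) (vmap f v) y" "c y = ?b \<bullet>\<^bsub>K'\<^esub> z \<bullet>\<^bsub>K'\<^esub> ?a"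
      using loops_collapse(2)[OF vmap_verts[OF v]] by blast
    then obtain x where x: "path_from_to K v v x" "normal_form K (fi x) = normal_form K y" using A by blast
    have "normal_form K' (f'i (c x)) = normal_form K' (?a \<bullet>\<^bsub>K'\<^esub> c y \<bullet>\<^bsub>K'\<^esub> ?b)"
      using key[OF x(1) y(1)] x fac by simp
    also have "?a \<bullet>\<^bsub>K'\<^esub> c y \<bullet>\<^bsub>K'\<^esub> ?b = z" unfolding y(2) using z by (intro conj) (auto simp: path_from_to_def)
    finally show "\<exists>x. path_from_to K' (p v) (p v) x \<and> normal_form K' (f'i x) = normal_form K' z"
      using loops_collapse(1)[OF v x(1)] by blast
  qed
  with pi1_map_surj_iff[OF edge_path_map_induced pv] pi1_map_surj_iff[OF f v]
  show ?thesis unfolding vu by simp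
qed

lemma pi1_iso_at_induced: "v \<in> verts K \<Longrightarrow> pi1_iso_at K' f' (p v) \<longleftrightarrow> pi1_iso_at K f v"
  using pi1_iso_at_iff[OF edge_path_map_induced, of "p v"] pi1_iso_at_iff[OF f, of v]
    pi1_map_induced_inj_iff[of v] pi1_map_induced_surj_iff[of v] by (simp del: induced_map_simps)

end

section \<open>Turns\<close>

lemma degenerate_pair: "degenerate {x, y} \<longleftrightarrow> x = y"
  unfolding degenerate_def by auto

lemma direction_eq_iff:
  assumes G: "graph_of_groups G" and e: "e \<in> edges G"
    and g: "g \<in> carrier (vgrp G (tm G e))" "g' \<in> carrier (vgrp G (tm G e))"
  shows "direction G g e = direction G g' e \<longleftrightarrow> (\<exists>h\<in>carrier (egrp G e). g' = g \<otimes>\<^bsub>vgrp G (tm G e)\<^esub> iota G e h)"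
proof -
  interpret i: group_hom "egrp G e" "vgrp G (tm G e)" "iota G e" using G e by (rule group_hom_iota)
  have one: "x \<in> x <#\<^bsub>vgrp G (tm G e)\<^esub> (iota G e ` carrier (egrp G e))" if "x \<in> carrier (vgrp G (tm G e))" for x
    using that by (auto simp: l_coset_def intro!: bexI[of _ "\<one>\<^bsub>egrp G e\<^esub>"])
  show ?thesis
  proof
    assume "direction G g e = direction G g' e"
    then have "g' \<in> g <#\<^bsub>vgrp G (tm G e)\<^esub> (iota G e ` carrier (egrp G e))"
      using one[OF g(2)] by (simp add: direction_def)
    then show "\<exists>h\<in>carrier (egrp G e). g' = g \<otimes>\<^bsub>vgrp G (tm G e)\<^esub> iota G e h"
      by (auto simp: l_coset_def)
  next
    assume "\<exists>h\<in>carrier (egrp G e). g' = g \<otimes>\<^bsub>vgrp G (tm G e)\<^esub> iota G e h"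
    then obtain h where h: "h \<in> carrier (egrp G e)" "g' = g \<otimes>\<^bsub>vgrp G (tm G e)\<^esub> iota G e h" by blast
    let ?H = "iota G e ` carrier (egrp G e)"
    have sub: "x <#\<^bsub>vgrp G (tm G e)\<^esub> ?H \<subseteq> y <#\<^bsub>vgrp G (tm G e)\<^esub> ?H"
      if "x = y \<otimes>\<^bsub>vgrp G (tm G e)\<^esub> iota G e h" "y \<in> carrier (vgrp G (tm G e))" "h \<in> carrier (egrp G e)" for x y h
    proof
      fix z assume "z \<in> x <#\<^bsub>vgrp G (tm G e)\<^esub> ?H"
      then obtain k where k: "k \<in> carrier (egrp G e)" "z = x \<otimes>\<^bsub>vgrp G (tm G e)\<^esub> iota G e k" by (auto simp: l_coset_def)
      then have "z = y \<otimes>\<^bsub>vgrp G (tm G e)\<^esub> iota G e (h \<otimes>\<^bsub>egrp G e\<^esub> k)" using that by (simp add: i.H.m_assoc)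
      then show "z \<in> y <#\<^bsub>vgrp G (tm G e)\<^esub> ?H" using k that unfolding l_coset_def
        by (rule_tac UN_I[OF imageI[of "h \<otimes>\<^bsub>egrp G e\<^esub> k"]]) simp_all
    qed
    have "g = g' \<otimes>\<^bsub>vgrp G (tm G e)\<^esub> iota G e (inv\<^bsub>egrp G e\<^esub> h)" using h g by (simp add: i.H.m_assoc)
    then have "g' <#\<^bsub>vgrp G (tm G e)\<^esub> ?H = g <#\<^bsub>vgrp G (tm G e)\<^esub> ?H"
      using sub[OF h(2) g(1) h(1)] sub[OF _ g(2)] h(1) by blast
    then show "direction G g e = direction G g' e" by (simp add: direction_def)
  qed
qed

lemma direction_edge: "direction G g e = direction G g' e' \<Longrightarrow> e = e'"
  by (simp add: direction_def)

lemma direction_mult_eq_iff: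
  assumes G: "graph_of_groups G" and "d \<in> edges G" "d' \<in> edges G" "tm G d = v" "tm G d' = v"
    "u \<in> carrier (vgrp G v)" "g \<in> carrier (vgrp G v)" "g' \<in> carrier (vgrp G v)"
  shows "direction G (u \<otimes>\<^bsub>vgrp G v\<^esub> g) d = direction G (u \<otimes>\<^bsub>vgrp G v\<^esub> g') d' \<longleftrightarrow> direction G g d = direction G g' d'"
proof (cases "d = d'")
  case True
  have v: "v \<in> verts G" using org_ebar[OF G assms(2)] assms(4) by simp
  then interpret group "vgrp G v" using G by (intro group_vgrp)
  have "u \<otimes>\<^bsub>vgrp G v\<^esub> g' = u \<otimes>\<^bsub>vgrp G v\<^esub> g \<otimes>\<^bsub>vgrp G v\<^esub> iota G d h \<longleftrightarrow> g' = g \<otimes>\<^bsub>vgrp G v\<^esub> iota G d h"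
    if "h \<in> carrier (egrp G d)" for h
    using assms iota_closed[OF G assms(2) that] by (simp add: m_assoc)
  then show ?thesis using True assms by (simp add: direction_eq_iff)
next
  case False
  then show ?thesis by (auto dest: direction_edge)
qed

text \<open>Directions see only the final letter of an image path. The homomorphism there tells how
  the image of the edge group passes the final group element.\<close>

lemma slides_last:
  "slides G E (v, a, xs) \<theta> \<xi> \<Longrightarrow> xs \<noteq> [] \<Longrightarrow> \<exists>\<phi>\<in>hom E (egrp G (fst (last xs))). \<forall>h\<in>carrier E.
    iota G (fst (last xs)) (\<phi> h) \<otimes>\<^bsub>vgrp G (tm G (fst (last xs)))\<^esub> snd (last xs) =
    snd (last xs) \<otimes>\<^bsub>vgrp G (tm G (fst (last xs)))\<^esub> \<xi> h"
proof (induction xs arbitrary: v a \<theta>)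
  case (Cons q xs)
  obtain e b where q: "q = (e, b)" by (cases q)
  obtain \<phi> where \<phi>: "\<phi> \<in> hom E (egrp G e)" "slides G E (tm G e, b, xs) (\<lambda>h. iota G e (\<phi> h)) \<xi>"
    using Cons(2) q by auto
  show ?case
  proof (cases "xs = []")
    case True
    then show ?thesis using \<phi> q by auto
  next
    case False
    then show ?thesis using Cons(1)[OF \<phi>(2)] by simp
  qed
qed simp

definition last_edge :: "('v, 'e, 'g, 'v, 'e, 'g) gmap \<Rightarrow> 'e \<Rightarrow> 'e" where
  "last_edge f e = fst (last (snd (snd (emap f e))))"

definition last_elt :: "('v, 'e, 'g, 'v, 'e, 'g) gmap \<Rightarrow> 'e \<Rightarrow> 'g" where
  "last_elt f e = snd (last (snd (snd (emap f e))))"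

lemma is_path_last:
  assumes "is_path G (v, g, xs)" "xs \<noteq> []"
  shows "fst (last xs) \<in> edges G" "tm G (fst (last xs)) = path_end G (v, g, xs)"
    "snd (last xs) \<in> carrier (vgrp G (path_end G (v, g, xs)))"
proof -
  have "fst (last xs) \<in> edges G \<and> tm G (fst (last xs)) = path_end G (v, g, xs) \<and>
    snd (last xs) \<in> carrier (vgrp G (path_end G (v, g, xs)))" using assms
  proof (induction xs arbitrary: v g)
    case (Cons q xs)
    obtain e b where q: "q = (e, b)" by (cases q)
    show ?case using Cons(1)[of "tm G e" b] Cons(2) q by (cases "xs = []") auto
  qed simp
  then show "fst (last xs) \<in> edges G" "tm G (fst (last xs)) = path_end G (v, g, xs)"
    "snd (last xs) \<in> carrier (vgrp G (path_end G (v, g, xs)))" by auto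
qed

context
  fixes G :: "('v, 'e, 'g, 'h) gog" and f :: "('v, 'e, 'g, 'v, 'e, 'g) gmap"
  assumes f: "edge_path_map G f"
begin

lemmas turn_G = edge_path_mapD(1)[OF f] and turn_pm = edge_path_mapD(2)[OF f]

lemma last_edge_elt:
  assumes e: "e \<in> edges G"
  shows "last_edge f e \<in> edges G" "tm G (last_edge f e) = vmap f (tm G e)"
    "last_elt f e \<in> carrier (vgrp G (vmap f (tm G e)))" "vmap f (tm G e) \<in> verts G"
proof -
  obtain v a xs where em: "emap f e = (v, a, xs)" by (cases "emap f e")
  have "xs \<noteq> []" using edge_path_mapD(3)[OF f e] em by auto
  with is_path_last[of G v a xs] path_morphism_edge[OF turn_pm e] em
  show "last_edge f e \<in> edges G" "tm G (last_edge f e) = vmap f (tm G e)"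
    "last_elt f e \<in> carrier (vgrp G (vmap f (tm G e)))"
    by (auto simp: last_edge_def last_elt_def)
  show "vmap f (tm G e) \<in> verts G"
    using org_ebar[OF turn_G e] path_morphism_vertex[OF turn_pm] by simp
qed

text \<open>The union in \<open>Ddir\<close> runs over a coset, and all its members agree. Another
  representative differs by some \<open>iota G e h\<close>, whose image slides across
  \<open>last_elt\<close> into the image of the group of the last edge, hence stays within one
  coset.\<close>

lemma Ddir_direction:
  assumes e: "e \<in> edges G" and g: "g \<in> carrier (vgrp G (tm G e))"
  shows "Ddir G f (direction G g e) = direction G (vhom f (tm G e) g
    \<otimes>\<^bsub>vgrp G (vmap f (tm G e))\<^esub> inv\<^bsub>vgrp G (vmap f (tm G e))\<^esub> last_elt f e) (last_edge f e)"
proof -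
  note G = turn_G and l = last_edge_elt[OF e]
  let ?w = "vmap f (tm G e)" and ?e = "last_edge f e" and ?a = "last_elt f e"
  note V = path_morphism_vertex[OF turn_pm org_ebar(3)[OF G e]]
  interpret w: group "vgrp G ?w" using G l by (intro group_vgrp)
  interpret i: group_hom "egrp G e" "vgrp G (tm G e)" "iota G e" using G e by (rule group_hom_iota)
  obtain v a xs where em: "emap f e = (v, a, xs)" by (cases "emap f e")
  have xs: "xs \<noteq> []" using edge_path_mapD(3)[OF f e] em by auto
  obtain \<phi> where \<phi>: "\<phi> \<in> hom (egrp G e) (egrp G ?e)"
    "\<And>h. h \<in> carrier (egrp G e) \<Longrightarrow> iota G ?e (\<phi> h) \<otimes>\<^bsub>vgrp G ?w\<^esub> ?a = ?a \<otimes>\<^bsub>vgrp G ?w\<^esub> vhom f (tm G e) (iota G e h)"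
    using slides_last[OF edge_path_map_slides(1)[OF f e, unfolded em] xs] l(2) em
    unfolding last_edge_def last_elt_def by auto
  have dir: "direction G (vhom f (tm G e) g' \<otimes>\<^bsub>vgrp G ?w\<^esub> inv\<^bsub>vgrp G ?w\<^esub> ?a) ?e =
      direction G (vhom f (tm G e) g \<otimes>\<^bsub>vgrp G ?w\<^esub> inv\<^bsub>vgrp G ?w\<^esub> ?a) ?e"
    if g': "g' \<in> g <#\<^bsub>vgrp G (tm G e)\<^esub> (iota G e ` carrier (egrp G e))" for g'
  proof -
    obtain h where h: "h \<in> carrier (egrp G e)" "g' = g \<otimes>\<^bsub>vgrp G (tm G e)\<^esub> iota G e h"
      using g' by (auto simp: l_coset_def)
    let ?x = "vhom f (tm G e) g" and ?y = "vhom f (tm G e) (iota G e h)" and ?z = "iota G ?e (\<phi> h)"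
    have c: "?x \<in> carrier (vgrp G ?w)" "?y \<in> carrier (vgrp G ?w)" "?z \<in> carrier (vgrp G ?w)" "\<phi> h \<in> carrier (egrp G ?e)"
      using V(3) g h \<phi>(1) iota_closed[OF G l(1), of "\<phi> h"] l(2) by (auto simp: hom_def)
    have "?z = ?a \<otimes>\<^bsub>vgrp G ?w\<^esub> ?y \<otimes>\<^bsub>vgrp G ?w\<^esub> inv\<^bsub>vgrp G ?w\<^esub> ?a"
      using w.swap_imp_conj(1)[OF l(3) c(3,2) \<phi>(2)[OF h(1)]] .
    then have "?y \<otimes>\<^bsub>vgrp G ?w\<^esub> inv\<^bsub>vgrp G ?w\<^esub> ?a = inv\<^bsub>vgrp G ?w\<^esub> ?a \<otimes>\<^bsub>vgrp G ?w\<^esub> ?z"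
      using c l by (simp add: w.m_assoc[symmetric])
    then have "vhom f (tm G e) g' \<otimes>\<^bsub>vgrp G ?w\<^esub> inv\<^bsub>vgrp G ?w\<^esub> ?a = ?x \<otimes>\<^bsub>vgrp G ?w\<^esub> inv\<^bsub>vgrp G ?w\<^esub> ?a \<otimes>\<^bsub>vgrp G ?w\<^esub> ?z"
      using V(4)[OF g, of "iota G e h"] h c l by (simp add: w.m_assoc)
    moreover have "?x \<otimes>\<^bsub>vgrp G ?w\<^esub> inv\<^bsub>vgrp G ?w\<^esub> ?a \<in> carrier (vgrp G ?w)" using c l by simp
    ultimately show ?thesis using direction_eq_iff[OF G l(1)] l(2) c(3,4)
      by (metis w.m_closed)
  qed
  have "g \<in> g <#\<^bsub>vgrp G (tm G e)\<^esub> (iota G e ` carrier (egrp G e))"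
    using g by (auto simp: l_coset_def intro!: bexI[of _ "\<one>\<^bsub>egrp G e\<^esub>"])
  then have "(\<Union>g'\<in>g <#\<^bsub>vgrp G (tm G e)\<^esub> (iota G e ` carrier (egrp G e)).
      fst (direction G (vhom f (tm G e) g' \<otimes>\<^bsub>vgrp G ?w\<^esub> inv\<^bsub>vgrp G ?w\<^esub> ?a) ?e)) =
    fst (direction G (vhom f (tm G e) g \<otimes>\<^bsub>vgrp G ?w\<^esub> inv\<^bsub>vgrp G ?w\<^esub> ?a) ?e)"
    using dir by (metis (no_types, lifting) SUP_eq_const empty_iff)
  moreover have "last xs = (?e, ?a)" by (simp add: last_edge_def last_elt_def em)
  moreover have "snd (direction G x ?e) = ?e" for x by (simp add: direction_def)
  ultimately show ?thesis using em l(2)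
    by (simp add: Ddir_def direction_def[of G g e]) (simp add: prod_eq_iff)
qed

lemma Dturn_pair:
  assumes "d \<in> edges G" "d' \<in> edges G" "tm G d = v" "tm G d' = v" "g \<in> carrier (vgrp G v)" "g' \<in> carrier (vgrp G v)"
  shows "Dturn G f {direction G g d, direction G g' d'} =
    {direction G (vhom f v g \<otimes>\<^bsub>vgrp G (vmap f v)\<^esub> inv\<^bsub>vgrp G (vmap f v)\<^esub> last_elt f d) (last_edge f d),
     direction G (vhom f v g' \<otimes>\<^bsub>vgrp G (vmap f v)\<^esub> inv\<^bsub>vgrp G (vmap f v)\<^esub> last_elt f d') (last_edge f d')}"
  using Ddir_direction[of d g] Ddir_direction[of d' g'] assms by (simp add: Dturn_def)

text \<open>The derivative is equivariant: translating a turn by \<open>u\<close> translates its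
  image by \<open>vhom f v u\<close>, and left translation is injective on directions. Hence only
  the turn up to translation matters, and the corrections \<open>\<eta>\<close> can be
  ignored.\<close>

lemma degenerate_translate:
  "d \<in> edges G \<Longrightarrow> d' \<in> edges G \<Longrightarrow> tm G d = v \<Longrightarrow> tm G d' = v \<Longrightarrow> u \<in> carrier (vgrp G v) \<Longrightarrow>
    g \<in> carrier (vgrp G v) \<Longrightarrow> g' \<in> carrier (vgrp G v) \<Longrightarrow>
  degenerate ((Dturn G f ^^ l) {direction G (u \<otimes>\<^bsub>vgrp G v\<^esub> g) d, direction G (u \<otimes>\<^bsub>vgrp G v\<^esub> g') d'}) \<longleftrightarrow>
    degenerate ((Dturn G f ^^ l) {direction G g d, direction G g' d'})"
proof (induction l arbitrary: d d' v u g g')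
  case 0
  then show ?case using direction_mult_eq_iff[OF turn_G] by (simp add: degenerate_pair)
next
  case (Suc l)
  note l = last_edge_elt[OF Suc(2)] and l' = last_edge_elt[OF Suc(3)]
  have v: "v \<in> verts G" using org_ebar[OF turn_G Suc(2)] Suc(4) by simp
  note V = path_morphism_vertex[OF turn_pm v]
  let ?w = "vmap f v"
  interpret w: group "vgrp G ?w" using turn_G V(1) by (intro group_vgrp)
  have c: "vhom f v u \<in> carrier (vgrp G ?w)" "vhom f v g \<in> carrier (vgrp G ?w)" "vhom f v g' \<in> carrier (vgrp G ?w)"
    "last_elt f d \<in> carrier (vgrp G ?w)" "last_elt f d' \<in> carrier (vgrp G ?w)"
    using V(3) Suc l l' by simp_all
  have "u \<otimes>\<^bsub>vgrp G v\<^esub> g \<in> carrier (vgrp G v)" "u \<otimes>\<^bsub>vgrp G v\<^esub> g' \<in> carrier (vgrp G v)"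
    using turn_G v Suc by simp_all
  then have "Dturn G f {direction G (u \<otimes>\<^bsub>vgrp G v\<^esub> g) d, direction G (u \<otimes>\<^bsub>vgrp G v\<^esub> g') d'} =
     {direction G (vhom f v u \<otimes>\<^bsub>vgrp G ?w\<^esub> (vhom f v g \<otimes>\<^bsub>vgrp G ?w\<^esub> inv\<^bsub>vgrp G ?w\<^esub> last_elt f d)) (last_edge f d),
     direction G (vhom f v u \<otimes>\<^bsub>vgrp G ?w\<^esub> (vhom f v g' \<otimes>\<^bsub>vgrp G ?w\<^esub> inv\<^bsub>vgrp G ?w\<^esub> last_elt f d')) (last_edge f d')}"
    using c Suc V(4) by (simp add: Dturn_pair w.m_assoc)
  moreover have "Dturn G f {direction G g d, direction G g' d'} =
    {direction G (vhom f v g \<otimes>\<^bsub>vgrp G ?w\<^esub> inv\<^bsub>vgrp G ?w\<^esub> last_elt f d) (last_edge f d),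
     direction G (vhom f v g' \<otimes>\<^bsub>vgrp G ?w\<^esub> inv\<^bsub>vgrp G ?w\<^esub> last_elt f d') (last_edge f d')}"
    using Suc by (simp add: Dturn_pair)
  ultimately show ?case
    using Suc(1)[OF l(1) l'(1) _ _ c(1)] l(2) l'(2) Suc(4,5) c by (simp add: funpow_swap1)
qed

lemma illegal_turn_translate:
  assumes "d \<in> edges G" "d' \<in> edges G" "tm G d = v" "tm G d' = v" "u \<in> carrier (vgrp G v)"
    "g \<in> carrier (vgrp G v)" "g' \<in> carrier (vgrp G v)"
  shows "illegal_turn G f {direction G (u \<otimes>\<^bsub>vgrp G v\<^esub> g) d, direction G (u \<otimes>\<^bsub>vgrp G v\<^esub> g') d'} \<longleftrightarrow>
    illegal_turn G f {direction G g d, direction G g' d'}"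
  using degenerate_translate[OF assms] by (simp add: illegal_turn_def)

lemma illegal_turn_Dturn: "illegal_turn G f (Dturn G f T) \<Longrightarrow> illegal_turn G f T"
  unfolding illegal_turn_def by (metis comp_apply funpow_Suc_right)

end

lemma turns_taken_start: "turns_taken G (v, g, xs) = turns_taken G (w, h, xs)"
  by (cases "(G, v, g, xs)" rule: turns_taken.cases; cases "(G, w, h, xs)" rule: turns_taken.cases) auto

lemma turns_taken_vertex_cat:
  "turns_taken G ((v, g, []) \<bullet>\<^bsub>G\<^esub> x) = turns_taken G x"
  "turns_taken G (x \<bullet>\<^bsub>G\<^esub> (w, h, [])) = turns_taken G x"
proof -
  show "turns_taken G ((v, g, []) \<bullet>\<^bsub>G\<^esub> x) = turns_taken G x"
    by (cases x) (simp add: vertex_path_cat turns_taken_start[of G v _ _ "fst x" "fst (snd x)"])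
  have "turns_taken G ((v, g, xs) \<bullet>\<^bsub>G\<^esub> (w, h, [])) = turns_taken G (v, g, xs)" for v g xs
  proof (induction xs arbitrary: v g)
    case Nil
    then show ?case by (simp add: vertex_path_cat)
  next
    case (Cons q xs)
    obtain e a where q: "q = (e, a)" by (cases q)
    show ?case
    proof (cases xs)
      case Nil
      then show ?thesis using q by (simp add: vertex_path_cat path_cat_Cons)
    next
      case (Cons r ys)
      obtain e' a' where r: "r = (e', a')" by (cases r)
      show ?thesis using Cons.IH[of "tm G e" a] q r Cons by (simp add: path_cat_Cons)
    qed
  qed
  then show "turns_taken G (x \<bullet>\<^bsub>G\<^esub> (w, h, [])) = turns_taken G x" by (cases x) auto
qed

lemma turns_taken_append:
  "turns_taken G (tm G e, a, zs) \<subseteq> turns_taken G (v, g, xs @ (e, a) # zs)"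
  "zs = (e', b) # us \<Longrightarrow> {direction G \<one>\<^bsub>vgrp G (tm G e)\<^esub> e, direction G a (ebar G e')} \<in> turns_taken G (v, g, xs @ (e, a) # zs)"
proof -
  have "turns_taken G (tm G e, a, zs) \<subseteq> turns_taken G (v, g, xs @ (e, a) # zs) \<and>
    (\<forall>e' b us. zs = (e', b) # us \<longrightarrow>
      {direction G \<one>\<^bsub>vgrp G (tm G e)\<^esub> e, direction G a (ebar G e')} \<in> turns_taken G (v, g, xs @ (e, a) # zs))"
  proof (induction xs arbitrary: v g)
    case Nil
    then show ?case by (cases zs) auto
  next
    case (Cons q xs)
    obtain e1 a1 where q: "q = (e1, a1)" by (cases q)
    show ?case using Cons[of "tm G e1" a1] q by (cases xs) auto
  qed
  then show "turns_taken G (tm G e, a, zs) \<subseteq> turns_taken G (v, g, xs @ (e, a) # zs)"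
    "zs = (e', b) # us \<Longrightarrow> {direction G \<one>\<^bsub>vgrp G (tm G e)\<^esub> e, direction G a (ebar G e')} \<in> turns_taken G (v, g, xs @ (e, a) # zs)"
    by auto
qed

lemma turns_restrict [simp]:
  fixes G :: "('v, 'e, 'g, 'h) gog"
  shows "direction (restrict_gog G S) = direction G" "Ddir (restrict_gog G S) f = Ddir G f"
    "Dturn (restrict_gog G S) f = Dturn G f" "illegal_turn (restrict_gog G S) f = illegal_turn G f"
    "turns_taken (restrict_gog G S) x = turns_taken G x"
proof -
  have d: "direction (restrict_gog G S) = direction G" for G :: "('v, 'e, 'g, 'h) gog"
    by (auto simp: direction_def fun_eq_iff)
  then show "direction (restrict_gog G S) = direction G" .
  show 1: "Ddir (restrict_gog G S) f = Ddir G f" by (auto simp: Ddir_def d fun_eq_iff split: prod.splits)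
  show 2: "Dturn (restrict_gog G S) f = Dturn G f" by (rule ext) (simp add: Dturn_def 1)
  show "illegal_turn (restrict_gog G S) f = illegal_turn G f" by (rule ext) (simp add: illegal_turn_def 2)
  show "turns_taken (restrict_gog G S) x = turns_taken G x"
    by (induction G x rule: turns_taken.induct) (simp_all add: d)
qed

section \<open>Turns of the collapse and their legality\<close>

context collapse_data
begin

text \<open>\<open>d1\<close> is an edge outside \<open>S\<close>, \<open>d2\<close> the reverse of
  the next such edge, and \<open>\<sigma>\<close> the piece in \<open>S\<close> between them. Since
  the path is tight, so is the piece: either it keeps its edges in normal form, or it is a vertex
  group element and the path takes the corresponding turn before collapsing.\<close>

lemma turns_taken_c:
  "is_path K \<gamma> \<Longrightarrow> tight K \<gamma> \<Longrightarrow> T \<in> turns_taken K' (c \<gamma>) \<Longrightarrow>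
   \<exists>d1 d2 \<sigma>. d1 \<in> edges K - snd S \<and> d2 \<in> edges K - snd S \<and> S_path \<sigma> \<and> path_start \<sigma> = tm K d1 \<and> path_end K \<sigma> = tm K d2 \<and>
     T = {direction K' \<one>\<^bsub>pi1 C (p (tm K d1))\<^esub> d1, direction K' (elt \<sigma>) d2} \<and>
     (path_edges (normal_form K \<sigma>) \<noteq> [] \<or>
      (\<exists>g. \<sigma> = (tm K d1, g, []) \<and> {direction K \<one>\<^bsub>vgrp K (tm K d1)\<^esub> d1, direction K g d2} \<in> turns_taken K \<gamma>))"
proof (induction rule: block_induct)
  case (S_path \<sigma>)
  then show ?case by (simp add: c_S_path)
next
  case (block \<sigma> e \<gamma>)
  have e: "e \<in> edges K" using block by simp
  note e' = org_ebar[OF K e]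
  have s: "is_path K \<sigma>" using block(1) by (rule S_path_is_path)
  note t = tight_block[OF K e block(4,5) s block(3,7)]
  have "path_start (c \<gamma>) = p (tm K e)" using block by simp
  then obtain x zs where cg: "c \<gamma> = (p (tm K e), x, zs)" by (cases "c \<gamma>") auto
  obtain v g xs where \<sigma>: "\<sigma> = (v, g, xs)" by (cases \<sigma>) auto
  obtain a ys where \<gamma>: "\<gamma> = (tm K e, a, ys)" using block(5) by (cases \<gamma>) auto
  have cat: "\<sigma> \<bullet>\<^bsub>K\<^esub> edge_path K e \<bullet>\<^bsub>K\<^esub> \<gamma> = (v, g, xs @ (e, a) # ys)"
    unfolding \<sigma> \<gamma> using block s \<sigma> \<gamma> by (intro cat_edge_cat[OF K e]) simp_all
  obtain e1 b us where zs: "zs = (e1, b) # us"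
    using block(8) by (cases zs) (auto simp: c_block[OF block(1-5)] cg)
  have T: "T = {direction K' \<one>\<^bsub>pi1 C (p (tm K e))\<^esub> e, direction K' x (ebar K e1)} \<or> T \<in> turns_taken K' (c \<gamma>)"
    using block(8) by (simp add: c_block[OF block(1-5)] cg zs)
  show ?case
  proof (cases "T \<in> turns_taken K' (c \<gamma>)")
    case True
    have sub: "turns_taken K \<gamma> \<subseteq> turns_taken K (\<sigma> \<bullet>\<^bsub>K\<^esub> edge_path K e \<bullet>\<^bsub>K\<^esub> \<gamma>)"
      unfolding cat unfolding \<gamma> by (rule turns_taken_append(1))
    obtain d1 d2 \<sigma>1 where A: "d1 \<in> edges K - snd S" "d2 \<in> edges K - snd S" "S_path \<sigma>1"
      "path_start \<sigma>1 = tm K d1" "path_end K \<sigma>1 = tm K d2"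
      "T = {direction K' \<one>\<^bsub>pi1 C (p (tm K d1))\<^esub> d1, direction K' (elt \<sigma>1) d2}"
      "path_edges (normal_form K \<sigma>1) \<noteq> [] \<or> (\<exists>g. \<sigma>1 = (tm K d1, g, []) \<and>
        {direction K \<one>\<^bsub>vgrp K (tm K d1)\<^esub> d1, direction K g d2} \<in> turns_taken K \<gamma>)"
      using block.IH[OF t(2) True] by (elim exE conjE) (rule that)
    have "path_edges (normal_form K \<sigma>1) \<noteq> [] \<or> (\<exists>g. \<sigma>1 = (tm K d1, g, []) \<and>
        {direction K \<one>\<^bsub>vgrp K (tm K d1)\<^esub> d1, direction K g d2} \<in> turns_taken K (\<sigma> \<bullet>\<^bsub>K\<^esub> edge_path K e \<bullet>\<^bsub>K\<^esub> \<gamma>))"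
      using A(7) by (elim disjE exE conjE) (auto dest: subsetD[OF sub])
    with A(1-6) show ?thesis
      by (intro exI[of _ d1] exI[of _ d2] exI[of _ \<sigma>1] conjI) assumption+
  next
    case False
    then have T: "T = {direction K' \<one>\<^bsub>pi1 C (p (tm K e))\<^esub> e, direction K' x (ebar K e1)}" using T by simp
    from block(4) show ?thesis
    proof (cases rule: block_cases)
      case S_path
      then show ?thesis using cg zs by (simp add: c_S_path)
    next
      case b: (block \<sigma>' e2 \<gamma>')
      have x: "x = elt \<sigma>'" "e2 = e1" "path_start \<sigma>' = tm K e"
        using c_block[OF b(1-5)] cg zs b(6) block(5) by simp_all
      have e2: "e2 \<in> edges K" using b by simp
      note e2' = org_ebar[OF K e2]
      have s': "is_path K \<sigma>'" using b(1) by (rule S_path_is_path)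
      have "tight K \<sigma>'"
        by (rule tight_block(1)[OF K e2 b(4,5) s' b(3)]) (use t(2) b(6) in simp)
      \<comment> \<open>Tightness makes the edges of the piece and of its normal form agree, so the
        alternative can be decided on the piece itself.\<close>
      then have pe: "path_edges (normal_form K \<sigma>') = path_edges \<sigma>'" by (rule path_edges_normal_form[OF K s'])
      have "path_edges \<sigma>' \<noteq> [] \<or> (\<exists>g. \<sigma>' = (tm K e, g, []) \<and>
          {direction K \<one>\<^bsub>vgrp K (tm K e)\<^esub> e, direction K g (ebar K e2)} \<in> turns_taken K (\<sigma> \<bullet>\<^bsub>K\<^esub> edge_path K e \<bullet>\<^bsub>K\<^esub> \<gamma>))"
      proof (cases "path_edges \<sigma>' = []")
        case True
        then obtain g' where g': "\<sigma>' = (tm K e, g', [])" using edgeless_eq[OF True] x(3) by metis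
        obtain a' zs' where "\<gamma>' = (tm K e2, a', zs')" using b(5) by (cases \<gamma>') auto
        then have "\<gamma> = (tm K e, g', (e2, a') # zs')"
          using b(3,4,6) g' cat_edge_cat[OF K e2, of a' zs' "tm K e" g' "[]"] s' by simp
        then show ?thesis using turns_taken_append(2)[of ys e2 a' zs' K e a v g xs] \<gamma> g' unfolding cat by auto
      qed simp
      moreover have "ebar K e2 \<in> edges K - snd S" "path_end K \<sigma>' = tm K (ebar K e2)"
        using b(2,3) e2' S_edges(3)[OF e2] by simp_all
      ultimately show ?thesis using block(2) b(1) x T unfolding pe
        by (intro exI[of _ e] exI[of _ "ebar K e2"] exI[of _ \<sigma>'] conjI) (simp_all only: pe)
    qed
  qed
qed

end

text \<open>The consequences of (RTT-i), (RTT-ii) and (RTT-iii) that the argument uses, in this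
  order. Directions outside \<open>S\<close> stay outside, nontrivial connecting paths in
  \<open>S\<close> stay nontrivial, and turns between edges outside \<open>S\<close> taken by images
  of such edges are legal before collapsing.\<close>

locale collapse_train_track = collapse_map_data K S p \<alpha> f
  for K :: "('v, 'e, 'g, 'h) gog" and S p \<alpha> f +
  assumes last_edge_not_S: "d \<in> edges K - snd S \<Longrightarrow> last_edge f d \<notin> snd S"
    and nontrivial_image: "S_path \<sigma> \<Longrightarrow> path_start \<sigma> \<in> tm K ` (edges K - snd S) \<Longrightarrow>
      path_end K \<sigma> \<in> tm K ` (edges K - snd S) \<Longrightarrow> path_edges (normal_form K \<sigma>) \<noteq> [] \<Longrightarrow>
      path_edges (normal_form K (fi \<sigma>)) \<noteq> []"
    and edge_turn_legal: "e \<in> edges K - snd S \<Longrightarrow> d1 \<in> edges K - snd S \<Longrightarrow> d2 \<in> edges K - snd S \<Longrightarrow>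
      tm K d1 = tm K d2 \<Longrightarrow> g \<in> carrier (vgrp K (tm K d1)) \<Longrightarrow>
      {direction K \<one>\<^bsub>vgrp K (tm K d1)\<^esub> d1, direction K g d2} \<in> turns_taken K (emap f e) \<Longrightarrow>
      \<not> illegal_turn K f {direction K \<one>\<^bsub>vgrp K (tm K d1)\<^esub> d1, direction K g d2}"
begin

text \<open>A path \<open>\<sigma>\<close> in \<open>S\<close> between edges outside \<open>S\<close> becomes a turn of the collapse. It stays
  nondegenerate either because \<open>\<sigma>\<close> is homotopically nontrivial, or because it is a vertex group
  element and the turn was legal before collapsing.\<close>

definition good_turn :: "'e \<Rightarrow> 'e \<Rightarrow> ('v, 'e, 'g) path \<Rightarrow> bool" where
  "good_turn d1 d2 \<sigma> \<longleftrightarrow> d1 \<in> edges K - snd S \<and> d2 \<in> edges K - snd S \<and> S_path \<sigma> \<and>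
     path_start \<sigma> = tm K d1 \<and> path_end K \<sigma> = tm K d2 \<and>
     (path_edges (normal_form K \<sigma>) \<noteq> [] \<or>
      (\<exists>g. \<sigma> = (tm K d1, g, []) \<and>
        \<not> illegal_turn K f {direction K \<one>\<^bsub>vgrp K (tm K d1)\<^esub> d1, direction K g d2}))"

text \<open>The last edge of \<open>emap f d\<close> lies outside \<open>S\<close>, so it is still
  last after collapsing. Its trailing element only acquires the end correction by
  \<open>\<eta>\<close>.\<close>

lemma last_edge_elt_induced:
  assumes d: "d \<in> edges K - snd S"
  shows "last_edge f' d = last_edge f d"
    "last_elt f' d = elt (vmap f (tm K d), last_elt f d, []) \<otimes>\<^bsub>pi1 C (p (vmap f (tm K d)))\<^esub>
      inv\<^bsub>pi1 C (p (vmap f (tm K d)))\<^esub> \<eta> (tm K d)"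
proof -
  have d1: "d \<in> edges K" using d by simp
  note d' = org_ebar[OF K d1] and E = f_edge[OF d1] and l = last_edge_elt[OF f d1]
  obtain v a xs where em: "emap f d = (v, a, xs)" by (cases "emap f d")
  have xs: "xs \<noteq> []" using edge_path_mapD(3)[OF f d1] em by auto
  then have snoc: "xs = butlast xs @ [(last_edge f d, last_elt f d)]" by (simp add: last_edge_def last_elt_def em)
  let ?e = "last_edge f d" and ?b = "last_elt f d"
  have "is_path K (v, a, butlast xs @ [(?e, ?b)])" using E(1) em snoc by simp
  moreover have "is_path K (v, a, ys @ [(?e, ?b)]) \<Longrightarrow> is_path K (v, a, ys) \<and> path_end K (v, a, ys) = org K ?e" for v a ys
    by (induction ys arbitrary: v a) auto
  ultimately have b: "is_path K (v, a, butlast xs)" "path_end K (v, a, butlast xs) = org K ?e" by blast+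
  have bl: "is_path K (tm K ?e, ?b, [])" using l by simp
  have sp: "S_path (tm K ?e, ?b, [])" using l by simp
  have e1: "is_path K (edge_path K ?e)" using K l by simp
  have "emap f d = (v, a, butlast xs) \<bullet>\<^bsub>K\<^esub> edge_path K ?e \<bullet>\<^bsub>K\<^esub> (tm K ?e, ?b, [])"
    using cat_edge_cat[OF K l(1) bl b] em snoc by simp
  then have "c (emap f d) = c (v, a, butlast xs) \<bullet>\<^bsub>K'\<^esub> edge_path K' ?e \<bullet>\<^bsub>K'\<^esub> (p (tm K ?e), elt (tm K ?e, ?b, []), [])"
    using b bl e1 K c_S_path[OF sp] c_edge_path[OF l(1)] last_edge_not_S[OF d]
    by (simp add: c_cat) (simp add: collapse_map_def)
  moreover obtain v' a' xs' where c': "c (v, a, butlast xs) = (v', a', xs')" by (metis prod_cases3)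
  moreover have "is_path K' (v', a', xs')" "path_end K' (v', a', xs') = org K' ?e"
    using b c_is_path[OF b(1)] c_end[OF b(1)] c' by simp_all
  moreover have "is_path K' (p (tm K ?e), elt (tm K ?e, ?b, []), [])" using l by simp
  moreover have "?e \<in> edges K'" using l last_edge_not_S[OF d] by simp
  ultimately have ce: "c (emap f d) = (v', a', xs' @ [(?e, elt (tm K ?e, ?b, []))])"
    using cat_edge_cat[OF K', of ?e] by simp
  have cat: "(v, a, xs @ [(e, b)]) \<bullet>\<^bsub>K'\<^esub> (w, h, []) = (v, a, xs @ [(e, b \<otimes>\<^bsub>vgrp K' (tm K' e)\<^esub> h)])" for v a xs e b w h
    by (induction xs arbitrary: v a) (auto simp: path_cat_Cons vertex_path_cat)
  have "snd (snd (emap f' d)) = xs' @ [(?e, elt (tm K ?e, ?b, []) \<otimes>\<^bsub>pi1 C (p (tm K ?e))\<^esub> inv\<^bsub>pi1 C (p (vmap f (tm K d)))\<^esub> \<eta> (tm K d))]"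
    unfolding emap_induced[OF d1] ce vertex_path_cat cat by simp
  then show "last_edge f' d = last_edge f d"
    "last_elt f' d = elt (vmap f (tm K d), last_elt f d, []) \<otimes>\<^bsub>pi1 C (p (vmap f (tm K d)))\<^esub>
      inv\<^bsub>pi1 C (p (vmap f (tm K d)))\<^esub> \<eta> (tm K d)"
    using l by (simp_all add: last_edge_def[of f'] last_elt_def[of f'] del: induced_map_simps)
qed

text \<open>The image of a good turn is a left translate of a good turn. Removing the translation is
  what allows the step to be iterated, as the new turn again has 1 in its first direction.\<close>

lemma good_turn_step:
  assumes good: "good_turn d1 d2 \<sigma>"
  obtains u e1 e2 \<sigma>' where "good_turn e1 e2 \<sigma>'" "u \<in> carrier (pi1 C (p (tm K e1)))"
    "Dturn K' f' {direction K' \<one>\<^bsub>pi1 C (p (tm K d1))\<^esub> d1, direction K' (elt \<sigma>) d2} =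
     {direction K' (u \<otimes>\<^bsub>pi1 C (p (tm K e1))\<^esub> \<one>\<^bsub>pi1 C (p (tm K e1))\<^esub>) e1,
      direction K' (u \<otimes>\<^bsub>pi1 C (p (tm K e1))\<^esub> elt \<sigma>') e2}"
proof -
  have d: "d1 \<in> edges K - snd S" "d2 \<in> edges K - snd S" "d1 \<in> edges K" "d2 \<in> edges K"
    and s: "S_path \<sigma>" "path_start \<sigma> = tm K d1" "path_end K \<sigma> = tm K d2"
    using good by (auto simp: good_turn_def)
  note l1 = last_edge_elt[OF f d(3)] and l2 = last_edge_elt[OF f d(4)]
  let ?e1 = "last_edge f d1" and ?e2 = "last_edge f d2" and ?b1 = "last_elt f d1" and ?b2 = "last_elt f d2"
  let ?v1 = "vmap f (tm K d1)" and ?v2 = "vmap f (tm K d2)"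
  let ?i1 = "inv\<^bsub>vgrp K ?v1\<^esub> ?b1" and ?i2 = "inv\<^bsub>vgrp K ?v2\<^esub> ?b2"
  have t: "tm K d1 \<in> verts K" "tm K d2 \<in> verts K" using org_ebar[OF K d(3)] org_ebar[OF K d(4)] by simp_all
  have pd: "p (tm K d2) = p (tm K d1)" using base_S_path[OF s(1)] s by simp
  have ps: "S_path (fi \<sigma>)" "path_start (fi \<sigma>) = ?v1" "path_end K (fi \<sigma>) = ?v2"
    using s S_path_is_path[OF s(1)] by simp_all
  have pv: "p ?v2 = p ?v1" using base_S_path[OF ps(1)] ps by simp
  have B: "S_path (?v1, ?b1, [])" "S_path (?v2, ?b2, [])" "S_path (?v1, ?i1, [])" "S_path (?v2, ?i2, [])"
    using l1 l2 K by simp_all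
  \<comment> \<open>The image of \<open>\<sigma>\<close>, extended by the final group elements of
    the two image paths so that it connects the new directions with 1 in the first of them.\<close>
  let ?\<sigma> = "(?v1, ?b1, []) \<bullet>\<^bsub>K\<^esub> fi \<sigma> \<bullet>\<^bsub>K\<^esub> (?v2, ?i2, [])"
  have b1s: "S_path ((?v1, ?b1, []) \<bullet>\<^bsub>K\<^esub> fi \<sigma>)" using B ps by simp
  have s': "S_path ?\<sigma>" "path_start ?\<sigma> = tm K ?e1" "path_end K ?\<sigma> = tm K ?e2"
    using b1s B ps l1 l2 by simp_all
  let ?P = "pi1 C (p ?v1)"
  interpret P: group ?P using t by (intro group_pi1_C) simp
  have eltc: "elt ?\<sigma> = elt (?v1, ?b1, []) \<otimes>\<^bsub>?P\<^esub> elt (fi \<sigma>) \<otimes>\<^bsub>?P\<^esub> elt (?v2, ?i2, [])"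
    using elt_cat[OF b1s B(4), of "p ?v1"] elt_cat[OF B(1) ps(1), of "p ?v1"] B ps by simp
  have inv1: "elt (?v1, ?i1, []) = inv\<^bsub>?P\<^esub> elt (?v1, ?b1, [])" using elt_rev[OF B(1)] by simp
  have inv2: "elt (?v2, ?i2, []) = inv\<^bsub>?P\<^esub> elt (?v2, ?b2, [])" using elt_rev[OF B(2)] pv by simp
  have car: "\<eta> (tm K d1) \<in> carrier ?P" "\<eta> (tm K d2) \<in> carrier ?P" "elt (?v1, ?b1, []) \<in> carrier ?P"
    "elt (?v2, ?b2, []) \<in> carrier ?P" "elt (fi \<sigma>) \<in> carrier ?P"
    using t B ps pv by simp_all
  \<comment> \<open>The inverse of the final element for \<open>d1\<close>, which includes its
    correction \<open>\<eta>\<close>. The correction at \<open>d2\<close> cancels against the end of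
    the image of \<open>elt \<sigma>\<close>.\<close>
  let ?u = "\<eta> (tm K d1) \<otimes>\<^bsub>?P\<^esub> inv\<^bsub>?P\<^esub> elt (?v1, ?b1, [])"
  have u: "?u \<in> carrier ?P" using car by simp
  have one: "vhom f' (p (tm K d1)) \<one>\<^bsub>pi1 C (p (tm K d1))\<^esub> = \<one>\<^bsub>?P\<^esub>"
    using path_morphism_vertex(5)[OF path_morphism_induced, of "p (tm K d1)"] t by simp
  have 1: "vhom f' (p (tm K d1)) \<one>\<^bsub>pi1 C (p (tm K d1))\<^esub> \<otimes>\<^bsub>?P\<^esub> inv\<^bsub>?P\<^esub> last_elt f' d1 = ?u \<otimes>\<^bsub>?P\<^esub> \<one>\<^bsub>?P\<^esub>"
    unfolding one last_edge_elt_induced(2)[OF d(1)] using car by (simp add: P.inv_mult_group)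
  have 2: "vhom f' (p (tm K d1)) (elt \<sigma>) \<otimes>\<^bsub>?P\<^esub> inv\<^bsub>?P\<^esub> last_elt f' d2 = ?u \<otimes>\<^bsub>?P\<^esub> elt ?\<sigma>"
  proof -
    have "vhom f' (p (tm K d1)) (elt \<sigma>) = \<eta> (tm K d1) \<otimes>\<^bsub>?P\<^esub> elt (fi \<sigma>) \<otimes>\<^bsub>?P\<^esub> inv\<^bsub>?P\<^esub> \<eta> (tm K d2)"
      using vhom_induced_elt[OF s(1), of _ "p ?v1"] s pv by simp
    moreover have "last_elt f' d2 = elt (?v2, ?b2, []) \<otimes>\<^bsub>?P\<^esub> inv\<^bsub>?P\<^esub> \<eta> (tm K d2)"
      using last_edge_elt_induced(2)[OF d(2)] pv by simp
    ultimately show ?thesis unfolding eltc inv2 using car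
      by (simp add: P.inv_mult_group P.m_assoc P.inv_solve_left')
         (simp add: P.m_assoc[symmetric])
  qed
  have dK': "d1 \<in> edges K'" "d2 \<in> edges K'" "tm K' d1 = p (tm K d1)" "tm K' d2 = p (tm K d1)"
    using d pd by simp_all
  have "Dturn K' f' {direction K' \<one>\<^bsub>pi1 C (p (tm K d1))\<^esub> d1, direction K' (elt \<sigma>) d2} =
     {direction K' (?u \<otimes>\<^bsub>?P\<^esub> \<one>\<^bsub>?P\<^esub>) ?e1, direction K' (?u \<otimes>\<^bsub>?P\<^esub> elt ?\<sigma>) ?e2}"
    using Dturn_pair[OF edge_path_map_induced dK', of "\<one>\<^bsub>pi1 C (p (tm K d1))\<^esub>" "elt \<sigma>"] 1 2 t s
      vgrp_simps(1)[OF K', of "p (tm K d1)"] last_edge_elt_induced(1)[OF d(1)] last_edge_elt_induced(1)[OF d(2)]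
    by simp
  moreover have "good_turn ?e1 ?e2 ?\<sigma>"
  proof -
    have e: "?e1 \<in> edges K - snd S" "?e2 \<in> edges K - snd S" using l1 l2 last_edge_not_S d by simp_all
    consider "path_edges (normal_form K \<sigma>) \<noteq> []" | g where "\<sigma> = (tm K d1, g, [])"
      "\<not> illegal_turn K f {direction K \<one>\<^bsub>vgrp K (tm K d1)\<^esub> d1, direction K g d2}" using good by (auto simp: good_turn_def)
    then show ?thesis
    proof cases
      case 1
      have "path_edges (normal_form K (fi \<sigma>)) \<noteq> []"
        by (rule nontrivial_image[OF s(1) _ _ 1]) (use s d in simp_all)
      \<comment> \<open>The extension by vertex group elements can be undone. If the extended path
        had an edgeless normal form, so would the image of \<open>\<sigma>\<close>, contrary to
        \<open>nontrivial_image\<close>.\<close>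
      moreover have "path_edges (normal_form K (fi \<sigma>)) = []" if nil: "path_edges (normal_form K ?\<sigma>) = []"
      proof -
        have ip: "is_path K (?v1, ?b1, [])" "is_path K (?v2, ?i2, [])" "is_path K (fi \<sigma>)"
           "is_path K (?v1, ?i1, [])" "is_path K (?v2, ?b2, [])"
          using B ps by (simp_all add: S_path_is_path del: is_path.simps)
        obtain x where x: "normal_form K ?\<sigma> = (?v1, x, [])" "x \<in> carrier (vgrp K ?v1)"
        proof -
          have "normal_form K ?\<sigma> = (path_start (normal_form K ?\<sigma>), fst (snd (normal_form K ?\<sigma>)), [])"
            by (rule edgeless_eq[OF nil])
          moreover have "path_start (normal_form K ?\<sigma>) = ?v1" "is_path K (normal_form K ?\<sigma>)"
            using K s' S_path_is_path[OF s'(1)] l1 by (simp_all add: normal_path_is_path)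
          ultimately show thesis using that by (metis is_path_fst_group)
        qed
        have xp: "is_path K (?v1, x, [])" using x l1 by simp
        have "path_end K ?\<sigma> = ?v1" using normal_form_props(3)[OF K S_path_is_path[OF s'(1)]] x by simp
        then have v12: "?v2 = ?v1" using s' l2 by simp
        have ne: "normal_form K ?\<sigma> = normal_form K (?v1, x, [])" using K x l1 by simp
        have eq: "fi \<sigma> = (?v1, ?i1, []) \<bullet>\<^bsub>K\<^esub> ?\<sigma> \<bullet>\<^bsub>K\<^esub> (?v2, ?b2, [])"
        proof -
          have 1: "(?v1, ?i1, []) \<bullet>\<^bsub>K\<^esub> (?v1, ?b1, []) = trivial_path K ?v1" "(?v2, ?i2, []) \<bullet>\<^bsub>K\<^esub> (?v2, ?b2, []) = trivial_path K ?v2"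
            using l1 l2 K by (simp_all add: vertex_path_cat trivial_path_def)
          have "(?v1, ?i1, []) \<bullet>\<^bsub>K\<^esub> ?\<sigma> \<bullet>\<^bsub>K\<^esub> (?v2, ?b2, []) = (?v1, ?i1, []) \<bullet>\<^bsub>K\<^esub> (?v1, ?b1, []) \<bullet>\<^bsub>K\<^esub> fi \<sigma> \<bullet>\<^bsub>K\<^esub> ((?v2, ?i2, []) \<bullet>\<^bsub>K\<^esub> (?v2, ?b2, []))"
            using K ip ps by (simp add: path_cat_assoc del: is_path.simps)
          then show ?thesis unfolding 1 using K ip ps by (simp add: trivial_cat cat_trivial del: is_path.simps)
        qed
        have "normal_form K ((?v1, ?i1, []) \<bullet>\<^bsub>K\<^esub> ?\<sigma>) = normal_form K ((?v1, ?i1, []) \<bullet>\<^bsub>K\<^esub> (?v1, x, []))"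
          by (rule normal_form_cat_cong[OF K ip(4,4) refl S_path_is_path[OF s'(1)] xp ne]) simp
        then have "normal_form K ((?v1, ?i1, []) \<bullet>\<^bsub>K\<^esub> ?\<sigma> \<bullet>\<^bsub>K\<^esub> (?v2, ?b2, [])) =
            normal_form K ((?v1, ?i1, []) \<bullet>\<^bsub>K\<^esub> (?v1, x, []) \<bullet>\<^bsub>K\<^esub> (?v2, ?b2, []))"
          by (rule_tac normal_form_cat_cong[OF K])
            (use K ip xp s' S_path_is_path[OF s'(1)] l2 in \<open>simp_all del: is_path.simps\<close>)
        note trans[OF arg_cong[OF eq, of "normal_form K"] this]
        moreover have "is_path K ((?v1, ?i1, []) \<bullet>\<^bsub>K\<^esub> (?v1, x, []) \<bullet>\<^bsub>K\<^esub> (?v2, ?b2, []))"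
          using K ip xp v12 by (simp del: is_path.simps)
        ultimately show ?thesis using normal_form_edgeless[OF K] by simp
      qed
      ultimately show ?thesis using e s' by (auto simp: good_turn_def)
    next
      case 2
      have g: "g \<in> carrier (vgrp K (tm K d1))" "tm K d2 = tm K d1" using s 2 by simp_all
      interpret Q: group "vgrp K ?v1" using K l1 by (intro group_vgrp)
      note V = path_morphism_vertex[OF f_pm t(1)]
      let ?g = "?b1 \<otimes>\<^bsub>vgrp K ?v1\<^esub> vhom f (tm K d1) g \<otimes>\<^bsub>vgrp K ?v1\<^esub> ?i2"
      have \<sigma>g: "?\<sigma> = (tm K ?e1, ?g, [])" using 2 g l1 by (simp add: vertex_path_cat)
      have cc: "?b1 \<in> carrier (vgrp K ?v1)" "?b2 \<in> carrier (vgrp K ?v1)" "vhom f (tm K d1) g \<in> carrier (vgrp K ?v1)"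
        using l1 l2 g V(3) by simp_all
      \<comment> \<open>Before collapsing, the image turn is likewise a translate of the turn of
        \<open>?\<sigma>\<close>. Illegality is invariant under translation and would pass back to
        the original turn.\<close>
      have "Dturn K f {direction K \<one>\<^bsub>vgrp K (tm K d1)\<^esub> d1, direction K g d2} =
          {direction K (?i1 \<otimes>\<^bsub>vgrp K ?v1\<^esub> \<one>\<^bsub>vgrp K ?v1\<^esub>) ?e1, direction K (?i1 \<otimes>\<^bsub>vgrp K ?v1\<^esub> ?g) ?e2}"
        using Dturn_pair[OF f d(3,4) refl g(2), of "\<one>\<^bsub>vgrp K (tm K d1)\<^esub>" g] K t g V(5) cc
        by (simp add: Q.m_assoc) (simp add: Q.m_assoc[symmetric])
      note D = this
      have gc: "?g \<in> carrier (vgrp K ?v1)" using cc g by simp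
      have "illegal_turn K f {direction K (?i1 \<otimes>\<^bsub>vgrp K ?v1\<^esub> \<one>\<^bsub>vgrp K ?v1\<^esub>) ?e1, direction K (?i1 \<otimes>\<^bsub>vgrp K ?v1\<^esub> ?g) ?e2} \<longleftrightarrow>
          illegal_turn K f {direction K \<one>\<^bsub>vgrp K ?v1\<^esub> ?e1, direction K ?g ?e2}"
        by (rule illegal_turn_translate[OF f l1(1) l2(1) l1(2)]) (use l2(2) g cc gc in simp_all)
      then have "\<not> illegal_turn K f {direction K \<one>\<^bsub>vgrp K ?v1\<^esub> ?e1, direction K ?g ?e2}"
        using illegal_turn_Dturn[OF f, of "{direction K \<one>\<^bsub>vgrp K (tm K d1)\<^esub> d1, direction K g d2}"] 2(2)
        unfolding D by blast
      then show ?thesis using e s' \<sigma>g l1 by (auto simp: good_turn_def)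
    qed
  qed
  ultimately show thesis using that[of ?e1 ?e2 ?\<sigma> ?u] u l1 by simp
qed

text \<open>Degeneracy forces equal edges and makes \<open>\<sigma>\<close> homotopic to an element
  of the image of \<open>iota\<close>. So \<open>\<sigma>\<close> has an edgeless normal form and
  must be of the second kind; but then its turn is degenerate before collapsing, hence illegal with
  exponent 0.\<close>

lemma good_turn_nondegenerate:
  assumes "good_turn d1 d2 \<sigma>"
  shows "direction K' \<one>\<^bsub>pi1 C (p (tm K d1))\<^esub> d1 \<noteq> direction K' (elt \<sigma>) d2"
proof
  assume eq: "direction K' \<one>\<^bsub>pi1 C (p (tm K d1))\<^esub> d1 = direction K' (elt \<sigma>) d2"
  then have d2: "d2 = d1" by (auto dest: direction_edge)
  have d: "d1 \<in> edges K'" "d1 \<in> edges K" and s: "S_path \<sigma>" "path_start \<sigma> = tm K d1" "path_end K \<sigma> = tm K d1"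
    using assms d2 by (auto simp: good_turn_def)
  have t: "tm K d1 \<in> verts K" using org_ebar[OF K d(2)] by simp
  interpret group "pi1 C (p (tm K d1))" using t by (intro group_pi1_C) simp
  obtain h where h: "h \<in> carrier (egrp K d1)" "elt \<sigma> = elt (tm K d1, iota K d1 h, [])"
    using direction_eq_iff[OF K' d(1), of "\<one>\<^bsub>pi1 C (p (tm K d1))\<^esub>" "elt \<sigma>"] eq d2 s t d K by auto
  then have n: "normal_form K \<sigma> = (tm K d1, iota K d1 h, [])"
    using elt_eq_vertex[OF s] d K by simp
  then obtain g where g: "\<sigma> = (tm K d1, g, [])" "\<not> illegal_turn K f {direction K \<one>\<^bsub>vgrp K (tm K d1)\<^esub> d1, direction K g d1}"
    using assms d2 by (auto simp: good_turn_def)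
  then have "g = iota K d1 h" using n s K t by simp
  then have "direction K \<one>\<^bsub>vgrp K (tm K d1)\<^esub> d1 = direction K g d1"
    using direction_eq_iff[OF K d(2), of "\<one>\<^bsub>vgrp K (tm K d1)\<^esub>" g] h(1) K t d by auto
  then have "degenerate ((Dturn K f ^^ 0) {direction K \<one>\<^bsub>vgrp K (tm K d1)\<^esub> d1, direction K g d1})"
    by (simp add: degenerate_def)
  then show False using g(2) unfolding illegal_turn_def by blast
qed

lemma good_turn_legal:
  "good_turn d1 d2 \<sigma> \<Longrightarrow>
    \<not> degenerate ((Dturn K' f' ^^ l) {direction K' \<one>\<^bsub>pi1 C (p (tm K d1))\<^esub> d1, direction K' (elt \<sigma>) d2})"
proof (induction l arbitrary: d1 d2 \<sigma>)
  case 0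
  then show ?case using good_turn_nondegenerate by (simp add: degenerate_pair)
next
  case (Suc l)
  from Suc(2) obtain u e1 e2 \<sigma>' where *: "good_turn e1 e2 \<sigma>'" "u \<in> carrier (pi1 C (p (tm K e1)))"
    "Dturn K' f' {direction K' \<one>\<^bsub>pi1 C (p (tm K d1))\<^esub> d1, direction K' (elt \<sigma>) d2} =
     {direction K' (u \<otimes>\<^bsub>pi1 C (p (tm K e1))\<^esub> \<one>\<^bsub>pi1 C (p (tm K e1))\<^esub>) e1,
      direction K' (u \<otimes>\<^bsub>pi1 C (p (tm K e1))\<^esub> elt \<sigma>') e2}" by (rule good_turn_step)
  have e: "e1 \<in> edges K'" "e2 \<in> edges K'" "S_path \<sigma>'" "path_start \<sigma>' = tm K e1" "path_end K \<sigma>' = tm K e2"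
    using *(1) by (auto simp: good_turn_def)
  have t: "tm K e1 \<in> verts K" using S_path_ends[OF e(3)] e(4) by simp
  interpret group "pi1 C (p (tm K e1))" using t by (intro group_pi1_C) simp
  have pe: "p (tm K e2) = p (tm K e1)" using base_S_path[OF e(3)] e by simp
  \<comment> \<open>The induction hypothesis concerns the untranslated turn and is carried over by
    \<open>degenerate_translate\<close>.\<close>
  have "\<not> degenerate ((Dturn K' f' ^^ l) {direction K' (u \<otimes>\<^bsub>pi1 C (p (tm K e1))\<^esub> \<one>\<^bsub>pi1 C (p (tm K e1))\<^esub>) e1,
      direction K' (u \<otimes>\<^bsub>pi1 C (p (tm K e1))\<^esub> elt \<sigma>') e2})"
    using degenerate_translate[OF edge_path_map_induced e(1,2), of "p (tm K e1)" u "\<one>\<^bsub>pi1 C (p (tm K e1))\<^esub>" "elt \<sigma>'" l]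
      Suc(1)[OF *(1)] *(2) e pe by simp
  then show ?case using *(3) by (simp add: funpow_swap1)
qed

theorem edges_to_legal_paths_induced: "edges_to_legal_paths K' f'"
  unfolding edges_to_legal_paths_def legal_path_def
proof (intro ballI conjI)
  fix e assume e: "e \<in> edges K'"
  then have e1: "e \<in> edges K" by simp
  show "is_path K' (emap f' e)" by (rule path_morphism_edge(1)[OF path_morphism_induced e])
  fix T assume "T \<in> turns_taken K' (emap f' e)"
  then have "T \<in> turns_taken K' (c (emap f e))" unfolding emap_induced[OF e1] turns_taken_vertex_cat .
  from turns_taken_c[OF f_edge(1)[OF e1] edge_path_mapD(4)[OF f e1] this]
  obtain d1 d2 \<sigma> where *: "d1 \<in> edges K - snd S" "d2 \<in> edges K - snd S" "S_path \<sigma>" "path_start \<sigma> = tm K d1"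
     "path_end K \<sigma> = tm K d2" "T = {direction K' \<one>\<^bsub>pi1 C (p (tm K d1))\<^esub> d1, direction K' (elt \<sigma>) d2}"
     "path_edges (normal_form K \<sigma>) \<noteq> [] \<or>
      (\<exists>g. \<sigma> = (tm K d1, g, []) \<and> {direction K \<one>\<^bsub>vgrp K (tm K d1)\<^esub> d1, direction K g d2} \<in> turns_taken K (emap f e))"
    by blast
  have "good_turn d1 d2 \<sigma>" unfolding good_turn_def
    using * edge_turn_legal[of e d1 d2] e by auto
  then show "\<not> illegal_turn K' f' T" unfolding illegal_turn_def *(6) using good_turn_legal by blast
qed

end

section \<open>Perron--Frobenius eigenvectors\<close>

lemma mat_power_cong:
  assumes "\<And>i j. i \<in> I \<Longrightarrow> j \<in> I \<Longrightarrow> M i j = M' i j"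
  shows "i \<in> I \<Longrightarrow> j \<in> I \<Longrightarrow> mat_power I M l i j = mat_power I M' l i j"
proof (induction l arbitrary: i)
  case (Suc l)
  then show ?case using assms by (auto intro!: sum.cong)
qed simp

lemma irreducible_matrix_cong:
  assumes "\<And>i j. i \<in> I \<Longrightarrow> j \<in> I \<Longrightarrow> M i j = M' i j" "irreducible_matrix I M"
  shows "irreducible_matrix I M'"
proof -
  have "mat_power I M' l i j = mat_power I M l i j" if "i \<in> I" "j \<in> I" for l i j
    using mat_power_cong[of I M M' i j l] assms(1) that by simp
  then show ?thesis using assms(2) unfolding irreducible_matrix_def by simp
qed

text \<open>\<open>mat_power\<close> multiplies by \<open>M\<close> on the left, so peeling off
  factors ends with a column of \<open>M\<close> itself. A zero column would persist in every
  positive power.\<close>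

lemma irreducible_column_nonzero:
  assumes "irreducible_matrix I M" "j \<in> I"
  shows "\<exists>k\<in>I. M k j > 0"
proof -
  have sum_pos: "\<exists>k\<in>I. g k \<noteq> 0" if "(\<Sum>k\<in>I. g k) > (0::nat)" for g
    using that by (rule_tac ccontr) simp
  have "mat_power I M (Suc l) i j > 0 \<Longrightarrow> i \<in> I \<Longrightarrow> \<exists>k\<in>I. M k j > 0" for l i
  proof (induction l arbitrary: i)
    case 0
    then obtain k where "k \<in> I" "M i k * mat_power I M 0 k j \<noteq> 0"
      using sum_pos[OF 0(1)[unfolded mat_power.simps(2)]] by blast
    then have "j = k" "M i k > 0" by (simp_all split: if_splits)
    then show ?case using 0 \<open>k \<in> I\<close> by blast
  next
    case (Suc l)
    then obtain k where "k \<in> I" "M i k * mat_power I M (Suc l) k j \<noteq> 0"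
      using sum_pos[OF Suc(2)[unfolded mat_power.simps(2)[of I M "Suc l"]]] by blast
    then show ?case using Suc.IH[of k] by simp
  qed
  moreover obtain l where "l \<ge> 1" "mat_power I M l j j > 0"
    using assms unfolding irreducible_matrix_def by blast
  ultimately show ?thesis using assms(2) by (cases l) auto
qed

text \<open>Compactness of a cube. A bounded monotone subsequence is extracted for one coordinate at
  a time, and passing to a further subsequence keeps the limits already obtained.\<close>

lemma convergent_subsequence_on_finite:
  fixes X :: "nat \<Rightarrow> 'i \<Rightarrow> real"
  assumes "finite I" "\<And>n i. i \<in> I \<Longrightarrow> \<bar>X n i\<bar> \<le> B"
  shows "\<exists>r. strict_mono r \<and> (\<forall>i\<in>I. convergent (\<lambda>n. X (r n) i))"
  using assms
proof (induction I rule: finite_induct)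
  case empty
  show ?case by (intro exI[of _ id]) (simp add: strict_mono_def)
next
  case (insert i I)
  then obtain r where r: "strict_mono r" "\<And>j. j \<in> I \<Longrightarrow> convergent (\<lambda>n. X (r n) j)" by force
  obtain s :: "nat \<Rightarrow> nat" where s: "strict_mono s" "monoseq (\<lambda>n. X (r (s n)) i)"
    using seq_monosub[of "\<lambda>n. X (r n) i"] by auto
  have "Bseq (\<lambda>n. X (r (s n)) i)" using insert(4)[of i] by (intro BseqI') auto
  then have "convergent (\<lambda>n. X (r (s n)) i)" using s(2) by (rule Bseq_monoseq_convergent)
  moreover have "convergent (\<lambda>n. X (r (s n)) j)" if "j \<in> I" for j
    using convergent_subseq_convergent[OF r(2)[OF that] s(1)] by (simp add: o_def)
  ultimately have "\<forall>j\<in>insert i I. convergent (\<lambda>n. X ((r \<circ> s) n) j)" by simp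
  then show ?case using strict_mono_o[OF r(1) s(1)] by blast
qed

definition mat_app :: "'i set \<Rightarrow> ('i \<Rightarrow> 'i \<Rightarrow> nat) \<Rightarrow> ('i \<Rightarrow> real) \<Rightarrow> 'i \<Rightarrow> real" where
  "mat_app I M x i = (\<Sum>j\<in>I. real (M i j) * x j)"

lemma mat_app_funpow:
  assumes "finite I" "i \<in> I"
  shows "(mat_app I M ^^ l) x i = (\<Sum>j\<in>I. real (mat_power I M l i j) * x j)"
  using assms(2)
proof (induction l arbitrary: i)
  case 0
  have "(\<Sum>j\<in>I. real (mat_power I M 0 i j) * x j) = (\<Sum>j\<in>I. if i = j then x j else 0)"
    by (intro sum.cong) auto
  then show ?case using 0 assms(1) by simp
next
  case (Suc l)
  have "(mat_app I M ^^ Suc l) x i = (\<Sum>k\<in>I. real (M i k) * (mat_app I M ^^ l) x k)"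
    unfolding funpow.simps o_apply by (simp only: mat_app_def)
  also have "\<dots> = (\<Sum>k\<in>I. real (M i k) * (\<Sum>j\<in>I. real (mat_power I M l k j) * x j))"
    by (intro sum.cong refl) (simp only: Suc.IH)
  also have "\<dots> = (\<Sum>k\<in>I. \<Sum>j\<in>I. real (M i k) * real (mat_power I M l k j) * x j)"
    by (simp add: sum_distrib_left mult.assoc)
  also have "\<dots> = (\<Sum>j\<in>I. \<Sum>k\<in>I. real (M i k) * real (mat_power I M l k j) * x j)" by (rule sum.swap)
  also have "\<dots> = (\<Sum>j\<in>I. real (mat_power I M (Suc l) i j) * x j)" by (simp add: sum_distrib_right)
  finally show ?case .
qed

lemma mat_app_funpow_pos:
  assumes "finite I" "i \<in> I" "j \<in> I" "mat_power I M l i j > 0" "\<And>k. k \<in> I \<Longrightarrow> x k \<ge> 0" "x j > 0"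
  shows "(mat_app I M ^^ l) x i > 0"
proof -
  have "0 < real (mat_power I M l i j) * x j" using assms by simp
  also have "\<dots> \<le> (\<Sum>j\<in>I. real (mat_power I M l i j) * x j)" using assms by (intro member_le_sum) auto
  finally show ?thesis using assms by (simp add: mat_app_funpow)
qed

lemma mat_app_funpow_nonneg:
  assumes "finite I" "i \<in> I" "\<And>k. k \<in> I \<Longrightarrow> x k \<ge> 0"
  shows "(mat_app I M ^^ l) x i \<ge> 0"
  using assms by (simp add: mat_app_funpow sum_nonneg)

text \<open>The eigenvector maximizes \<open>t\<close> subject to \<open>M x \<ge> t x\<close> among nonnegative vectors of sum one. At
  the maximum equality holds, as applying a positive sum of powers of \<open>M\<close> to \<open>x\<close> makes the inequality strict.\<close>

lemma perron_frobenius_exists: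
  assumes I: "finite I" "I \<noteq> {}" and irr: "irreducible_matrix I M"
  shows "\<exists>r x. (\<forall>i\<in>I. x i > 0) \<and> sum x I = 1 \<and> (\<forall>i\<in>I. mat_app I M x i = r * x i)"
proof -
  \<comment> \<open>The admissible values \<open>t\<close> of the Collatz-Wielandt problem. Fixing
    the sum of \<open>x\<close> keeps the vectors in a compact set.\<close>
  define A where "A = {t. \<exists>x. (\<forall>i\<in>I. 0 \<le> x i) \<and> sum x I = 1 \<and> (\<forall>i\<in>I. t * x i \<le> mat_app I M x i)}"
  have le1: "x i \<le> 1" if "\<forall>i\<in>I. 0 \<le> x i" "sum x I = 1" "i \<in> I" for x :: "'a \<Rightarrow> real" and i
    using member_le_sum[of i I x] that I by auto
  \<comment> \<open>The sum of all entries bounds \<open>A\<close>: in the summed inequality each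
    coordinate of \<open>x\<close> is at most one.\<close>
  define B where "B = (\<Sum>i\<in>I. \<Sum>j\<in>I. real (M i j))"
  have bound: "t \<le> B" if "t \<in> A" for t
  proof -
    obtain x where x: "\<forall>i\<in>I. 0 \<le> x i" "sum x I = 1" "\<forall>i\<in>I. t * x i \<le> mat_app I M x i" using \<open>t \<in> A\<close> by (auto simp: A_def)
    have "t = (\<Sum>i\<in>I. t * x i)" using x by (simp flip: sum_distrib_left)
    also have "\<dots> \<le> (\<Sum>i\<in>I. mat_app I M x i)" using x by (intro sum_mono) auto
    also have "\<dots> \<le> B" unfolding B_def mat_app_def
    proof (intro sum_mono)
      fix i j assume "j \<in> I"
      then show "real (M i j) * x j \<le> real (M i j)" using le1[OF x(1,2)] x(1) by (simp add: mult_left_le)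
    qed
    finally show ?thesis .
  qed
  have bdd: "bdd_above A" using bound by (auto simp: bdd_above_def)
  have "0 \<in> A"
    unfolding A_def using I by (auto intro!: exI[of _ "\<lambda>_. 1 / card I"] simp: mat_app_def sum_nonneg)
  then have ne: "A \<noteq> {}" by auto
  define r where "r = Sup A"
  \<comment> \<open>The supremum is not yet known to be attained. Vectors for values within
    \<open>1 / Suc n\<close> of it are chosen, and a limit of a subsequence will attain it.\<close>
  have "\<exists>x. (\<forall>i\<in>I. 0 \<le> x i) \<and> sum x I = 1 \<and> (\<forall>i\<in>I. (r - 1 / real (Suc n)) * x i \<le> mat_app I M x i)" for n
  proof -
    have "r - 1 / real (Suc n) < Sup A" by (simp add: r_def)
    then obtain t where "t \<in> A" "r - 1 / real (Suc n) < t" using less_cSup_iff[OF ne bdd] by auto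
    then obtain x where x: "\<forall>i\<in>I. 0 \<le> x i" "sum x I = 1" "\<forall>i\<in>I. t * x i \<le> mat_app I M x i"
      "r - 1 / real (Suc n) < t" by (auto simp: A_def)
    moreover have "(r - 1 / real (Suc n)) * x i \<le> t * x i" if "i \<in> I" for i
      using x that by (intro mult_right_mono) auto
    ultimately show ?thesis by (intro exI[of _ x]) (auto intro: order_trans)
  qed
  then obtain X where X: "\<And>n i. i \<in> I \<Longrightarrow> 0 \<le> X n i" "\<And>n. sum (X n) I = 1"
     "\<And>n i. i \<in> I \<Longrightarrow> (r - 1 / real (Suc n)) * X n i \<le> mat_app I M (X n) i" by metis
  have "\<bar>X n i\<bar> \<le> 1" if "i \<in> I" for n i using X(1)[OF that] le1[of "X n" i] X(1,2) that by simp
  then obtain s where s: "strict_mono s" "\<And>i. i \<in> I \<Longrightarrow> convergent (\<lambda>n. X (s n) i)"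
    using convergent_subsequence_on_finite[OF I(1)] by metis
  define y where "y i = lim (\<lambda>n. X (s n) i)" for i
  have lim: "(\<lambda>n. X (s n) i) \<longlonglongrightarrow> y i" if "i \<in> I" for i
    using s(2)[OF that] by (simp add: y_def convergent_LIMSEQ_iff)
  have y0: "0 \<le> y i" if "i \<in> I" for i using X(1)[OF that] lim[OF that] by (intro LIMSEQ_le_const) auto
  have "(\<lambda>n. sum (X (s n)) I) \<longlonglongrightarrow> sum y I" using lim by (intro tendsto_sum) auto
  then have y1: "sum y I = 1" by (simp add: X(2) LIMSEQ_const_iff)
  have ry: "r * y i \<le> mat_app I M y i" if "i \<in> I" for i
  proof (rule LIMSEQ_le)
    have "(\<lambda>n. 1 / real (Suc n)) \<longlonglongrightarrow> 0" using LIMSEQ_inverse_real_of_nat by (simp add: inverse_eq_divide)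
    from LIMSEQ_subseq_LIMSEQ[OF this s(1)] have "(\<lambda>n. 1 / real (Suc (s n))) \<longlonglongrightarrow> 0" by (simp add: o_def)
    from tendsto_mult[OF tendsto_diff[OF tendsto_const[of r] this] lim[OF that]]
    show "(\<lambda>n. (r - 1 / real (Suc (s n))) * X (s n) i) \<longlonglongrightarrow> r * y i" by simp
    show "(\<lambda>n. mat_app I M (X (s n)) i) \<longlonglongrightarrow> mat_app I M y i"
      unfolding mat_app_def using lim by (intro tendsto_sum tendsto_mult tendsto_const) auto
    show "\<exists>N. \<forall>n\<ge>N. (r - 1 / real (Suc (s n))) * X (s n) i \<le> mat_app I M (X (s n)) i" using X(3)[OF that] by blast
  qed
  have eq: "mat_app I M y i = r * y i" if "i \<in> I" for i
  proof (rule ccontr)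
    assume neq: "mat_app I M y i \<noteq> r * y i"
    \<comment> \<open>The slack of the inequality: nonnegative everywhere and positive at
      \<open>i\<close>.\<close>
    define w where "w j = mat_app I M y j - r * y j" for j
    have w: "w j \<ge> 0" if "j \<in> I" for j using ry[OF that] by (simp add: w_def)
    have wi: "w i > 0" using w[OF that] neq by (simp add: w_def)
    have "\<forall>j\<in>I. \<exists>l. mat_power I M l j i > 0" using irr that unfolding irreducible_matrix_def by blast
    then obtain l where l: "\<And>j. j \<in> I \<Longrightarrow> mat_power I M (l j) j i > 0" using bchoice by meson
    \<comment> \<open>By irreducibility each row \<open>j\<close> has some power with a positive
      entry in column \<open>i\<close>. Up to exponent \<open>L\<close> all these powers occur, so
      the sum of powers applied to \<open>w\<close> is positive in every coordinate.\<close>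
    define L where "L = Max (l ` I)"
    have lL: "l j \<le> L" if "j \<in> I" for j using I that by (simp add: L_def)
    let ?it = "\<lambda>n x. (mat_app I M ^^ n) x"
    define z where "z j = (\<Sum>n\<le>L. ?it n y j)" for j
    \<comment> \<open>Powers of \<open>M\<close> commute with \<open>M\<close>, so the slack of
      \<open>z\<close> is the sum of powers applied to the slack of \<open>y\<close>.\<close>
    have zz: "mat_app I M z j - r * z j = (\<Sum>n\<le>L. ?it n w j)" if j: "j \<in> I" for j
    proof -
      have it: "?it n w j = mat_app I M (?it n y) j - r * ?it n y j" for n
      proof -
        have "?it n w j = (\<Sum>k\<in>I. real (mat_power I M n j k) * mat_app I M y k) - r * (\<Sum>k\<in>I. real (mat_power I M n j k) * y k)"
          using mat_app_funpow[OF I(1) j, of n M w]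
          by (simp add: w_def algebra_simps sum_subtractf sum_distrib_left)
        also have "\<dots> = ?it n (mat_app I M y) j - r * ?it n y j"
          using mat_app_funpow[OF I(1) j, of n M] by simp
        also have "?it n (mat_app I M y) = mat_app I M (?it n y)" by (simp add: funpow_swap1)
        finally show ?thesis .
      qed
      have "mat_app I M z j = (\<Sum>n\<le>L. mat_app I M (?it n y) j)"
        unfolding mat_app_def z_def by (simp add: sum_distrib_left) (rule sum.swap)
      then show ?thesis by (simp add: z_def it sum_subtractf sum_distrib_left)
    qed
    have pos: "(\<Sum>n\<le>L. ?it n w j) > 0" if j: "j \<in> I" for j
    proof -
      have "0 < ?it (l j) w j" using w wi
        by (intro mat_app_funpow_pos[OF I(1) j \<open>i \<in> I\<close> l[OF j]]) auto
      also have "\<dots> \<le> (\<Sum>n\<le>L. ?it n w j)"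
        using lL[OF j] mat_app_funpow_nonneg[OF I(1) j, of w] w by (intro member_le_sum) auto
      finally show ?thesis .
    qed
    have z0: "z j \<ge> y j" if j: "j \<in> I" for j
    proof -
      have "?it 0 y j \<le> z j" unfolding z_def
        using mat_app_funpow_nonneg[OF I(1) j, of y] y0 by (intro member_le_sum) auto
      then show ?thesis by simp
    qed
    have zn: "z j \<ge> 0" if "j \<in> I" for j using z0[OF that] y0[OF that] by simp
    define t where "t = sum z I"
    have t: "t \<ge> 1" using sum_mono[of I y z] z0 y1 by (simp add: t_def)
    \<comment> \<open>The least slack of the normalized vector. Its coordinates are at most one, so
      \<open>r + d\<close> is still admissible, against the choice of \<open>r\<close>.\<close>
    define d where "d = Min ((\<lambda>j. (\<Sum>n\<le>L. ?it n w j) / t) ` I)"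
    have d0: "d > 0" using I pos t by (simp add: d_def)
    have dle: "d \<le> (\<Sum>n\<le>L. ?it n w j) / t" if "j \<in> I" for j
      unfolding d_def using I that by (intro Min_le) auto
    have zt: "z j / t \<le> 1" if "j \<in> I" for j
      using member_le_sum[of j I z] that I zn t by (simp add: t_def)
    have "r + d \<in> A" unfolding A_def
    proof (intro CollectI exI[of _ "\<lambda>j. z j / t"] conjI ballI)
      fix j assume j: "j \<in> I"
      show "0 \<le> z j / t" using zn[OF j] t by simp
      have "d * (z j / t) \<le> d * 1" using zt[OF j] d0 by (intro mult_left_mono) auto
      also have "\<dots> \<le> (mat_app I M z j - r * z j) / t" using dle[OF j] zz[OF j] by simp
      finally have "(r + d) * (z j / t) \<le> mat_app I M z j / t" by (simp add: algebra_simps diff_divide_distrib add_divide_distrib)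
      also have "\<dots> = mat_app I M (\<lambda>j. z j / t) j" by (simp add: mat_app_def sum_divide_distrib)
      finally show "(r + d) * (z j / t) \<le> mat_app I M (\<lambda>j. z j / t) j" .
    next
      show "(\<Sum>j\<in>I. z j / t) = 1" using t by (simp add: t_def flip: sum_divide_distrib)
    qed
    then have "r + d \<le> r" unfolding r_def using bdd by (rule cSup_upper)
    then show False using d0 by simp
  qed
  have "y i > 0" if i: "i \<in> I" for i
  proof -
    \<comment> \<open>Some coordinate is positive because the sum is one. Irreducibility carries
      positivity from \<open>j\<close> to \<open>i\<close> through a power of \<open>M\<close>,
      which acts on the eigenvector as the scalar \<open>r ^ l\<close>.\<close>
    obtain j where j: "j \<in> I" "y j > 0" using y1 y0 sum.neutral[of I y] by (metis less_eq_real_def zero_neq_one)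
    obtain l where l: "mat_power I M l i j > 0" using irr i j unfolding irreducible_matrix_def by blast
    have "(mat_app I M ^^ l) y k = r ^ l * y k" if "k \<in> I" for k using that
    proof (induction l arbitrary: k)
      case (Suc l)
      have "(mat_app I M ^^ Suc l) y k = (\<Sum>j\<in>I. real (M k j) * (mat_app I M ^^ l) y j)"
        unfolding funpow.simps o_apply by (simp only: mat_app_def)
      also have "\<dots> = mat_app I M (\<lambda>k. r ^ l * y k) k"
        unfolding mat_app_def[of I M "\<lambda>k. r ^ l * y k"] by (intro sum.cong refl) (simp only: Suc.IH)
      also have "\<dots> = r ^ l * mat_app I M y k" by (simp add: mat_app_def sum_distrib_left algebra_simps)
      finally show ?case using eq[OF Suc(2)] by simp
    qed simp
    moreover have "(mat_app I M ^^ l) y i > 0"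
      by (rule mat_app_funpow_pos[OF I(1) i j(1) l]) (use y0 j(2) in auto)
    ultimately have "r ^ l * y i > 0" using i by simp
    then show ?thesis using y0[OF i] by (metis less_eq_real_def mult_zero_right less_irrefl)
  qed
  then show ?thesis using y1 eq by blast
qed

text \<open>Summing the eigenvector equation over the rows expresses \<open>r\<close> as the average
  of the column sums, weighted by the eigenvector. Each column sum is at least one by
  irreducibility, and one of them is at least two.\<close>

lemma perron_frobenius_gt_one:
  assumes I: "finite I" and irr: "irreducible_matrix I M" and j0: "j0 \<in> I" and two: "(\<Sum>i\<in>I. M i j0) \<ge> 2"
  shows "\<exists>lam>1. perron_frobenius_eigenvalue I M lam"
proof -
  obtain r x where x: "\<forall>i\<in>I. x i > 0" "sum x I = 1" "\<forall>i\<in>I. mat_app I M x i = r * x i"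
    using perron_frobenius_exists[OF I _ irr] j0 by blast
  have one: "real (\<Sum>i\<in>I. M i j) \<ge> 1" if "j \<in> I" for j
  proof -
    obtain k where "k \<in> I" "M k j > 0" using irreducible_column_nonzero[OF irr \<open>j \<in> I\<close>] by blast
    then have "1 \<le> (\<Sum>i\<in>I. M i j)" using member_le_sum[of k I "\<lambda>i. M i j"] I by simp
    then show ?thesis by linarith
  qed
  have "r = (\<Sum>i\<in>I. mat_app I M x i)" using x by (simp flip: sum_distrib_left)
  also have "\<dots> = (\<Sum>j\<in>I. \<Sum>i\<in>I. real (M i j) * x j)" unfolding mat_app_def by (rule sum.swap)
  also have "\<dots> = (\<Sum>j\<in>I. real (\<Sum>i\<in>I. M i j) * x j)" by (simp add: sum_distrib_right)
  also have "\<dots> > (\<Sum>j\<in>I. 1 * x j)"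
  proof (rule sum_strict_mono_ex1[OF I])
    show "\<forall>j\<in>I. 1 * x j \<le> real (\<Sum>i\<in>I. M i j) * x j"
      using one x(1) by (intro ballI mult_right_mono) (auto simp: less_imp_le)
    have "real (\<Sum>i\<in>I. M i j0) \<ge> 2" using two by linarith
    then have "1 * x j0 < real (\<Sum>i\<in>I. M i j0) * x j0" using x(1) j0 by (intro mult_strict_right_mono) auto
    then show "\<exists>j\<in>I. 1 * x j < real (\<Sum>i\<in>I. M i j) * x j" using j0 by blast
  qed
  finally have "r > 1" using x by simp
  then show ?thesis unfolding perron_frobenius_eigenvalue_def
    using x j0 by (intro exI[of _ r]) (auto simp: mat_app_def)
qed

section \<open>Strata\<close>

lemma length_filter_partition:
  assumes "finite I" "\<And>i j. i \<in> I \<Longrightarrow> j \<in> I \<Longrightarrow> i \<noteq> j \<Longrightarrow> i \<inter> j = {}"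
  shows "(\<Sum>i\<in>I. length (filter (\<lambda>e. e \<in> i) xs)) = length (filter (\<lambda>e. e \<in> \<Union>I) xs)"
proof (induction xs)
  case (Cons e xs)
  have "(\<Sum>i\<in>I. if e \<in> i then 1 else 0 :: nat) = (if e \<in> \<Union>I then 1 else 0)"
  proof (cases "e \<in> \<Union>I")
    case True
    then obtain i where i: "i \<in> I" "e \<in> i" by blast
    then have "(\<Sum>j\<in>I. if e \<in> j then 1 else 0 :: nat) = (\<Sum>j\<in>I. if i = j then 1 else 0)"
      using assms(2) by (intro sum.cong) auto
    then show ?thesis using i assms(1) True by simp
  qed auto
  moreover have "(\<Sum>i\<in>I. length (filter (\<lambda>e. e \<in> i) (e # xs))) =
      (\<Sum>i\<in>I. (if e \<in> i then 1 else 0) + length (filter (\<lambda>e. e \<in> i) xs))"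
    by (intro sum.cong) auto
  ultimately show ?case using Cons by (simp add: sum.distrib)
qed simp

section \<open>The collapsed stratum of a relative train track map\<close>

locale relative_train_track =
  fixes G :: "('v, 'e, 'g, 'h) gog" and f :: "('v, 'e, 'g, 'v, 'e, 'g) gmap"
    and F :: "nat \<Rightarrow> 'v set \<times> 'e set" and m k :: nat and S :: "'v set \<times> 'e set"
    and p :: "'v \<Rightarrow> 'v" and \<alpha> :: "'v \<Rightarrow> ('v, 'e, 'g) path"
  assumes finite: "finite_graph G" and rtt: "relative_train_track_map G f F m"
    and k: "1 \<le> k" "k \<le> m" and irr: "irreducible_stratum G f F k"
    and S_eq: "F (k - 1) = S" and base: "base_data (restrict_gog G (F k)) S p \<alpha>"
begin

abbreviation "K \<equiv> restrict_gog G (F k)"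
abbreviation "H \<equiv> stratum_edges F k"

lemma H_def: "H = snd (F k) - snd S"
  by (simp only: stratum_edges_def S_eq)

lemma stratum_verts_eq: "stratum_verts G F k = (fst (F k) - fst S) \<union> tm G ` H"
  by (simp only: stratum_verts_def S_eq)

lemma f_G: "edge_path_map G f"
  and filt: "filtration G F m" and pres: "preserves_filtration f F m"
  using rtt by (auto simp: relative_train_track_map_def topological_realization_def)

lemma G: "graph_of_groups G"
  using edge_path_mapD(1)[OF f_G] .

lemma sub: "subgraph G (F k)" "subgraph G S"
  using filt k S_eq unfolding filtration_def by (blast, metis diff_le_self le_trans)

lemma S_le: "fst S \<subseteq> fst (F k)" "snd S \<subseteq> snd (F k)"
proof -
  have "k - 1 < m" "Suc (k - 1) = k" using k by auto
  then show "fst S \<subseteq> fst (F k)" "snd S \<subseteq> snd (F k)" using filt S_eq unfolding filtration_def by metis+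
qed

lemma f_pres: "v \<in> fst (F k) \<Longrightarrow> vmap f v \<in> fst (F k)"
  "e \<in> snd (F k) \<Longrightarrow> set (path_edges (emap f e)) \<subseteq> snd (F k)"
  "e \<in> snd S \<Longrightarrow> set (path_edges (emap f e)) \<subseteq> snd S"
proof -
  have "k - 1 \<le> m" using k by simp
  then show "v \<in> fst (F k) \<Longrightarrow> vmap f v \<in> fst (F k)"
    "e \<in> snd (F k) \<Longrightarrow> set (path_edges (emap f e)) \<subseteq> snd (F k)"
    "e \<in> snd S \<Longrightarrow> set (path_edges (emap f e)) \<subseteq> snd S"
    using pres k S_eq unfolding preserves_filtration_def by blast+
qed

lemma f_K: "edge_path_map K f"
  using f_G sub(1) f_pres(1,2) by (rule edge_path_map_restrict)

lemma H_edges: "e \<in> H \<longleftrightarrow> e \<in> edges K - snd S" "e \<in> H \<Longrightarrow> e \<in> edges G" "e \<in> H \<Longrightarrow> ebar G e \<in> H"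
proof -
  show "e \<in> H \<longleftrightarrow> e \<in> edges K - snd S" by (simp add: H_def)
  show 1: "e \<in> H \<Longrightarrow> e \<in> edges G" using sub(1) by (auto simp: H_def subgraph_def)
  assume e: "e \<in> H"
  then have "ebar G (ebar G e) = e" using org_ebar[OF G 1] by simp
  then show "ebar G e \<in> H" using e sub unfolding H_def subgraph_def by (metis DiffD1 DiffD2 DiffI)
qed

lemma irr_matrix: "irreducible_matrix (unoriented G H) (transition f)"
  using irr by (simp add: irreducible_stratum_def)

text \<open>\<open>transition\<close> evaluates \<open>f\<close> on an unspecified orientation of an
  unoriented edge, so both orientations have to be dealt with; their images are reverses of each
  other.\<close>

lemma some_edge:
  assumes "e \<in> H"
  obtains "(SOME e'. e' \<in> {e, ebar G e}) = e" | "(SOME e'. e' \<in> {e, ebar G e}) = ebar G e"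
proof -
  have "(SOME e'. e' \<in> {e, ebar G e}) \<in> {e, ebar G e}" by (rule someI[of _ e]) simp
  then show ?thesis using that by blast
qed

lemma emap_ebar_edges:
  assumes "e \<in> H"
  shows "path_edges (emap f (ebar G e)) = rev (map (ebar G) (path_edges (emap f e)))"
  using path_morphism_edge(4)[OF edge_path_mapD(2)[OF f_G] H_edges(2)[OF assms]] by simp

lemma path_edges_emap:
  assumes "e \<in> H"
  shows "set (path_edges (emap f e)) \<subseteq> edges K" "e' \<in> set (path_edges (emap f e)) \<Longrightarrow> e' \<in> snd S \<or> e' \<in> H"
  using f_pres(2)[of e] assms by (auto simp: H_def)

text \<open>An irreducible matrix has no zero column, and the column of \<open>e\<close> counts only
  edges of the stratum.\<close>

lemma f_not_S:
  assumes e: "e \<in> H"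
  shows "\<not> set (path_edges (emap f e)) \<subseteq> snd S"
proof
  assume sS: "set (path_edges (emap f e)) \<subseteq> snd S"
  have "{e, ebar G e} \<in> unoriented G H" using e by (auto simp: unoriented_def)
  from irreducible_column_nonzero[OF irr_matrix this]
  obtain i where i: "i \<in> unoriented G H" "transition f i {e, ebar G e} > 0" by blast
  have iH: "i \<subseteq> H" using i(1) H_edges(3) by (auto simp: unoriented_def)
  have "set (path_edges (emap f (SOME e'. e' \<in> {e, ebar G e}))) \<subseteq> snd S"
    using e
  proof (cases rule: some_edge)
    case 2
    have "ebar G e' \<in> snd S" if "e' \<in> snd S" for e' using that sub(2) by (auto simp: subgraph_def)
    then show ?thesis unfolding 2 emap_ebar_edges[OF e] using sS by auto
  qed (use sS in simp)
  then have "filter (\<lambda>e. e \<in> i) (path_edges (emap f (SOME e'. e' \<in> {e, ebar G e}))) = []"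
    using iH by (auto simp: filter_empty_conv H_def)
  then show False using i(2) by (simp add: transition_def)
qed

sublocale collapse_map_data K S p \<alpha> f
proof
  show "graph_of_groups K" using G sub by simp
  show "subgraph K S" using sub S_le by (auto simp: subgraph_def)
  show "base_data K S p \<alpha>" by (rule base)
  show "edge_path_map K f" by (rule f_K)
  show "set (path_edges (emap f e)) \<subseteq> snd S" if "e \<in> snd S" for e using f_pres(3)[OF that] .
  show "\<not> set (path_edges (emap f e)) \<subseteq> snd S" if "e \<in> edges K - snd S" for e
    using f_not_S that H_edges(1) by blast
qed

lemma unoriented_H: "finite (unoriented G H)" "\<Union>(unoriented G H) = H"
  "i \<in> unoriented G H \<Longrightarrow> j \<in> unoriented G H \<Longrightarrow> i \<noteq> j \<Longrightarrow> i \<inter> j = {}"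
proof -
  have "H \<subseteq> edges G" using H_edges(2) by blast
  then have "finite H" using finite by (auto simp: finite_graph_def intro: finite_subset)
  then show "finite (unoriented G H)" by (simp add: unoriented_def)
  show "\<Union>(unoriented G H) = H" using H_edges(3) by (auto simp: unoriented_def)
  have rep: "i = {x, ebar G x}" if "i \<in> unoriented G H" "x \<in> i" for i x
  proof -
    obtain a where a: "a \<in> H" "i = {a, ebar G a}" using \<open>i \<in> unoriented G H\<close> by (auto simp: unoriented_def)
    then have "ebar G (ebar G a) = a" using org_ebar(5)[OF G H_edges(2)] by simp
    then show ?thesis using that(2) unfolding a(2) by (metis insertE insert_commute singletonD)
  qed
  assume ij: "i \<in> unoriented G H" "j \<in> unoriented G H" "i \<noteq> j"
  show "i \<inter> j = {}"
  proof (rule ccontr)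
    assume "i \<inter> j \<noteq> {}"
    then obtain x where x: "x \<in> i" "x \<in> j" by blast
    show False using trans[OF rep[OF ij(1) x(1)] rep[OF ij(2) x(2), symmetric]] ij(3) by simp
  qed
qed

text \<open>The classes of unoriented edges partition the stratum, so the column sum counts all
  stratum edges of the image. These are the edges that survive the collapse.\<close>

lemma column_sum:
  assumes e: "e \<in> H"
  shows "(\<Sum>i\<in>unoriented G H. transition f i {e, ebar G e}) = length (path_edges (emap f' e))"
proof -
  let ?s = "SOME e'. e' \<in> {e, ebar G e}"
  have "e \<in> edges K" using e H_edges(1) by simp
  then have pe: "path_edges (emap f' e) = filter (\<lambda>e. e \<notin> snd S) (path_edges (emap f e))"
    using emap_induced[of e] path_edges_c[OF f_edge(1)[of e]] by (simp del: induced_map_simps)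
  have "(\<Sum>i\<in>unoriented G H. transition f i {e, ebar G e}) = length (filter (\<lambda>e. e \<in> H) (path_edges (emap f ?s)))"
    unfolding transition_def using length_filter_partition[OF unoriented_H(1,3)] unoriented_H(2) by simp
  also have "\<dots> = length (filter (\<lambda>e. e \<in> H) (path_edges (emap f e)))"
    using e
  proof (cases rule: some_edge)
    case 2
    have "ebar G e' \<in> H \<longleftrightarrow> e' \<in> H" if "e' \<in> set (path_edges (emap f e))" for e'
    proof -
      have "e' \<in> edges G" using that path_edges_emap(1)[OF e] sub(1) by (auto simp: subgraph_def)
      then show ?thesis using H_edges(3)[of e'] H_edges(3)[of "ebar G e'"] org_ebar(5)[OF G] by auto
    qed
    then have "filter ((\<lambda>e. e \<in> H) \<circ> ebar G) (path_edges (emap f e)) = filter (\<lambda>e. e \<in> H) (path_edges (emap f e))"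
      by (intro filter_cong) auto
    then show ?thesis unfolding 2 emap_ebar_edges[OF e] by (simp add: rev_filter[symmetric] filter_map)
  qed simp
  also have "filter (\<lambda>e. e \<in> H) (path_edges (emap f e)) = path_edges (emap f' e)"
    unfolding pe using path_edges_emap(2)[OF e] by (intro filter_cong) (auto simp: H_def)
  finally show ?thesis .
qed

text \<open>Two surviving edges in one image give a column sum of at least two and hence an
  eigenvalue above one. So outside the exponentially growing case each image in the collapse has a
  single edge and no turn.\<close>

lemma exponentially_growing:
  assumes "e \<in> H" "length (path_edges (emap f' e)) \<ge> 2"
  shows "exponentially_growing G f F k"
proof -
  have "{e, ebar G e} \<in> unoriented G H" using assms by (auto simp: unoriented_def)
  then show ?thesis
    using perron_frobenius_gt_one[OF unoriented_H(1) irr_matrix, of "{e, ebar G e}"] column_sum[OF assms(1)] assms(2) irr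
    by (simp add: exponentially_growing_def)
qed

text \<open>The edges of \<open>S\<close> dropped from the images belong to no index of the matrix,
  so the transition matrix of the stratum and that of the induced map agree entry by entry.\<close>

lemma irreducible_induced: "irreducible_map K' f'"
proof -
  have I: "unoriented K' (edges K') = unoriented G H" by (simp add: unoriented_def H_def)
  have "transition f i j = transition f' i j" if ij: "i \<in> unoriented G H" "j \<in> unoriented G H" for i j
  proof -
    obtain e where e: "e \<in> H" "j = {e, ebar G e}" using ij(2) by (auto simp: unoriented_def)
    have iH: "i \<subseteq> H" using ij(1) H_edges(3) by (auto simp: unoriented_def)
    have "(SOME e'. e' \<in> j) \<in> H" unfolding e(2) using e(1) by (cases rule: some_edge) (use e H_edges(3) in auto)
    then have s: "(SOME e'. e' \<in> j) \<in> edges K" using H_edges(1) by simp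
    have "filter (\<lambda>e. e \<in> i) (filter (\<lambda>e. e \<notin> snd S) (path_edges (emap f (SOME e'. e' \<in> j)))) =
        filter (\<lambda>e. e \<in> i) (path_edges (emap f (SOME e'. e' \<in> j)))"
      using iH by (auto simp: H_def intro!: filter_cong)
    then show ?thesis unfolding transition_def
      using emap_induced[OF s] path_edges_c[OF f_edge(1)[OF s]] by (simp del: induced_map_simps)
  qed
  then show ?thesis unfolding irreducible_map_def I
    using irr_matrix by (rule irreducible_matrix_cong)
qed

text \<open>Injectivity restricts from \<open>G\<close> to \<open>K\<close>, as loops of
  \<open>K\<close> are loops of \<open>G\<close> with the same normal forms, and then passes to the
  collapse. Surjectivity does not restrict in this way: a preimage in \<open>G\<close> of a loop of
  \<open>K\<close> may leave \<open>K\<close>.\<close>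

lemma pi1_induced_mon:
  assumes "v \<in> verts K'"
  shows "pi1_map K' f' \<in> mon (pi1 K' v) (pi1 K' (vmap f' v))"
proof -
  obtain u where "u \<in> verts K" "v = p u" using assms by auto
  then have v: "v \<in> verts K" "p v = v" using base_path(5,6)[of u] by simp_all
  have vG: "v \<in> verts G" using v sub(1) by (auto simp: subgraph_def)
  have "pi1_iso_at G f v" using rtt vG by (auto simp: relative_train_track_map_def topological_realization_def)
  then have "inj_on (pi1_map G f) (carrier (pi1 G v))" using pi1_iso_at_iff[OF f_G vG] by simp
  then have "inj_on (pi1_map K f) (carrier (pi1 K v))"
    unfolding pi1_map_inj_iff[OF f_G vG] pi1_map_inj_iff[OF f_K v(1)]
    by (auto simp: path_from_to_def is_path_restrict[OF sub(1)])
  then have "inj_on (pi1_map K' f') (carrier (pi1 K' v))" using pi1_map_induced_inj_iff[OF v(1)] v(2) by simp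
  then show ?thesis using pi1_map_hom[OF edge_path_map_induced assms] by (simp add: mon_def)
qed

lemma turns_in_H:
  assumes "d1 \<in> H" "d2 \<in> H" "tm G d1 = tm G d2" "g \<in> carrier (vgrp G (tm G d1))" "g' \<in> carrier (vgrp G (tm G d1))"
  shows "{direction G g d1, direction G g' d2} \<in> turns_in G H"
proof -
  have "d1 \<in> edges G" "d2 \<in> edges G" "tm G d1 \<in> verts G"
    using assms H_edges(2) org_ebar(3)[OF G] by auto
  then have "direction G g d1 \<in> directions_at G (tm G d1)" "direction G g' d2 \<in> directions_at G (tm G d1)" "tm G d1 \<in> verts G"
    using assms(3-5) unfolding directions_at_def by auto
  then have "{direction G g d1, direction G g' d2} \<in> turns G" unfolding turns_def by blast
  then show ?thesis using assms by (auto simp: turns_in_def direction_def)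
qed

lemma edges_to_legal_paths_EG:
  assumes eg: "exponentially_growing G f F k"
  shows "edges_to_legal_paths K' f'"
proof -
  have R: "RTT_i G f F k" "RTT_ii G f F k" "RTT_iii G f F k"
    using rtt eg k by (auto simp: relative_train_track_map_def)
  interpret collapse_train_track K S p \<alpha> f
  proof
    fix d assume "d \<in> edges K - snd S"
    then have d: "d \<in> H" using H_edges(1) by simp
    note dG = H_edges(2)[OF d]
    have t: "tm G d \<in> verts G" using org_ebar(3)[OF G dG] .
    let ?o = "\<one>\<^bsub>vgrp G (tm G d)\<^esub>"
    have o: "?o \<in> carrier (vgrp G (tm G d))" using G t by simp
    \<comment> \<open>A degenerate turn also counts as a turn in the stratum. Since (RTT-i) keeps
      its image there, the image of a single direction has its edge in the stratum.\<close>
    have "{direction G ?o d, direction G ?o d} \<in> turns_in G H" using d o by (intro turns_in_H) auto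
    then have "Dturn G f {direction G ?o d, direction G ?o d} \<in> turns_in G H"
      using R(1) unfolding RTT_i_def by blast
    then show "last_edge f d \<notin> snd S"
      using Ddir_direction[OF f_G dG o] by (simp add: Dturn_def turns_in_def direction_def H_def)
  next
    fix \<sigma> assume \<sigma>: "S_path \<sigma>" "path_start \<sigma> \<in> tm K ` (edges K - snd S)" "path_end K \<sigma> \<in> tm K ` (edges K - snd S)"
      "path_edges (normal_form K \<sigma>) \<noteq> []"
    have ip: "is_path K \<sigma>" using \<sigma>(1) by (rule S_path_is_path)
    then have ipG: "is_path G \<sigma>" using is_path_restrict[OF sub(1)] by simp
    \<comment> \<open>A nontrivial path crosses an edge, necessarily one of \<open>S\<close>. This
      places its endpoints in \<open>S\<close>, as (RTT-ii) requires; vertices of \<open>K\<close>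
      outside \<open>S\<close> carry only trivial connecting paths.\<close>
    have "path_edges \<sigma> \<noteq> []" using normal_form_edgeless[OF G ipG] \<sigma>(4) by auto
    then obtain v g e a xs where s: "\<sigma> = (v, g, (e, a) # xs)" by (cases \<sigma> rule: path_cases) auto
    have "e \<in> snd S" "org G e = v" using \<sigma>(1) ip s by (auto simp: S_path_def)
    then have "path_start \<sigma> \<in> fst S" using sub(2) s by (auto simp: subgraph_def org_def)
    then have ipS: "is_path (restrict_gog G S) \<sigma>"
      using is_path_restrict[OF sub(2)] ipG \<sigma>(1) by (simp add: S_path_def)
    then have "path_end G \<sigma> \<in> fst S" using is_path_end[OF ipS] by simp
    moreover have "homotopically_nontrivial G \<sigma>" using homotopically_nontrivial_iff[OF G ipG] \<sigma>(4) by simp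
    ultimately have "homotopically_nontrivial G (path_image G G f \<sigma>)"
      using spec[OF R(2)[unfolded RTT_ii_def S_eq stratum_verts_eq], of \<sigma>] \<sigma>(2,3) ipS
        \<open>path_start \<sigma> \<in> fst S\<close> by (simp add: H_def)
    then show "path_edges (normal_form K (fi \<sigma>)) \<noteq> []"
      using homotopically_nontrivial_iff[OF G path_image_is_path[OF edge_path_mapD(2)[OF f_G] ipG]] by simp
  next
    fix e d1 d2 g assume *: "e \<in> edges K - snd S" "d1 \<in> edges K - snd S" "d2 \<in> edges K - snd S"
      "tm K d1 = tm K d2" "g \<in> carrier (vgrp K (tm K d1))"
      "{direction K \<one>\<^bsub>vgrp K (tm K d1)\<^esub> d1, direction K g d2} \<in> turns_taken K (emap f e)"
    have e: "e \<in> H" "e \<in> edges G" using * H_edges(1,2) by auto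
    have d: "d1 \<in> H" "d2 \<in> H" "d1 \<in> edges G" using * H_edges(1,2) by auto
    have o: "\<one>\<^bsub>vgrp G (tm G d1)\<^esub> \<in> carrier (vgrp G (tm G d1))" using G org_ebar(3)[OF G d(3)] by simp
    \<comment> \<open>A single edge takes no turn and is therefore legal, so (RTT-iii) applies to
      its image.\<close>
    have "legal_path G f (edge_path G e) \<and> path_edges (edge_path G e) \<noteq> [] \<and> set (path_edges (edge_path G e)) \<subseteq> H"
      using e G is_path_edge_path[OF G e(2)] by (simp add: legal_path_def) (simp add: edge_path_def)
    moreover have "path_image G G f (edge_path G e) = emap f e"
      using path_image_edge_path[OF edge_path_mapD(2)[OF f_G] e(2)] .
    moreover have "{direction G \<one>\<^bsub>vgrp G (tm G d1)\<^esub> d1, direction G g d2} \<in> turns_in G H"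
      using * d o by (intro turns_in_H) auto
    ultimately have "\<not> illegal_turn G f {direction G \<one>\<^bsub>vgrp G (tm G d1)\<^esub> d1, direction G g d2}"
      using R(3) *(6) unfolding RTT_iii_def by fastforce
    then show "\<not> illegal_turn K f {direction K \<one>\<^bsub>vgrp K (tm K d1)\<^esub> d1, direction K g d2}" by simp
  qed
  show ?thesis by (rule edges_to_legal_paths_induced)
qed

lemma edges_to_legal_paths_collapse: "edges_to_legal_paths K' f'"
proof (cases "\<exists>e\<in>H. length (path_edges (emap f' e)) \<ge> 2")
  case True
  then show ?thesis using exponentially_growing edges_to_legal_paths_EG by blast
next
  case False
  have none: "turns_taken K' x = {}" if "length (path_edges x) < 2" for x
    using that by (cases "(K', x)" rule: turns_taken.cases) auto
  show ?thesis unfolding edges_to_legal_paths_def legal_path_def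
  proof (intro ballI conjI)
    fix e assume e: "e \<in> edges K'"
    then have "e \<in> H" using H_edges(1) by simp
    then have "length (path_edges (emap f' e)) < 2" using False by (meson not_le)
    from none[OF this] show "\<not> illegal_turn K' f' T" if "T \<in> turns_taken K' (emap f' e)" for T
      using that by simp
    show "is_path K' (emap f' e)" by (rule path_morphism_edge(1)[OF path_morphism_induced e])
  qed
qed

end

theorem proposition3p9p2:
  fixes G :: "('v, 'e, 'g, 'h) gog"
    and f :: "('v, 'e, 'g, 'v, 'e, 'g) gmap"
    and F :: "nat \<Rightarrow> 'v set \<times> 'e set"
    and m k :: nat
    and p :: "'v \<Rightarrow> 'v"
    and \<alpha> :: "'v \<Rightarrow> ('v, 'e, 'g) path"
  defines "Gk \<equiv> restrict_gog G (F k)"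
    and "G' \<equiv> collapse (restrict_gog G (F k)) (F (k - 1)) p \<alpha>"
    and "f' \<equiv> induced_map (restrict_gog G (F k)) (F (k - 1)) p \<alpha> f"
  assumes "finite_graph G"
    and "relative_train_track_map G f F m"
    and "1 \<le> k" and "k \<le> m"
    and "irreducible_stratum G f F k"
    and "base_data (restrict_gog G (F k)) (F (k - 1)) p \<alpha>"
  shows "factors_through_collapse Gk (F (k - 1)) p \<alpha> f f'
    \<and> edge_path_map G' f'
    \<and> (\<forall>v\<in>verts G'. pi1_map G' f' \<in> mon (pi1 G' v) (pi1 G' (vmap f' v)))
    \<and> (\<forall>v\<in>verts Gk. pi1_iso_at G' f' (p v) \<longleftrightarrow> pi1_iso_at Gk f v)
    \<and> edges_to_legal_paths G' f'
    \<and> ((\<forall>v\<in>verts Gk. pi1_iso_at Gk f v) \<longrightarrow> train_track_map G' f')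
    \<and> irreducible_map G' f'"
proof -
  interpret R: relative_train_track G f F m k "F (k - 1)" p \<alpha>
    by (rule relative_train_track.intro[OF assms(4-8) refl assms(9)])
  have "pi1_iso_at R.K' R.f' u" if u: "\<forall>v\<in>verts R.K. pi1_iso_at R.K f v" "u \<in> verts R.K'" for u
  proof -
    obtain v where "v \<in> verts R.K" "u = p v" using R.collapse_simps(1) u(2) by blast
    then show ?thesis using R.pi1_iso_at_induced u(1) by blast
  qed
  then have "(\<forall>v\<in>verts R.K. pi1_iso_at R.K f v) \<longrightarrow> train_track_map R.K' R.f'"
    using R.edge_path_map_induced R.edges_to_legal_paths_collapse
    unfolding train_track_map_def topological_realization_def by blast
  then show ?thesis unfolding Gk_def G'_def f'_def
    using R.factors R.edge_path_map_induced R.pi1_induced_mon R.pi1_iso_at_induced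
      R.edges_to_legal_paths_collapse R.irreducible_induced by blast
qed

end
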